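(* Let $A$ be a profinite algebra over a finite field $k=\mathbb{F}_q$. Then $A$ is PFG if and only if $A$ has PMSG. Moreover, if $A$ is infinite then $M^*(A)\le d_0(A)+1$.
   Context: All algebras are associative and unital over $k=\mathbb{F}_q$, and subalgebras contain the identity. A profinite algebra is a topological $k$-algebra isomorphic to a projective limit of discrete finite (i.e. finite-dimensional) $k$-algebras. It carries a unique translation-invariant (additive Haar) probability measure. For $d\ge1$, $P(A,d)$ is the probability that $d$ elements of $A$, chosen independently at random with respect to this measure, generate $A$ (topologically if $A$ is infinite) as a unital $k$-algebra. $A$ is positively finitely generated (PFG) if $P(A,d)>0$ for some $d$. For $n\ge 2$, $m_n(A)$ is the number of (open) maximal subalgebras of $A$ of index $n$ (index as additive group). $A$ has polynomial maximal subalgebra growth (PMSG) if there is a fixed constant $c$ with $m_n(A)\le n^c$ for all $n \geq 2$. Define $M^*(A):=\limsup_{n>1}\log m_n(A)/\log n$ (with $\log$ to base $2$) and $d_0(A):=\min\{d\ge1: P(A,d)>0\}$ (infinite if no such $d$ exists). *)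

theory Defs
  imports "HOL-Analysis.Analysis" "HOL-Algebra.Module" "HOL-Algebra.AbelCoset" "HOL-Algebra.Subrings"
begin

section \<open>Algebras, subalgebras and homomorphisms\<close>

text \<open>The library's locale \<open>algebra\<close> requires multiplication to be commutative; here the algebra is
  an arbitrary unital ring, in which zero and one may coincide.\<close>

locale assoc_algebra = module K A + ring A
  for K :: "('k, 'n) ring_scheme" (structure) and A :: "('k, 'a, 'm) module_scheme" (structure) +
  assumes smult_mult_left:
      "\<lbrakk>c \<in> carrier K; x \<in> carrier A; y \<in> carrier A\<rbrakk>
        \<Longrightarrow> (c \<odot>\<^bsub>A\<^esub> x) \<otimes>\<^bsub>A\<^esub> y = c \<odot>\<^bsub>A\<^esub> (x \<otimes>\<^bsub>A\<^esub> y)"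
    and smult_mult_right:
      "\<lbrakk>c \<in> carrier K; x \<in> carrier A; y \<in> carrier A\<rbrakk>
        \<Longrightarrow> x \<otimes>\<^bsub>A\<^esub> (c \<odot>\<^bsub>A\<^esub> y) = c \<odot>\<^bsub>A\<^esub> (x \<otimes>\<^bsub>A\<^esub> y)"

definition unital_subalgebra ::
    "('k, 'n) ring_scheme \<Rightarrow> ('k, 'a, 'm) module_scheme \<Rightarrow> 'a set \<Rightarrow> bool" where
  "unital_subalgebra K A S \<longleftrightarrow> subring S A \<and> submodule S K A"

definition generated_subalgebra ::
    "('k, 'n) ring_scheme \<Rightarrow> ('k, 'a, 'm) module_scheme \<Rightarrow> 'a set \<Rightarrow> 'a set" where
  "generated_subalgebra K A X = \<Inter> {S. unital_subalgebra K A S \<and> X \<subseteq> S}"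

definition algebra_hom ::
    "('k, 'n) ring_scheme \<Rightarrow> ('k, 'a, 'm) module_scheme \<Rightarrow> ('k, 'b, 'p) module_scheme
      \<Rightarrow> ('a \<Rightarrow> 'b) set" where
  "algebra_hom K A B =
    {h \<in> ring_hom A B. \<forall>c \<in> carrier K. \<forall>x \<in> carrier A. h (c \<odot>\<^bsub>A\<^esub> x) = c \<odot>\<^bsub>B\<^esub> h x}"


section \<open>Topological algebras and projective limits of finite algebras\<close>

definition topological_algebra ::
    "('k, 'n) ring_scheme \<Rightarrow> ('k, 'a, 'm) module_scheme \<Rightarrow> 'a topology \<Rightarrow> bool" where
  "topological_algebra K A T \<longleftrightarrow>
     assoc_algebra K A \<and> topspace T = carrier A \<and>
     continuous_map (prod_topology T T) T (\<lambda>(x, y). x \<oplus>\<^bsub>A\<^esub> y) \<and>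
     continuous_map T T (\<lambda>x. \<ominus>\<^bsub>A\<^esub> x) \<and>
     continuous_map (prod_topology T T) T (\<lambda>(x, y). x \<otimes>\<^bsub>A\<^esub> y) \<and>
     continuous_map (prod_topology (discrete_topology (carrier K)) T) T (\<lambda>(c, x). c \<odot>\<^bsub>A\<^esub> x)"

definition finite_inverse_system ::
    "('k, 'n) ring_scheme \<Rightarrow> 'i set \<Rightarrow> ('i \<times> 'i) set \<Rightarrow> ('i \<Rightarrow> ('k, 'b) module)
      \<Rightarrow> ('i \<Rightarrow> 'i \<Rightarrow> 'b \<Rightarrow> 'b) \<Rightarrow> bool" where
  "finite_inverse_system K I r B \<phi> \<longleftrightarrow>
     I \<noteq> {} \<and> partial_order_on I r \<and>
     (\<forall>i\<in>I. \<forall>j\<in>I. \<exists>k\<in>I. (i, k) \<in> r \<and> (j, k) \<in> r) \<and>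
     (\<forall>i\<in>I. assoc_algebra K (B i) \<and> finite (carrier (B i))) \<and>
     (\<forall>i j. (i, j) \<in> r \<longrightarrow> \<phi> i j \<in> algebra_hom K (B j) (B i)) \<and>
     (\<forall>i\<in>I. \<forall>x\<in>carrier (B i). \<phi> i i x = x) \<and>
     (\<forall>i j k. (i, j) \<in> r \<longrightarrow> (j, k) \<in> r \<longrightarrow>
        (\<forall>x\<in>carrier (B k). \<phi> i j (\<phi> j k x) = \<phi> i k x))"

definition projective_limit ::
    "'i set \<Rightarrow> ('i \<times> 'i) set \<Rightarrow> ('i \<Rightarrow> ('k, 'b) module) \<Rightarrow> ('i \<Rightarrow> 'i \<Rightarrow> 'b \<Rightarrow> 'b)
      \<Rightarrow> ('k, 'i \<Rightarrow> 'b) module" where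
  "projective_limit I r B \<phi> =
     \<lparr>carrier = {x \<in> (\<Pi>\<^sub>E i\<in>I. carrier (B i)). \<forall>i j. (i, j) \<in> r \<longrightarrow> \<phi> i j (x j) = x i},
      monoid.mult = (\<lambda>x y. \<lambda>i\<in>I. x i \<otimes>\<^bsub>B i\<^esub> y i),
      one = (\<lambda>i\<in>I. \<one>\<^bsub>B i\<^esub>),
      zero = (\<lambda>i\<in>I. \<zero>\<^bsub>B i\<^esub>),
      add = (\<lambda>x y. \<lambda>i\<in>I. x i \<oplus>\<^bsub>B i\<^esub> y i),
      smult = (\<lambda>c x. \<lambda>i\<in>I. c \<odot>\<^bsub>B i\<^esub> x i)\<rparr>"

definition projective_limit_topology ::
    "'i set \<Rightarrow> ('i \<times> 'i) set \<Rightarrow> ('i \<Rightarrow> ('k, 'b) module) \<Rightarrow> ('i \<Rightarrow> 'i \<Rightarrow> 'b \<Rightarrow> 'b)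
      \<Rightarrow> ('i \<Rightarrow> 'b) topology" where
  "projective_limit_topology I r B \<phi> =
     subtopology (product_topology (\<lambda>i. discrete_topology (carrier (B i))) I)
       (carrier (projective_limit I r B \<phi>))"

text \<open>A definition cannot quantify existentially over types, so the types \<open>'i\<close> of the indices and
  \<open>'b\<close> of the elements of the finite algebras are parameters. In a theorem that assumes
  \<open>profinite_algebra TYPE('i) TYPE('b) K A T\<close> both are universally quantified, and hence the theorem
  covers all projective limits of finite algebras.\<close>

definition profinite_algebra ::
    "'i itself \<Rightarrow> 'b itself \<Rightarrow> ('k, 'n) ring_scheme \<Rightarrow> ('k, 'a, 'm) module_scheme
      \<Rightarrow> 'a topology \<Rightarrow> bool" where
  "profinite_algebra _ _ K A T \<longleftrightarrow>
     topological_algebra K A T \<and>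
     (\<exists>(I :: 'i set) r (B :: 'i \<Rightarrow> ('k, 'b) module) \<phi> h.
        finite_inverse_system K I r B \<phi> \<and>
        h \<in> algebra_hom K A (projective_limit I r B \<phi>) \<and>
        homeomorphic_map T (projective_limit_topology I r B \<phi>) h)"


section \<open>Haar measure and the probability of generation\<close>

text \<open>The normalized Haar measure of the compact group \<open>(A, +)\<close> is a Borel measure. As usual for
  Haar measures, regularity is required, since without it uniqueness could fail if \<open>A\<close> is not second
  countable.\<close>

definition is_haar_probability ::
    "('k, 'a, 'm) module_scheme \<Rightarrow> 'a topology \<Rightarrow> 'a measure \<Rightarrow> bool" where
  "is_haar_probability A T \<mu> \<longleftrightarrow>
     space \<mu> = topspace T \<and>
     sets \<mu> = sigma_sets (topspace T) {U. openin T U} \<and>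
     emeasure \<mu> (space \<mu>) = 1 \<and>
     (\<forall>a \<in> carrier A. \<forall>E \<in> sets \<mu>. emeasure \<mu> ((\<lambda>x. a \<oplus>\<^bsub>A\<^esub> x) ` E) = emeasure \<mu> E) \<and>
     (\<forall>E \<in> sets \<mu>. emeasure \<mu> E = (INF U \<in> {U. openin T U \<and> E \<subseteq> U}. emeasure \<mu> U))"

definition haar_probability ::
    "('k, 'a, 'm) module_scheme \<Rightarrow> 'a topology \<Rightarrow> 'a measure" where
  "haar_probability A T = (THE \<mu>. is_haar_probability A T \<mu>)"

text \<open>If \<open>A\<close> is a finite profinite algebra, its topology is discrete and the closure is redundant.\<close>

definition topologically_generates ::
    "('k, 'n) ring_scheme \<Rightarrow> ('k, 'a, 'm) module_scheme \<Rightarrow> 'a topology \<Rightarrow> 'a set \<Rightarrow> bool" where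
  "topologically_generates K A T X \<longleftrightarrow> T closure_of (generated_subalgebra K A X) = carrier A"

text \<open>The set of generating \<open>d\<close>-tuples is closed in \<open>A\<^sup>d\<close>, as the complement of the union of the open
  sets \<open>M\<^sup>d\<close> for \<open>M\<close> open maximal. It is measurable for the product \<open>\<sigma>\<close>-algebra: it is empty unless \<open>A\<close>
  is topologically finitely generated, and in that case \<open>A\<close> is second countable.\<close>

definition generation_probability ::
    "('k, 'n) ring_scheme \<Rightarrow> ('k, 'a, 'm) module_scheme \<Rightarrow> 'a topology \<Rightarrow> nat \<Rightarrow> real" where
  "generation_probability K A T d =
     measure (\<Pi>\<^sub>M i\<in>{..<d}. haar_probability A T)
       {x \<in> {..<d} \<rightarrow>\<^sub>E carrier A. topologically_generates K A T (x ` {..<d})}"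

definition positively_finitely_generated ::
    "('k, 'n) ring_scheme \<Rightarrow> ('k, 'a, 'm) module_scheme \<Rightarrow> 'a topology \<Rightarrow> bool" where
  "positively_finitely_generated K A T \<longleftrightarrow> (\<exists>d\<ge>1. generation_probability K A T d > 0)"

definition d0 ::
    "('k, 'n) ring_scheme \<Rightarrow> ('k, 'a, 'm) module_scheme \<Rightarrow> 'a topology \<Rightarrow> enat" where
  "d0 K A T =
     (if \<exists>d\<ge>1. generation_probability K A T d > 0
      then enat (LEAST d. 1 \<le> d \<and> generation_probability K A T d > 0) else \<infinity>)"


section \<open>Maximal subalgebra growth\<close>

definition maximal_subalgebra ::
    "('k, 'n) ring_scheme \<Rightarrow> ('k, 'a, 'm) module_scheme \<Rightarrow> 'a set \<Rightarrow> bool" where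
  "maximal_subalgebra K A M \<longleftrightarrow>
     unital_subalgebra K A M \<and> M \<noteq> carrier A \<and>
     (\<forall>S. unital_subalgebra K A S \<longrightarrow> M \<subseteq> S \<longrightarrow> S = M \<or> S = carrier A)"

definition open_maximal_subalgebras ::
    "('k, 'n) ring_scheme \<Rightarrow> ('k, 'a, 'm) module_scheme \<Rightarrow> 'a topology \<Rightarrow> nat \<Rightarrow> 'a set set" where
  "open_maximal_subalgebras K A T n =
     {M. maximal_subalgebra K A M \<and> openin T M \<and>
         finite (a_rcosets\<^bsub>A\<^esub> M) \<and> card (a_rcosets\<^bsub>A\<^esub> M) = n}"

text \<open>The number of such subalgebras may be infinite if \<open>A\<close> is not finitely generated.\<close>

definition max_subalgebra_count ::
    "('k, 'n) ring_scheme \<Rightarrow> ('k, 'a, 'm) module_scheme \<Rightarrow> 'a topology \<Rightarrow> nat \<Rightarrow> enat" where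
  "max_subalgebra_count K A T n =
     (if finite (open_maximal_subalgebras K A T n)
      then enat (card (open_maximal_subalgebras K A T n)) else \<infinity>)"

definition polynomial_maximal_subalgebra_growth ::
    "('k, 'n) ring_scheme \<Rightarrow> ('k, 'a, 'm) module_scheme \<Rightarrow> 'a topology \<Rightarrow> bool" where
  "polynomial_maximal_subalgebra_growth K A T \<longleftrightarrow>
     (\<exists>c::real. \<forall>n\<ge>2. ereal_of_enat (max_subalgebra_count K A T n) \<le> ereal (real n powr c))"

definition log2_enat :: "enat \<Rightarrow> ereal" where
  "log2_enat m =
     (case m of enat l \<Rightarrow> if l = 0 then -\<infinity> else ereal (log 2 (real l)) | \<infinity> \<Rightarrow> \<infinity>)"

definition Mstar ::
    "('k, 'n) ring_scheme \<Rightarrow> ('k, 'a, 'm) module_scheme \<Rightarrow> 'a topology \<Rightarrow> ereal" where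
  "Mstar K A T =
     limsup (\<lambda>n. log2_enat (max_subalgebra_count K A T n) / ereal (log 2 (real n)))"

end

theory Submission
  imports Defs "HOL-Algebra.Multiplicative_Group" "HOL-Algebra.QuotRing" "HOL-Probability.Probability"
    "HOL-Real_Asymp.Real_Asymp"
begin

text \<open>Call the largest ideal of \<open>A\<close> contained in an open maximal subalgebra \<open>M\<close> the core of \<open>M\<close>. If \<open>M\<close>
  and \<open>N\<close> have different cores, then \<open>M + N = A\<close>, so that the events \<open>M\<^sup>d\<close> and \<open>N\<^sup>d\<close> of \<open>A\<^sup>d\<close> are
  independent, and a second moment estimate bounds the number of cores of maximal subalgebras of index
  \<open>n\<close> by \<open>n\<^sup>d / P(A, d)\<close>. At most \<open>n (4 + 12 log n)\<close> subalgebras of index \<open>n\<close> share a core. This is a statement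
  about maximal subrings \<open>M\<close> of a finite ring \<open>R\<close> that contain no nonzero ideal of \<open>R\<close>. If \<open>R\<close> has a nonzero
  ideal of square zero, the subrings \<open>M\<close> are complements of it that differ by derivations.
  Otherwise \<open>R\<close> is a product of two simple rings and each \<open>M\<close> is the graph of an isomorphism, or
  \<open>R\<close> is simple. A maximal subring of a matrix ring over a field is the stabilizer of a subspace, or the
  centralizer of a field extension of prime degree, or does not contain the centre.

  Conversely, if \<open>m\<^sub>n(A) \<le> n\<^sup>c\<close> and \<open>d \<ge> c + 3\<close>, then \<open>\<Sum>n. m\<^sub>n(A) n\<^sup>-\<^sup>d \<le> 1 / 2\<close>. By compactness some \<open>d\<close>-tuple
  generates \<open>A\<close>, hence \<open>A\<close> is second countable, and by subadditivity \<open>P(A, d) \<ge> 1 / 2\<close>. Second countability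
  is what makes the Haar measure accessible, as the completion of the counting densities on clopen sets.\<close>

section \<open>Finite rings and division rings\<close>

text \<open>The finite rings that occur are corners, ideals with a unit, centralizers and quotients.
  As subsets of one type of class \<open>ring_1\<close>, each with its own unit \<open>e\<close>,
  they keep the arithmetic of the type class, and subrings and modules become plain sets. Quotients
  of \<open>A\<close> reach such a type only at the end, through an embedding that forgets the unit.
  The bound \<open>d0 + 1\<close> is a product of two counts, \<open>n ^ d\<close> up to a constant
  for the cores and \<open>n\<close> up to a logarithm for the subalgebras with a given core. So for
  the second count a polynomial bound is not enough. The logarithm enters through the dimension
  \<open>r\<close> of the simple module of a simple ring: the types of \<open>M\<close> are indexed
  by at most \<open>r - 1\<close> dimensions or degrees, and when these types occur at all,
  \<open>2 ^ (r - 1) \<le> n\<close>. The converse is threatened by a circle: the Haar measure is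
  accessible once the base is countable, countability comes from a generating tuple, and the tuple
  should come from a probability. The circle is broken by counting tuples in finite quotients, where
  no measure on \<open>A\<close> is involved.\<close>

definition addsub :: "'r::ab_group_add set \<Rightarrow> bool" where
  "addsub X \<longleftrightarrow> 0 \<in> X \<and> (\<forall>x\<in>X. \<forall>y\<in>X. x - y \<in> X)"

lemma addsub_zero: "addsub X \<Longrightarrow> 0 \<in> X"
  and addsub_diff: "addsub X \<Longrightarrow> x \<in> X \<Longrightarrow> y \<in> X \<Longrightarrow> x - y \<in> X"
  by (auto simp: addsub_def)

lemma addsub_uminus: "addsub X \<Longrightarrow> x \<in> X \<Longrightarrow> - x \<in> X"
  using addsub_diff[of X 0 x] by (simp add: addsub_zero)

lemma addsub_add: "addsub X \<Longrightarrow> x \<in> X \<Longrightarrow> y \<in> X \<Longrightarrow> x + y \<in> X"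
  using addsub_diff[of X x "- y"] by (simp add: addsub_uminus)

lemma addsub_sum: "addsub X \<Longrightarrow> (\<And>i. i \<in> I \<Longrightarrow> f i \<in> X) \<Longrightarrow> sum f I \<in> X"
  by (induction I rule: infinite_finite_induct) (auto simp: addsub_zero addsub_add)

lemma addsub_Int: "addsub X \<Longrightarrow> addsub Y \<Longrightarrow> addsub (X \<inter> Y)"
  by (auto simp: addsub_def)

lemma addsub_setsum: "addsub X \<Longrightarrow> addsub Y \<Longrightarrow> addsub {x + y | x y. x \<in> X \<and> y \<in> Y}"
  unfolding addsub_def
  by (safe, force, metis (no_types, opaque_lifting) add_diff_add)

lemma addsub_image:
  fixes f :: "'a::ab_group_add \<Rightarrow> 'b::ab_group_add"
  assumes "addsub V" "\<And>x y. x \<in> V \<Longrightarrow> y \<in> V \<Longrightarrow> f (x - y) = f x - f y"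
  shows "addsub (f ` V)"
proof -
  have "f 0 = 0" using assms(2)[of 0 0] addsub_zero[OF assms(1)] by simp
  then show ?thesis using assms unfolding addsub_def by (auto simp: image_iff) metis+
qed

lemma addsub_kernel:
  fixes f :: "'a::ab_group_add \<Rightarrow> 'b::ab_group_add"
  assumes "addsub V" "\<And>x y. x \<in> V \<Longrightarrow> y \<in> V \<Longrightarrow> f (x - y) = f x - f y"
  shows "addsub {x \<in> V. f x = 0}"
proof -
  have "f 0 = 0" using assms(2)[of 0 0] addsub_zero[OF assms(1)] by simp
  then show ?thesis using assms unfolding addsub_def by auto
qed

text \<open>All nonempty fibres of \<open>f\<close> are translates of its kernel.\<close>

lemma card_additive:
  fixes f :: "'a::ab_group_add \<Rightarrow> 'b::ab_group_add"
  assumes V: "addsub V" "finite V" and f: "\<And>x y. x \<in> V \<Longrightarrow> y \<in> V \<Longrightarrow> f (x - y) = f x - f y"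
  shows "card V = card {x \<in> V. f x = 0} * card (f ` V)"
proof -
  have fib: "card {x \<in> V. f x = y} = card {x \<in> V. f x = 0}" if y: "y \<in> f ` V" for y
  proof -
    obtain x0 where x0: "x0 \<in> V" "f x0 = y" using y by auto
    have fadd: "f (x + x0) = f x + f x0" if "x \<in> V" for x
      using f[of "x + x0" x0] addsub_add[OF V(1) that x0(1)] x0 by simp
    have "(\<lambda>x. x + x0) ` {x \<in> V. f x = 0} = {x \<in> V. f x = y}"
    proof (intro equalityI subsetI)
      fix z assume "z \<in> {x \<in> V. f x = y}"
      then have "z - x0 \<in> {x \<in> V. f x = 0}"
        using addsub_diff[OF V(1) _ x0(1)] f[OF _ x0(1), of z] x0(2) by simp
      then show "z \<in> (\<lambda>x. x + x0) ` {x \<in> V. f x = 0}" by (rule rev_image_eqI) simp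
    next
      fix z assume "z \<in> (\<lambda>x. x + x0) ` {x \<in> V. f x = 0}"
      then obtain x where x: "x \<in> V" "f x = 0" "z = x + x0" by blast
      then show "z \<in> {x \<in> V. f x = y}" using fadd[OF x(1)] addsub_add[OF V(1) x(1) x0(1)] x0(2) by simp
    qed
    then show ?thesis using card_image[of "\<lambda>x. x + x0" "{x \<in> V. f x = 0}"] by (simp add: inj_on_def)
  qed
  have "card V = (\<Sum>y\<in>f ` V. card {x \<in> V. f x = y})"
    using sum.image_gen[OF V(2), of "\<lambda>_. 1::nat" f] by simp
  also have "\<dots> = (\<Sum>y\<in>f ` V. card {x \<in> V. f x = 0})" using fib by (intro sum.cong) auto
  finally show ?thesis by simp
qed

text \<open>This is \<open>card_additive\<close> for subtraction on \<open>X \<times> Y\<close>,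
  whose kernel is the diagonal copy of \<open>X \<inter> Y\<close>.\<close>

lemma card_sumset:
  assumes "addsub X" "addsub Y" "finite X" "finite Y"
  shows "card X * card Y = card (X \<inter> Y) * card {x + y | x y. x \<in> X \<and> y \<in> Y}"
proof -
  let ?f = "\<lambda>(x, y). x - y"
  have V: "addsub (X \<times> Y)" using assms by (auto simp: addsub_def zero_prod_def)
  have "card (X \<times> Y) = card {p \<in> X \<times> Y. ?f p = 0} * card (?f ` (X \<times> Y))"
    by (rule card_additive[OF V]) (use assms in \<open>auto simp: algebra_simps\<close>)
  moreover have "card {p \<in> X \<times> Y. ?f p = 0} = card (X \<inter> Y)"
    by (rule bij_betw_same_card[of fst], rule bij_betw_byWitness[where f' = "\<lambda>x. (x, x)"]) auto
  moreover have "?f ` (X \<times> Y) = {x + y | x y. x \<in> X \<and> y \<in> Y}"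
  proof (safe; clarsimp)
    fix a b assume "a \<in> X" "b \<in> Y"
    then show "\<exists>x y. a - b = x + y \<and> x \<in> X \<and> y \<in> Y"
      using addsub_uminus[OF assms(2)] by (metis diff_conv_add_uminus)
  next
    fix a b assume "a \<in> X" "b \<in> Y"
    then have "(a, - b) \<in> X \<times> Y" using addsub_uminus[OF assms(2)] by simp
    then show "a + b \<in> (\<lambda>(x, y). x - y) ` (X \<times> Y)" by (force simp: image_iff)
  qed
  ultimately show ?thesis by (simp add: card_cartesian_product)
qed

text \<open>Translation by \<open>x\<close> permutes \<open>X\<close>, so adding \<open>x\<close> to
  every summand does not change the sum over \<open>X\<close>. For a finite field \<open>X\<close>
  this says that its order vanishes in it.\<close>

lemma card_mult_eq_0:
  fixes x :: "'r::ring_1"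
  assumes "addsub X" "finite X" "x \<in> X"
  shows "of_nat (card X) * x = 0"
proof -
  have "(\<Sum>y\<in>X. y) = (\<Sum>y\<in>X. y + x)"
    by (rule sum.reindex_bij_witness[of _ "\<lambda>y. y + x" "\<lambda>y. y - x"])
      (use assms addsub_add addsub_diff in auto)
  then show ?thesis by (simp add: sum.distrib)
qed

section \<open>Rings inside a ring and finite fields\<close>

definition ring_on :: "'r::ring_1 \<Rightarrow> 'r set \<Rightarrow> bool" where
  "ring_on e S \<longleftrightarrow> addsub S \<and> (\<forall>x\<in>S. \<forall>y\<in>S. x * y \<in> S) \<and> e \<in> S \<and> (\<forall>x\<in>S. e * x = x \<and> x * e = x)"

lemma ring_onD:
  assumes "ring_on e S"
  shows "addsub S" "\<And>x y. x \<in> S \<Longrightarrow> y \<in> S \<Longrightarrow> x * y \<in> S" "e \<in> S"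
    "\<And>x. x \<in> S \<Longrightarrow> e * x = x" "\<And>x. x \<in> S \<Longrightarrow> x * e = x"
  using assms by (auto simp: ring_on_def)

lemma power_closed:
  fixes x :: "'r::ring_1"
  assumes "\<And>x y. x \<in> S \<Longrightarrow> y \<in> S \<Longrightarrow> x * y \<in> S" "x \<in> S" "n > 0"
  shows "x ^ n \<in> S"
  using assms(3)
proof (induction n)
  case (Suc n)
  then show ?case using assms(1,2) by (cases "n = 0") auto
qed simp

text \<open>The unit \<open>e\<close> of a subset of the ambient ring may differ from \<open>1\<close>, so that \<open>x ^ 0\<close>
  can lie outside the subset; powers are therefore indexed from one.\<close>

definition div_ring_on :: "'r::ring_1 \<Rightarrow> 'r set \<Rightarrow> bool" where
  "div_ring_on e D \<longleftrightarrow> ring_on e D \<and> finite D \<and> e \<noteq> 0 \<and>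
     (\<forall>x\<in>D. x \<noteq> 0 \<longrightarrow> (\<exists>y\<in>D. x * y = e \<and> y * x = e))"

text \<open>Left multiplication by a nonzero \<open>x\<close> is injective, hence onto; a right
  inverse \<open>y\<close> is also a left inverse because
  \<open>x * (y * x - e) = 0\<close>.\<close>

lemma finite_domain_div_ring_on:
  assumes S: "ring_on e S" "finite S" "e \<noteq> 0"
    and dom: "\<And>x y. x \<in> S \<Longrightarrow> y \<in> S \<Longrightarrow> x * y = 0 \<Longrightarrow> x = 0 \<or> y = 0"
  shows "div_ring_on e S"
  unfolding div_ring_on_def
proof (intro conjI ballI impI S)
  fix x assume x: "x \<in> S" "x \<noteq> 0"
  note R = ring_onD[OF S(1)]
  have "inj_on ((*) x) S"
  proof (rule inj_onI)
    fix y z assume yz: "y \<in> S" "z \<in> S" "x * y = x * z"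
    then have "x * (y - z) = 0" by (simp add: algebra_simps)
    then show "y = z" using dom[OF x(1) addsub_diff[OF R(1) yz(1,2)]] x by simp
  qed
  then have "(*) x ` S = S" using x R S by (intro card_subset_eq) (auto simp: card_image)
  then obtain y where y: "y \<in> S" "x * y = e" using R(3) by (metis imageE)
  have "x * (y * x - e) = 0" using y R(4,5)[OF x(1)] by (simp add: algebra_simps flip: mult.assoc)
  then have "y * x = e"
    using dom[OF x(1), of "y * x - e"] x y R by (simp add: addsub_diff)
  then show "\<exists>y\<in>S. x * y = e \<and> y * x = e" using y by auto
qed

lemma div_ring_on_domain:
  assumes "div_ring_on e D" "x \<in> D" "y \<in> D" "x * y = 0"
  shows "x = 0 \<or> y = 0"
proof (rule ccontr)
  assume n: "\<not> ?thesis"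
  then obtain z where "z \<in> D" "z * x = e" using assms by (auto simp: div_ring_on_def)
  then have "e * y = 0" using assms(4) by (metis mult.assoc mult_zero_right)
  then show False using n assms by (auto simp: div_ring_on_def ring_on_def)
qed

text \<open>A bridge to the record-based algebra, crossed for three facts on finite fields: the
  bound on the number of roots, Lagrange's theorem for the unit group, and its cyclicity.\<close>

definition record_ring :: "'r::ring_1 \<Rightarrow> 'r set \<Rightarrow> 'r ring" where
  "record_ring e S = \<lparr>carrier = S, mult = (*), one = e, zero = 0, add = (+)\<rparr>"

lemma record_ring_field:
  assumes "div_ring_on e E" "\<And>x y. x \<in> E \<Longrightarrow> y \<in> E \<Longrightarrow> x * y = y * x"
  shows "field (record_ring e E)"
proof -
  have D: "ring_on e E" "e \<noteq> 0" using assms by (auto simp: div_ring_on_def)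
  note R = ring_onD[OF D(1)]
  have "cring (record_ring e E)"
  proof (intro cringI abelian_groupI comm_monoidI)
    fix x assume "x \<in> carrier (record_ring e E)"
    then show "\<exists>y\<in>carrier (record_ring e E). y \<oplus>\<^bsub>record_ring e E\<^esub> x = \<zero>\<^bsub>record_ring e E\<^esub>"
      using addsub_uminus[OF R(1)] by (intro bexI[of _ "- x"]) (auto simp: record_ring_def)
  qed (use R assms in \<open>auto simp: record_ring_def addsub_zero addsub_add algebra_simps\<close>)
  then show ?thesis
  proof (rule cring.cring_fieldI2)
    show "\<zero>\<^bsub>record_ring e E\<^esub> \<noteq> \<one>\<^bsub>record_ring e E\<^esub>" using D by (simp add: record_ring_def)
    fix a assume "a \<in> carrier (record_ring e E)" "a \<noteq> \<zero>\<^bsub>record_ring e E\<^esub>"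
    then show "\<exists>b\<in>carrier (record_ring e E). a \<otimes>\<^bsub>record_ring e E\<^esub> b = \<one>\<^bsub>record_ring e E\<^esub>"
      using assms(1) by (simp add: record_ring_def div_ring_on_def) blast
  qed
qed

lemma record_ring_pow:
  assumes "ring_on e E" "x \<in> E" "n > 0"
  shows "x [^]\<^bsub>record_ring e E\<^esub> n = x ^ n"
  using assms(3)
proof (induction n)
  case (Suc n)
  then show ?case
    using ring_onD[OF assms(1)] assms
    by (cases "n = 0") (auto simp: nat_pow_def record_ring_def power_commutes)
qed simp

lemma field_on_roots:
  assumes "div_ring_on e E" "\<And>x y. x \<in> E \<Longrightarrow> y \<in> E \<Longrightarrow> x * y = y * x" "n > 0"
  shows "card {x \<in> E. x ^ n = e} \<le> n"
proof -
  interpret field "record_ring e E" by (rule record_ring_field[OF assms(1,2)])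
  have "card {x \<in> carrier (record_ring e E). x [^]\<^bsub>record_ring e E\<^esub> n = \<one>\<^bsub>record_ring e E\<^esub>} \<le> n"
    using assms by (intro num_roots_le_deg) (auto simp: div_ring_on_def record_ring_def)
  also have "{x \<in> carrier (record_ring e E). x [^]\<^bsub>record_ring e E\<^esub> n = \<one>\<^bsub>record_ring e E\<^esub>} = {x \<in> E. x ^ n = e}"
    using assms record_ring_pow[of e E] by (auto simp: div_ring_on_def) (auto simp: record_ring_def)
  finally show ?thesis .
qed

lemma div_ring_pow_card:
  assumes "div_ring_on e D" "\<And>x y. x \<in> D \<Longrightarrow> y \<in> D \<Longrightarrow> x * y = y * x" "x \<in> D" "x \<noteq> 0"
  shows "x ^ (card D - 1) = e"
proof -
  interpret field "record_ring e D" by (rule record_ring_field[OF assms(1,2)])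
  interpret G: group "mult_of (record_ring e D)" by (rule field_mult_group)
  have c: "carrier (record_ring e D) = D" by (simp add: record_ring_def)
  have D: "finite D" "ring_on e D" "e \<noteq> 0" using assms by (auto simp: div_ring_on_def)
  have "card {0, e} \<le> card D" using D ring_onD[OF D(2)] by (intro card_mono) (auto simp: addsub_zero)
  then have "card D - 1 > 0" using D by auto
  have "x [^]\<^bsub>mult_of (record_ring e D)\<^esub> order (mult_of (record_ring e D)) = \<one>\<^bsub>mult_of (record_ring e D)\<^esub>"
    using assms by (intro G.pow_order_eq_1) (auto simp: record_ring_def)
  moreover have "order (mult_of (record_ring e D)) = card D - 1"
    using order_mult_of D by (simp add: c order_def)
  ultimately show ?thesis
    using record_ring_pow[OF D(2) assms(3) \<open>card D - 1 > 0\<close>]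
    by (simp add: nat_pow_mult_of) (simp add: record_ring_def)
qed

lemma field_on_generator:
  assumes "div_ring_on e E" "\<And>x y. x \<in> E \<Longrightarrow> y \<in> E \<Longrightarrow> x * y = y * x"
  obtains c where "c \<in> E" "c \<noteq> 0" "E - {0} = (\<lambda>i. c ^ i) ` {1..card E - 1}" "c ^ (card E - 1) = e"
    "\<And>i. 0 < i \<Longrightarrow> i < card E - 1 \<Longrightarrow> c ^ i \<noteq> e"
proof -
  interpret field "record_ring e E" by (rule record_ring_field[OF assms(1,2)])
  have c: "carrier (record_ring e E) = E" "\<zero>\<^bsub>record_ring e E\<^esub> = 0" "\<one>\<^bsub>record_ring e E\<^esub> = e" by (simp_all add: record_ring_def)
  have E: "finite E" "ring_on e E" "e \<noteq> 0" using assms by (auto simp: div_ring_on_def)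
  note R = ring_onD[OF E(2)]
  have "card {0, e} \<le> card E" using E R by (intro card_mono) (auto simp: addsub_zero)
  then have pos: "card E - 1 > 0" using E by auto
  obtain a where a: "a \<in> E - {0}" "E - {0} = {a [^]\<^bsub>record_ring e E\<^esub> i | i::nat. True}"
    using finite_field_mult_group_has_gen E by (simp add: c nat_pow_mult_of) blast
  have aE: "a \<in> E" using a(1) by simp
  have aN: "a ^ (card E - 1) = e" using div_ring_pow_card[OF assms] a(1) by auto
  have a0: "a [^]\<^bsub>record_ring e E\<^esub> (0::nat) = e" by (simp add: nat_pow_def record_ring_def)
  \<comment> \<open>Once \<open>a ^ m = e\<close>, exponents can be reduced modulo \<open>m\<close>
    into \<open>{1..m}\<close>. With \<open>m = card E - 1\<close> this lists
    \<open>E - {0}\<close>; with a smaller \<open>m\<close> it would list too few elements, which is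
    the last claim on \<open>c\<close>.\<close>
  have sub: "E - {0} \<subseteq> (\<lambda>i. a ^ i) ` {1..m}" if m: "m > 0" "a ^ m = e" for m
  proof
    fix x assume "x \<in> E - {0}"
    then obtain i :: nat where i: "x = a [^]\<^bsub>record_ring e E\<^esub> i" using a by auto
    have am: "a ^ (m * k + i) = a ^ i" if "i > 0" for k i
    proof (induction k)
      case (Suc k)
      have "a ^ (m * Suc k + i) = a ^ m * a ^ (m * k + i)" by (simp flip: power_add add: algebra_simps)
      also have "\<dots> = e * a ^ i" by (simp only: Suc m(2))
      also have "\<dots> = a ^ i" by (rule R(4)[OF power_closed[of E a i]]) (use R(2) aE that in auto)
      finally show ?case .
    qed simp
    show "x \<in> (\<lambda>i. a ^ i) ` {1..m}"
    proof (cases "i mod m = 0")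
      case True
      have "x = e"
      proof (cases "i = 0")
        case False
        then have "x = a ^ i" using i record_ring_pow E aE by auto
        moreover obtain k where "i = m * Suc k" using True False by (metis dvdE mod_0_imp_dvd mult_0_right not0_implies_Suc)
        then have "a ^ i = a ^ (m * k + m)" by (simp add: algebra_simps)
        then have "a ^ i = e" using am[OF m(1)] m by simp
        ultimately show ?thesis by simp
      qed (use i a0 in simp)
      then show ?thesis using m by (auto intro!: image_eqI[of _ _ m])
    next
      case False
      then have "i > 0" by (cases i) auto
      then have "x = a ^ i" using i record_ring_pow E aE by auto
      also have "\<dots> = a ^ (i mod m)" using am[of "i mod m" "i div m"] False by (simp add: mult.commute)
      finally show ?thesis using False m mod_less_divisor[of m i] by (intro image_eqI[of _ _ "i mod m"]) auto
    qed
  qed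
  show ?thesis
  proof (rule that[of a])
    show "a ^ (card E - 1) = e" by fact
    show "E - {0} = (\<lambda>i. a ^ i) ` {1..card E - 1}"
    proof
      show "(\<lambda>i. a ^ i) ` {1..card E - 1} \<subseteq> E - {0}"
      proof clarify
        fix i assume i: "i \<in> {1..card E - 1}"
        then have "a ^ i \<in> {a [^]\<^bsub>record_ring e E\<^esub> i | i::nat. True}"
          using record_ring_pow[OF E(2), of a i] a(1) by (auto intro!: exI[of _ i])
        then show "a ^ i \<in> E - {0}" using a(2) by blast
      qed
    qed (rule sub[OF pos aN])
    show "a ^ i \<noteq> e" if "0 < i" "i < card E - 1" for i
    proof
      assume "a ^ i = e"
      from sub[OF that(1) this] have "card (E - {0}) \<le> card ((\<lambda>i. a ^ i) ` {1..i})"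
        by (intro card_mono) auto
      also have "\<dots> \<le> i" using card_image_le[of "{1..i}" "\<lambda>i. a ^ i"] by simp
      finally show False using that E R by (simp add: addsub_zero)
    qed
  qed (use a(1) in auto)
qed

lemma addsubI:
  assumes "0 \<in> X" "\<And>x y. x \<in> X \<Longrightarrow> y \<in> X \<Longrightarrow> x - y \<in> X"
  shows "addsub X"
  using assms by (simp add: addsub_def)

section \<open>Wedderburn's little theorem\<close>

definition centralizer :: "'r::ring_1 set \<Rightarrow> 'r set \<Rightarrow> 'r set" where
  "centralizer R X = {x \<in> R. \<forall>y\<in>X. x * y = y * x}"

lemma ring_centralizer:
  assumes "ring_on e R" "X \<subseteq> R"
  shows "ring_on e (centralizer R X)"
  unfolding ring_on_def
proof (intro conjI ballI)
  note R = ring_onD[OF assms(1)]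
  have I: "z \<in> centralizer R X" if "z \<in> R" "\<And>x. x \<in> X \<Longrightarrow> z * x = x * z" for z
    using that unfolding centralizer_def by blast
  have D: "z \<in> R" "x \<in> X \<Longrightarrow> z * x = x * z" if "z \<in> centralizer R X" for z x
    using that unfolding centralizer_def by blast+
  show "addsub (centralizer R X)"
  proof (rule addsubI)
    show "0 \<in> centralizer R X" by (rule I) (simp_all add: addsub_zero[OF R(1)])
    fix x y assume xy: "x \<in> centralizer R X" "y \<in> centralizer R X"
    show "x - y \<in> centralizer R X"
    proof (rule I)
      show "x - y \<in> R" by (rule addsub_diff[OF R(1) D(1)[OF xy(1)] D(1)[OF xy(2)]])
      fix s assume "s \<in> X"
      then show "(x - y) * s = s * (x - y)"
        by (simp only: left_diff_distrib right_diff_distrib D(2)[OF xy(1)] D(2)[OF xy(2)])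
    qed
  qed
  show "e \<in> centralizer R X"
  proof (rule I[OF R(3)])
    fix x assume "x \<in> X"
    then have "x \<in> R" using assms(2) by blast
    then show "e * x = x * e" by (simp only: R(4,5))
  qed
  fix x y assume xy: "x \<in> centralizer R X" "y \<in> centralizer R X"
  show "x * y \<in> centralizer R X"
  proof (rule I)
    show "x * y \<in> R" by (rule R(2)[OF D(1)[OF xy(1)] D(1)[OF xy(2)]])
    fix s assume s: "s \<in> X"
    have "x * y * s = x * s * y" by (simp only: mult.assoc D(2)[OF xy(2) s])
    then show "x * y * s = s * (x * y)" by (simp only: mult.assoc D(2)[OF xy(1) s])
  qed
next
  note R = ring_onD[OF assms(1)]
  fix x assume "x \<in> centralizer R X"
  then have "x \<in> R" by (simp add: centralizer_def)
  then show "e * x = x" "x * e = x" by (rule R(4), rule R(5))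
qed

lemma sum_power_shift:
  fixes a :: "'r::ring_1"
  shows "(\<Sum>j=1..N. a ^ Suc j) = (\<Sum>j=1..N. a ^ j) + a ^ Suc N - a"
  by (induction N) simp_all

text \<open>Multiplication by \<open>a\<close> shifts the exponents by one and only exchanges the
  term \<open>a\<close> for \<open>a ^ Suc N\<close>, which is \<open>a\<close> again; so
  \<open>a - e\<close> annihilates the sum.\<close>

lemma geometric_sum_zero:
  assumes D: "div_ring_on e D" and a: "a \<in> D" "a \<noteq> e" "a ^ N = e"
  shows "(\<Sum>j=1..N. a ^ j) = 0"
proof -
  have R: "ring_on e D" using D by (simp add: div_ring_on_def)
  note R = ring_onD[OF R]
  let ?S = "\<Sum>j=1..N. a ^ j"
  have S: "?S \<in> D" by (rule addsub_sum[OF R(1)], rule power_closed) (use R a in auto)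
  have "a * ?S = ?S + a ^ Suc N - a"
    using sum_power_shift[of a N] by (simp add: sum_distrib_left)
  then have "(a - e) * ?S = 0" using a R(5) R(4)[OF S] by (simp add: algebra_simps)
  then show ?thesis using div_ring_on_domain[OF D addsub_diff[OF R(1) a(1) R(3)] S] a by simp
qed

lemma div_ring_pow_eq_unit:
  assumes D: "div_ring_on e D" and x: "x \<in> D" "x \<noteq> 0"
  shows "\<exists>k>0. x ^ k = e"
proof -
  have R: "ring_on e D" "finite D" using D by (auto simp: div_ring_on_def)
  note R = ring_onD[OF R(1)] R(2)
  have pD: "x ^ i \<in> D" if "i > 0" for i using power_closed[of D] R x that by auto
  have "\<not> inj_on (\<lambda>i::nat. x ^ i) {1..}"
  proof
    assume "inj_on (\<lambda>i::nat. x ^ i) {1..}"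
    then have "finite {1::nat..}" by (rule inj_on_finite[of _ _ D]) (use pD R in auto)
    then show False by (simp add: infinite_Ici)
  qed
  then obtain i' j' :: nat where "i' \<ge> 1" "j' \<ge> 1" "i' \<noteq> j'" "x ^ i' = x ^ j'" by (auto simp: inj_on_def)
  then obtain i j :: nat where ij: "0 < i" "i < j" "x ^ i = x ^ j"
    by (metis linorder_neqE_nat less_eq_Suc_le One_nat_def)
  have nz: "x ^ n \<noteq> 0" if "n > 0" for n
    using that
  proof (induction n)
    case (Suc n)
    then show ?case using x pD div_ring_on_domain[OF D x(1) pD[of n]] by (cases "n = 0") auto
  qed simp
  have "x ^ i * x ^ (j - i) = x ^ i" using ij power_add[of x i "j - i"] by simp
  then have "x ^ i * (x ^ (j - i) - e) = 0"
    using R(5)[OF pD[OF ij(1)]] by (simp add: right_diff_distrib)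
  then have "x ^ (j - i) - e = 0"
    using div_ring_on_domain[OF D pD[OF ij(1)] addsub_diff[OF R(1) pD[of "j - i"] R(3)]] nz[OF ij(1)] ij by auto
  then show ?thesis using ij by (intro exI[of _ "j - i"]) auto
qed

lemma power_mult_distrib_comm:
  fixes a b :: "'r::monoid_mult"
  assumes "a * b = b * a"
  shows "(a * b) ^ n = a ^ n * b ^ n"
proof (induction n)
  case (Suc n)
  have "b * a ^ n = a ^ n * b" using power_commuting_commutes[of a b n] assms by simp
  then show ?case using Suc by (simp add: mult.assoc) (metis mult.assoc)
qed simp

lemma pow_inverse:
  assumes R: "ring_on e D" and ab: "a \<in> D" "b \<in> D" "a * b = e" and i: "i > 0"
  shows "a ^ i * b ^ i = e"
  using i
proof (induction i)
  case (Suc i)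
  show ?case
  proof (cases "i = 0")
    case False
    have "a ^ Suc i * b ^ Suc i = a * (a ^ i * b ^ i) * b"
      by (simp add: power_commutes mult.assoc)
    also have "\<dots> = e" using Suc False ring_onD[OF R] ab by simp
    finally show ?thesis .
  qed (use ab in simp)
qed simp

text \<open>If \<open>E\<close> is a maximal commutative subring of \<open>D\<close> and \<open>E \<noteq> D\<close>, averaging over the cyclic
  group \<open>E\<^sup>*\<close> gives an \<open>x \<notin> E\<close> that normalises \<open>E\<close>; counting norms, \<open>x\<close> can be rescaled by \<open>E\<close> to
  have \<open>x ^ t = e\<close>, where \<open>t\<close> is minimal with \<open>x ^ t \<in> E\<close>. Then \<open>x + \<dots> + x ^ t = 0\<close>, which
  contradicts the independence of the powers of \<open>x\<close> over \<open>E\<close>.\<close>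

theorem wedderburn_little:
  assumes D: "div_ring_on e D" and xy: "x \<in> D" "y \<in> D"
  shows "x * y = y * x"
proof (rule ccontr)
  assume noncomm: "x * y \<noteq> y * x"
  have D': "ring_on e D" "finite D" "e \<noteq> 0" using D by (auto simp: div_ring_on_def)
  note R = ring_onD[OF D'(1)]
  have dom: "a = 0 \<or> b = 0" if "a \<in> D" "b \<in> D" "a * b = 0" for a b
    using div_ring_on_domain[OF D that] .
  define C where "C X = centralizer D X" for X
  have CI: "z \<in> C X" if "z \<in> D" "\<And>x. x \<in> X \<Longrightarrow> z * x = x * z" for z X
    using that by (simp add: C_def centralizer_def)
  have CD: "z \<in> D" "x \<in> X \<Longrightarrow> z * x = x * z" if "z \<in> C X" for z x X
    using that by (auto simp: C_def centralizer_def)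
  have C_ring: "ring_on e (C X)" if X: "X \<subseteq> D" for X
    unfolding C_def by (rule ring_centralizer[OF D'(1) X])
  \<comment> \<open>The double centralizer of a commuting set is a commutative subring containing
    it. Maximality of \<open>E\<close> can thus be tested by adjoining a single element, and
    \<open>E\<close> turns out to be its own centralizer (\<open>CE\<close>).\<close>
  have CC: "ring_on e (C (C X)) \<and> (\<forall>a\<in>C (C X). \<forall>b\<in>C (C X). a * b = b * a) \<and> X \<subseteq> C (C X)"
    if "X \<subseteq> D" "\<forall>a\<in>X. \<forall>b\<in>X. a * b = b * a" for X
  proof -
    have XC: "X \<subseteq> C X"
    proof
      fix z assume "z \<in> X"
      then show "z \<in> C X" using that by (intro CI) blast+
    qed
    have CCX: "C (C X) \<subseteq> C X"
    proof
      fix z assume z: "z \<in> C (C X)"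
      show "z \<in> C X"
      proof (rule CI)
        fix x assume "x \<in> X"
        then have "x \<in> C X" using XC by blast
        then show "z * x = x * z" by (rule CD(2)[OF z])
      qed (rule CD(1)[OF z])
    qed
    have "X \<subseteq> C (C X)"
    proof
      fix z assume z: "z \<in> X"
      show "z \<in> C (C X)"
      proof (rule CI)
        show "z \<in> D" using z that by blast
        fix x assume "x \<in> C X"
        from CD(2)[OF this z] show "z * x = x * z" by (rule sym)
      qed
    qed
    moreover have "a * b = b * a" if "a \<in> C (C X)" "b \<in> C (C X)" for a b
      using CD(2)[OF that(1)] CCX that(2) by blast
    moreover have "C X \<subseteq> D" using CD(1) by blast
    ultimately show ?thesis using C_ring[of "C X"] by blast
  qed
  define \<F> where "\<F> = {E. E \<subseteq> D \<and> ring_on e E \<and> (\<forall>a\<in>E. \<forall>b\<in>E. a * b = b * a)}"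
  have FI: "C (C X) \<in> \<F>" if "X \<subseteq> D" "\<forall>a\<in>X. \<forall>b\<in>X. a * b = b * a" for X
    using CC[OF that] CD(1) unfolding \<F>_def by blast
  have "C (C {}) \<in> \<F>" by (rule FI) auto
  moreover have "finite \<F>" by (rule finite_subset[of _ "Pow D"]) (use D'(2) in \<open>auto simp: \<F>_def\<close>)
  ultimately obtain E where E: "E \<in> \<F>" and max: "\<And>E'. E' \<in> \<F> \<Longrightarrow> E \<subseteq> E' \<Longrightarrow> E = E'"
    using finite_has_maximal[of \<F>] by blast
  have ED: "E \<subseteq> D" and ER: "ring_on e E" and Ecomm: "\<And>a b. a \<in> E \<Longrightarrow> b \<in> E \<Longrightarrow> a * b = b * a"
    using E unfolding \<F>_def by blast+
  note RE = ring_onD[OF ER]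
  have CE: "d \<in> E" if "d \<in> D" "\<And>z. z \<in> E \<Longrightarrow> d * z = z * d" for d
  proof -
    have i: "insert d E \<subseteq> D" "\<forall>a\<in>insert d E. \<forall>b\<in>insert d E. a * b = b * a"
      using that(1) ED apply blast
      using that(2) Ecomm by (metis insert_iff)
    have "C (C (insert d E)) \<in> \<F>" "insert d E \<subseteq> C (C (insert d E))"
      using FI[OF i] CC[OF i] by blast+
    then show ?thesis using max by blast
  qed
  have "E \<noteq> D" using noncomm xy Ecomm by blast
  have finE: "finite E" using ED D'(2) finite_subset by auto
  have Ediv: "div_ring_on e E"
    by (rule finite_domain_div_ring_on[OF ER finE D'(3)]) (use dom ED in auto)
  define iv where "iv a = (SOME b. b \<in> D \<and> a * b = e \<and> b * a = e)" for a
  have iv: "iv a \<in> D" "a * iv a = e" "iv a * a = e" if "a \<in> D" "a \<noteq> 0" for a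
    using someI_ex[of "\<lambda>b. b \<in> D \<and> a * b = e \<and> b * a = e"] D that
    by (auto simp: div_ring_on_def iv_def)
  have ivE: "iv a \<in> E" if aE: "a \<in> E" "a \<noteq> 0" for a
  proof -
    obtain b where b: "b \<in> E" "a * b = e" using Ediv aE unfolding div_ring_on_def by blast
    have a: "a \<in> D" using aE ED by auto
    have "iv a = iv a * (a * b)" using R(5)[OF iv(1)[OF a aE(2)]] by (simp only: b(2))
    also have "\<dots> = e * b" by (simp only: iv(3)[OF a aE(2)] flip: mult.assoc)
    also have "\<dots> = b" by (rule RE(4)[OF b(1)])
    finally show ?thesis using b(1) by simp
  qed
  define N where "N = card E - 1"
  obtain c where c: "c \<in> E" "c \<noteq> 0" "E - {0} = (\<lambda>i. c ^ i) ` {1..N}" "c ^ N = e"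
    "\<And>i. 0 < i \<Longrightarrow> i < N \<Longrightarrow> c ^ i \<noteq> e"
    using field_on_generator[OF Ediv Ecomm] unfolding N_def by metis
  have cardE: "card E = Suc N"
  proof -
    have "e \<in> E" using RE by simp
    then have "card E > 0" using finE by (auto simp: card_gt_0_iff)
    then show ?thesis by (simp add: N_def)
  qed
  have Npos: "N > 0" using c(4) D'(3) RE c(1,3) by (cases N) auto
  have pE: "a ^ i \<in> E" if "a \<in> E" "i > 0" for a i using power_closed[of E] RE that by auto
  have pD: "a ^ i \<in> D" if "a \<in> D" "i > 0" for a i using power_closed[of D] R that by auto
  have pN: "a ^ N = e" if "a \<in> E" "a \<noteq> 0" for a
    using div_ring_pow_card[OF Ediv Ecomm that] by (simp add: N_def)
  \<comment> \<open>\<open>card E = N + 1\<close> annihilates \<open>D\<close>, so \<open>N\<close>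
    acts as \<open>-1\<close>. Averages over the cyclic group of order \<open>N\<close> can
    therefore be inverted, although the characteristic is positive.\<close>
  have Nd: "of_nat N * d = - d" if "d \<in> D" for d
  proof -
    have "of_nat (card E) * e = 0" using card_mult_eq_0 RE finE by blast
    then have "of_nat (card E) * e * d = 0" by simp
    then have "of_nat (card E) * d = 0" using R(4)[OF that] by (simp add: mult.assoc)
    then show ?thesis by (simp add: cardE algebra_simps add_eq_0_iff)
  qed
  have cD: "c \<in> D" using c ED by auto
  define c' where "c' = iv c"
  have c': "c' \<in> E" "c * c' = e" "c' * c = e" "c' \<in> D"
    using iv[OF cD c(2)] ivE[OF c(1,2)] by (auto simp: c'_def)
  have eP: "e ^ i = e" if "i > 0" for i
    using that
  proof (induction i)
    case (Suc i)
    then show ?case using R(3,4) by (cases "i = 0") auto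
  qed simp
  have sum_pow: "(\<Sum>j=1..N. a ^ j) = (if a = e then of_nat N * e else 0)" if "a \<in> E" "a \<noteq> 0" for a
    using geometric_sum_zero[OF Ediv that(1) _ pN[OF that]] eP by auto
  obtain d where d: "d \<in> D" "d \<notin> E" using \<open>E \<noteq> D\<close> ED by auto
  have powcomm: "a * z ^ i = z ^ i * a" if "a * z = z * a" for a z :: 'a and i
    using power_commuting_commutes[of z a i] that by simp
  have comm_all: "a * z = z * a" if az: "a * c = c * a" "z \<in> E" for a z
  proof (cases "z = 0")
    case False
    then obtain i where "z = c ^ i" using c(3) az(2) by blast
    then show ?thesis using powcomm[OF az(1)] by simp
  qed simp
  have dc: "d * c \<noteq> c * d" using CE[OF d(1)] d(2) comm_all by blast
  \<comment> \<open>Up to sign, \<open>P l\<close> projects \<open>d\<close> onto the solutions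
    \<open>x\<close> of \<open>x * c = l * c * x\<close>, an eigenspace of conjugation by
    \<open>c\<close>. The sum over all \<open>l\<close> recovers \<open>- d\<close>, and since
    \<open>d\<close> does not commute with \<open>c\<close>, some \<open>l \<noteq> e\<close> has a
    nonzero component.\<close>
  define P where "P l = (\<Sum>i=1..N. l ^ i * (c ^ i * d * c' ^ i))" for l
  have PD: "P l \<in> D" if "l \<in> E" for l
    unfolding P_def by (rule addsub_sum[OF R(1)])
      (use R(2) pD[of c] pD[of c'] pD[of l] cD c' d that ED in auto)
  have Peig: "P l * c = l * c * P l" if l: "l \<in> E" "l \<noteq> 0" for l
  proof -
    define h where "h i = l ^ i * (c ^ i * d * c' ^ i)" for i
    have h: "l * (c * h i * c') = h (Suc i)" if "i > 0" for i
    proof -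
      have "c * l ^ i = l ^ i * c" using Ecomm[OF c(1) pE[OF l(1) that]] .
      then have sw: "c * (l ^ i * z) = l ^ i * (c * z)" for z by (simp flip: mult.assoc)
      show ?thesis by (simp only: h_def mult.assoc sw power_Suc power_commutes)
    qed
    have "h (Suc N) = h 1"
    proof -
      have "a ^ Suc N = a" if "a \<in> E" "a \<noteq> 0" for a using pN[OF that] RE(5)[OF that(1)] by simp
      moreover have "c' \<noteq> 0" using c'(2) D'(3) by auto
      ultimately show ?thesis using l c c' by (simp add: h_def del: power_Suc)
    qed
    then have shift: "(\<Sum>i=1..N. h (Suc i)) = (\<Sum>i=1..N. h i)"
    proof -
      have "(\<Sum>i=1..N. h (Suc i)) = (\<Sum>i=1..N. h i) + h (Suc N) - h 1" by (induction N) simp_all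
      then show ?thesis using \<open>h (Suc N) = h 1\<close> by simp
    qed
    have "l * (c * P l * c') = (\<Sum>i=1..N. l * (c * h i * c'))"
      by (simp add: P_def h_def sum_distrib_left sum_distrib_right)
    also have "\<dots> = (\<Sum>i=1..N. h (Suc i))" by (rule sum.cong) (auto simp: h)
    also have "\<dots> = P l" by (simp only: shift) (simp only: h_def P_def)
    finally have "P l * c = l * c * P l * (c' * c)" by (metis mult.assoc)
    also have "\<dots> = l * c * P l"
      using R(5)[OF R(2)[OF R(2) PD]] l c(1) ED c' by (auto simp: c'(3))
    finally show ?thesis .
  qed
  have "(\<Sum>j=1..N. P (c ^ j)) = - d"
  proof -
    have cc: "(\<Sum>j=1..N. (c ^ j) ^ i) = (if i = N then of_nat N * e else 0)" if "i \<in> {1..N}" for i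
    proof -
      have "(\<Sum>j=1..N. (c ^ j) ^ i) = (\<Sum>j=1..N. (c ^ i) ^ j)" by (simp flip: power_mult add: mult.commute)
      moreover have "c ^ i \<in> E" "c ^ i \<noteq> 0" using that c(3) by (auto simp: )
      moreover have "c ^ i = e \<longleftrightarrow> i = N" using that c(4) c(5)[of i] by (cases "i = N") auto
      ultimately show ?thesis using sum_pow[of "c ^ i"] by simp
    qed
    have "(\<Sum>j=1..N. P (c ^ j)) = (\<Sum>i=1..N. (\<Sum>j=1..N. (c ^ j) ^ i) * (c ^ i * d * c' ^ i))"
      unfolding P_def sum_distrib_right by (rule sum.swap)
    also have "\<dots> = (\<Sum>i=1..N. (if i = N then of_nat N * e * (c ^ i * d * c' ^ i) else 0))"
      by (rule sum.cong) (simp_all only: cc, simp)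
    also have "\<dots> = of_nat N * e * (c ^ N * d * c' ^ N)" using Npos by simp
    also have "\<dots> = of_nat N * (e * (e * d * c' ^ N))" by (simp only: c(4) mult.assoc)
    also have "c' ^ N = e"
    proof (rule pN[OF c'(1)])
      show "c' \<noteq> 0" using c'(2) D'(3) by auto
    qed
    also have "e * (e * d * e) = d" by (simp only: R(4,5)[OF d(1)])
    also have "of_nat N * d = - d" by (rule Nd[OF d(1)])
    finally show ?thesis .
  qed
  have "\<exists>j. 0 < j \<and> j < N \<and> P (c ^ j) \<noteq> 0"
  proof (rule ccontr)
    assume n: "\<not> ?thesis"
    have "P (c ^ j) = (if j = N then P e else 0)" if "j \<in> {1..N}" for j
    proof (cases "j = N")
      case False
      then have "0 < j" "j < N" using that by auto
      then show ?thesis using n False by auto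
    qed (simp add: c(4))
    then have "(\<Sum>j=1..N. P (c ^ j)) = (\<Sum>j=1..N. if j = N then P e else 0)"
      by (intro sum.cong) blast+
    then have "P e = - d" using \<open>(\<Sum>j=1..N. P (c ^ j)) = - d\<close> Npos by simp
    then have "d * c = c * d" using Peig[OF RE(3) D'(3)] RE(4)[OF c(1)] by simp
    then show False using dc by simp
  qed
  then obtain j where j: "0 < j" "j < N" "P (c ^ j) \<noteq> 0" by auto
  define l where "l = c ^ j"
  have l: "l \<in> E" "l \<noteq> 0" "l \<noteq> e"
    using c(3) j c(5)[of j] by (auto simp: l_def)
  define x where "x = P l"
  have x: "x \<in> D" "x \<noteq> 0" "x * c = l * c * x" using PD Peig l j by (auto simp: x_def l_def)
  \<comment> \<open>Conjugation by \<open>x\<close> multiplies \<open>c\<close> by \<open>l\<close>;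
    as the powers of \<open>c\<close> exhaust \<open>E - {0}\<close>, it maps \<open>E\<close> into
    itself, and it moves \<open>c\<close>.\<close>
  define \<sigma> where "\<sigma> z = x * z * iv x" for z
  have \<sigma>_mult: "\<sigma> (a * b) = \<sigma> a * \<sigma> b" if "a \<in> D" "b \<in> D" for a b
  proof -
    have "\<sigma> a * \<sigma> b = x * a * (iv x * x) * b * iv x" by (simp add: \<sigma>_def mult.assoc)
    also have "\<dots> = x * (a * b) * iv x" using iv(3)[OF x(1,2)] R(5)[OF R(2)[OF x(1) that(1)]] by (simp add: mult.assoc)
    finally show ?thesis by (simp add: \<sigma>_def)
  qed
  have \<sigma>x: "x * z = \<sigma> z * x" if "z \<in> D" for z
    using iv(3)[OF x(1,2)] R(5)[OF R(2)[OF x(1) that]] by (simp add: \<sigma>_def mult.assoc)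
  have \<sigma>e: "\<sigma> e = e" using iv(2)[OF x(1,2)] R(5)[OF x(1)] by (simp add: \<sigma>_def)
  have \<sigma>c: "\<sigma> c = l * c"
  proof -
    have "\<sigma> c = l * c * (x * iv x)" by (simp add: \<sigma>_def x(3) mult.assoc)
    then show ?thesis using iv(2)[OF x(1,2)] RE l c by simp
  qed
  have \<sigma>D: "\<sigma> z \<in> D" if "z \<in> D" for z using R(2) iv[OF x(1,2)] x that by (simp add: \<sigma>_def)
  have \<sigma>pow: "\<sigma> (a ^ i) = \<sigma> a ^ i" if "a \<in> D" "i > 0" for a i
    using that(2)
  proof (induction i)
    case (Suc i)
    then show ?case using \<sigma>_mult[OF that(1) pD[OF that(1), of i]] by (cases "i = 0") auto
  qed simp
  have \<sigma>E: "\<sigma> z \<in> E" if zE: "z \<in> E" for z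
  proof (cases "z = 0")
    case False
    then obtain i where "i \<in> {1..N}" "z = c ^ i" using c(3) zE by blast
    then show ?thesis using \<sigma>pow[OF cD, of i] pE[of "l * c" i] RE l c by (simp add: \<sigma>c)
  qed (simp add: \<sigma>_def RE addsub_zero)
  have \<sigma>nz: "\<sigma> z \<noteq> 0" if "z \<in> D" "z \<noteq> 0" for z
    using \<sigma>x[OF that(1)] dom[OF x(1) that(1)] x that by auto
  have \<sigma>iE: "(\<sigma> ^^ i) z \<in> E" if "z \<in> E" for z i using that \<sigma>E by (induction i) auto
  have \<sigma>ipow: "(\<sigma> ^^ i) (z ^ k) = (\<sigma> ^^ i) z ^ k" if "z \<in> E" "k > 0" for z i k
  proof (induction i)
    case (Suc i)
    have "(\<sigma> ^^ i) z \<in> D" using \<sigma>iE[OF that(1), of i] ED by blast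
    then show ?case using Suc \<sigma>pow[OF _ that(2)] by simp
  qed simp
  have xE: "x \<notin> E"
  proof
    assume "x \<in> E"
    then have "c * x = l * (c * x)" using x(3) Ecomm c(1) by (metis mult.assoc)
    then have "(l - e) * (c * x) = 0" using R(4)[OF R(2)[OF cD x(1)]] by (simp add: algebra_simps)
    moreover have "l - e \<in> D" using l ED R by (intro addsub_diff) auto
    ultimately show False using dom R(2)[OF cD x(1)] l c x cD by (metis eq_iff_diff_eq_0)
  qed
  define t where "t = (LEAST t. t > 0 \<and> x ^ t \<in> E)"
  have t: "t > 0" "x ^ t \<in> E"
  proof -
    obtain k where "k > 0" "x ^ k = e" using div_ring_pow_eq_unit[OF D x(1,2)] by auto
    then have "k > 0 \<and> x ^ k \<in> E" using RE by simp
    then have "t > 0 \<and> x ^ t \<in> E" unfolding t_def by (rule LeastI)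
    then show "t > 0" "x ^ t \<in> E" by auto
  qed
  have tmin: "x ^ i \<notin> E" if "0 < i" "i < t" for i
    using not_less_Least[of i "\<lambda>t. t > 0 \<and> x ^ t \<in> E"] that by (auto simp: t_def)
  have rel: "w ^ i * z = (\<sigma> ^^ i) z * w ^ i" if "\<And>z. z \<in> E \<Longrightarrow> w * z = \<sigma> z * w" "z \<in> E" for w z i
  proof (induction i)
    case (Suc i)
    have "w ^ Suc i * z = w * (w ^ i * z)" by (simp add: mult.assoc)
    also have "\<dots> = \<sigma> ((\<sigma> ^^ i) z) * w * w ^ i"
      using that(1)[OF \<sigma>iE[OF that(2), of i]] by (simp add: Suc flip: mult.assoc)
    finally show ?case by (simp add: mult.assoc)
  qed simp
  have nzpow: "a ^ i \<noteq> 0" if "a \<in> D" "a \<noteq> 0" for a i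
  proof (induction i)
    case (Suc i)
    then show ?case using dom[OF that(1) pD[OF that(1), of i]] that by (cases "i = 0") auto
  qed (use D'(3) in \<open>auto\<close>)
  \<comment> \<open>\<open>\<mu> i\<close> is the factor by which \<open>x ^ i\<close> fails to
    commute with \<open>c\<close>. By minimality of \<open>t\<close> it differs from
    \<open>e\<close> for \<open>0 < i < t\<close>, so a summation over all powers \<open>j\<close>
    singles out the index \<open>t\<close>; this is the independence stated in
    \<open>indep\<close>.\<close>
  define \<mu> where "\<mu> i = (\<sigma> ^^ i) c * c'" for i
  have \<mu>E: "\<mu> i \<in> E" for i using RE(2) \<sigma>iE c c' by (simp add: \<mu>_def)
  have \<mu>c: "\<mu> i * c = (\<sigma> ^^ i) c" for i
    using c'(3) RE(5)[OF \<sigma>iE[OF c(1)]] by (simp add: \<mu>_def mult.assoc)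
  have \<sigma>t: "(\<sigma> ^^ t) z = z" if "z \<in> E" for z
  proof -
    have "x ^ t * z = (\<sigma> ^^ t) z * x ^ t" by (rule rel) (use \<sigma>x ED that in auto)
    then have "((\<sigma> ^^ t) z - z) * x ^ t = 0" using Ecomm[OF t(2) that] by (simp add: algebra_simps)
    moreover have "(\<sigma> ^^ t) z - z \<in> D" using \<sigma>iE[OF that, of t] that ED R by (intro addsub_diff) auto
    ultimately show ?thesis using dom pD[OF x(1) t(1)] nzpow[OF x(1,2)] by force
  qed
  have \<mu>t: "\<mu> t = e" using \<sigma>t[OF c(1)] c' by (simp add: \<mu>_def)
  have \<mu>ne: "\<mu> i \<noteq> e" if "0 < i" "i < t" for i
  proof
    assume "\<mu> i = e"
    then have "(\<sigma> ^^ i) c = c" using \<mu>c[of i] RE c by simp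
    moreover have "x ^ i * c = (\<sigma> ^^ i) c * x ^ i" by (rule rel) (use \<sigma>x ED c in auto)
    ultimately have "x ^ i * z = z * x ^ i" if "z \<in> E" for z using comm_all that by simp
    then show False using CE[OF pD[OF x(1) that(1)]] tmin[OF that] by simp
  qed
  have \<mu>nz: "\<mu> i \<noteq> 0" for i
  proof -
    have "(\<sigma> ^^ i) c \<noteq> 0 \<and> (\<sigma> ^^ i) c \<in> D"
      by (induction i) (use c cD \<sigma>nz \<sigma>D in auto)
    then show ?thesis using \<mu>c[of i] by auto
  qed
  have indep: "g t = 0" if g: "\<And>i. g i \<in> D" "\<And>j. j \<in> {1..N} \<Longrightarrow> (\<Sum>i=1..t. \<mu> i ^ j * g i) = 0" for g
  proof -
    have "0 = (\<Sum>j=1..N. \<Sum>i=1..t. \<mu> i ^ j * g i)" using g(2) by simp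
    also have "\<dots> = (\<Sum>i=1..t. (\<Sum>j=1..N. \<mu> i ^ j) * g i)"
      unfolding sum_distrib_right by (rule sum.swap)
    also have "\<dots> = (\<Sum>i=1..t. if i = t then of_nat N * e * g t else 0)"
      by (intro sum.cong) (use \<mu>t \<mu>ne sum_pow[OF \<mu>E \<mu>nz] in auto)
    also have "\<dots> = of_nat N * (e * g t)" using t by (simp add: mult.assoc)
    also have "\<dots> = - g t" using R(4) g(1) Nd by simp
    finally show ?thesis by simp
  qed
  define Ey where "Ey = E - {0}"
  define K0 where "K0 = {z \<in> Ey. \<sigma> z = z}"
  \<comment> \<open>This is the norm of \<open>y\<close> with respect to \<open>\<sigma>\<close>,
    that is the product of \<open>y\<close>, \<open>\<sigma> y\<close>, and so on up to
    \<open>t\<close> factors, times \<open>x ^ t\<close>.\<close>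
  define f where "f y = (y * x) ^ t" for y
  have w: "y * x * z = \<sigma> z * (y * x)" if "y \<in> E" "z \<in> E" for y z
  proof -
    have "y * x * z = y * (\<sigma> z * x)" using \<sigma>x[of z] that ED by (auto simp: mult.assoc)
    also have "\<dots> = \<sigma> z * (y * x)" using Ecomm[OF that(1) \<sigma>E[OF that(2)]] by (metis mult.assoc)
    finally show ?thesis .
  qed
  have wD: "y * x \<in> D" "y * x \<noteq> 0" if "y \<in> Ey" for y
    using R(2) dom[of y x] x that ED by (auto simp: Ey_def)
  have fK0: "f y \<in> K0" if y: "y \<in> Ey" for y
  proof -
    have yE: "y \<in> E" using y by (simp add: Ey_def)
    let ?w = "y * x"
    have "f y \<in> E"
    proof (rule CE)
      show "f y \<in> D" using pD[OF wD(1)[OF y] t(1)] by (simp add: f_def)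
      show "f y * z = z * f y" if "z \<in> E" for z
        using rel[of ?w z t, OF w[OF yE] that] \<sigma>t[OF that] by (simp add: f_def)
    qed
    moreover have "f y \<noteq> 0" using nzpow[OF wD[OF y]] by (simp add: f_def)
    moreover have "\<sigma> (f y) = f y"
    proof -
      have "(\<sigma> (f y) - f y) * ?w = 0"
        using w[OF yE \<open>f y \<in> E\<close>] power_commutes[of ?w t] by (simp add: f_def algebra_simps)
      moreover have "\<sigma> (f y) - f y \<in> D"
        using \<sigma>E[OF \<open>f y \<in> E\<close>] \<open>f y \<in> E\<close> ED R by (intro addsub_diff) auto
      ultimately show ?thesis using dom[OF _ wD(1)[OF y]] wD(2)[OF y] by force
    qed
    ultimately show ?thesis by (simp add: K0_def Ey_def)
  qed
  define G where "G = (\<lambda>b. b * iv (\<sigma> b)) ` Ey"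
  \<comment> \<open>Hilbert's theorem 90: if \<open>f\<close> has equal values, the quotient
    \<open>u\<close> has norm \<open>U t = e\<close>, and a resolvent \<open>s b\<close>, which is
    nonzero for some \<open>b\<close> by \<open>indep\<close>, satisfies
    \<open>\<sigma> (s b) * u = s b\<close>.\<close>
  have fibre: "\<exists>v\<in>G. y2 = y * v" if y: "y \<in> Ey" "y2 \<in> Ey" and eq: "f y = f y2" for y y2
  proof -
    have yE: "y \<in> E" "y2 \<in> E" "y \<noteq> 0" "y \<in> D" using y ED by (auto simp: Ey_def)
    define u where "u = y2 * iv y"
    have u: "u \<in> E" "u * y = y2"
      using yE RE iv[OF yE(4,3)] ivE by (auto simp: u_def mult.assoc)
    have w2: "y2 * x = u * (y * x)" using u(2) by (simp flip: mult.assoc)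
    define U where "U = rec_nat e (\<lambda>i a. \<sigma> a * u)"
    have U: "U 0 = e" "U (Suc i) = \<sigma> (U i) * u" for i by (simp_all add: U_def)
    have UE: "U i \<in> E" for i by (induction i) (use RE \<sigma>E u U in auto)
    have Uw: "(y2 * x) ^ i = U i * (y * x) ^ i" if "i > 0" for i
      using that
    proof (induction i)
      case (Suc i)
      show ?case
      proof (cases "i = 0")
        case False
        have "(y2 * x) ^ Suc i = y2 * x * U i * (y * x) ^ i" using Suc False by (simp add: mult.assoc)
        also have "y2 * x * U i = \<sigma> (U i) * (u * (y * x))" using w[OF yE(2) UE[of i]] w2 by simp
        finally show ?thesis by (simp add: U mult.assoc)
      qed (use U \<sigma>e RE(4)[OF u(1)] w2 in simp)
    qed simp
    have Ut: "U t = e"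
    proof -
      have "(U t - e) * (y * x) ^ t = 0"
        using Uw[OF t(1)] eq R(4)[OF pD[OF wD(1)[OF y(1)] t(1)]] by (simp add: f_def algebra_simps)
      moreover have "U t - e \<in> D" using UE[of t] ED R by (intro addsub_diff) auto
      ultimately show ?thesis
        using dom[OF _ pD[OF wD(1)[OF y(1)] t(1)]] nzpow[OF wD[OF y(1)]] by force
    qed
    define s where "s b = (\<Sum>i=1..t. U i * (\<sigma> ^^ i) b)" for b
    have sE: "s b \<in> E" if "b \<in> E" for b
      unfolding s_def by (rule addsub_sum[OF RE(1)]) (use RE(2) UE \<sigma>iE that in auto)
    have "\<exists>b\<in>E. s b \<noteq> 0"
    proof (rule ccontr)
      assume s0: "\<not> ?thesis"
      have "U t = 0"
      proof (rule indep)
        show "U i \<in> D" for i using UE ED by auto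
        fix j assume j: "j \<in> {1..N}"
        then have "s (c ^ j) = 0" using s0 pE[OF c(1)] by auto
        then have "0 = s (c ^ j) * c' ^ j" by simp
        also have "\<dots> = (\<Sum>i=1..t. \<mu> i ^ j * U i)"
          unfolding s_def sum_distrib_right
        proof (rule sum.cong)
          fix i assume "i \<in> {1..t}"
          have "U i * (\<sigma> ^^ i) (c ^ j) * c' ^ j = U i * (((\<sigma> ^^ i) c) ^ j * c' ^ j)"
            using \<sigma>ipow[OF c(1)] j by (simp add: mult.assoc)
          also have "((\<sigma> ^^ i) c) ^ j * c' ^ j = \<mu> i ^ j"
            unfolding \<mu>_def by (rule power_mult_distrib_comm[symmetric, OF Ecomm[OF \<sigma>iE[OF c(1)] c'(1)]])
          finally show "U i * (\<sigma> ^^ i) (c ^ j) * c' ^ j = \<mu> i ^ j * U i"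
            using Ecomm[OF UE pE[OF \<mu>E, of j]] j by simp
        qed simp
        finally show "(\<Sum>i=1..t. \<mu> i ^ j * U i) = 0" by simp
      qed
      then show False using Ut D'(3) by simp
    qed
    then obtain b where b: "b \<in> E" "s b \<noteq> 0" by auto
    define a where "a = s b"
    have a: "a \<in> E" "a \<noteq> 0" "a \<in> D" using sE b ED by (auto simp: a_def)
    have "\<sigma> a * u = a"
    proof -
      have "\<sigma> a * u = (\<Sum>i=1..t. \<sigma> (U i * (\<sigma> ^^ i) b) * u)"
        by (simp add: a_def s_def \<sigma>_def sum_distrib_left sum_distrib_right)
      also have "\<dots> = (\<Sum>i=1..t. U (Suc i) * (\<sigma> ^^ Suc i) b)"
      proof (rule sum.cong)
        fix i assume "i \<in> {1..t}"
        have "\<sigma> (U i * (\<sigma> ^^ i) b) = \<sigma> (U i) * \<sigma> ((\<sigma> ^^ i) b)"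
          using UE[of i] \<sigma>iE[OF b(1), of i] ED by (intro \<sigma>_mult) auto
        then show "\<sigma> (U i * (\<sigma> ^^ i) b) * u = U (Suc i) * (\<sigma> ^^ Suc i) b"
          using Ecomm[OF u(1) \<sigma>E[OF \<sigma>iE[OF b(1), of i]]] by (simp add: U mult.assoc)
      qed simp
      also have "\<dots> = s b + U (Suc t) * (\<sigma> ^^ Suc t) b - U (Suc 0) * (\<sigma> ^^ Suc 0) b"
        unfolding s_def by (induction t) simp_all
      also have "\<dots> = a"
        using Ut \<sigma>t[OF b(1)] by (simp add: U \<sigma>e a_def)
      finally show ?thesis .
    qed
    have \<sigma>a: "\<sigma> a \<in> D" "\<sigma> a \<noteq> 0" "\<sigma> a \<in> E" using \<sigma>nz \<sigma>E \<sigma>D a by auto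
    have "u = iv (\<sigma> a) * (\<sigma> a * u)" using iv(3)[OF \<sigma>a(1,2)] RE(4)[OF u(1)] by (simp flip: mult.assoc)
    then have "u = iv (\<sigma> a) * a" using \<open>\<sigma> a * u = a\<close> by simp
    then have "y2 = y * (a * iv (\<sigma> a))"
      using u Ecomm[OF u(1) yE(1)] Ecomm[OF a(1) ivE[OF \<sigma>a(3,2)]] by simp
    then show ?thesis using a by (auto simp: G_def Ey_def)
  qed
  have finEy: "finite Ey" using finE by (simp add: Ey_def)
  \<comment> \<open>The fibres of \<open>f\<close> have at most \<open>card G\<close> elements,
    those of \<open>b \<mapsto> b * iv (\<sigma> b)\<close> at least \<open>card K0\<close>. Hence
    \<open>f\<close> has at least \<open>card K0\<close> values, is onto \<open>K0\<close>, and
    takes the value \<open>e\<close>.\<close>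
  have "card Ey \<le> card (f ` Ey) * card G"
  proof -
    have "card Ey = (\<Sum>v\<in>f ` Ey. card {y \<in> Ey. f y = v})"
      using sum.image_gen[OF finEy, of "\<lambda>_. 1::nat" f] by simp
    also have "\<dots> \<le> (\<Sum>v\<in>f ` Ey. card G)"
    proof (rule sum_mono)
      fix v assume "v \<in> f ` Ey"
      then obtain y where y: "y \<in> Ey" "v = f y" by auto
      then have "{y \<in> Ey. f y = v} \<subseteq> (\<lambda>v. y * v) ` G" using fibre[OF y(1)] by fastforce
      then have "card {y \<in> Ey. f y = v} \<le> card ((\<lambda>v. y * v) ` G)"
        using finEy by (intro card_mono) (auto simp: G_def)
      also have "\<dots> \<le> card G" using finEy by (intro card_image_le) (auto simp: G_def)
      finally show "card {y \<in> Ey. f y = v} \<le> card G" .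
    qed
    finally show ?thesis by simp
  qed
  moreover have "card G * card K0 \<le> card Ey"
  proof -
    have "card Ey = (\<Sum>v\<in>G. card {b \<in> Ey. b * iv (\<sigma> b) = v})"
      unfolding G_def using sum.image_gen[OF finEy, of "\<lambda>_. 1::nat"] by simp
    also have "\<dots> \<ge> (\<Sum>v\<in>G. card K0)"
    proof (rule sum_mono)
      fix v assume "v \<in> G"
      then obtain b where b: "b \<in> Ey" "v = b * iv (\<sigma> b)" by (auto simp: G_def)
      have bE: "b \<in> E" "b \<noteq> 0" "b \<in> D" using b ED by (auto simp: Ey_def)
      have "(\<lambda>k. k * b) ` K0 \<subseteq> {b \<in> Ey. b * iv (\<sigma> b) = v}"
      proof clarify
        fix k assume "k \<in> K0"
        then have k: "k \<in> E" "k \<noteq> 0" "\<sigma> k = k" "k \<in> D" using ED by (auto simp: K0_def Ey_def)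
        have kb: "k * b \<in> Ey" "k * b \<in> D" "k * b \<noteq> 0" using dom[of k b] k bE RE(2) R(2) by (auto simp: Ey_def)
        have kb': "k * b * iv (\<sigma> (k * b)) = b * iv (\<sigma> b)"
        proof -
          have s: "\<sigma> b \<in> D" "\<sigma> b \<noteq> 0" "\<sigma> b \<in> E" using \<sigma>D \<sigma>nz \<sigma>E bE by auto
          have "\<sigma> (k * b) = k * \<sigma> b" using \<sigma>_mult[OF k(4) bE(3)] k by simp
          moreover have ks: "k * \<sigma> b \<in> D" "k * \<sigma> b \<noteq> 0" "k * \<sigma> b \<in> E" using R(2) k s dom[of k "\<sigma> b"] RE(2) by auto
          moreover have "(k * b * iv (k * \<sigma> b)) * (k * \<sigma> b) = (b * iv (\<sigma> b)) * (k * \<sigma> b)"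
          proof -
            have "(k * b * iv (k * \<sigma> b)) * (k * \<sigma> b) = k * b"
              using iv(3)[OF ks(1,2)] R(5)[OF kb(2)] by (simp add: mult.assoc)
            moreover have "(b * iv (\<sigma> b)) * (k * \<sigma> b) = b * k"
              using iv(3)[OF s(1,2)] Ecomm[OF k(1) s(3)] R(4)[OF k(4)] by (metis mult.assoc)
            ultimately show ?thesis using Ecomm[OF k(1) bE(1)] by simp
          qed
          then have "(k * b * iv (k * \<sigma> b) - b * iv (\<sigma> b)) * (k * \<sigma> b) = 0" by (simp add: algebra_simps)
          moreover have "k * b * iv (k * \<sigma> b) - b * iv (\<sigma> b) \<in> D"
            using R kb bE iv(1)[OF ks(1,2)] iv(1)[OF s(1,2)] by (intro addsub_diff) auto
          ultimately show ?thesis using dom[OF _ ks(1)] ks(2) by force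
        qed
        show "k * b \<in> Ey \<and> k * b * iv (\<sigma> (k * b)) = v" using kb kb' b by simp
      qed
      then have "card ((\<lambda>k. k * b) ` K0) \<le> card {b \<in> Ey. b * iv (\<sigma> b) = v}"
        using finEy by (intro card_mono) auto
      moreover have "inj_on (\<lambda>k. k * b) K0"
      proof (rule inj_onI)
        fix k k' assume kk: "k \<in> K0" "k' \<in> K0" "k * b = k' * b"
        then have "(k - k') * b = 0" by (simp add: algebra_simps)
        moreover have "k - k' \<in> D" using kk ED R by (intro addsub_diff) (auto simp: K0_def Ey_def)
        ultimately show "k = k'" using dom bE by force
      qed
      ultimately show "card K0 \<le> card {b \<in> Ey. b * iv (\<sigma> b) = v}" by (simp add: card_image)
    qed
    finally show ?thesis by simp
  qed
  moreover have "card G > 0"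
  proof -
    have "e \<in> Ey" using RE D'(3) by (simp add: Ey_def)
    then show ?thesis using finEy by (auto simp: card_gt_0_iff G_def)
  qed
  ultimately have "card K0 \<le> card (f ` Ey)"
    by (metis le_trans mult.commute mult_le_cancel2)
  moreover have "f ` Ey \<subseteq> K0" "finite K0" using fK0 finEy by (auto simp: K0_def)
  ultimately have "f ` Ey = K0" by (metis card_seteq)
  moreover have "e \<in> K0" using RE D'(3) \<sigma>e by (simp add: K0_def Ey_def)
  ultimately obtain y where y: "y \<in> Ey" "(y * x) ^ t = e" by (auto simp: f_def image_iff)
  define w where "w = y * x"
  have yE: "y \<in> E" "y \<noteq> 0" "y \<in> D" using y ED by (auto simp: Ey_def)
  have wE: "w \<notin> E"
  proof
    assume "w \<in> E"
    moreover have "x = iv y * w" using iv(3)[OF yE(3,2)] R(4)[OF x(1)] by (simp add: w_def flip: mult.assoc)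
    ultimately show False using xE ivE[OF yE(1,2)] RE(2) by simp
  qed
  then have "w \<noteq> e" using RE by auto
  then have S0: "(\<Sum>i=1..t. w ^ i) = 0"
    using geometric_sum_zero[OF D wD(1)[OF y(1)]] y by (simp add: w_def)
  have wDi: "w ^ i \<in> D" if "i > 0" for i using pD[OF wD(1)[OF y(1)]] that by (simp add: w_def)
  \<comment> \<open>Conjugating the vanishing sum of the powers of \<open>w\<close> by
    \<open>c ^ j\<close> multiplies its \<open>i\<close>-th term by \<open>\<mu> i ^ j\<close>,
    which is the hypothesis of \<open>indep\<close>. Its conclusion fails, as the term at
    \<open>t\<close> is \<open>e\<close>.\<close>
  define g where "g i = (if i = 0 then e else w ^ i)" for i
  have "g t = 0"
  proof (rule indep)
    show "g i \<in> D" for i using wDi R by (simp add: g_def)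
    fix j assume j: "j \<in> {1..N}"
    have "0 = c' ^ j * (\<Sum>i=1..t. w ^ i) * c ^ j" by (simp only: S0 mult_zero_right mult_zero_left)
    also have "\<dots> = (\<Sum>i=1..t. \<mu> i ^ j * g i)"
      unfolding sum_distrib_left sum_distrib_right
    proof (rule sum.cong)
      fix i assume i: "i \<in> {1..t}"
      have "w ^ i * c ^ j = (\<sigma> ^^ i) (c ^ j) * w ^ i"
        unfolding w_def using rel[OF w[OF yE(1)] pE[OF c(1)]] j by simp
      also have "\<dots> = ((\<sigma> ^^ i) c) ^ j * w ^ i" using \<sigma>ipow[OF c(1)] j by simp
      finally have "c' ^ j * w ^ i * c ^ j = c' ^ j * ((\<sigma> ^^ i) c) ^ j * w ^ i" by (simp add: mult.assoc)
      also have "c' ^ j * ((\<sigma> ^^ i) c) ^ j = \<mu> i ^ j"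
        unfolding \<mu>_def power_mult_distrib_comm[OF Ecomm[OF \<sigma>iE[OF c(1)] c'(1)]]
        by (rule Ecomm[OF pE[OF c'(1)] pE[OF \<sigma>iE[OF c(1)]]]) (use j in auto)
      finally show "c' ^ j * w ^ i * c ^ j = \<mu> i ^ j * g i" using i by (simp add: g_def)
    qed simp
    finally show "(\<Sum>i=1..t. \<mu> i ^ j * g i) = 0" by simp
  qed
  then show False using y t D'(3) by (simp add: g_def w_def)
qed

section \<open>Finite simple rings\<close>

text \<open>Modules are additive subgroups of the ambient ring, acted on by its multiplication. As
  \<open>V\<close> may lie outside \<open>S\<close>, left ideals, their right multiples and ideals
  of a larger ring are all treated alike.\<close>

definition left_mod :: "'r::ring_1 set \<Rightarrow> 'r set \<Rightarrow> bool" where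
  "left_mod S V \<longleftrightarrow> addsub V \<and> (\<forall>s\<in>S. \<forall>v\<in>V. s * v \<in> V)"

definition simple_mod :: "'r::ring_1 set \<Rightarrow> 'r set \<Rightarrow> bool" where
  "simple_mod S V \<longleftrightarrow> left_mod S V \<and> V \<noteq> {0} \<and> (\<forall>W. W \<subseteq> V \<longrightarrow> left_mod S W \<longrightarrow> W = {0} \<or> W = V)"

definition ideal_on :: "'r::ring_1 set \<Rightarrow> 'r set \<Rightarrow> bool" where
  "ideal_on S I \<longleftrightarrow> addsub I \<and> I \<subseteq> S \<and> (\<forall>s\<in>S. \<forall>x\<in>I. s * x \<in> I \<and> x * s \<in> I)"

text \<open>Primeness is what annihilator arguments establish for a maximal subring; for finite
  rings it already gives simplicity.\<close>

definition prime_on :: "'r::ring_1 \<Rightarrow> 'r set \<Rightarrow> bool" where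
  "prime_on e S \<longleftrightarrow> ring_on e S \<and> finite S \<and> e \<noteq> 0 \<and>
     (\<forall>I J. ideal_on S I \<longrightarrow> ideal_on S J \<longrightarrow> (\<forall>x\<in>I. \<forall>y\<in>J. x * y = 0) \<longrightarrow> I = {0} \<or> J = {0})"

definition simple_on :: "'r::ring_1 \<Rightarrow> 'r set \<Rightarrow> bool" where
  "simple_on e S \<longleftrightarrow> ring_on e S \<and> finite S \<and> e \<noteq> 0 \<and> (\<forall>I. ideal_on S I \<longrightarrow> I = {0} \<or> I = S)"

definition center :: "'r::ring_1 set \<Rightarrow> 'r set" where
  "center S = {z \<in> S. \<forall>s\<in>S. z * s = s * z}"

lemma left_modI:
  assumes "addsub V" "\<And>s v. s \<in> S \<Longrightarrow> v \<in> V \<Longrightarrow> s * v \<in> V"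
  shows "left_mod S V"
  using assms by (simp add: left_mod_def)

lemma ideal_onI:
  assumes "addsub I" "I \<subseteq> S" "\<And>s x. s \<in> S \<Longrightarrow> x \<in> I \<Longrightarrow> s * x \<in> I" "\<And>s x. s \<in> S \<Longrightarrow> x \<in> I \<Longrightarrow> x * s \<in> I"
  shows "ideal_on S I"
  using assms by (simp add: ideal_on_def)

lemma ideal_onD:
  assumes "ideal_on S I"
  shows "addsub I" "I \<subseteq> S" "\<And>s x. s \<in> S \<Longrightarrow> x \<in> I \<Longrightarrow> s * x \<in> I" "\<And>s x. s \<in> S \<Longrightarrow> x \<in> I \<Longrightarrow> x * s \<in> I"
  using assms unfolding ideal_on_def by blast+

lemma left_modD:
  assumes "left_mod S V"
  shows "addsub V" "\<And>s v. s \<in> S \<Longrightarrow> v \<in> V \<Longrightarrow> s * v \<in> V"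
  using assms unfolding left_mod_def by blast+

lemma simple_modD:
  assumes "simple_mod S V"
  shows "addsub V" "\<And>s v. s \<in> S \<Longrightarrow> v \<in> V \<Longrightarrow> s * v \<in> V" "V \<noteq> {0}"
    "\<And>W. W \<subseteq> V \<Longrightarrow> left_mod S W \<Longrightarrow> x \<in> W \<Longrightarrow> x \<noteq> 0 \<Longrightarrow> W = V"
    "\<And>W. W \<subseteq> V \<Longrightarrow> left_mod S W \<Longrightarrow> x \<in> V \<Longrightarrow> x \<notin> W \<Longrightarrow> W = {0}"
proof -
  have L: "left_mod S V" "V \<noteq> {0}" and W: "\<And>W. W \<subseteq> V \<Longrightarrow> left_mod S W \<Longrightarrow> W = {0} \<or> W = V"
    using assms unfolding simple_mod_def by blast+
  show "addsub V" by (rule left_modD(1)[OF L(1)])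
  show "\<And>s v. s \<in> S \<Longrightarrow> v \<in> V \<Longrightarrow> s * v \<in> V" by (rule left_modD(2)[OF L(1)])
  show "V \<noteq> {0}" by fact
  show "\<And>W. W \<subseteq> V \<Longrightarrow> left_mod S W \<Longrightarrow> x \<in> W \<Longrightarrow> x \<noteq> 0 \<Longrightarrow> W = V" by (drule (1) W) auto
  show "\<And>W. W \<subseteq> V \<Longrightarrow> left_mod S W \<Longrightarrow> x \<in> V \<Longrightarrow> x \<notin> W \<Longrightarrow> W = {0}" by (drule (1) W) auto
qed

lemma nonzero_elem: "addsub V \<Longrightarrow> V \<noteq> {0} \<Longrightarrow> \<exists>v\<in>V. v \<noteq> 0"
  using addsub_zero by blast

lemma exists_simple_mod:
  assumes "left_mod S V" "finite V" "V \<noteq> {0}"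
  obtains L where "L \<subseteq> V" "simple_mod S L"
proof -
  let ?F = "{W. W \<subseteq> V \<and> left_mod S W \<and> W \<noteq> {0}}"
  have "finite ?F" by (rule finite_subset[of _ "Pow V"]) (use assms in auto)
  moreover have "?F \<noteq> {}" using assms by blast
  ultimately have "\<exists>L\<in>?F. \<forall>W\<in>?F. W \<subseteq> L \<longrightarrow> L = W" by (rule finite_has_minimal)
  then obtain L where L: "L \<in> ?F" "\<forall>W\<in>?F. W \<subseteq> L \<longrightarrow> L = W" by (elim bexE)
  show ?thesis
  proof (rule that[of L])
    show "L \<subseteq> V" using L(1) by simp
    show "simple_mod S L" unfolding simple_mod_def
    proof (intro conjI allI impI)
      fix W assume W: "W \<subseteq> L" "left_mod S W"
      show "W = {0} \<or> W = L"
      proof (rule disjCI, rule ccontr)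
        assume n: "W \<noteq> L" "W \<noteq> {0}"
        then have "W \<in> ?F" using W \<open>L \<subseteq> V\<close> by simp
        then show False using L(2) W(1) n by blast
      qed
    qed (use L(1) in simp_all)
  qed
qed

lemma left_mod_mult_right:
  assumes "addsub P" "\<And>s p. s \<in> S \<Longrightarrow> p \<in> P \<Longrightarrow> s * p \<in> P"
  shows "left_mod S ((\<lambda>p. p * v) ` P)"
proof (rule left_modI)
  show "addsub ((\<lambda>p. p * v) ` P)" by (rule addsub_image[OF assms(1)]) (simp add: left_diff_distrib)
  fix s x assume "s \<in> S" "x \<in> (\<lambda>p. p * v) ` P"
  then obtain p where "s * p \<in> P" "s * x = (s * p) * v" using assms(2) by (auto simp: mult.assoc)
  then show "s * x \<in> (\<lambda>p. p * v) ` P" by blast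
qed

lemma left_mod_right_annihilator:
  assumes "left_mod S V"
  shows "left_mod S {v \<in> V. v * a = 0}"
proof (rule left_modI)
  show "addsub {v \<in> V. v * a = 0}"
    by (rule addsub_kernel) (use left_modD[OF assms] in \<open>auto simp: left_diff_distrib\<close>)
qed (use left_modD[OF assms] in \<open>auto simp: mult.assoc\<close>)

text \<open>By the pigeonhole principle the powers of \<open>y\<close> have some period
  \<open>k\<close> from some exponent \<open>i\<close> on; the exponent \<open>i * k\<close> is at
  least \<open>i\<close> and a multiple of \<open>k\<close>.\<close>

lemma power_idempotent:
  fixes y :: "'r::ring_1"
  assumes S: "finite S" "\<And>x y. x \<in> S \<Longrightarrow> y \<in> S \<Longrightarrow> x * y \<in> S" "y \<in> S"
  shows "\<exists>m>0. y ^ m * y ^ m = y ^ m"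
proof -
  have pS: "y ^ i \<in> S" if "i > 0" for i using power_closed[of S y i] S that by blast
  have "\<not> inj_on (\<lambda>i::nat. y ^ i) {1..}"
  proof
    assume "inj_on (\<lambda>i::nat. y ^ i) {1..}"
    then have "finite {1::nat..}" by (rule inj_on_finite[of _ _ S]) (use pS S in auto)
    then show False by (simp add: infinite_Ici)
  qed
  then obtain i' j' :: nat where "i' \<ge> 1" "j' \<ge> 1" "i' \<noteq> j'" "y ^ i' = y ^ j'" by (auto simp: inj_on_def)
  then obtain i j :: nat where ij: "0 < i" "i < j" "y ^ i = y ^ j"
    by (metis linorder_neqE_nat less_eq_Suc_le One_nat_def)
  define k where "k = j - i"
  have k: "k > 0" "y ^ (i + k) = y ^ i" using ij by (auto simp: k_def)
  have step: "y ^ (n + k * l) = y ^ n" if "n \<ge> i" for n l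
  proof (induction l)
    case (Suc l)
    have "y ^ (n + k * Suc l) = y ^ (i + k) * y ^ (n - i + k * l)"
      using that by (simp flip: power_add add: algebra_simps)
    also have "\<dots> = y ^ (n + k * l)" using that k by (simp flip: power_add)
    finally show ?case using Suc by simp
  qed simp
  have "y ^ (i * k) * y ^ (i * k) = y ^ (i * k + k * i)" by (simp add: power_add mult.commute)
  also have "\<dots> = y ^ (i * k)" by (rule step) (use k in simp)
  finally show ?thesis using k ij by (intro exI[of _ "i * k"]) auto
qed

text \<open>Take an idempotent \<open>f\<close> of \<open>P\<close> whose image in \<open>L\<close>
  is largest. If \<open>f\<close> moved \<open>v\<close>, an element of \<open>P\<close> fixing
  \<open>v - f * v\<close>, cut down to the complement of \<open>f\<close>, would have an idempotent
  power \<open>g\<close> orthogonal to \<open>f\<close>, and \<open>f + g\<close> would have a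
  larger image. Elements of \<open>P\<close> with prescribed value at a nonzero vector exist because
  the vectors killed by \<open>P\<close> form a submodule of \<open>L\<close>.\<close>

lemma ideal_contains_local_unit:
  assumes S: "ring_on e S" "finite S" and L: "simple_mod S L" "finite L"
    and P: "ideal_on S P" and nz: "p0 \<in> P" "v0 \<in> L" "p0 * v0 \<noteq> 0"
  obtains f where "f \<in> P" "\<And>v. v \<in> L \<Longrightarrow> f * v = v"
proof -
  note R = ring_onD[OF S(1)] and I = ideal_onD[OF P] and LM = simple_modD[OF L(1)]
  have finP: "finite P" using I(2) S(2) finite_subset by blast
  have "left_mod S {v \<in> L. \<forall>p\<in>P. p * v = 0}"
  proof (rule left_modI, rule addsubI)
    fix s v assume s: "s \<in> S" and v: "v \<in> {v \<in> L. \<forall>p\<in>P. p * v = 0}"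
    have "p * (s * v) = 0" if "p \<in> P" for p
      using I(4)[OF s that] v by (simp flip: mult.assoc)
    then show "s * v \<in> {v \<in> L. \<forall>p\<in>P. p * v = 0}" using LM(2) s v by simp
  qed (use LM(1) addsub_zero addsub_diff in \<open>auto simp: right_diff_distrib\<close>)
  from LM(5)[OF _ this nz(2)] nz have "{v \<in> L. \<forall>p\<in>P. p * v = 0} = {0}" by blast
  then have onto: "\<exists>p\<in>P. p * v = w" if "v \<in> L" "v \<noteq> 0" "w \<in> L" for v w
  proof -
    assume "{v \<in> L. \<forall>p\<in>P. p * v = 0} = {0}"
    then obtain p where p: "p \<in> P" "p * v \<noteq> 0" using \<open>v \<in> L\<close> \<open>v \<noteq> 0\<close> by blast
    have "(\<lambda>p. p * v) ` P = L"
      by (rule LM(4)[of _ "p * v"]) (use left_mod_mult_right I(1,3) p I(2) LM(2) \<open>v \<in> L\<close> in auto)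
    then show ?thesis using \<open>w \<in> L\<close> by blast
  qed
  define \<E> where "\<E> = {f \<in> P. f * f = f}"
  have E0: "finite \<E>" "0 \<in> \<E>" using finP I(1) addsub_zero by (auto simp: \<E>_def)
  define h where "h g = card ((*) g ` L)" for g
  have "Max (h ` \<E>) \<in> h ` \<E>" by (rule Max_in) (use E0 in auto)
  then obtain f where f: "f \<in> \<E>" "Max (h ` \<E>) = h f" by blast
  then have max: "card ((*) g ` L) \<le> card ((*) f ` L)" if "g \<in> \<E>" for g
    using that E0(1) Max_ge[of "h ` \<E>" "h g"] by (simp add: h_def)
  have fP: "f \<in> P" "f * f = f" using f by (auto simp: \<E>_def)
  have "f * v = v" if v: "v \<in> L" for v
  proof (rule ccontr)
    assume ne: "f * v \<noteq> v"
    define v1 where "v1 = v - f * v"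
    have fS: "f \<in> S" using fP I(2) by blast
    have v1: "v1 \<in> L" "v1 \<noteq> 0" "f * v1 = 0"
      using ne v LM(2)[OF fS v] addsub_diff[OF LM(1)] fP(2)
      by (auto simp: v1_def right_diff_distrib simp flip: mult.assoc)
    obtain x where x: "x \<in> P" "x * v1 = v1" using onto[OF v1(1,2,1)] by blast
    \<comment> \<open>This is \<open>(1 - f) * x * (1 - f)\<close>, expanded so that it visibly lies
      in \<open>P\<close>.\<close>
    define y where "y = x - f * x - (x * f - f * x * f)"
    have yP: "y \<in> P" unfolding y_def
      using I(1) x fS I(3,4) by (intro addsub_diff) auto
    have yf: "y * f = 0" "f * y = 0"
      using fP(2) by (auto simp: y_def algebra_simps) (simp flip: mult.assoc)
    have yv: "y * v1 = v1" using x v1(3) by (simp add: y_def left_diff_distrib mult.assoc)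
    obtain m where m: "m > 0" "y ^ m * y ^ m = y ^ m"
      using power_idempotent[OF finP _ yP] I(2,3) by blast
    define g where "g = y ^ m"
    have gP: "g \<in> P" unfolding g_def using power_closed[of P y m] I(2,3) yP m by blast
    have gv: "g * v1 = v1"
    proof -
      have "y ^ i * v1 = v1" for i by (induction i) (simp_all add: yv mult.assoc)
      then show ?thesis by (simp add: g_def)
    qed
    obtain m' where m': "m = Suc m'" using m gr0_implies_Suc by blast
    have "g * f = y ^ m' * (y * f)" by (simp only: g_def m' power_Suc2 mult.assoc)
    moreover have "f * g = f * y * y ^ m'" by (simp only: g_def m' power_Suc mult.assoc)
    ultimately have gf: "g * f = 0" "f * g = 0" using yf by simp_all
    have "f + g \<in> \<E>"
      using addsub_add[OF I(1) fP(1) gP] fP(2) m(2) gf by (simp add: \<E>_def g_def algebra_simps)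
    then have "card ((*) (f + g) ` L) \<le> card ((*) f ` L)" by (rule max)
    moreover have "(*) f ` L \<subset> (*) (f + g) ` L"
    proof
      show "(*) f ` L \<subseteq> (*) (f + g) ` L"
      proof clarify
        fix u assume "u \<in> L"
        then have "f * u \<in> L" "f * u = (f + g) * (f * u)"
          using LM(2) fS fP(2) gf by (auto simp: distrib_right simp flip: mult.assoc)
        then show "f * u \<in> (*) (f + g) ` L" by (metis imageI)
      qed
      have "v1 = (f + g) * v1" using v1(3) gv by (simp add: distrib_right)
      then have "v1 \<in> (*) (f + g) ` L" using v1(1) by (metis imageI)
      moreover have "v1 \<notin> (*) f ` L"
      proof
        assume "v1 \<in> (*) f ` L"
        then obtain u where "v1 = f * u" by blast
        then have "f * v1 = v1" using fP(2) by (simp flip: mult.assoc)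
        then show False using v1 by simp
      qed
      ultimately show "(*) f ` L \<noteq> (*) (f + g) ` L" by blast
    qed
    ultimately show False using psubset_card_mono[of "(*) (f + g) ` L" "(*) f ` L"] L(2) by auto
  qed
  then show ?thesis using that fP(1) by blast
qed

lemma right_annihilator_ideal:
  assumes "ring_on e S" "P \<subseteq> S" "\<And>s p. s \<in> S \<Longrightarrow> p \<in> P \<Longrightarrow> p * s \<in> P"
  shows "ideal_on S {s \<in> S. \<forall>p\<in>P. p * s = 0}"
proof (rule ideal_onI)
  note R = ring_onD[OF assms(1)]
  show "addsub {s \<in> S. \<forall>p\<in>P. p * s = 0}"
    using R addsub_zero addsub_diff by (auto intro!: addsubI simp: right_diff_distrib)
  fix s x assume s: "s \<in> S" and x: "x \<in> {s \<in> S. \<forall>p\<in>P. p * s = 0}"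
  have "p * (s * x) = 0" if "p \<in> P" for p using assms(3)[OF s that] x by (simp flip: mult.assoc)
  then show "s * x \<in> {s \<in> S. \<forall>p\<in>P. p * s = 0}" using R(2) s x by simp
  show "x * s \<in> {s \<in> S. \<forall>p\<in>P. p * s = 0}" using R(2) s x by (simp flip: mult.assoc)
qed auto

lemma left_annihilator_ideal:
  assumes "ring_on e S" "\<And>s p. s \<in> S \<Longrightarrow> p \<in> P \<Longrightarrow> s * p \<in> P"
  shows "ideal_on S {s \<in> S. \<forall>p\<in>P. s * p = 0}"
proof (rule ideal_onI)
  note R = ring_onD[OF assms(1)]
  show "addsub {s \<in> S. \<forall>p\<in>P. s * p = 0}"
    using R addsub_zero addsub_diff by (auto intro!: addsubI simp: left_diff_distrib)
  fix s x assume s: "s \<in> S" and x: "x \<in> {s \<in> S. \<forall>p\<in>P. s * p = 0}"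
  have "x * s * p = 0" if "p \<in> P" for p using assms(2)[OF s that] x by (simp add: mult.assoc)
  then show "x * s \<in> {s \<in> S. \<forall>p\<in>P. s * p = 0}" using R(2) s x by simp
  show "s * x \<in> {s \<in> S. \<forall>p\<in>P. s * p = 0}" using R(2) s x by (simp add: mult.assoc)
qed auto

lemma ring_left_mod: "ring_on e S \<Longrightarrow> left_mod S S"
  by (simp add: left_mod_def ring_on_def)

text \<open>Let \<open>L\<close> be a minimal left ideal and \<open>P\<close> a nonzero ideal.
  Primeness forbids \<open>P L = 0\<close>, so \<open>P\<close> contains an \<open>f\<close> acting
  as the identity on \<open>L\<close>. Then \<open>e - f\<close> annihilates \<open>L\<close>, and
  the annihilator of \<open>L\<close> is zero, again by primeness; hence \<open>e = f\<close> lies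
  in \<open>P\<close>.\<close>

lemma prime_imp_simple:
  assumes "prime_on e S"
  shows "simple_on e S"
  unfolding simple_on_def
proof (intro conjI allI impI)
  have S: "ring_on e S" "finite S" "e \<noteq> 0" and
    pr: "\<And>I J. ideal_on S I \<Longrightarrow> ideal_on S J \<Longrightarrow> (\<And>x y. x \<in> I \<Longrightarrow> y \<in> J \<Longrightarrow> x * y = 0) \<Longrightarrow> I = {0} \<or> J = {0}"
    using assms unfolding prime_on_def by blast+
  show "ring_on e S" "finite S" "e \<noteq> 0" by fact+
  note R = ring_onD[OF S(1)]
  fix P assume P: "ideal_on S P"
  note I = ideal_onD[OF P]
  have "S \<noteq> {0}" using S(3) R(3) by blast
  then obtain L where L: "L \<subseteq> S" "simple_mod S L"
    using exists_simple_mod[OF ring_left_mod[OF S(1)] S(2)] by blast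
  note LM = simple_modD[OF L(2)]
  have finL: "finite L" using L(1) S(2) finite_subset by blast
  obtain l where l: "l \<in> L" "l \<noteq> 0" using nonzero_elem LM(1,3) by blast
  show "P = {0} \<or> P = S"
  proof (cases "P = {0}")
    case False
    have "\<exists>p\<in>P. \<exists>v\<in>L. p * v \<noteq> 0"
    proof (rule ccontr)
      assume n: "\<not> ?thesis"
      let ?J = "{s \<in> S. \<forall>p\<in>P. p * s = 0}"
      have "P = {0} \<or> ?J = {0}"
        by (rule pr[OF P right_annihilator_ideal[OF S(1) I(2,4)]]) auto
      moreover have "l \<in> ?J" using n l L by blast
      ultimately show False using l False by blast
    qed
    then obtain f where f: "f \<in> P" "\<And>v. v \<in> L \<Longrightarrow> f * v = v"
      using ideal_contains_local_unit[OF S(1,2) L(2) finL P] by blast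
    let ?Q = "{s \<in> S. \<forall>v\<in>L. s * v = 0}"
    let ?J = "{s \<in> S. \<forall>q\<in>?Q. q * s = 0}"
    have Q: "ideal_on S ?Q" by (rule left_annihilator_ideal[OF S(1) LM(2)])
    have "?Q = {0} \<or> ?J = {0}"
      by (rule pr[OF Q right_annihilator_ideal[OF S(1) ideal_onD(2,4)[OF Q]]]) auto
    moreover have "l \<in> ?J" using l L by blast
    ultimately have "?Q = {0}" using l by blast
    moreover have "e - f \<in> ?Q"
      using f I(2) L(1) R addsub_diff[OF R(1) R(3)] by (auto simp: left_diff_distrib)
    ultimately have "e \<in> P" using f by auto
    then have "S \<subseteq> P" using I(3) R(5) by (metis subsetI)
    then show ?thesis using I(2) by blast
  qed simp
qed

text \<open>For an idempotent \<open>f\<close> this is \<open>S f\<close>, just as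
  \<open>corner S f\<close> is \<open>f S f\<close>; the fixed-point form turns membership into
  equations.\<close>

definition left_ideal_of :: "'r::ring_1 set \<Rightarrow> 'r \<Rightarrow> 'r set" where
  "left_ideal_of S f = {x \<in> S. x * f = x}"

definition corner :: "'r::ring_1 set \<Rightarrow> 'r \<Rightarrow> 'r set" where
  "corner S f = {x \<in> S. f * x = x \<and> x * f = x}"

text \<open>A primitive idempotent \<open>f\<close> of a finite simple ring together with a decomposition
  \<open>e = \<Sum> a * b\<close>, where \<open>a \<in> S f\<close> and \<open>b \<in> f S\<close>; the pairs \<open>(a, b)\<close> play the role of dual bases.\<close>

locale simple_frame =
  fixes e :: "'r::ring_1" and S f ps
  assumes simple: "simple_on e S"
    and f: "f \<in> S" "f \<noteq> 0" "f * f = f"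
    and simple_V: "simple_mod S (left_ideal_of S f)"
    and ps: "\<And>a b. (a, b) \<in> set ps \<Longrightarrow> a \<in> left_ideal_of S f \<and> b \<in> S \<and> f * b = b"
    and e_ps: "e = sum_list (map (\<lambda>(a, b). a * b) ps)"

text \<open>Brauer's lemma: a minimal left ideal \<open>L\<close> satisfies \<open>L a = L\<close>
  for some \<open>a \<in> L\<close>; the solution \<open>f \<in> L\<close> of
  \<open>f * a = a\<close> is idempotent, since \<open>v * a = 0\<close> only for
  \<open>v = 0\<close> in \<open>L\<close>; and \<open>L = S f\<close>. The sums of products
  \<open>a * b\<close> with \<open>a \<in> S f\<close> and \<open>b \<in> f S\<close> form the ideal
  generated by \<open>f\<close>, which contains \<open>e\<close>.\<close>

lemma exists_simple_frame:
  assumes S: "simple_on e S"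
  obtains f ps where "simple_frame e S f ps"
proof -
  have S': "ring_on e S" "finite S" "e \<noteq> 0" and
    si: "\<And>I x. ideal_on S I \<Longrightarrow> x \<in> I \<Longrightarrow> x \<noteq> 0 \<Longrightarrow> I = S"
    using S unfolding simple_on_def by blast+
  note R = ring_onD[OF S'(1)]
  have "S \<noteq> {0}" using S'(3) R(3) by blast
  then obtain L where L: "L \<subseteq> S" "simple_mod S L"
    using exists_simple_mod[OF ring_left_mod[OF S'(1)] S'(2)] by blast
  note LM = simple_modD[OF L(2)]
  obtain l where l: "l \<in> L" "l \<noteq> 0" using nonzero_elem LM(1,3) by blast
  have "\<exists>a\<in>L. \<exists>b\<in>L. b * a \<noteq> 0"
  proof (rule ccontr)
    assume n: "\<not> ?thesis"
    have "{s \<in> S. \<forall>v\<in>L. s * v = 0} = S"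
      by (rule si[OF left_annihilator_ideal[OF S'(1) LM(2)], of l]) (use n l L in blast)+
    then have "e * l = 0" using R(3) l(1) by blast
    moreover have "e * l = l" using R(4) l(1) L(1) by blast
    ultimately show False using l by simp
  qed
  then obtain a b where ab: "a \<in> L" "b \<in> L" "b * a \<noteq> 0" by blast
  have La: "(\<lambda>p. p * a) ` L = L"
    by (rule LM(4)[of _ "b * a"]) (use left_mod_mult_right[OF LM(1,2)] ab L LM(2) in auto)
  then obtain f where f: "f \<in> L" "f * a = a" using ab(1) by (metis imageE)
  have ann: "{v \<in> L. v * a = 0} = {0}"
    by (rule LM(5)[OF _ left_mod_right_annihilator ab(2)]) (use L(2) ab in \<open>auto simp: simple_mod_def\<close>)
  have "f * f - f \<in> {v \<in> L. v * a = 0}"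
    using f L LM(2) addsub_diff[OF LM(1)] by (auto simp: left_diff_distrib mult.assoc)
  then have ff: "f * f = f" using ann by auto
  have f0: "f \<noteq> 0" using f(2) ab(3) by auto
  have fS: "f \<in> S" using f L by blast
  have Lf: "left_ideal_of S f = L"
  proof -
    have "(\<lambda>s. s * f) ` S = L"
    proof (rule LM(4)[of _ f])
      show "left_mod S ((\<lambda>s. s * f) ` S)" using left_mod_mult_right R(1,2) by blast
      show "f \<in> (\<lambda>s. s * f) ` S" using ff fS by (metis imageI)
    qed (use LM(2) f f0 in auto)
    moreover have "left_ideal_of S f = (\<lambda>s. s * f) ` S"
    proof
      show "(\<lambda>s. s * f) ` S \<subseteq> left_ideal_of S f" using R(2) fS ff by (auto simp: left_ideal_of_def mult.assoc)
      show "left_ideal_of S f \<subseteq> (\<lambda>s. s * f) ` S" unfolding left_ideal_of_def by (auto simp: image_iff) metis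
    qed
    ultimately show ?thesis by simp
  qed
  let ?ok = "\<lambda>ps. \<forall>(a, b) \<in> set ps. a \<in> left_ideal_of S f \<and> b \<in> S \<and> f * b = b"
  let ?sm = "\<lambda>ps. sum_list (map (\<lambda>(a, b). a * b) ps)"
  define X where "X = {?sm ps | ps. ?ok ps}"
  have LM': "addsub (left_ideal_of S f)" "\<And>s v. s \<in> S \<Longrightarrow> v \<in> left_ideal_of S f \<Longrightarrow> s * v \<in> left_ideal_of S f"
    unfolding Lf using LM(1,2) by blast+
  have "ideal_on S X"
  proof (rule ideal_onI)
    show "addsub X"
    proof (rule addsubI)
      show "0 \<in> X" unfolding X_def by (auto intro!: exI[of _ "[]"])
      fix x y assume "x \<in> X" "y \<in> X"
      then obtain p q where pq: "?ok p" "x = ?sm p" "?ok q" "y = ?sm q" unfolding X_def by blast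
      let ?q = "map (\<lambda>(a, b). (- a, b)) q"
      have "?sm ?q = - y" unfolding pq(4) by (induction q) auto
      then have "x - y = ?sm (p @ ?q)" using pq by simp
      moreover have "?ok (p @ ?q)" using pq(1,3) addsub_uminus[OF LM'(1)] by fastforce
      ultimately show "x - y \<in> X" unfolding X_def by blast
    qed
    show "X \<subseteq> S"
    proof
      fix x assume "x \<in> X"
      then obtain p where p: "?ok p" "x = ?sm p" unfolding X_def by blast
      have "?sm p \<in> S" using p(1)
        by (induction p) (use addsub_zero[OF R(1)] R(2) in \<open>auto simp: left_ideal_of_def intro!: addsub_add[OF R(1)]\<close>)
      then show "x \<in> S" using p by simp
    qed
    fix s x assume s: "s \<in> S" and "x \<in> X"
    then obtain p where p: "?ok p" "x = ?sm p" unfolding X_def by blast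
    have "s * x = ?sm (map (\<lambda>(a, b). (s * a, b)) p)"
      unfolding p(2) by (induction p) (auto simp: distrib_left mult.assoc)
    moreover have "?ok (map (\<lambda>(a, b). (s * a, b)) p)" using p(1) LM'(2)[OF s] by fastforce
    ultimately show "s * x \<in> X" unfolding X_def by blast
    have "x * s = ?sm (map (\<lambda>(a, b). (a, b * s)) p)"
      unfolding p(2) by (induction p) (auto simp: distrib_right mult.assoc)
    moreover have "?ok (map (\<lambda>(a, b). (a, b * s)) p)" using p(1) R(2)[OF _ s]
      by (fastforce simp flip: mult.assoc)
    ultimately show "x * s \<in> X" unfolding X_def by blast
  qed
  moreover have "f \<in> X"
    unfolding X_def using ff fS by (auto intro!: exI[of _ "[(f, f)]"] simp: left_ideal_of_def)
  ultimately have "X = S" using si f0 by blast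
  then obtain ps where "?ok ps" "e = ?sm ps" using R(3) unfolding X_def by blast
  then have "simple_frame e S f ps"
    using S fS f0 ff L(2) by unfold_locales (auto simp: Lf)
  then show ?thesis by (rule that)
qed

section \<open>The simple module of a finite simple ring and its scalars\<close>

context simple_frame
begin

abbreviation "V \<equiv> left_ideal_of S f"
abbreviation "F \<equiv> corner S f"
abbreviation "Z \<equiv> center S"

lemma ring: "ring_on e S" and fin: "finite S" and e_nz: "e \<noteq> 0"
  and simpleD: "ideal_on S I \<Longrightarrow> x \<in> I \<Longrightarrow> x \<noteq> 0 \<Longrightarrow> I = S"
  using simple unfolding simple_on_def by blast+

lemmas R = ring_onD[OF ring] and VM = simple_modD[OF simple_V]

lemma V_sub: "V \<subseteq> S" and F_sub: "F \<subseteq> S" and f_V: "f \<in> V" and f_F: "f \<in> F"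
  using f by (auto simp: left_ideal_of_def corner_def)

lemma finV: "finite V" and finF: "finite F" and finZ: "finite Z"
  using fin V_sub F_sub by (auto intro: finite_subset simp: center_def)

lemma faithful:
  assumes "s \<in> S" "\<And>v. v \<in> V \<Longrightarrow> s * v = 0"
  shows "s = 0"
proof (rule ccontr)
  assume "s \<noteq> 0"
  have "{s \<in> S. \<forall>v\<in>V. s * v = 0} = S"
    by (rule simpleD[OF left_annihilator_ideal[OF ring VM(2)] _ \<open>s \<noteq> 0\<close>]) (use assms in auto)
  then have "f * f = 0" using f_V f(1) by blast
  then show False using f by simp
qed

lemma ring_F: "ring_on f F"
  unfolding ring_on_def
proof (intro conjI ballI)
  show "addsub F"
  proof (rule addsubI)
    show "0 \<in> F" using addsub_zero[OF R(1)] by (simp add: corner_def)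
    fix x y assume "x \<in> F" "y \<in> F"
    then show "x - y \<in> F" using addsub_diff[OF R(1)] by (simp add: corner_def left_diff_distrib right_diff_distrib)
  qed
  fix x y assume "x \<in> F" "y \<in> F"
  then show "x * y \<in> F" unfolding corner_def using R(2) by (simp add: mult.assoc) (simp flip: mult.assoc)
qed (use f_F in \<open>auto simp: corner_def\<close>)

text \<open>Schur's lemma for right multiplication by \<open>y\<close> on \<open>V\<close>.\<close>

lemma div_F: "div_ring_on f F"
proof (rule finite_domain_div_ring_on[OF ring_F finF f(2)])
  fix x y assume xy: "x \<in> F" "y \<in> F" "x * y = 0"
  show "x = 0 \<or> y = 0"
  proof (cases "y = 0")
    case False
    have "{v \<in> V. v * y = 0} = {0}"
      by (rule VM(5)[OF _ left_mod_right_annihilator f_V])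
        (use xy False simple_V in \<open>auto simp: simple_mod_def corner_def\<close>)
    moreover have "x \<in> V" using xy by (auto simp: corner_def left_ideal_of_def)
    ultimately show ?thesis using xy by blast
  qed simp
qed

lemma comm_F: "x \<in> F \<Longrightarrow> y \<in> F \<Longrightarrow> x * y = y * x"
  by (rule wedderburn_little[OF div_F])

lemma V_mult_F: "v \<in> V \<Longrightarrow> x \<in> F \<Longrightarrow> v * x \<in> V"
  using R(2) by (auto simp: left_ideal_of_def corner_def mult.assoc)

lemma dual_in_F: "v \<in> V \<Longrightarrow> (a, b) \<in> set ps \<Longrightarrow> b * v \<in> F"
  using ps R(2) by (auto simp: left_ideal_of_def corner_def mult.assoc) (simp flip: mult.assoc)

text \<open>As \<open>v\<close> is the sum of the \<open>a * (b * v)\<close> with coefficients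
  \<open>b * v\<close> in \<open>F\<close>, an \<open>F\<close>-linear \<open>D\<close> is
  determined by its values at the \<open>a\<close>. The values of \<open>D\<close> may lie anywhere
  in the ambient ring, so that the lemma serves endomorphisms, derivations and automorphisms
  alike.\<close>

lemma linear_is_mult:
  assumes add: "\<And>x y. x \<in> V \<Longrightarrow> y \<in> V \<Longrightarrow> D (x + y) = D x + D y"
    and lin: "\<And>v x. v \<in> V \<Longrightarrow> x \<in> F \<Longrightarrow> D (v * x) = D v * x" and v: "v \<in> V"
  shows "D v = sum_list (map (\<lambda>(a, b). D a * b) ps) * v"
proof -
  have D0: "D 0 = 0" using add[of 0 0] addsub_zero[OF VM(1)] by simp
  have "D (sum_list (map (\<lambda>(a, b). a * b) qs) * v) = sum_list (map (\<lambda>(a, b). D a * b) qs) * v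
      \<and> sum_list (map (\<lambda>(a, b). a * b) qs) * v \<in> V" if "set qs \<subseteq> set ps" for qs
    using that
  proof (induction qs)
    case (Cons p qs)
    obtain a b where p: "p = (a, b)" "(a, b) \<in> set ps" using Cons.prems by (cases p) auto
    have bv: "b * v \<in> F" and aV: "a \<in> V" using dual_in_F[OF v p(2)] ps[OF p(2)] by auto
    have "D (a * (b * v)) = D a * (b * v)" by (rule lin[OF aV bv])
    moreover have "a * (b * v) \<in> V" by (rule V_mult_F[OF aV bv])
    ultimately show ?case
      using Cons add[of "a * (b * v)"] addsub_add[OF VM(1)] p(1) by (auto simp: distrib_right mult.assoc)
  qed (simp add: D0 addsub_zero[OF VM(1)])
  from this[of ps] have "D (e * v) = sum_list (map (\<lambda>(a, b). D a * b) ps) * v" by (simp flip: e_ps)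
  then show ?thesis using R(4) v V_sub by (metis subsetD)
qed

lemma sum_list_in_S:
  assumes "\<And>a b. (a, b) \<in> set qs \<Longrightarrow> h a b \<in> S"
  shows "sum_list (map (\<lambda>(a, b). h a b) qs) \<in> S"
  using assms by (induction qs) (auto simp: addsub_zero[OF R(1)] intro!: addsub_add[OF R(1)])

lemma eq_on_V:
  assumes "s \<in> S" "t \<in> S" "\<And>v. v \<in> V \<Longrightarrow> s * v = t * v"
  shows "s = t"
  using faithful[of "s - t"] assms addsub_diff[OF R(1)] by (auto simp: left_diff_distrib)

text \<open>Right multiplication by \<open>x\<close> is \<open>F\<close>-linear because
  \<open>F\<close> is commutative, hence it is left multiplication by some \<open>z\<close>; being a
  right multiplication, it commutes with \<open>S\<close>. In this way the right scalars
  \<open>F\<close> become left scalars in \<open>Z\<close>.\<close>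

lemma corner_from_center:
  assumes x: "x \<in> F"
  obtains z where "z \<in> Z" "\<And>v. v \<in> V \<Longrightarrow> z * v = v * x"
proof -
  define z where "z = sum_list (map (\<lambda>(a, b). (a * x) * b) ps)"
  have zv: "v * x = z * v" if "v \<in> V" for v
    unfolding z_def
  proof (rule linear_is_mult[where D = "\<lambda>v. v * x"])
    fix v y assume "v \<in> V" "y \<in> F"
    then show "v * y * x = v * x * y" using comm_F[OF x] by (simp add: mult.assoc)
  qed (simp_all add: distrib_right that)
  have zS: "z \<in> S" unfolding z_def
  proof (rule sum_list_in_S)
    fix a b assume "(a, b) \<in> set ps"
    then have "a \<in> S" "b \<in> S" using ps V_sub by blast+
    then show "a * x * b \<in> S" using x F_sub R(2) by blast
  qed
  have "z * s = s * z" if s: "s \<in> S" for s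
  proof (rule eq_on_V)
    fix v assume v: "v \<in> V"
    have "z * (s * v) = s * v * x" using zv[OF VM(2)[OF s v]] by simp
    also have "\<dots> = s * (z * v)" using zv[OF v] by (simp add: mult.assoc)
    finally show "z * s * v = s * z * v" by (simp add: mult.assoc)
  qed (use R(2) zS s in auto)
  then have "z \<in> Z" using zS unfolding center_def by blast
  then show ?thesis using that[of z] zv by simp
qed

lemma center_comm: "z \<in> Z \<Longrightarrow> s \<in> S \<Longrightarrow> z * s = s * z"
  and Z_sub: "Z \<subseteq> S"
  and Z_intro: "z \<in> S \<Longrightarrow> (\<And>s. s \<in> S \<Longrightarrow> z * s = s * z) \<Longrightarrow> z \<in> Z"
  unfolding center_def by blast+

lemma ring_Z: "ring_on e Z"
  unfolding ring_on_def
proof (intro conjI ballI)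
  show "addsub Z"
  proof (rule addsubI)
    show "0 \<in> Z" by (rule Z_intro) (simp_all add: addsub_zero[OF R(1)])
    fix x y assume xy: "x \<in> Z" "y \<in> Z"
    show "x - y \<in> Z"
    proof (rule Z_intro)
      show "x - y \<in> S" using addsub_diff[OF R(1)] xy Z_sub by blast
      fix s assume "s \<in> S"
      then show "(x - y) * s = s * (x - y)"
        by (simp only: left_diff_distrib right_diff_distrib center_comm[OF xy(1)] center_comm[OF xy(2)])
    qed
  qed
  show "e \<in> Z" by (rule Z_intro) (simp_all add: R(3-5))
  fix x y assume xy: "x \<in> Z" "y \<in> Z"
  show "x * y \<in> Z"
  proof (rule Z_intro)
    show "x * y \<in> S" using R(2) xy Z_sub by blast
    fix s assume s: "s \<in> S"
    have "x * y * s = x * s * y" by (simp only: mult.assoc center_comm[OF xy(2) s])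
    then show "x * y * s = s * (x * y)" by (simp only: mult.assoc center_comm[OF xy(1) s])
  qed
qed (use R(4,5) Z_sub in blast)+

text \<open>The annihilator of a central element is a two-sided ideal.\<close>

lemma center_regular:
  assumes "z \<in> Z" "z \<noteq> 0" "s \<in> S" "z * s = 0"
  shows "s = 0"
proof (rule ccontr)
  assume "s \<noteq> 0"
  have "ideal_on S {s \<in> S. z * s = 0}"
  proof (rule ideal_onI)
    show "addsub {s \<in> S. z * s = 0}"
      by (rule addsub_kernel[OF R(1)]) (simp add: right_diff_distrib)
    fix s x assume sx: "s \<in> S" "x \<in> {s \<in> S. z * s = 0}"
    have "z * (s * x) = s * (z * x)" using center_comm[OF assms(1) sx(1)] by (metis mult.assoc)
    then show "s * x \<in> {s \<in> S. z * s = 0}" using sx R(2) by simp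
    show "x * s \<in> {s \<in> S. z * s = 0}" using sx R(2) by (simp flip: mult.assoc)
  qed auto
  then have "{s \<in> S. z * s = 0} = S" by (rule simpleD[OF _ _ \<open>s \<noteq> 0\<close>]) (use assms in auto)
  then have "z * e = 0" using R(3) by blast
  then show False using R(5)[of z] assms(1,2) Z_sub by auto
qed

lemma div_Z: "div_ring_on e Z"
  by (rule finite_domain_div_ring_on[OF ring_Z finZ e_nz]) (use center_regular Z_sub in blast)

text \<open>\<open>\<theta>\<close> is determined by \<open>\<theta> f\<close>, which lies in the
  corner, through \<open>\<theta> v = \<theta> (v * f) = v * \<theta> f\<close>.\<close>

lemma commutant_V:
  assumes th: "\<And>v. v \<in> V \<Longrightarrow> \<theta> v \<in> V" "\<And>s v. s \<in> S \<Longrightarrow> v \<in> V \<Longrightarrow> \<theta> (s * v) = s * \<theta> v"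
  shows "\<exists>z\<in>Z. \<forall>v\<in>V. \<theta> v = z * v"
proof -
  have "f * \<theta> f = \<theta> f" using th(2)[OF f(1) f_V] f(3) by simp
  then have "\<theta> f \<in> F" using th(1)[OF f_V] by (auto simp: corner_def left_ideal_of_def)
  then obtain z where z: "z \<in> Z" "\<And>v. v \<in> V \<Longrightarrow> z * v = v * \<theta> f" using corner_from_center by blast
  have "\<theta> v = z * v" if "v \<in> V" for v
    using th(2)[of v f] f_V V_sub that z(2)[OF that] by (auto simp: left_ideal_of_def)
  then show ?thesis using z by blast
qed

end

section \<open>Linear algebra over a finite division ring\<close>

fun lspan :: "'r::ring_1 set \<Rightarrow> 'r list \<Rightarrow> 'r set" where
  "lspan F [] = {0}"
| "lspan F (w # ws) = {z * w + y | z y. z \<in> F \<and> y \<in> lspan F ws}"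

text \<open>Testing each vector of a list against the later ones lets independent tuples be counted
  one entry at a time.\<close>

fun indep :: "'r::ring_1 set \<Rightarrow> 'r list \<Rightarrow> bool" where
  "indep F [] \<longleftrightarrow> True"
| "indep F (w # ws) \<longleftrightarrow> w \<notin> lspan F ws \<and> indep F ws"

lemma lspan_ConsI: "z \<in> F \<Longrightarrow> y \<in> lspan F ws \<Longrightarrow> z * w + y \<in> lspan F (w # ws)"
  by auto

lemma lspan_mono_Cons: "0 \<in> F \<Longrightarrow> lspan F ws \<subseteq> lspan F (w # ws)"
  using lspan_ConsI[of 0 F _ ws w] by auto

lemma lspan_least:
  assumes W: "addsub W" and "\<And>z v. z \<in> F \<Longrightarrow> v \<in> set ws \<Longrightarrow> z * v \<in> W"
  shows "lspan F ws \<subseteq> W"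
  using assms(2)
  by (induction ws) (auto simp: addsub_zero[OF W] intro!: addsub_add[OF W])

definition scalar_space :: "'r::ring_1 \<Rightarrow> 'r set \<Rightarrow> 'r set \<Rightarrow> bool" where
  "scalar_space e F V \<longleftrightarrow> div_ring_on e F \<and> left_mod F V \<and> finite V \<and> (\<forall>v\<in>V. e * v = v)"

context
  fixes e :: "'r::ring_1" and F V
  assumes sp: "scalar_space e F V"
begin

lemma spD: "div_ring_on e F" "addsub V" "\<And>z v. z \<in> F \<Longrightarrow> v \<in> V \<Longrightarrow> z * v \<in> V" "finite V"
  "\<And>v. v \<in> V \<Longrightarrow> e * v = v" "ring_on e F" "finite F" "e \<noteq> 0"
proof -
  show "div_ring_on e F" "finite V" using sp by (simp_all add: scalar_space_def)
  have L: "left_mod F V" using sp by (simp add: scalar_space_def)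
  show "addsub V" by (rule left_modD(1)[OF L])
  show "\<And>z v. z \<in> F \<Longrightarrow> v \<in> V \<Longrightarrow> z * v \<in> V" by (rule left_modD(2)[OF L])
  show "\<And>v. v \<in> V \<Longrightarrow> e * v = v" using sp by (simp add: scalar_space_def)
  show "ring_on e F" "finite F" "e \<noteq> 0" using sp by (simp_all add: scalar_space_def div_ring_on_def)
qed

lemmas FR = ring_onD[OF spD(6)]

lemma card_scalars_ge_2: "2 \<le> card F"
proof -
  have "card {0, e} \<le> card F" using spD(7) FR addsub_zero[OF FR(1)] by (intro card_mono) auto
  then show ?thesis using spD(8) by auto
qed

lemma lspan_closed:
  assumes "set ws \<subseteq> V"
  shows "addsub (lspan F ws)" "\<And>z v. z \<in> F \<Longrightarrow> v \<in> lspan F ws \<Longrightarrow> z * v \<in> lspan F ws" "lspan F ws \<subseteq> V"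
proof -
  have "addsub (lspan F ws) \<and> (\<forall>z\<in>F. \<forall>v\<in>lspan F ws. z * v \<in> lspan F ws) \<and> lspan F ws \<subseteq> V"
    using assms
  proof (induction ws)
    case (Cons w ws)
    then have IH: "addsub (lspan F ws)" "\<And>z v. z \<in> F \<Longrightarrow> v \<in> lspan F ws \<Longrightarrow> z * v \<in> lspan F ws"
      "lspan F ws \<subseteq> V" and w: "w \<in> V" by auto
    have "addsub (lspan F (w # ws))"
    proof (rule addsubI)
      show "0 \<in> lspan F (w # ws)"
        using addsub_zero[OF FR(1)] addsub_zero[OF IH(1)] by (auto intro!: exI[of _ 0])
      fix x y assume "x \<in> lspan F (w # ws)" "y \<in> lspan F (w # ws)"
      then obtain z1 y1 z2 y2 where *: "x = z1 * w + y1" "y = z2 * w + y2" "z1 \<in> F" "z2 \<in> F"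
        "y1 \<in> lspan F ws" "y2 \<in> lspan F ws" by auto
      have "x - y = (z1 - z2) * w + (y1 - y2)" using * by (simp add: algebra_simps)
      then show "x - y \<in> lspan F (w # ws)"
        using addsub_diff[OF FR(1) *(3,4)] addsub_diff[OF IH(1) *(5,6)] by auto
    qed
    moreover have "z * v \<in> lspan F (w # ws)" if zv: "z \<in> F" "v \<in> lspan F (w # ws)" for z v
    proof -
      obtain z1 y1 where *: "v = z1 * w + y1" "z1 \<in> F" "y1 \<in> lspan F ws" using zv by auto
      have "z * v = (z * z1) * w + z * y1" by (simp add: * distrib_left mult.assoc)
      then show ?thesis using FR(2)[OF zv(1) *(2)] IH(2)[OF zv(1) *(3)] by auto
    qed
    moreover have "lspan F (w # ws) \<subseteq> V"
      using IH(3) w spD(3) by (auto intro!: addsub_add[OF spD(2)])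
    ultimately show ?case by blast
  qed (auto simp: addsub_def addsub_zero[OF spD(2)])
  then show "addsub (lspan F ws)" "\<And>z v. z \<in> F \<Longrightarrow> v \<in> lspan F ws \<Longrightarrow> z * v \<in> lspan F ws" "lspan F ws \<subseteq> V"
    by blast+
qed

lemma set_subset_lspan:
  assumes "set ws \<subseteq> V"
  shows "set ws \<subseteq> lspan F ws"
  using assms
proof (induction ws)
  case (Cons w ws)
  have "w \<in> lspan F (w # ws)"
    using lspan_ConsI[OF FR(3) addsub_zero[OF lspan_closed(1)[of ws]], of w] spD(5)[of w] Cons.prems
    by (simp del: lspan.simps)
  moreover have "lspan F ws \<subseteq> lspan F (w # ws)" by (rule lspan_mono_Cons[OF addsub_zero[OF FR(1)]])
  ultimately show ?case using Cons by auto
qed simp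

lemma scale_cancel:
  assumes "addsub W" "\<And>z v. z \<in> F \<Longrightarrow> v \<in> W \<Longrightarrow> z * v \<in> W" "z \<in> F" "z \<noteq> 0" "w \<in> V" "z * w \<in> W"
  shows "w \<in> W"
proof -
  obtain y where y: "y \<in> F" "y * z = e" using spD(1) assms(3,4) unfolding div_ring_on_def by blast
  have "y * (z * w) = w" using y(2) spD(5)[OF assms(5)] by (simp flip: mult.assoc)
  then show ?thesis using assms(2)[OF y(1) assms(6)] by simp
qed

lemma card_lspan:
  assumes "set ws \<subseteq> V" "indep F ws"
  shows "card (lspan F ws) = card F ^ length ws"
  using assms
proof (induction ws)
  case (Cons w ws)
  let ?L = "lspan F ws" and ?f = "\<lambda>(z, y). z * w + y"
  have ws: "set ws \<subseteq> V" "w \<in> V" "w \<notin> ?L" using Cons.prems by auto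
  note L = lspan_closed[OF ws(1)]
  have fin: "finite ?L" using L(3) spD(4) finite_subset by blast
  have V: "addsub (F \<times> ?L)" using FR(1) L(1) by (auto simp: addsub_def zero_prod_def)
  have "inj_on ?f (F \<times> ?L)"
  proof (rule inj_onI, clarsimp)
    fix z y z' y' assume *: "z \<in> F" "y \<in> ?L" "z' \<in> F" "y' \<in> ?L" "z * w + y = z' * w + y'"
    have "(z - z') * w = y' - y" using *(5) by (simp add: algebra_simps)
    then have d: "(z - z') * w \<in> ?L" using addsub_diff[OF L(1) *(4,2)] by simp
    have "z - z' = 0"
    proof (rule ccontr)
      assume "z - z' \<noteq> 0"
      then have "w \<in> ?L" using scale_cancel[of ?L "z - z'" w] L(1,2) addsub_diff[OF FR(1) *(1,3)] ws(2) d by blast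
      then show False using ws by simp
    qed
    then show "z = z' \<and> y = y'" using *(5) by simp
  qed
  then have "card (?f ` (F \<times> ?L)) = card F * card ?L" by (simp add: card_image card_cartesian_product)
  moreover have "?f ` (F \<times> ?L) = lspan F (w # ws)" by force
  ultimately show ?case using Cons by simp
qed simp

lemma extend_indep:
  assumes "set ws \<subseteq> V" "indep F ws"
  obtains us where "set us \<subseteq> V" "indep F (us @ ws)" "lspan F (us @ ws) = V"
proof -
  have "\<exists>us. set us \<subseteq> V \<and> indep F (us @ ws) \<and> lspan F (us @ ws) = V"
    using assms
  proof (induction "card V - card (lspan F ws)" arbitrary: ws rule: less_induct)
    case less
    note L = lspan_closed[OF less.prems(1)]
    show ?case
    proof (cases "lspan F ws = V")
      case True
      then show ?thesis using less.prems by (intro exI[of _ "[]"]) auto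
    next
      case False
      then obtain w where w: "w \<in> V" "w \<notin> lspan F ws" using L(3) by blast
      have ww: "set (w # ws) \<subseteq> V" "indep F (w # ws)" using w less.prems by auto
      have "lspan F ws \<subset> lspan F (w # ws)"
      proof
        show "lspan F ws \<subseteq> lspan F (w # ws)" by (rule lspan_mono_Cons[OF addsub_zero[OF FR(1)]])
        show "lspan F ws \<noteq> lspan F (w # ws)" using set_subset_lspan[OF ww(1)] w(2) by auto
      qed
      then have "card (lspan F ws) < card (lspan F (w # ws))"
        using lspan_closed(3)[OF ww(1)] spD(4) by (meson finite_subset psubset_card_mono)
      moreover have "card (lspan F (w # ws)) \<le> card V"
        using lspan_closed(3)[OF ww(1)] spD(4) by (rule card_mono[rotated])
      ultimately have "card V - card (lspan F (w # ws)) < card V - card (lspan F ws)" by simp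
      from less.hyps[OF this ww] obtain us where
        "set us \<subseteq> V" "indep F (us @ w # ws)" "lspan F (us @ w # ws) = V" by blast
      then show ?thesis using w(1) by (intro exI[of _ "us @ [w]"]) auto
    qed
  qed
  then show ?thesis using that by blast
qed

lemma exists_basis:
  obtains ws where "set ws \<subseteq> V" "indep F ws" "lspan F ws = V"
  using extend_indep[of "[]"] by auto

lemma finite_lists: "finite {ws. length ws = k \<and> set ws \<subseteq> V \<and> P ws}"
  by (rule finite_subset[OF _ finite_lists_length_eq[OF spD(4), of k]]) auto

lemma card_indep_lists:
  "card {ws. length ws = k \<and> set ws \<subseteq> V \<and> indep F ws} = (\<Prod>i<k. card V - card F ^ i)"
proof (induction k)
  case 0
  have "{ws. length ws = 0 \<and> set ws \<subseteq> V \<and> indep F ws} = {[]}" by auto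
  then show ?case by simp
next
  case (Suc k)
  let ?I = "\<lambda>k. {ws. length ws = k \<and> set ws \<subseteq> V \<and> indep F ws}"
  have "?I (Suc k) = (\<lambda>(ws, w). w # ws) ` (SIGMA ws:?I k. V - lspan F ws)"
  proof (intro equalityI subsetI)
    fix x assume "x \<in> ?I (Suc k)"
    then obtain w ws where "x = w # ws" "ws \<in> ?I k" "w \<in> V - lspan F ws"
      by (cases x) auto
    then show "x \<in> (\<lambda>(ws, w). w # ws) ` (SIGMA ws:?I k. V - lspan F ws)"
      by (intro image_eqI[of _ _ "(ws, w)"]) auto
  qed auto
  then have "card (?I (Suc k)) = card (SIGMA ws:?I k. V - lspan F ws)"
    by (simp only:) (rule card_image, auto simp: inj_on_def)
  also have "\<dots> = (\<Sum>ws\<in>?I k. card (V - lspan F ws))"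
    by (rule card_SigmaI) (use finite_lists[of k] spD(4) in auto)
  also have "\<dots> = (\<Sum>ws\<in>?I k. card V - card F ^ k)"
  proof (rule sum.cong)
    fix ws assume "ws \<in> ?I k"
    then have ws: "set ws \<subseteq> V" "indep F ws" "length ws = k" by auto
    have "card (V - lspan F ws) = card V - card (lspan F ws)"
      by (rule card_Diff_subset) (use lspan_closed(3)[OF ws(1)] spD(4) finite_subset in auto)
    then show "card (V - lspan F ws) = card V - card F ^ k" using card_lspan[OF ws(1,2)] ws(3) by simp
  qed simp
  finally show ?case using Suc by (simp add: mult.commute)
qed

lemma indep_length_lspan:
  assumes "set ws \<subseteq> V" "indep F ws" "card V = card F ^ length ws"
  shows "lspan F ws = V"
  using card_subset_eq[OF spD(4) lspan_closed(3)[OF assms(1)]] card_lspan[OF assms(1,2)] assms(3) by simp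

end

text \<open>The bare bound does not reproduce itself in an induction, which therefore carries the
  extra term \<open>(1 / 2) ^ Suc k\<close>. It starts at \<open>k = 1\<close>, where equality holds
  for \<open>q = 2\<close>.\<close>

lemma prod_half_powers:
  fixes q :: real
  assumes "q \<ge> 2"
  shows "(\<Prod>m<k. 1 - 1 / q ^ Suc m) \<ge> 1 / 4"
proof -
  have *: "k \<ge> 1 \<Longrightarrow> (\<Prod>m<k. 1 - 1 / q ^ Suc m) \<ge> 1 / 4 + (1 / 2) ^ Suc k" for k
  proof (induction k rule: dec_induct)
    case base
    have "1 / q \<le> 1 / 2" using assms by (simp add: field_simps)
    then show ?case by (simp add: power2_eq_square)
  next
    case (step k)
    let ?h = "(1 / 2 :: real) ^ Suc k"
    have "1 / q ^ Suc k \<le> 1 / 2 ^ Suc k"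
      using assms by (intro divide_left_mono power_mono) auto
    then have 1: "1 - ?h \<le> 1 - 1 / q ^ Suc k" by (simp add: power_one_over)
    have h: "0 < ?h" "?h \<le> 1 / 4"
    proof -
      have "?h \<le> (1 / 2) ^ 2" using step by (intro power_decreasing) auto
      then show "?h \<le> 1 / 4" by (simp add: power2_eq_square)
    qed simp
    have "1 / 4 + ?h / 2 \<le> (1 / 4 + ?h) * (1 - ?h)"
    proof -
      have "?h * ?h \<le> ?h * (1 / 4)" using h by (intro mult_left_mono) auto
      then show ?thesis by (simp add: algebra_simps)
    qed
    also have "\<dots> \<le> (\<Prod>m<k. 1 - 1 / q ^ Suc m) * (1 - 1 / q ^ Suc k)"
      using step(3) 1 h by (intro mult_mono) (auto intro: order_trans[of _ "1 / 4 + ?h"] simp del: power_Suc)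
    finally show ?case by simp
  qed
  show ?thesis
  proof (cases "k \<ge> 1")
    case True
    have "1 / 4 \<le> 1 / 4 + (1 / 2 :: real) ^ Suc k" by simp
    also note *[OF True]
    finally show ?thesis .
  qed (simp add: not_le)
qed

text \<open>The product counts the bases among the \<open>q ^ k ^ 2\<close> tuples of length
  \<open>k\<close> in a space of dimension \<open>k\<close> over \<open>q\<close> scalars. Dividing
  by it costs a factor of at most \<open>4\<close>, which is where the constants \<open>4\<close>
  and \<open>8\<close> in the counts of subrings come from.\<close>

lemma card_bases_ge:
  fixes q k :: nat
  assumes "q \<ge> 2"
  shows "q ^ k ^ 2 \<le> 4 * (\<Prod>i<k. q ^ k - q ^ i)"
proof -
  have "real (\<Prod>i<k. q ^ k - q ^ i) = (\<Prod>i<k. real q ^ k * (1 - 1 / real q ^ (k - i)))"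
    unfolding of_nat_prod
  proof (rule prod.cong)
    fix i assume i: "i \<in> {..<k}"
    have "q ^ i \<le> q ^ k" using i assms by (intro power_increasing) auto
    then have "real (q ^ k - q ^ i) = real q ^ k - real q ^ i" by (simp add: of_nat_diff)
    also have "real q ^ i = real q ^ k / real q ^ (k - i)"
      using i assms by (simp add: field_simps flip: power_add)
    finally show "real (q ^ k - q ^ i) = real q ^ k * (1 - 1 / real q ^ (k - i))" by (simp add: algebra_simps)
  qed simp
  also have "\<dots> = real q ^ (k ^ 2) * (\<Prod>i<k. 1 - 1 / real q ^ (k - i))"
    by (simp add: prod.distrib power2_eq_square power_mult)
  also have "(\<Prod>i<k. 1 - 1 / real q ^ (k - i)) = (\<Prod>m<k. 1 - 1 / real q ^ Suc m)"
    by (rule prod.reindex_bij_witness[of _ "\<lambda>i. k - Suc i" "\<lambda>i. k - Suc i"]) (auto simp: Suc_diff_Suc)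
  finally have "real (q ^ k ^ 2) * (1 / 4) \<le> real (\<Prod>i<k. q ^ k - q ^ i)"
    using prod_half_powers[of "real q" k] assms by (simp add: mult_left_mono)
  then have "real (q ^ k ^ 2) \<le> real (4 * (\<Prod>i<k. q ^ k - q ^ i))" by simp
  then show ?thesis using of_nat_le_iff by blast
qed

section \<open>The Jacobson density theorem\<close>

locale dense_action =
  fixes e :: "'r::ring_1" and M F V
  assumes ring_M: "ring_on e M" and fin_M: "finite M"
    and simple_V: "simple_mod M V" and sp: "scalar_space e F V"
    and comm: "\<And>m z v. m \<in> M \<Longrightarrow> z \<in> F \<Longrightarrow> v \<in> V \<Longrightarrow> m * (z * v) = z * (m * v)"
    and commutant: "\<And>\<theta>. (\<And>v. v \<in> V \<Longrightarrow> \<theta> v \<in> V) \<Longrightarrow> (\<And>u v. u \<in> V \<Longrightarrow> v \<in> V \<Longrightarrow> \<theta> (u - v) = \<theta> u - \<theta> v)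
      \<Longrightarrow> (\<And>m v. m \<in> M \<Longrightarrow> v \<in> V \<Longrightarrow> \<theta> (m * v) = m * \<theta> v) \<Longrightarrow> \<exists>z\<in>F. \<forall>v\<in>V. \<theta> v = z * v"
begin

lemmas MR = ring_onD[OF ring_M] and VM = simple_modD[OF simple_V] and SP = spD[OF sp]

definition ann :: "'r list \<Rightarrow> 'r set" where
  "ann ws = {m \<in> M. \<forall>u\<in>set ws. m * u = 0}"

lemma ann_left: "addsub (ann ws)" "\<And>s m. s \<in> M \<Longrightarrow> m \<in> ann ws \<Longrightarrow> s * m \<in> ann ws" "ann ws \<subseteq> M"
proof -
  show "addsub (ann ws)"
  proof (rule addsubI)
    show "0 \<in> ann ws" using addsub_zero[OF MR(1)] by (simp add: ann_def)
    fix x y assume "x \<in> ann ws" "y \<in> ann ws"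
    then show "x - y \<in> ann ws" using addsub_diff[OF MR(1)] by (simp add: ann_def left_diff_distrib)
  qed
qed (use MR(2) in \<open>auto simp: ann_def mult.assoc\<close>)

text \<open>Suppose \<open>a\<close> is outside the span of \<open>ws\<close>. Then
  \<open>ann ws\<close> carries \<open>a\<close> onto all of \<open>V\<close>, and
  \<open>m * a \<mapsto> m * w\<close> is well defined on \<open>V\<close> and commutes with
  \<open>M\<close>, so it is a scalar \<open>z\<close>. Hence \<open>ann ws\<close> kills
  \<open>w - z * a\<close>, to which the induction hypothesis applies.\<close>

lemma density:
  assumes "set ws \<subseteq> V" "w \<in> V" "\<And>m. m \<in> ann ws \<Longrightarrow> m * w = 0"
  shows "w \<in> lspan F ws"
  using assms
proof (induction ws arbitrary: w)
  case Nil
  then have "e * w = 0" using MR(3) by (simp add: ann_def)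
  then show ?case using SP(5)[OF Nil(2)] by simp
next
  case (Cons a ws)
  have a: "a \<in> V" "set ws \<subseteq> V" using Cons.prems by auto
  show ?case
  proof (cases "a \<in> lspan F ws")
    case True
    have "m * a = 0" if m: "m \<in> ann ws" for m
    proof -
      have "lspan F ws \<subseteq> {v \<in> V. m * v = 0}"
      proof (rule lspan_least)
        show "addsub {v \<in> V. m * v = 0}" by (rule addsub_kernel[OF SP(2)]) (simp add: right_diff_distrib)
        fix z v assume "z \<in> F" "v \<in> set ws"
        then show "z * v \<in> {v \<in> V. m * v = 0}" using comm[of m z v] m SP(3)[of z v] a(2) by (auto simp: ann_def)
      qed
      then show ?thesis using True by auto
    qed
    then have "ann ws = ann (a # ws)" by (auto simp: ann_def)
    then have "w \<in> lspan F ws" using Cons.IH[OF a(2) Cons.prems(2)] Cons.prems(3) by simp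
    then show ?thesis using lspan_mono_Cons[OF addsub_zero[OF ring_onD(1)[OF SP(6)]]] by blast
  next
    case False
    then obtain m0 where m0: "m0 \<in> ann ws" "m0 * a \<noteq> 0" using Cons.IH[OF a(2,1)] by blast
    have onto: "(\<lambda>m. m * a) ` ann ws = V"
      by (rule VM(4)[of _ "m0 * a"])
        (use left_mod_mult_right[OF ann_left(1,2)] m0 VM(2) a subsetD[OF ann_left(3)] in auto)
    have wd: "m * w = m' * w" if m: "m \<in> ann ws" "m' \<in> ann ws" "m * a = m' * a" for m m'
    proof -
      have "m - m' \<in> ann (a # ws)" using addsub_diff[OF ann_left(1) m(1,2)] m(3)
        by (auto simp: ann_def left_diff_distrib)
      then show ?thesis using Cons.prems(3)[of "m - m'"] by (simp add: left_diff_distrib)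
    qed
    define pick where "pick v = (SOME m. m \<in> ann ws \<and> m * a = v)" for v
    have pick: "pick v \<in> ann ws" "pick v * a = v" if v: "v \<in> V" for v
    proof -
      have "\<exists>m. m \<in> ann ws \<and> m * a = v" using onto v by blast
      then have "pick v \<in> ann ws \<and> pick v * a = v" unfolding pick_def by (rule someI_ex)
      then show "pick v \<in> ann ws" "pick v * a = v" by auto
    qed
    have "\<exists>z\<in>F. \<forall>v\<in>V. pick v * w = z * v"
    proof (rule commutant)
      show "pick v * w \<in> V" if "v \<in> V" for v using VM(2) pick(1)[OF that] ann_left(3) Cons.prems(2) by blast
      show "pick (u - v) * w = pick u * w - pick v * w" if uv: "u \<in> V" "v \<in> V" for u v
      proof -
        have "pick (u - v) * w = (pick u - pick v) * w"
          by (rule wd) (use pick uv addsub_diff[OF SP(2) uv] addsub_diff[OF ann_left(1)] in \<open>auto simp: left_diff_distrib\<close>)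
        then show ?thesis by (simp add: left_diff_distrib)
      qed
      show "pick (m * v) * w = m * (pick v * w)" if mv: "m \<in> M" "v \<in> V" for m v
      proof -
        have "pick (m * v) * w = (m * pick v) * w"
          by (rule wd) (use pick mv VM(2)[OF mv] ann_left(2) in \<open>auto simp: mult.assoc\<close>)
        then show ?thesis by (simp add: mult.assoc)
      qed
    qed
    then obtain z where z: "z \<in> F" "\<And>v. v \<in> V \<Longrightarrow> pick v * w = z * v" by blast
    have "w - z * a \<in> lspan F ws"
    proof (rule Cons.IH[OF a(2)])
      show "w - z * a \<in> V" by (intro addsub_diff[OF SP(2)] Cons.prems(2) SP(3) z(1) a(1))
      fix m assume m: "m \<in> ann ws"
      have mM: "m \<in> M" using m ann_left(3) by blast
      have "m * w = pick (m * a) * w" by (rule wd) (use m pick VM(2)[OF mM a(1)] in auto)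
      also have "\<dots> = m * (z * a)" using z(2)[OF VM(2)[OF mM a(1)]] comm[OF mM z(1) a(1)] by simp
      finally show "m * (w - z * a) = 0" by (simp add: right_diff_distrib)
    qed
    moreover have "w = z * a + (w - z * a)" by simp
    ultimately show ?thesis using z(1) by (simp only: lspan.simps) blast
  qed
qed

lemma ann_onto:
  assumes "set ws \<subseteq> V" "w \<in> V" "w \<notin> lspan F ws"
  shows "(\<lambda>m. m * w) ` ann ws = V"
proof -
  obtain m0 where m0: "m0 \<in> ann ws" "m0 * w \<noteq> 0" using density[OF assms(1,2)] assms(3) by blast
  show ?thesis
    by (rule VM(4)[of _ "m0 * w"])
      (use left_mod_mult_right[OF ann_left(1,2)] m0 VM(2) assms(2) subsetD[OF ann_left(3)] in auto)
qed

text \<open>Evaluation at \<open>w\<close> maps \<open>ann ws\<close> onto \<open>V\<close> by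
  density, with kernel \<open>ann (w # ws)\<close>.\<close>

lemma card_acting:
  assumes "set ws \<subseteq> V" "indep F ws"
  shows "card M = card V ^ length ws * card (ann ws)"
  using assms
proof (induction ws)
  case Nil
  then show ?case by (simp add: ann_def)
next
  case (Cons w ws)
  have fin: "finite (ann ws)" using ann_left(3) fin_M finite_subset by blast
  have "card (ann ws) = card {m \<in> ann ws. m * w = 0} * card ((\<lambda>m. m * w) ` ann ws)"
    by (rule card_additive[OF ann_left(1) fin]) (simp add: left_diff_distrib)
  moreover have "{m \<in> ann ws. m * w = 0} = ann (w # ws)" by (auto simp: ann_def)
  ultimately show ?case using Cons ann_onto[of ws w] by simp
qed

lemma card_acting_faithful:
  assumes "set ws \<subseteq> V" "indep F ws" "lspan F ws = V" "\<And>m. m \<in> M \<Longrightarrow> (\<And>v. v \<in> V \<Longrightarrow> m * v = 0) \<Longrightarrow> m = 0"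
  shows "card M = card V ^ length ws"
proof -
  have "ann ws = {0}"
  proof (intro equalityI subsetI)
    fix m assume m: "m \<in> ann ws"
    have "lspan F ws \<subseteq> {v \<in> V. m * v = 0}"
    proof (rule lspan_least)
      show "addsub {v \<in> V. m * v = 0}" by (rule addsub_kernel[OF SP(2)]) (simp add: right_diff_distrib)
      fix z v assume "z \<in> F" "v \<in> set ws"
      then show "z * v \<in> {v \<in> V. m * v = 0}" using comm[of m z v] m SP(3)[of z v] assms(1) by (auto simp: ann_def)
    qed
    then have "m = 0" using assms(3,4) m by (auto simp: ann_def)
    then show "m \<in> {0}" by simp
  qed (simp add: addsub_zero[OF ann_left(1)])
  then show ?thesis using card_acting[OF assms(1,2)] by simp
qed

end

context simple_frame
begin

lemma scalar_space_V: "scalar_space e Z V"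
  unfolding scalar_space_def left_mod_def
  using div_Z VM(1) finV R(4) V_sub VM(2) Z_sub by (meson subsetD)

sublocale action: dense_action e S Z V
proof
  show "m * (z * v) = z * (m * v)" if "m \<in> S" "z \<in> Z" "v \<in> V" for m z v
    using center_comm[OF that(2,1)] by (simp flip: mult.assoc)
qed (use ring fin simple_V scalar_space_V commutant_V in blast)+

lemma card_S:
  assumes "set ws \<subseteq> V" "indep Z ws" "lspan Z ws = V"
  shows "card S = card V ^ length ws" "card V = card Z ^ length ws"
  using action.card_acting_faithful[OF assms faithful] card_lspan[OF scalar_space_V assms(1,2)] assms(3) by auto

end

section \<open>Maximal subrings of finite simple rings\<close>

definition max_subring :: "'r::ring_1 \<Rightarrow> 'r set \<Rightarrow> 'r set \<Rightarrow> bool" where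
  "max_subring e R M \<longleftrightarrow> ring_on e M \<and> M \<subseteq> R \<and> M \<noteq> R \<and>
     (\<forall>S. ring_on e S \<longrightarrow> M \<subseteq> S \<longrightarrow> S \<subseteq> R \<longrightarrow> S = M \<or> S = R)"

definition core_free :: "'r::ring_1 set \<Rightarrow> 'r set \<Rightarrow> bool" where
  "core_free R M \<longleftrightarrow> (\<forall>I. ideal_on R I \<longrightarrow> I \<subseteq> M \<longrightarrow> I = {0})"

definition core_free_max_subrings :: "'r::ring_1 \<Rightarrow> 'r set \<Rightarrow> nat \<Rightarrow> 'r set set" where
  "core_free_max_subrings e R n = {M. max_subring e R M \<and> core_free R M \<and> card R = n * card M}"

definition stabilizer :: "'r::ring_1 set \<Rightarrow> 'r set \<Rightarrow> 'r set" where
  "stabilizer R W = {x \<in> R. \<forall>w\<in>W. x * w \<in> W}"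

lemma ring_stabilizer:
  assumes "ring_on e R" "addsub W" "\<And>w. w \<in> W \<Longrightarrow> e * w = w"
  shows "ring_on e (stabilizer R W)"
  unfolding ring_on_def
proof (intro conjI ballI)
  note R = ring_onD[OF assms(1)]
  show "addsub (stabilizer R W)"
  proof (rule addsubI)
    show "0 \<in> stabilizer R W" using addsub_zero[OF R(1)] addsub_zero[OF assms(2)] by (simp add: stabilizer_def)
    fix x y assume "x \<in> stabilizer R W" "y \<in> stabilizer R W"
    then show "x - y \<in> stabilizer R W"
      using addsub_diff[OF R(1)] addsub_diff[OF assms(2)] by (simp add: stabilizer_def left_diff_distrib)
  qed
  show "e \<in> stabilizer R W" using R(3) assms(3) by (simp add: stabilizer_def)
  fix x y assume "x \<in> stabilizer R W" "y \<in> stabilizer R W"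
  then show "x * y \<in> stabilizer R W" using R(2) by (simp add: stabilizer_def mult.assoc)
next
  note R = ring_onD[OF assms(1)]
  fix x assume "x \<in> stabilizer R W"
  then show "e * x = x" "x * e = x" using R(4,5) by (auto simp: stabilizer_def)
qed

lemma centralizerD: "z \<in> centralizer R X \<Longrightarrow> x \<in> X \<Longrightarrow> z * x = x * z"
  and centralizer_sub: "centralizer R X \<subseteq> R"
  and centralizerI: "z \<in> R \<Longrightarrow> (\<And>x. x \<in> X \<Longrightarrow> z * x = x * z) \<Longrightarrow> z \<in> centralizer R X"
  unfolding centralizer_def by blast+

lemma nat_square_split:
  fixes j r :: nat
  assumes "j \<le> r"
  shows "r * r = j * (r - j) + (r * (r - j) + j * j)" "r * j = j * (r - j) + j ^ 2"
    "0 < j \<Longrightarrow> j < r \<Longrightarrow> r - 1 \<le> j * (r - j)"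
proof -
  obtain d where d: "r = j + d" using assms by (auto simp: le_iff_add)
  then show "r * r = j * (r - j) + (r * (r - j) + j * j)" "r * j = j * (r - j) + j ^ 2"
    by (simp_all add: algebra_simps power2_eq_square)
  show "r - 1 \<le> j * (r - j)" if "0 < j" "j < r"
    using that d by (cases j; cases d) auto
qed

text \<open>Double counting: each \<open>M\<close> in \<open>B\<close> owns a block of at least
  \<open>c\<close> witnesses in \<open>Y\<close>, and a witness determines its owner. The counts of
  subrings and automorphisms differ in the choice of the witnesses: bases, field elements, tables of
  values, conjugating elements.\<close>

lemma card_disjoint_bound:
  assumes "finite Y" "\<And>M. M \<in> B \<Longrightarrow> X M \<subseteq> Y" "\<And>M. M \<in> B \<Longrightarrow> c \<le> card (X M)"
    "\<And>M M' x. M \<in> B \<Longrightarrow> M' \<in> B \<Longrightarrow> x \<in> X M \<Longrightarrow> x \<in> X M' \<Longrightarrow> M = M'" "finite B"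
  shows "card B * c \<le> card Y"
proof -
  have "card B * c \<le> (\<Sum>M\<in>B. card (X M))" using sum_mono[of B "\<lambda>_. c" "\<lambda>M. card (X M)"] assms(3) by simp
  also have "\<dots> = card (\<Union>M\<in>B. X M)"
    by (rule card_UN_disjoint[symmetric]) (use assms finite_subset in \<open>blast+\<close>)
  also have "\<dots> \<le> card Y" using assms(1,2) by (intro card_mono) auto
  finally show ?thesis .
qed

lemma card_lists_in: "finite A \<Longrightarrow> card {xs. set xs \<subseteq> A \<and> length xs = k} = card A ^ k"
  by (rule card_lists_length_eq)

lemma max_subringD:
  assumes "max_subring e R M"
  shows "ring_on e M" "M \<subseteq> R" "M \<noteq> R" "\<And>S x. ring_on e S \<Longrightarrow> M \<subseteq> S \<Longrightarrow> S \<subseteq> R \<Longrightarrow> x \<in> S \<Longrightarrow> x \<notin> M \<Longrightarrow> S = R"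
    "\<And>S. ring_on e S \<Longrightarrow> M \<subseteq> S \<Longrightarrow> S \<subseteq> R \<Longrightarrow> S \<noteq> R \<Longrightarrow> S = M"
proof -
  have *: "ring_on e S \<Longrightarrow> M \<subseteq> S \<Longrightarrow> S \<subseteq> R \<Longrightarrow> S = M \<or> S = R" for S
    using assms unfolding max_subring_def by simp
  show "ring_on e S \<Longrightarrow> M \<subseteq> S \<Longrightarrow> S \<subseteq> R \<Longrightarrow> x \<in> S \<Longrightarrow> x \<notin> M \<Longrightarrow> S = R" for S x using *[of S] by blast
  show "ring_on e S \<Longrightarrow> M \<subseteq> S \<Longrightarrow> S \<subseteq> R \<Longrightarrow> S \<noteq> R \<Longrightarrow> S = M" for S using *[of S] by blast
qed (use assms in \<open>simp_all add: max_subring_def\<close>)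

fun pow_on :: "'r::ring_1 \<Rightarrow> 'r \<Rightarrow> nat \<Rightarrow> 'r" where
  "pow_on e c 0 = e"
| "pow_on e c (Suc i) = c * pow_on e c i"

text \<open>The powers are listed in decreasing order, so that \<open>indep\<close> compares
  \<open>c ^ l\<close> with the span of the lower powers.\<close>

fun pow_list :: "'r::ring_1 \<Rightarrow> 'r \<Rightarrow> nat \<Rightarrow> 'r list" where
  "pow_list e c 0 = []"
| "pow_list e c (Suc l) = pow_on e c l # pow_list e c l"

lemma length_pow_list [simp]: "length (pow_list e c l) = l"
  by (induction l) auto

lemma set_pow_list: "set (pow_list e c l) = pow_on e c ` {..<l}"
  by (induction l) (auto simp: lessThan_Suc)

definition lin_comb :: "'r::ring_1 list \<Rightarrow> 'r list \<Rightarrow> 'r" where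
  "lin_comb zs ws = sum_list (map2 (*) zs ws)"

lemma lspan_lin_comb:
  "x \<in> lspan F ws \<Longrightarrow> \<exists>zs. length zs = length ws \<and> set zs \<subseteq> F \<and> x = lin_comb zs ws"
proof (induction ws arbitrary: x)
  case (Cons w ws)
  then obtain z y where zy: "z \<in> F" "y \<in> lspan F ws" "x = z * w + y" by auto
  then obtain zs where "length zs = length ws" "set zs \<subseteq> F" "y = lin_comb zs ws" using Cons.IH by blast
  then show ?case using zy by (intro exI[of _ "z # zs"]) (auto simp: lin_comb_def)
qed (simp add: lin_comb_def)

lemma lin_comb_mult: "lin_comb zs ws * u = lin_comb zs (map (\<lambda>w. w * u) ws)"
proof (induction zs arbitrary: ws)
  case (Cons z zs)
  then show ?case by (cases ws) (auto simp: lin_comb_def distrib_right mult.assoc)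
qed (simp add: lin_comb_def)

section \<open>Maximal subrings containing the centre: stabilizers of subspaces\<close>

context simple_frame
begin

abbreviation "\<M> n \<equiv> core_free_max_subrings e S n"

lemma MD:
  assumes "M \<in> \<M> n"
  shows "max_subring e S M" "card S = n * card M" "ring_on e M" "M \<subseteq> S" "M \<noteq> S" "finite M" "card M > 0"
proof -
  show m: "max_subring e S M" "card S = n * card M" using assms by (auto simp: core_free_max_subrings_def)
  show r: "ring_on e M" "M \<subseteq> S" "M \<noteq> S" using max_subringD[OF m(1)] by auto
  show "finite M" using r(2) fin by (rule finite_subset)
  then show "card M > 0" using ring_onD(3)[OF r(1)] by (auto simp: card_gt_0_iff)
qed

lemma fin_M: "finite (\<M> n)"
  by (rule finite_subset[of _ "Pow S"]) (use MD(4) fin in auto)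

lemma agree_on_span:
  assumes "s \<in> S" "t \<in> S" "\<And>u. u \<in> set us \<Longrightarrow> s * u = t * u" "lspan Z us = V" "set us \<subseteq> V"
  shows "s = t"
proof (rule eq_on_V[OF assms(1,2)])
  have "lspan Z us \<subseteq> {v \<in> V. (s - t) * v = 0}"
  proof (rule lspan_least)
    show "addsub {v \<in> V. (s - t) * v = 0}" by (rule addsub_kernel[OF VM(1)]) (simp add: right_diff_distrib)
    fix z u assume zu: "z \<in> Z" "u \<in> set us"
    have d: "s - t \<in> S" by (rule addsub_diff[OF R(1) assms(1,2)])
    have "(s - t) * (z * u) = z * ((s - t) * u)" using center_comm[OF zu(1) d] by (simp flip: mult.assoc)
    also have "(s - t) * u = 0" using assms(3)[OF zu(2)] by (simp add: left_diff_distrib)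
    finally have "(s - t) * (z * u) = 0" by simp
    moreover have "z * u \<in> V" using VM(2) zu Z_sub assms(5) by blast
    ultimately show "z * u \<in> {v \<in> V. (s - t) * v = 0}" by simp
  qed
  then show "s * v = t * v" if "v \<in> V" for v using that assms(4) by (auto simp: left_diff_distrib)
qed

text \<open>The tool for subrings that miss part of the centre: a property that holds on
  \<open>M\<close> and on \<open>Z\<close> and defines a subring holds on all of
  \<open>S\<close>.\<close>

lemma generated_by_center:
  assumes M: "M \<in> \<M> n" and nZ: "\<not> Z \<subseteq> M" and T: "ring_on e T" "M \<subseteq> T" "T \<subseteq> S" "Z \<subseteq> T"
  shows "T = S"
proof -
  obtain z where "z \<in> Z" "z \<notin> M" using nZ by blast
  then show ?thesis using max_subringD(4)[OF MD(1)[OF M] T(1-3)] T(4) by blast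
qed

text \<open>The dimension of \<open>V\<close> over \<open>Z\<close>, read off from orders so that no
  basis has to be carried along.\<close>

definition "dimV = (SOME r. card V = card Z ^ r \<and> card S = card V ^ r)"

lemma dimV: "card V = card Z ^ dimV" "card S = card Z ^ (dimV * dimV)"
proof -
  obtain ws where ws: "set ws \<subseteq> V" "indep Z ws" "lspan Z ws = V" by (rule exists_basis[OF scalar_space_V])
  have "card V = card Z ^ dimV \<and> card S = card V ^ dimV"
    unfolding dimV_def by (rule someI[of _ "length ws"]) (use card_S[OF ws] in auto)
  then show "card V = card Z ^ dimV" "card S = card Z ^ (dimV * dimV)" by (auto simp: power_mult)
qed

lemma q2: "2 \<le> card Z" by (rule card_scalars_ge_2[OF scalar_space_V])

lemma power_q_inj: "card Z ^ a = card Z ^ b \<Longrightarrow> a = b"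
  using q2 power_inject_exp[of "card Z" a b] by auto

lemma power_q_le: "card Z ^ a \<le> card Z ^ b \<longleftrightarrow> a \<le> b"
  using q2 power_increasing_iff[of "card Z" a b] by auto

lemma basis_length:
  assumes "set ws \<subseteq> V" "indep Z ws" "lspan Z ws = V"
  shows "length ws = dimV"
  using card_S(2)[OF assms] dimV(1) power_q_inj by metis

lemma dimV_pos: "dimV > 0"
proof (rule ccontr)
  assume "\<not> ?thesis"
  then have "card V = 1" using dimV(1) by simp
  moreover have "card {0, f} \<le> card V" using finV f_V addsub_zero[OF VM(1)] by (intro card_mono) auto
  ultimately show False using f(2) by auto
qed

definition reducible_max :: "nat \<Rightarrow> nat \<Rightarrow> 'r set set" where
  "reducible_max n j = {M \<in> \<M> n. Z \<subseteq> M \<and> (\<exists>W\<subseteq>V. left_mod M W \<and> card W = card Z ^ j)}"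

text \<open>By maximality \<open>M\<close> is the full stabilizer of its invariant subspace
  \<open>W\<close> of dimension \<open>j\<close>, and its index is at least
  \<open>q ^ (j * (r - j))\<close>. Counting bases shows that there are at most
  \<open>4 * q ^ (j * (r - j))\<close> subspaces of this dimension, hence at most
  \<open>4 * n\<close>. The second claim uses \<open>j * (r - j) \<ge> r - 1\<close>.\<close>

lemma reducible_count:
  assumes j: "0 < j" "j < dimV"
  shows "card (reducible_max n j) \<le> 4 * n" "reducible_max n j \<noteq> {} \<Longrightarrow> 2 ^ (dimV - 1) \<le> n"
proof -
  let ?q = "card Z" and ?r = dimV
  define W where "W M = (SOME W. W \<subseteq> V \<and> left_mod M W \<and> card W = ?q ^ j)" for M
  have W: "W M \<subseteq> V" "left_mod M (W M)" "card (W M) = ?q ^ j" "M \<in> \<M> n" "Z \<subseteq> M" if M: "M \<in> reducible_max n j" for M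
  proof -
    have "\<exists>W. W \<subseteq> V \<and> left_mod M W \<and> card W = ?q ^ j" using M by (auto simp: reducible_max_def)
    from someI_ex[OF this] show "W M \<subseteq> V" "left_mod M (W M)" "card (W M) = ?q ^ j" unfolding W_def by auto
    show "M \<in> \<M> n" "Z \<subseteq> M" using M by (auto simp: reducible_max_def)
  qed
  have spW: "scalar_space e Z (W M)" if M: "M \<in> reducible_max n j" for M
  proof -
    have "left_mod Z (W M)" using left_modD[OF W(2)[OF M]] W(5)[OF M] by (auto simp: left_mod_def)
    moreover have "finite (W M)" using W(1)[OF M] finV by (rule finite_subset)
    moreover have "e * v = v" if "v \<in> W M" for v using that W(1)[OF M] V_sub R(4) by blast
    ultimately show ?thesis using div_Z by (simp add: scalar_space_def)
  qed
  have stab: "M = stabilizer S (W M)" if M: "M \<in> reducible_max n j" for M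
  proof (rule max_subringD(5)[OF MD(1)[OF W(4)[OF M]], symmetric])
    note L = left_modD[OF W(2)[OF M]]
    show "ring_on e (stabilizer S (W M))"
      by (rule ring_stabilizer[OF ring L(1)]) (use W(1)[OF M] V_sub R(4) in blast)
    show "M \<subseteq> stabilizer S (W M)" using L(2) MD(4)[OF W(4)[OF M]] by (auto simp: stabilizer_def)
    show "stabilizer S (W M) \<subseteq> S" by (auto simp: stabilizer_def)
    show "stabilizer S (W M) \<noteq> S"
    proof
      assume "stabilizer S (W M) = S"
      then have "\<And>s w. s \<in> S \<Longrightarrow> w \<in> W M \<Longrightarrow> s * w \<in> W M" unfolding stabilizer_def by blast
      then have "left_mod S (W M)" by (rule left_modI[OF L(1)])
      then have "W M = {0} \<or> W M = V" using simple_V W(1)[OF M] by (simp add: simple_mod_def)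
      then have "card (W M) = 1 \<or> card (W M) = card V" by (elim disjE) simp_all
      then have "?q ^ j = ?q ^ 0 \<or> ?q ^ j = ?q ^ ?r" unfolding W(3)[OF M] dimV(1) power_0 .
      then show False using j power_q_inj by blast
    qed
  qed
  \<comment> \<open>An element of \<open>M\<close> is determined by the images of a basis adapted to
    \<open>W\<close>: those of \<open>us\<close> may be anywhere in \<open>V\<close>, those of
    \<open>ws\<close> stay in \<open>W\<close>.\<close>
  have idx: "?q ^ (j * (?r - j)) \<le> n" if M: "M \<in> reducible_max n j" for M
  proof -
    obtain ws where ws: "set ws \<subseteq> W M" "indep Z ws" "lspan Z ws = W M" by (rule exists_basis[OF spW[OF M]])
    have lw: "length ws = j" using card_lspan[OF spW[OF M] ws(1,2)] ws(3) W(3)[OF M] power_q_inj by metis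
    obtain us where us: "set us \<subseteq> V" "indep Z (us @ ws)" "lspan Z (us @ ws) = V"
      using extend_indep[OF scalar_space_V _ ws(2)] ws(1) W(1)[OF M] by blast
    have uw: "set (us @ ws) \<subseteq> V" using us(1) ws(1) W(1)[OF M] by auto
    have lu: "length us = ?r - j" using basis_length[OF uw us(2,3)] lw by simp
    note m = MD[OF W(4)[OF M]]
    let ?Y = "{xs. set xs \<subseteq> V \<and> length xs = ?r - j} \<times> {xs. set xs \<subseteq> W M \<and> length xs = j}"
    have finW: "finite (W M)" using W(1)[OF M] finV by (rule finite_subset)
    let ?h = "\<lambda>m. (map ((*) m) us, map ((*) m) ws)"
    have "inj_on ?h M"
    proof (rule inj_onI)
      fix s t assume st: "s \<in> M" "t \<in> M" "?h s = ?h t"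
      show "s = t" by (rule agree_on_span[OF _ _ _ us(3) uw]) (use st m(4) in auto)
    qed
    moreover have "?h ` M \<subseteq> ?Y"
    proof -
      have "x * u \<in> V" if "x \<in> M" "u \<in> set us" for x u using that VM(2) m(4) us(1) by blast
      moreover have "x * w \<in> W M" if "x \<in> M" "w \<in> set ws" for x w
        using that left_modD(2)[OF W(2)[OF M]] ws(1) by blast
      ultimately show ?thesis using lu lw by auto
    qed
    moreover have "finite ?Y" using finV finW by (intro finite_cartesian_product finite_lists_length_eq)
    ultimately have "card M \<le> card ?Y" by (rule card_inj_on_le)
    also have "\<dots> = ?q ^ (?r * (?r - j)) * ?q ^ (j * j)"
      using finV finW W(3)[OF M] dimV(1) by (simp add: card_cartesian_product card_lists_in power_mult)
    finally have "card M \<le> ?q ^ (?r * (?r - j) + j * j)" by (simp add: power_add)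
    then have "card S \<le> n * ?q ^ (?r * (?r - j) + j * j)" using m(2) by simp
    moreover have "?r * ?r = j * (?r - j) + (?r * (?r - j) + j * j)"
      using j(2) by (intro nat_square_split) simp
    ultimately have "?q ^ (j * (?r - j)) * ?q ^ (?r * (?r - j) + j * j) \<le> n * ?q ^ (?r * (?r - j) + j * j)"
      using dimV(2) by (simp flip: power_add)
    then show ?thesis using q2 by simp
  qed
  let ?c = "\<Prod>i<j. ?q ^ j - ?q ^ i"
  have "card (reducible_max n j) * ?c \<le> card {xs. set xs \<subseteq> V \<and> length xs = j}"
  proof (rule card_disjoint_bound[where X = "\<lambda>M. {ws. length ws = j \<and> set ws \<subseteq> W M \<and> indep Z ws}"])
    show "finite {xs. set xs \<subseteq> V \<and> length xs = j}" using finV by (rule finite_lists_length_eq)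
    show "finite (reducible_max n j)" by (rule finite_subset[OF _ fin_M]) (auto simp: reducible_max_def)
    fix M assume M: "M \<in> reducible_max n j"
    show "{ws. length ws = j \<and> set ws \<subseteq> W M \<and> indep Z ws} \<subseteq> {xs. set xs \<subseteq> V \<and> length xs = j}"
      using W(1)[OF M] by auto
    show "?c \<le> card {ws. length ws = j \<and> set ws \<subseteq> W M \<and> indep Z ws}"
      using card_indep_lists[OF spW[OF M], of j] W(3)[OF M] by simp
    fix M' ws assume M': "M' \<in> reducible_max n j"
      and ws: "ws \<in> {ws. length ws = j \<and> set ws \<subseteq> W M \<and> indep Z ws}" "ws \<in> {ws. length ws = j \<and> set ws \<subseteq> W M' \<and> indep Z ws}"
    have "lspan Z ws = W M" "lspan Z ws = W M'"
      using indep_length_lspan[OF spW[OF M], of ws] indep_length_lspan[OF spW[OF M'], of ws] ws W(3)[OF M] W(3)[OF M'] by auto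
    then show "M = M'" using stab[OF M] stab[OF M'] by simp
  qed
  also have "\<dots> = ?q ^ (?r * j)" using finV dimV(1) by (simp add: card_lists_in power_mult)
  also have "\<dots> = ?q ^ (j * (?r - j)) * ?q ^ (j ^ 2)"
    using nat_square_split(2)[of j ?r] j(2) by (simp only: less_imp_le flip: power_add)
  finally have 1: "card (reducible_max n j) * ?c \<le> ?q ^ (j * (?r - j)) * ?q ^ (j ^ 2)" .
  have "card (reducible_max n j) * ?q ^ (j ^ 2) \<le> card (reducible_max n j) * (4 * ?c)"
    using card_bases_ge[OF q2] by (intro mult_left_mono) auto
  also have "\<dots> \<le> 4 * ?q ^ (j * (?r - j)) * ?q ^ (j ^ 2)" using 1 by simp
  finally have 2: "card (reducible_max n j) \<le> 4 * ?q ^ (j * (?r - j))" using q2 by simp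
  show "card (reducible_max n j) \<le> 4 * n"
  proof (cases "reducible_max n j = {}")
    case False
    then obtain M where "M \<in> reducible_max n j" by blast
    then show ?thesis using 2 idx by fastforce
  qed simp
  show "2 ^ (?r - 1) \<le> n" if ne: "reducible_max n j \<noteq> {}"
  proof -
    obtain M where M: "M \<in> reducible_max n j" using ne by blast
    have "?r - 1 \<le> j * (?r - j)" by (rule nat_square_split(3)) (use j in simp_all)
    then have "2 ^ (?r - 1) \<le> (2::nat) ^ (j * (?r - j))" by (intro power_increasing) auto
    also have "\<dots> \<le> ?q ^ (j * (?r - j))" using q2 by (intro power_mono) auto
    also have "\<dots> \<le> n" by (rule idx[OF M])
    finally show ?thesis .
  qed
qed

lemma simple_over_max:
  assumes M: "M \<in> \<M> n" "Z \<subseteq> M" and nr: "\<And>j. 0 < j \<Longrightarrow> j < dimV \<Longrightarrow> M \<notin> reducible_max n j"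
  shows "simple_mod M V"
  unfolding simple_mod_def
proof (intro conjI allI impI)
  note m = MD[OF M(1)]
  show "left_mod M V" by (rule left_modI[OF VM(1)]) (use VM(2) m(4) in blast)
  show "V \<noteq> {0}" by (rule VM(3))
  fix W assume W: "W \<subseteq> V" "left_mod M W"
  have "scalar_space e Z W"
  proof -
    have "left_mod Z W" using left_modD[OF W(2)] M(2) by (auto simp: left_mod_def)
    moreover have "e * v = v" if "v \<in> W" for v using that W(1) V_sub R(4) by blast
    ultimately show ?thesis using div_Z finite_subset[OF W(1) finV] by (simp add: scalar_space_def)
  qed
  then obtain ws where ws: "set ws \<subseteq> W" "indep Z ws" "lspan Z ws = W" by (rule exists_basis)
  have c: "card W = card Z ^ length ws" using card_lspan[OF \<open>scalar_space e Z W\<close> ws(1,2)] ws(3) by simp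
  have "card W \<le> card V" by (rule card_mono[OF finV W(1)])
  then have "length ws \<le> dimV" using c dimV(1) power_q_le by simp
  moreover have "\<not> (0 < length ws \<and> length ws < dimV)"
    using nr[of "length ws"] M W c by (auto simp: reducible_max_def)
  ultimately consider "ws = []" | "length ws = dimV" by fastforce
  then show "W = {0} \<or> W = V"
  proof cases
    case 2
    then show ?thesis using card_subset_eq[OF finV W(1)] c dimV(1) by simp
  qed (use ws in auto)
qed

text \<open>\<open>M\<close> contains \<open>Z\<close>, whose elements induce the right scalars
  \<open>F\<close> on \<open>V\<close>; so \<open>\<theta>\<close> is
  \<open>F\<close>-linear.\<close>

lemma commuting_endomorphism_is_mult:
  assumes M: "Z \<subseteq> M" "M \<subseteq> S" and th: "\<And>v. v \<in> V \<Longrightarrow> \<theta> v \<in> V" "\<And>u v. u \<in> V \<Longrightarrow> v \<in> V \<Longrightarrow> \<theta> (u - v) = \<theta> u - \<theta> v"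
    "\<And>m v. m \<in> M \<Longrightarrow> v \<in> V \<Longrightarrow> \<theta> (m * v) = m * \<theta> v"
  shows "\<exists>c\<in>centralizer S M. \<forall>v\<in>V. \<theta> v = c * v"
proof -
  define c where "c = sum_list (map (\<lambda>(a, b). \<theta> a * b) ps)"
  have c: "\<theta> v = c * v" if v: "v \<in> V" for v
    unfolding c_def
  proof (rule linear_is_mult[OF _ _ v])
    fix x y assume xy: "x \<in> V" "y \<in> V"
    have "\<theta> 0 = 0" using th(2)[OF xy(1,1)] by simp
    then have "\<theta> (- y) = - \<theta> y" using th(2)[of 0 y] addsub_zero[OF VM(1)] xy by simp
    then show "\<theta> (x + y) = \<theta> x + \<theta> y" using th(2)[of x "- y"] addsub_uminus[OF VM(1)] xy by simp
  next
    fix v x assume vx: "v \<in> V" "x \<in> F"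
    obtain z where z: "z \<in> Z" "\<And>v. v \<in> V \<Longrightarrow> z * v = v * x" using corner_from_center[OF vx(2)] by blast
    have "\<theta> (v * x) = \<theta> (z * v)" using z(2)[OF vx(1)] by simp
    also have "\<dots> = z * \<theta> v" using th(3) z(1) M(1) vx(1) by blast
    finally show "\<theta> (v * x) = \<theta> v * x" using z(2)[OF th(1)[OF vx(1)]] by simp
  qed
  have cS: "c \<in> S" unfolding c_def
  proof (rule sum_list_in_S)
    fix a b assume "(a, b) \<in> set ps"
    then have "a \<in> V" "b \<in> S" using ps by blast+
    then show "\<theta> a * b \<in> S" using th(1) V_sub R(2) by blast
  qed
  have "c \<in> centralizer S M"
  proof (rule centralizerI[OF cS])
    fix m assume m: "m \<in> M"
    show "c * m = m * c"
    proof (rule eq_on_V)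
      fix v assume v: "v \<in> V"
      have "m * v \<in> V" using VM(2) m M(2) v by blast
      then show "c * m * v = m * c * v" using c[of "m * v"] c[OF v] th(3)[OF m v] by (simp add: mult.assoc)
    qed (use R(2) cS m M(2) in blast)+
  qed
  then show ?thesis using c by blast
qed

text \<open>If only \<open>Z\<close> commuted with \<open>M\<close>, density would give
  \<open>M\<close> as many elements as \<open>S\<close>.\<close>

lemma centralizer_nontrivial:
  assumes M: "M \<in> \<M> n" "Z \<subseteq> M" and simp: "simple_mod M V"
  shows "\<exists>c\<in>centralizer S M. c \<notin> Z"
proof (rule ccontr)
  assume n: "\<not> ?thesis"
  note m = MD[OF M(1)]
  interpret D: dense_action e M Z V
  proof
    show "ring_on e M" "finite M" "simple_mod M V" "scalar_space e Z V" using m simp scalar_space_V by auto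
    show "m * (z * v) = z * (m * v)" if "m \<in> M" "z \<in> Z" "v \<in> V" for m z v
      using action.comm that m(4) by blast
    show "\<exists>z\<in>Z. \<forall>v\<in>V. \<theta> v = z * v"
      if "\<And>v. v \<in> V \<Longrightarrow> \<theta> v \<in> V" "\<And>u v. u \<in> V \<Longrightarrow> v \<in> V \<Longrightarrow> \<theta> (u - v) = \<theta> u - \<theta> v"
        "\<And>m v. m \<in> M \<Longrightarrow> v \<in> V \<Longrightarrow> \<theta> (m * v) = m * \<theta> v" for \<theta>
      using commuting_endomorphism_is_mult[OF M(2) m(4) that] n by blast
  qed
  obtain ws where ws: "set ws \<subseteq> V" "indep Z ws" "lspan Z ws = V" by (rule exists_basis[OF scalar_space_V])
  have "card M = card V ^ length ws"
    by (rule D.card_acting_faithful[OF ws]) (use faithful m(4) in blast)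
  then have "card M = card S" using card_S(1)[OF ws] by simp
  then show False using card_subset_eq[OF fin m(4)] m(5) by simp
qed

end

section \<open>Maximal subrings containing the centre: centralizers of subfields\<close>

context simple_frame
begin

text \<open>The degree of the minimal polynomial of \<open>c\<close> over \<open>Z\<close>.\<close>

definition deg :: "'r \<Rightarrow> nat" where
  "deg c = (LEAST l. pow_on e c l \<in> lspan Z (pow_list e c l))"

definition field_elem :: "'r \<Rightarrow> bool" where
  "field_elem c \<longleftrightarrow> c \<in> S \<and> div_ring_on e (lspan Z (pow_list e c (deg c)))"

lemma scalar_space_S: "scalar_space e Z S"
  unfolding scalar_space_def left_mod_def
  using div_Z R Z_sub fin by (meson subsetD)

lemma pow_on_S: "c \<in> S \<Longrightarrow> pow_on e c l \<in> S"
  by (induction l) (use R in auto)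

lemma pow_list_S: "c \<in> S \<Longrightarrow> set (pow_list e c l) \<subseteq> S"
  using pow_on_S by (auto simp: set_pow_list)

text \<open>If the first \<open>k + 1\<close> powers were independent, they would span
  \<open>card Z ^ Suc k\<close> elements inside \<open>E\<close>.\<close>

lemma deg_exists:
  assumes c: "c \<in> S" and E: "set (pow_list e c (Suc k)) \<subseteq> E" "finite E" "card E \<le> card Z ^ k"
    "\<And>l. lspan Z (pow_list e c (Suc k)) \<subseteq> E"
  shows "\<exists>l\<le>k. pow_on e c l \<in> lspan Z (pow_list e c l)"
proof (rule ccontr)
  assume n: "\<not> ?thesis"
  have "indep Z (pow_list e c l)" if "l \<le> Suc k" for l using that n by (induction l) auto
  from card_lspan[OF scalar_space_S pow_list_S[OF c] this[of "Suc k"]]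
  have "card (lspan Z (pow_list e c (Suc k))) = card Z ^ Suc k" by (simp only: length_pow_list)
  moreover have "card (lspan Z (pow_list e c (Suc k))) \<le> card E" by (rule card_mono[OF E(2,4)])
  ultimately have "card Z ^ Suc k \<le> card Z ^ k" using E(3) by linarith
  then have "Suc k \<le> k" unfolding power_q_le .
  then show False by simp
qed

lemma deg_props:
  assumes c: "c \<in> S"
  shows "pow_on e c (deg c) \<in> lspan Z (pow_list e c (deg c))" "indep Z (pow_list e c (deg c))"
    "card (lspan Z (pow_list e c (deg c))) = card Z ^ deg c" "deg c > 0"
proof -
  have "card S \<le> card Z ^ (dimV * dimV)" using dimV(2) by simp
  from deg_exists[OF c pow_list_S[OF c] fin this lspan_closed(3)[OF scalar_space_S pow_list_S[OF c]]]
  have "\<exists>l. pow_on e c l \<in> lspan Z (pow_list e c l)" by (elim exE conjE) (rule exI)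
  then show 1: "pow_on e c (deg c) \<in> lspan Z (pow_list e c (deg c))" unfolding deg_def by (rule LeastI_ex)
  have n: "pow_on e c i \<notin> lspan Z (pow_list e c i)" if "i < deg c" for i
    using not_less_Least that unfolding deg_def by blast
  have "indep Z (pow_list e c l)" if "l \<le> deg c" for l using that n by (induction l) auto
  then show ind: "indep Z (pow_list e c (deg c))" by simp
  show "card (lspan Z (pow_list e c (deg c))) = card Z ^ deg c"
    using card_lspan[OF scalar_space_S pow_list_S[OF c] ind] by simp
  show "deg c > 0" using 1 e_nz by (cases "deg c") auto
qed

lemma pow_list_0_in: "l > 0 \<Longrightarrow> e \<in> set (pow_list e c l)"
  by (auto simp: set_pow_list image_iff intro!: bexI[of _ 0])

lemma Z_in_lspan:
  assumes "c \<in> S" "l > 0"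
  shows "Z \<subseteq> lspan Z (pow_list e c l)"
proof
  fix z assume z: "z \<in> Z"
  have "e \<in> lspan Z (pow_list e c l)"
    using set_subset_lspan[OF scalar_space_S pow_list_S[OF assms(1)]] pow_list_0_in[OF assms(2)] by blast
  then have "z * e \<in> lspan Z (pow_list e c l)"
    by (rule lspan_closed(2)[OF scalar_space_S pow_list_S[OF assms(1)] z])
  then show "z \<in> lspan Z (pow_list e c l)" using R(5) z Z_sub by auto
qed

lemma deg_ge_2:
  assumes "c \<in> S" "c \<notin> Z"
  shows "deg c \<ge> 2"
proof (rule ccontr)
  assume "\<not> ?thesis"
  then have "deg c = 1" using deg_props(4)[OF assms(1)] by simp
  then have "c * e \<in> lspan Z [e]" using deg_props(1)[OF assms(1)] by simp
  then obtain z where "z \<in> Z" "c * e = z * e" by auto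
  then show False using assms R(5) Z_sub by (metis subsetD)
qed

text \<open>\<open>lspan Z (pow_list e c (deg c))\<close> is the ring \<open>Z[c]\<close>.\<close>

lemma adjoin_closed:
  assumes c: "c \<in> S"
  defines "E \<equiv> lspan Z (pow_list e c (deg c))"
  shows "x \<in> E \<Longrightarrow> c * x \<in> E" "x \<in> E \<Longrightarrow> pow_on e c i * x \<in> E" "x \<in> E \<Longrightarrow> y \<in> E \<Longrightarrow> x * y \<in> E"
    "ring_on e E" "E \<subseteq> S" "c \<in> E" "pow_on e c i \<in> E"
    "\<And>M x. (\<And>m. m \<in> M \<Longrightarrow> c * m = m * c) \<Longrightarrow> M \<subseteq> S \<Longrightarrow> x \<in> E \<Longrightarrow> m \<in> M \<Longrightarrow> x * m = m * x"
proof -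
  note L = lspan_closed[OF scalar_space_S pow_list_S[OF c, of "deg c"], folded E_def]
  have P: "pow_on e c i \<in> E" if "i < deg c" for i
    using set_subset_lspan[OF scalar_space_S pow_list_S[OF c, of "deg c"]] that
    unfolding E_def set_pow_list by blast
  have c1: "c * x \<in> E" if x: "x \<in> E" for x
  proof -
    have "E \<subseteq> {x \<in> S. c * x \<in> E}"
      unfolding E_def
    proof (rule lspan_least)
      show "addsub {x \<in> S. c * x \<in> lspan Z (pow_list e c (deg c))}"
      proof (rule addsubI)
        show "0 \<in> {x \<in> S. c * x \<in> lspan Z (pow_list e c (deg c))}"
          using addsub_zero[OF R(1)] addsub_zero[OF L(1)] by (simp add: E_def)
        fix x y assume "x \<in> {x \<in> S. c * x \<in> lspan Z (pow_list e c (deg c))}"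
          "y \<in> {x \<in> S. c * x \<in> lspan Z (pow_list e c (deg c))}"
        then show "x - y \<in> {x \<in> S. c * x \<in> lspan Z (pow_list e c (deg c))}"
          using addsub_diff[OF R(1)] addsub_diff[OF L(1)] by (simp add: right_diff_distrib E_def)
      qed
      fix z v assume z: "z \<in> Z" and "v \<in> set (pow_list e c (deg c))"
      then obtain i where i: "i < deg c" "v = pow_on e c i" by (auto simp: set_pow_list)
      have "c * (z * v) = z * pow_on e c (Suc i)"
        using center_comm[OF z c] by (simp add: i flip: mult.assoc)
      moreover have "pow_on e c (Suc i) \<in> E"
        using P[of "Suc i"] deg_props(1)[OF c] i(1) unfolding E_def by (cases "Suc i = deg c") auto
      moreover have "z * v \<in> S" using R(2) z Z_sub pow_on_S[OF c] i(2) by blast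
      ultimately show "z * v \<in> {x \<in> S. c * x \<in> lspan Z (pow_list e c (deg c))}" using L(2)[OF z] by (simp add: E_def)
    qed
    then show ?thesis using x by blast
  qed
  then show "x \<in> E \<Longrightarrow> c * x \<in> E" .
  have ES: "E \<subseteq> S" by (rule L(3))
  have ci: "pow_on e c i * x \<in> E" if x: "x \<in> E" for x i
    by (induction i) (use c1 x ES R(4) in \<open>auto simp: mult.assoc\<close>)
  then show "x \<in> E \<Longrightarrow> pow_on e c i * x \<in> E" .
  have xy: "x * y \<in> E" if xy: "x \<in> E" "y \<in> E" for x y
  proof -
    have "E \<subseteq> {x \<in> S. x * y \<in> E}"
      unfolding E_def
    proof (rule lspan_least)
      show "addsub {x \<in> S. x * y \<in> lspan Z (pow_list e c (deg c))}"
      proof (rule addsubI)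
        show "0 \<in> {x \<in> S. x * y \<in> lspan Z (pow_list e c (deg c))}"
          using addsub_zero[OF R(1)] addsub_zero[OF L(1)] by (simp add: E_def)
        fix x x' assume "x \<in> {x \<in> S. x * y \<in> lspan Z (pow_list e c (deg c))}"
          "x' \<in> {x \<in> S. x * y \<in> lspan Z (pow_list e c (deg c))}"
        then show "x - x' \<in> {x \<in> S. x * y \<in> lspan Z (pow_list e c (deg c))}"
          using addsub_diff[OF R(1)] addsub_diff[OF L(1)] by (simp add: left_diff_distrib E_def)
      qed
      fix z v assume z: "z \<in> Z" and "v \<in> set (pow_list e c (deg c))"
      then obtain i where i: "i < deg c" "v = pow_on e c i" by (auto simp: set_pow_list)
      have "z * v * y \<in> E" using L(2)[OF z ci[OF xy(2), of i]] i(2) by (simp add: mult.assoc)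
      moreover have "z * v \<in> S" using R(2) z Z_sub pow_on_S[OF c] i(2) by blast
      ultimately show "z * v \<in> {x \<in> S. x * y \<in> lspan Z (pow_list e c (deg c))}" by (simp add: E_def)
    qed
    then show ?thesis using xy by blast
  qed
  then show "x \<in> E \<Longrightarrow> y \<in> E \<Longrightarrow> x * y \<in> E" .
  have eE: "e \<in> E" using P[of 0] deg_props(4)[OF c] by simp
  show "ring_on e E" unfolding ring_on_def using L(1) xy eE ES R(4,5) by blast
  show "E \<subseteq> S" by (rule ES)
  show "c \<in> E" using c1[OF eE] R(5)[OF c] by simp
  show "pow_on e c i \<in> E" using ci[OF eE, of i] R(5)[OF pow_on_S[OF c]] by simp
  fix M x m assume M: "\<And>m. m \<in> M \<Longrightarrow> c * m = m * c" "M \<subseteq> S" "x \<in> E" "m \<in> M"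
  have "E \<subseteq> centralizer S {m}"
    unfolding E_def
  proof (rule lspan_least)
    have rc: "ring_on e (centralizer S {m})" by (rule ring_centralizer[OF ring]) (use M in blast)
    note RC = ring_onD[OF rc]
    show "addsub (centralizer S {m})" by (rule RC(1))
    fix z v assume z: "z \<in> Z" and "v \<in> set (pow_list e c (deg c))"
    then obtain i where i: "i < deg c" "v = pow_on e c i" by (auto simp: set_pow_list)
    have cc: "c \<in> centralizer S {m}" using c M(1)[OF M(4)] by (auto simp: centralizer_def)
    have "pow_on e c i \<in> centralizer S {m}" by (induction i) (use RC cc in auto)
    moreover have "z \<in> centralizer S {m}"
      by (rule centralizerI) (use z Z_sub center_comm M in blast)+
    ultimately show "z * v \<in> centralizer S {m}" using RC(2) i(2) by blast
  qed
  then show "x * m = m * x" using M(3) centralizerD by blast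
qed

definition irreducible_max :: "nat \<Rightarrow> 'r set set" where
  "irreducible_max n = {M \<in> \<M> n. Z \<subseteq> M \<and> simple_mod M V}"

text \<open>By Schur's lemma a nonzero element commuting with \<open>M\<close> is injective on
  \<open>V\<close>, so the ring \<open>Z[c]\<close> has no zero divisors. The centralizer of
  \<open>c\<close> contains \<open>M\<close> and differs from \<open>S\<close> as \<open>c\<close>
  is not central, hence it is \<open>M\<close>.\<close>

lemma irreducible_props:
  assumes M: "M \<in> irreducible_max n" and c: "c \<in> centralizer S M" "c \<notin> Z"
  shows "field_elem c" "centralizer S {c} = M" "lspan Z (pow_list e c (deg c)) \<subseteq> centralizer S M"
proof -
  have M': "M \<in> \<M> n" "Z \<subseteq> M" "simple_mod M V" using M by (auto simp: irreducible_max_def)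
  note m = MD[OF M'(1)]
  have cS: "c \<in> S" using c centralizer_sub by blast
  have cM: "c * x = x * c" if "x \<in> M" for x using centralizerD[OF c(1) that] .
  let ?E = "lspan Z (pow_list e c (deg c))"
  note A = adjoin_closed[OF cS]
  show sub: "?E \<subseteq> centralizer S M"
  proof
    fix x assume x: "x \<in> ?E"
    then show "x \<in> centralizer S M"
      by (intro centralizerI) (use A(5) A(8)[OF cM m(4) x] in blast)+
  qed
  have "div_ring_on e ?E"
  proof (rule finite_domain_div_ring_on[OF A(4) finite_subset[OF A(5) fin] e_nz])
    fix x y assume xy: "x \<in> ?E" "y \<in> ?E" "x * y = 0"
    have "x = 0" if y0: "y \<noteq> 0"
    proof -
      have yS: "y \<in> S" and xS: "x \<in> S" using xy A(5) by auto
      have xc: "x * m = m * x" if "m \<in> M" for m using A(8)[OF cM m(4) xy(1) that] .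
      obtain v where v: "v \<in> V" "y * v \<noteq> 0" using faithful[OF yS] y0 by blast
      have "{v \<in> V. x * v = 0} = V"
      proof (rule simple_modD(4)[OF M'(3), of _ "y * v"])
        show "left_mod M {v \<in> V. x * v = 0}"
        proof (rule left_modI)
          show "addsub {v \<in> V. x * v = 0}" by (rule addsub_kernel[OF VM(1)]) (simp add: right_diff_distrib)
          fix s v assume s: "s \<in> M" and v: "v \<in> {v \<in> V. x * v = 0}"
          have "x * (s * v) = s * (x * v)" using xc[OF s] by (simp flip: mult.assoc)
          moreover have "s * v \<in> V" using VM(2) s m(4) v by blast
          ultimately show "s * v \<in> {v \<in> V. x * v = 0}" using v by simp
        qed
        show "y * v \<in> {v \<in> V. x * v = 0}" using xy(3) VM(2)[OF yS v(1)] by (simp flip: mult.assoc)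
      qed (use v in auto)
      then show ?thesis using faithful[OF xS] by blast
    qed
    then show "x = 0 \<or> y = 0" by blast
  qed
  then show "field_elem c" using cS by (simp add: field_elem_def)
  show "centralizer S {c} = M"
  proof (rule max_subringD(5)[OF m(1)])
    show "ring_on e (centralizer S {c})" by (rule ring_centralizer[OF ring]) (use cS in blast)
    show "M \<subseteq> centralizer S {c}"
    proof
      fix x assume x: "x \<in> M"
      then show "x \<in> centralizer S {c}" by (intro centralizerI) (use m(4) cM[OF x] in auto)
    qed
    show "centralizer S {c} \<noteq> S"
    proof
      assume *: "centralizer S {c} = S"
      have "c \<in> Z"
      proof (rule Z_intro[OF cS])
        fix s assume "s \<in> S"
        then have "s \<in> centralizer S {c}" using * by simp
        then have "s * c = c * s" using centralizerD by blast
        then show "c * s = s * c" by simp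
      qed
      then show False using c by simp
    qed
  qed (rule centralizer_sub)
qed

text \<open>The irreducible \<open>M\<close> are sorted by the least degree of a noncentral element
  commuting with them; this minimality takes over the role of a prime degree.\<close>

definition degM :: "nat \<Rightarrow> nat \<Rightarrow> 'r set set" where
  "degM n l = {M \<in> irreducible_max n. l = (LEAST l. \<exists>c\<in>centralizer S M. c \<notin> Z \<and> deg c = l)}"

text \<open>For \<open>c\<close> of least degree, an \<open>x\<close> in \<open>Z[c]\<close> outside
  \<open>Z\<close> has degree at most \<open>l\<close> because its powers stay in
  \<open>Z[c]\<close>, and at least \<open>l\<close> by minimality. So \<open>M\<close> owns all
  \<open>q ^ l - q\<close> such elements.\<close>

lemma degM_props:
  assumes M: "M \<in> degM n l"
  shows "\<exists>E. Z \<subseteq> E \<and> card E = card Z ^ l \<and> finite E \<and> l \<ge> 2 \<and>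
    (\<forall>x\<in>E - Z. field_elem x \<and> centralizer S {x} = M \<and> deg x = l)"
proof -
  have Mi: "M \<in> irreducible_max n" and l: "l = (LEAST l. \<exists>c\<in>centralizer S M. c \<notin> Z \<and> deg c = l)"
    using M by (auto simp: degM_def)
  have "\<exists>c\<in>centralizer S M. c \<notin> Z" using Mi centralizer_nontrivial by (auto simp: irreducible_max_def)
  then have "\<exists>l. \<exists>c\<in>centralizer S M. c \<notin> Z \<and> deg c = l" by blast
  from LeastI_ex[OF this] obtain c where c: "c \<in> centralizer S M" "c \<notin> Z" "deg c = l"
    unfolding l by blast
  have min: "l \<le> deg x" if "x \<in> centralizer S M" "x \<notin> Z" for x
    unfolding l by (rule Least_le) (use that in blast)
  have cS: "c \<in> S" using c centralizer_sub by blast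
  let ?E = "lspan Z (pow_list e c (deg c))"
  note A = adjoin_closed[OF cS] and I = irreducible_props[OF Mi c(1,2)]
  have cE: "card ?E = card Z ^ l" using deg_props(3)[OF cS] c(3) by simp
  show ?thesis
  proof (intro exI[of _ ?E] conjI ballI)
    show "Z \<subseteq> ?E" by (rule Z_in_lspan[OF cS deg_props(4)[OF cS]])
    show "card ?E = card Z ^ l" by (rule cE)
    show "finite ?E" by (rule finite_subset[OF A(5) fin])
    show "l \<ge> 2" using deg_ge_2[OF cS c(2)] c(3) by simp
    fix x assume x: "x \<in> ?E - Z"
    then have xc: "x \<in> centralizer S M" "x \<notin> Z" using I(3) by auto
    have xS: "x \<in> S" using xc centralizer_sub by blast
    have pE: "pow_on e x i \<in> ?E" for i
      by (induction i) (use ring_onD(3)[OF A(4)] A(3) x in auto)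
    have "\<exists>k\<le>l. pow_on e x k \<in> lspan Z (pow_list e x k)"
    proof (rule deg_exists[OF xS])
      show "set (pow_list e x (Suc l)) \<subseteq> ?E" using pE by (auto simp: set_pow_list)
      show "finite ?E" by (rule finite_subset[OF A(5) fin])
      show "card ?E \<le> card Z ^ l" using cE by simp
      show "lspan Z (pow_list e x (Suc l)) \<subseteq> ?E"
      proof (rule lspan_least)
        show "addsub ?E" by (rule ring_onD(1)[OF A(4)])
        show "z * v \<in> ?E" if "z \<in> Z" "v \<in> set (pow_list e x (Suc l))" for z v
          using lspan_closed(2)[OF scalar_space_S pow_list_S[OF cS] that(1)] pE that(2)
          by (auto simp: set_pow_list)
      qed
    qed
    then obtain k where k: "k \<le> l" "pow_on e x k \<in> lspan Z (pow_list e x k)" by blast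
    have "deg x \<le> k" unfolding deg_def by (rule Least_le) (rule k(2))
    then have "deg x = l" using min[OF xc] k(1) by simp
    then show "field_elem x" "centralizer S {x} = M" "deg x = l" using irreducible_props[OF Mi xc] by simp_all
  qed
qed

text \<open>Let \<open>C\<close> consist of the field elements of degree \<open>l\<close> owned by
  these \<open>M\<close>. An element \<open>c\<close> is determined by its minimal polynomial and a
  table of the vectors \<open>c ^ i * u\<close> for \<open>i < l\<close> and \<open>u\<close> in a
  basis of \<open>V\<close> over \<open>Z[c]\<close>, which has \<open>s = r / l\<close> members.
  There are \<open>q ^ (r * r + l)\<close> conceivable tables, each \<open>c\<close> has at least
  \<open>q ^ (r * s) / 4\<close>, and the index satisfies
  \<open>q ^ (r * r) \<le> n * q ^ (r * s)\<close>. So \<open>C\<close> has at most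
  \<open>4 * n * q ^ l\<close> elements, of which each \<open>M\<close> owns at least
  \<open>q ^ l / 2\<close>.\<close>

lemma degM_count:
  shows "card (degM n l) \<le> 8 * n" "degM n l \<noteq> {} \<Longrightarrow> l \<in> {2..dimV} \<and> 2 ^ (dimV - 1) \<le> n"
proof -
  let ?q = "card Z" and ?r = dimV
  define C where "C = {c. field_elem c \<and> centralizer S {c} \<in> degM n l \<and> deg c = l}"
  have CS: "C \<subseteq> S" by (auto simp: C_def field_elem_def)
  have *: "card (degM n l) \<le> 8 * n \<and> l \<in> {2..?r} \<and> 2 ^ (?r - 1) \<le> n" if ne: "degM n l \<noteq> {}"
  proof -
    obtain M0 where M0: "M0 \<in> degM n l" using ne by blast
    have l2: "l \<ge> 2" using degM_props[OF M0] by (elim exE conjE)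
    have M0': "M0 \<in> \<M> n" using M0 by (auto simp: degM_def irreducible_max_def)
    have sub: "card (degM n l) * (?q ^ l - ?q) \<le> card C"
    proof (rule card_disjoint_bound[where X = "\<lambda>M. {x \<in> C. centralizer S {x} = M}"])
      show "finite C" by (rule finite_subset[OF CS fin])
      show "finite (degM n l)" by (rule finite_subset[OF _ fin_M]) (auto simp: degM_def irreducible_max_def)
      fix M assume M: "M \<in> degM n l"
      obtain E where E: "Z \<subseteq> E" "card E = card Z ^ l" "finite E" "l \<ge> 2"
        "\<forall>x\<in>E - Z. field_elem x \<and> centralizer S {x} = M \<and> deg x = l"
        using degM_props[OF M] by (elim exE conjE)
      have "?q ^ l - ?q = card (E - Z)" using E(1-3) by (simp add: card_Diff_subset finite_subset)
      also have "\<dots> \<le> card {x \<in> C. centralizer S {x} = M}"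
      proof (rule card_mono)
        show "finite {x \<in> C. centralizer S {x} = M}" using finite_subset[OF CS fin] by simp
        show "E - Z \<subseteq> {x \<in> C. centralizer S {x} = M}" using E(5) M by (auto simp: C_def)
      qed
      finally show "?q ^ l - ?q \<le> card {x \<in> C. centralizer S {x} = M}" .
    qed auto
    define E where "E c = lspan Z (pow_list e c l)" for c
    have spE: "scalar_space e (E c) V" if c: "c \<in> C" for c
    proof -
      have cS: "c \<in> S" and d: "deg c = l" and fe: "div_ring_on e (E c)"
        using c by (auto simp: C_def field_elem_def E_def)
      have "left_mod (E c) V"
        by (rule left_modI[OF VM(1)]) (use VM(2) adjoin_closed(5)[OF cS] d in \<open>auto simp: E_def\<close>)
      moreover have "e * v = v" if "v \<in> V" for v using R(4) that V_sub by blast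
      ultimately show ?thesis using fe finV by (simp add: scalar_space_def)
    qed
    have cardE: "card (E c) = ?q ^ l" if "c \<in> C" for c
      using deg_props(3)[of c] that by (auto simp: C_def field_elem_def E_def)
    obtain c0 where c0: "c0 \<in> C" "centralizer S {c0} = M0"
    proof -
      obtain E where E: "Z \<subseteq> E" "card E = card Z ^ l" "finite E" "l \<ge> 2"
        "\<forall>x\<in>E - Z. field_elem x \<and> centralizer S {x} = M0 \<and> deg x = l"
        using degM_props[OF M0] by (elim exE conjE)
      have "E \<noteq> Z" using E(2) power_q_inj[of l 1] l2 by auto
      then obtain x where "x \<in> E - Z" using E(1) by blast
      then show ?thesis using that[of x] E(5) M0 by (auto simp: C_def)
    qed
    obtain us0 where us0: "set us0 \<subseteq> V" "indep (E c0) us0" "lspan (E c0) us0 = V"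
      by (rule exists_basis[OF spE[OF c0(1)]])
    define s where "s = length us0"
    have cV: "card V = (?q ^ l) ^ s"
      using card_lspan[OF spE[OF c0(1)] us0(1,2)] us0(3) cardE[OF c0(1)] by (simp add: s_def)
    have rs: "?r = l * s" using cV dimV(1) power_q_inj by (simp flip: power_mult)
    have s0: "s > 0" using rs dimV_pos by (cases s) auto
    have c0S: "c0 \<in> S" using c0(1) CS by blast
    \<comment> \<open>\<open>M0\<close> commutes with \<open>Z[c0]\<close>, so its elements are
      determined by their values on the \<open>s\<close> basis vectors over
      \<open>Z[c0]\<close>.\<close>
    have cardM: "card M0 \<le> ?q ^ (?r * s)"
    proof -
      have "inj_on (\<lambda>m. map ((*) m) us0) M0"
      proof (rule inj_onI)
        fix x y assume xy: "x \<in> M0" "y \<in> M0" "map ((*) x) us0 = map ((*) y) us0"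
        have M0S: "M0 \<subseteq> S" by (rule MD(4)[OF M0'])
        have d: "x - y \<in> M0" by (rule addsub_diff[OF ring_onD(1)[OF MD(3)[OF M0']] xy(1,2)])
        have "lspan (E c0) us0 \<subseteq> {v \<in> V. (x - y) * v = 0}"
        proof (rule lspan_least)
          show "addsub {v \<in> V. (x - y) * v = 0}" by (rule addsub_kernel[OF VM(1)]) (simp add: right_diff_distrib)
          fix z u assume zu: "z \<in> E c0" "u \<in> set us0"
          have "z * (x - y) = (x - y) * z"
          proof (rule adjoin_closed(8)[OF c0S, of M0])
            show "c0 * m = m * c0" if "m \<in> M0" for m
            proof -
              have "m \<in> centralizer S {c0}" using that c0(2) by simp
              then show ?thesis using centralizerD by fastforce
            qed
            show "z \<in> lspan Z (pow_list e c0 (deg c0))" using zu(1) c0(1) by (simp add: E_def C_def)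
          qed (use d M0S in blast)+
          then have "(x - y) * (z * u) = z * ((x - y) * u)" by (simp flip: mult.assoc)
          also have "(x - y) * u = 0" using xy(3) zu(2) by (simp add: left_diff_distrib)
          finally have "(x - y) * (z * u) = 0" by simp
          moreover have "z * u \<in> V" using spD(3)[OF spE[OF c0(1)]] zu us0(1) by blast
          ultimately show "z * u \<in> {v \<in> V. (x - y) * v = 0}" by simp
        qed
        then have "(x - y) * v = 0" if "v \<in> V" for v using that us0(3) by blast
        then have "x - y = 0" using faithful d M0S by blast
        then show "x = y" by simp
      qed
      moreover have "(\<lambda>m. map ((*) m) us0) ` M0 \<subseteq> {xs. set xs \<subseteq> V \<and> length xs = s}"
      proof -
        have "x * u \<in> V" if "x \<in> M0" "u \<in> set us0" for x u using that VM(2) MD(4)[OF M0'] us0(1) by blast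
        then show ?thesis by (auto simp: s_def)
      qed
      moreover have "finite {xs. set xs \<subseteq> V \<and> length xs = s}" using finV by (rule finite_lists_length_eq)
      ultimately have "card M0 \<le> card {xs. set xs \<subseteq> V \<and> length xs = s}" by (rule card_inj_on_le)
      also have "\<dots> = ?q ^ (?r * s)" using finV dimV(1) by (simp add: card_lists_in power_mult)
      finally show ?thesis .
    qed
    have n_ge: "?q ^ (?r * ?r) \<le> n * ?q ^ (?r * s)"
      using MD(2)[OF M0'] cardM dimV(2) by (metis mult_le_mono2)
    let ?c = "\<Prod>i<s. (?q ^ l) ^ s - (?q ^ l) ^ i"
    let ?Y = "{T. set T \<subseteq> {xs. set xs \<subseteq> V \<and> length xs = s} \<and> length T = l} \<times> {zs. set zs \<subseteq> Z \<and> length zs = l}"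
    define coef where "coef c = (SOME zs. length zs = l \<and> set zs \<subseteq> Z \<and> pow_on e c l = lin_comb zs (pow_list e c l))" for c
    have coef: "length (coef c) = l" "set (coef c) \<subseteq> Z" "pow_on e c l = lin_comb (coef c) (pow_list e c l)" if c: "c \<in> C" for c
    proof -
      have "\<exists>zs. length zs = l \<and> set zs \<subseteq> Z \<and> pow_on e c l = lin_comb zs (pow_list e c l)"
        using lspan_lin_comb[OF deg_props(1)[of c]] c by (auto simp: C_def field_elem_def)
      from someI_ex[OF this] show "length (coef c) = l" "set (coef c) \<subseteq> Z"
        "pow_on e c l = lin_comb (coef c) (pow_list e c l)" unfolding coef_def by auto
    qed
    \<comment> \<open>Row \<open>i\<close> lists the vectors \<open>c ^ i * u\<close>. Row
      \<open>0\<close> is the basis itself, since \<open>e\<close> acts as the identity, so the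
      table also remembers \<open>us\<close>.\<close>
    define tab where "tab c us = (map (\<lambda>i. map ((*) (pow_on e c i)) us) [0..<l], coef c)" for c us
    define X where "X c = tab c ` {us. length us = s \<and> set us \<subseteq> V \<and> indep (E c) us}" for c
    have finY: "finite ?Y"
      using finV finZ by (intro finite_cartesian_product finite_lists_length_eq) auto
    have tabD: "us = us' \<and> (\<forall>i<l. \<forall>u\<in>set us. pow_on e c i * u = pow_on e c' i * u) \<and> coef c = coef c'"
      if t: "tab c us = tab c' us'" and us: "set us \<subseteq> V" "set us' \<subseteq> V" for c c' us us'
    proof -
      have i: "map ((*) (pow_on e c i)) us = map ((*) (pow_on e c' i)) us'" if "i < l" for i
        using t that by (auto simp: tab_def)
      have "map ((*) e) us = us" "map ((*) e) us' = us'"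
        using us V_sub R(4) by (auto intro!: map_idI)
      then have "us = us'" using i[of 0] l2 by simp
      then show ?thesis using i t by (auto simp: tab_def)
    qed
    have "card C * ?c \<le> card ?Y"
    proof (rule card_disjoint_bound[where X = X, OF finY])
      fix c assume c: "c \<in> C"
      have cS: "c \<in> S" using c CS by blast
      show "X c \<subseteq> ?Y"
      proof -
        have "pow_on e c i * u \<in> V" if "u \<in> V" for i u using that VM(2) pow_on_S[OF cS] by blast
        then show ?thesis using coef[OF c] by (auto simp: X_def tab_def subset_eq)
      qed
      have "inj_on (tab c) {us. length us = s \<and> set us \<subseteq> V \<and> indep (E c) us}"
        by (rule inj_onI) (use tabD in blast)
      then have "card (X c) = card {us. length us = s \<and> set us \<subseteq> V \<and> indep (E c) us}"
        unfolding X_def by (rule card_image)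
      also have "\<dots> = ?c" using card_indep_lists[OF spE[OF c], of s] cV cardE[OF c] by simp
      finally show "?c \<le> card (X c)" by simp
      fix c' x assume c': "c' \<in> C" and x: "x \<in> X c" "x \<in> X c'"
      obtain us where us: "length us = s" "set us \<subseteq> V" "indep (E c) us" "x = tab c us" using x(1) by (auto simp: X_def)
      obtain us' where us': "set us' \<subseteq> V" "x = tab c' us'" using x(2) by (auto simp: X_def)
      have T: "pow_on e c i * u = pow_on e c' i * u" if "i < l" "u \<in> set us" for i u
        using tabD[of c us c' us'] us us' that by blast
      have co: "coef c = coef c'" using tabD[of c us c' us'] us us' by blast
      have c'S: "c' \<in> S" using c' CS by blast
      \<comment> \<open>The row for \<open>c ^ l\<close> is missing from the table and is recovered
        from the coefficients of the minimal polynomial. With it, multiplication by \<open>c\<close>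
        is known on the whole span.\<close>
      have Tl: "pow_on e c l * u = pow_on e c' l * u" if u: "u \<in> set us" for u
      proof -
        have "map (\<lambda>w. w * u) (pow_list e c k) = map (\<lambda>w. w * u) (pow_list e c' k)" if "k \<le> l" for k
          using that by (induction k) (auto simp: T[OF _ u])
        then show ?thesis using coef(3)[OF c] coef(3)[OF c'] co by (simp add: lin_comb_mult)
      qed
      show "c = c'"
      proof (rule eq_on_V[OF cS c'S])
        let ?W = "{v \<in> V. (c - c') * v = 0}"
        have W: "addsub ?W" by (rule addsub_kernel[OF VM(1)]) (simp add: right_diff_distrib)
        have "lspan (E c) us \<subseteq> ?W"
        proof (rule lspan_least[OF W])
          fix x u assume x: "x \<in> E c" and u: "u \<in> set us"
          have uV: "u \<in> V" using u us by blast
          have "E c \<subseteq> {x \<in> S. x * u \<in> ?W}"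
            unfolding E_def
          proof (rule lspan_least)
            show "addsub {x \<in> S. x * u \<in> ?W}"
            proof (rule addsubI)
              show "0 \<in> {x \<in> S. x * u \<in> ?W}" using addsub_zero[OF R(1)] addsub_zero[OF W] by simp
              fix x y assume "x \<in> {x \<in> S. x * u \<in> ?W}" "y \<in> {x \<in> S. x * u \<in> ?W}"
              then show "x - y \<in> {x \<in> S. x * u \<in> ?W}"
                using addsub_diff[OF R(1)] addsub_diff[OF W, of "x * u" "y * u"] by (simp add: left_diff_distrib)
            qed
            fix z p assume z: "z \<in> Z" and "p \<in> set (pow_list e c l)"
            then obtain i where i: "i < l" "p = pow_on e c i" by (auto simp: set_pow_list)
            have "c * (p * u) = pow_on e c (Suc i) * u" by (simp add: i mult.assoc)
            also have "\<dots> = pow_on e c' (Suc i) * u"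
              using T[OF _ u, of "Suc i"] Tl[OF u] i(1) by (cases "Suc i = l") auto
            also have "\<dots> = c' * (p * u)" using T[OF i(1) u] by (simp add: i mult.assoc)
            finally have "(c - c') * (p * u) = 0" by (simp add: left_diff_distrib)
            moreover have "(c - c') * (z * p * u) = z * ((c - c') * (p * u))"
              using center_comm[OF z addsub_diff[OF R(1) cS c'S]] by (metis mult.assoc)
            moreover have zp: "z * p \<in> S" using R(2) z Z_sub pow_on_S[OF cS] i(2) by blast
            moreover have "z * p * u \<in> V" by (rule VM(2)[OF zp uV])
            ultimately show "z * p \<in> {x \<in> S. x * u \<in> ?W}" by simp
          qed
          then show "x * u \<in> ?W" using x by blast
        qed
        moreover have "lspan (E c) us = V"
          by (rule indep_length_lspan[OF spE[OF c] us(2,3)]) (simp add: cV cardE[OF c] us(1))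
        ultimately show "c * v = c' * v" if "v \<in> V" for v using that by (auto simp: left_diff_distrib)
      qed
    qed (rule finite_subset[OF CS fin])
    also have "card ?Y = ?q ^ (?r * ?r) * ?q ^ l"
      using finV finZ dimV(1) by (simp add: card_cartesian_product card_lists_in finite_lists_length_eq rs mult_ac flip: power_mult)
    finally have 1: "card C * ?c \<le> ?q ^ (?r * ?r) * ?q ^ l" .
    have "card C * ?q ^ (?r * s) \<le> card C * (4 * ?c)"
    proof -
      have "?q ^ l \<ge> 2"
        using q2 l2 self_le_power[of ?q l] by linarith
      from card_bases_ge[OF this, of s] show ?thesis
        by (intro mult_left_mono) (simp_all add: rs power2_eq_square mult_ac flip: power_mult)
    qed
    also have "\<dots> \<le> 4 * (?q ^ (?r * ?r) * ?q ^ l)" using 1 by simp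
    also have "\<dots> \<le> 4 * (n * ?q ^ (?r * s) * ?q ^ l)" using n_ge by simp
    finally have "card C * ?q ^ (?r * s) \<le> (4 * n * ?q ^ l) * ?q ^ (?r * s)" by (simp add: mult_ac)
    then have C: "card C \<le> 4 * n * ?q ^ l" using q2 by simp
    \<comment> \<open>From \<open>q \<ge> 2\<close> and \<open>l \<ge> 2\<close>: the removed
      elements of \<open>Z\<close> are at most half of \<open>Z[c]\<close>.\<close>
    have half: "?q ^ l \<le> 2 * (?q ^ l - ?q)"
    proof -
      have "?q * 2 \<le> ?q * ?q" using q2 by (intro mult_left_mono) auto
      also have "\<dots> \<le> ?q ^ l" using q2 l2 power_increasing[of 2 l ?q] by (simp add: power2_eq_square)
      finally show ?thesis by simp
    qed
    have "card (degM n l) * ?q ^ l \<le> card (degM n l) * (2 * (?q ^ l - ?q))"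
      using half by (intro mult_left_mono) auto
    also have "\<dots> \<le> 2 * (4 * n * ?q ^ l)" using sub C by simp
    finally have A: "card (degM n l) \<le> 8 * n" using q2 by simp
    have B: "l \<in> {2..?r}" using l2 rs s0 by simp
    have "?q ^ (?r * (?r - s)) * ?q ^ (?r * s) \<le> n * ?q ^ (?r * s)"
    proof -
      have "s \<le> ?r" using rs l2 by simp
      then have "?r * (?r - s) + ?r * s = ?r * ?r" by (metis add_mult_distrib2 le_add_diff_inverse2)
      then show ?thesis using n_ge by (simp flip: power_add)
    qed
    then have "?q ^ (?r * (?r - s)) \<le> n" using q2 by simp
    moreover have "?r - 1 \<le> ?r * (?r - s)"
    proof -
      have "s < ?r" using rs l2 s0 by simp
      then have "1 \<le> ?r - s" by simp
      from mult_le_mono2[OF this, of ?r] show ?thesis by linarith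
    qed
    moreover have "(2::nat) ^ (?r - 1) \<le> ?q ^ (?r - 1)" using q2 by (intro power_mono) auto
    moreover have "?q ^ (?r - 1) \<le> ?q ^ (?r * (?r - s))" using calculation(2) power_q_le by simp
    ultimately have D: "2 ^ (?r - 1) \<le> n" by simp
    show ?thesis using A B D by simp
  qed
  show "card (degM n l) \<le> 8 * n" using * by (cases "degM n l = {}") auto
  show "degM n l \<noteq> {} \<Longrightarrow> l \<in> {2..dimV} \<and> 2 ^ (dimV - 1) \<le> n" using * by blast
qed

end

section \<open>Maximal subrings that do not contain the centre\<close>

context simple_frame
begin

definition off_center_max :: "nat \<Rightarrow> 'r set set" where
  "off_center_max n = {M \<in> \<M> n. \<not> Z \<subseteq> M}"

text \<open>An element that is central in \<open>M\<close> commutes with \<open>M\<close> and with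
  \<open>Z\<close>, which together generate \<open>S\<close>.\<close>

lemma off_center_center:
  assumes M: "M \<in> off_center_max n"
  shows "center M = Z \<inter> M"
proof (intro equalityI subsetI)
  have M': "M \<in> \<M> n" "\<not> Z \<subseteq> M" using M by (auto simp: off_center_max_def)
  note m = MD[OF M'(1)]
  fix x assume x: "x \<in> center M"
  have xM: "x \<in> M" "\<And>y. y \<in> M \<Longrightarrow> x * y = y * x" using x unfolding center_def by blast+
  have xS: "x \<in> S" using xM m(4) by blast
  have "centralizer S {x} = S"
  proof (rule generated_by_center[OF M'])
    show "ring_on e (centralizer S {x})" by (rule ring_centralizer[OF ring]) (use xS in blast)
    show "M \<subseteq> centralizer S {x}"
    proof
      fix y assume y: "y \<in> M"
      then show "y \<in> centralizer S {x}" by (intro centralizerI) (use m(4) xM(2)[OF y] in auto)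
    qed
    show "Z \<subseteq> centralizer S {x}"
    proof
      fix y assume y: "y \<in> Z"
      then show "y \<in> centralizer S {x}" by (intro centralizerI) (use Z_sub center_comm[OF y xS] in auto)
    qed
  qed (rule centralizer_sub)
  then have "x \<in> Z" by (intro Z_intro[OF xS]) (metis centralizerD singletonI)
  then show "x \<in> Z \<inter> M" using xM by simp
next
  fix x assume "x \<in> Z \<inter> M"
  moreover have "M \<subseteq> S" using M MD(4) by (auto simp: off_center_max_def)
  ultimately show "x \<in> center M" using center_comm unfolding center_def by blast
qed

text \<open>If \<open>I J = 0\<close> in \<open>M\<close>, the left annihilator \<open>K\<close> of
  \<open>J\<close> in \<open>S\<close> is stable under right multiplication by \<open>M\<close> and
  by \<open>Z\<close>, hence by \<open>S\<close>, and is an ideal of the simple ring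
  \<open>S\<close>. If \<open>K\<close> is zero, so is \<open>I\<close>; if \<open>K = S\<close>,
  then \<open>J\<close> is zero.\<close>

lemma off_center_simple:
  assumes M: "M \<in> off_center_max n"
  shows "simple_on e M"
proof (rule prime_imp_simple)
  have M': "M \<in> \<M> n" "\<not> Z \<subseteq> M" using M by (auto simp: off_center_max_def)
  note m = MD[OF M'(1)]
  note MR = ring_onD[OF m(3)]
  show "prime_on e M"
    unfolding prime_on_def
  proof (intro conjI allI impI)
    show "ring_on e M" "finite M" "e \<noteq> 0" using m e_nz by auto
    fix I J assume I: "ideal_on M I" and J: "ideal_on M J" and IJ: "\<forall>x\<in>I. \<forall>y\<in>J. x * y = 0"
    note I' = ideal_onD[OF I] and J' = ideal_onD[OF J]
    define K where "K = {x \<in> S. \<forall>y\<in>J. x * y = 0}"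
    have K: "addsub K"
    proof (rule addsubI)
      show "0 \<in> K" using addsub_zero[OF R(1)] by (simp add: K_def)
      fix x y assume "x \<in> K" "y \<in> K"
      then show "x - y \<in> K" using addsub_diff[OF R(1)] by (simp add: K_def left_diff_distrib)
    qed
    have Kl: "s * x \<in> K" if "s \<in> S" "x \<in> K" for s x
      using that R(2) by (simp add: K_def mult.assoc)
    define T where "T = {a \<in> S. \<forall>x\<in>K. x * a \<in> K}"
    have "T = S"
    proof (rule generated_by_center[OF M'])
      show "ring_on e T"
        unfolding ring_on_def
      proof (intro conjI ballI)
        show "addsub T"
        proof (rule addsubI)
          show "0 \<in> T" using addsub_zero[OF R(1)] addsub_zero[OF K] by (simp add: T_def)
          fix x y assume "x \<in> T" "y \<in> T"
          then show "x - y \<in> T" using addsub_diff[OF R(1)] addsub_diff[OF K] by (simp add: T_def right_diff_distrib)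
        qed
        show "e \<in> T" using R(3,5) by (simp add: T_def K_def)
        fix x y assume "x \<in> T" "y \<in> T"
        then show "x * y \<in> T" using R(2) by (simp add: T_def flip: mult.assoc)
      next
        fix x assume "x \<in> T"
        then show "e * x = x" "x * e = x" using R(4,5) by (simp_all add: T_def)
      qed
      show "M \<subseteq> T"
      proof
        fix a assume a: "a \<in> M"
        have "x * a \<in> K" if "x \<in> K" for x
          using that R(2) a m(4) J'(3)[OF a] by (auto simp: K_def mult.assoc)
        then show "a \<in> T" using a m(4) by (auto simp: T_def)
      qed
      show "Z \<subseteq> T"
      proof
        fix z assume z: "z \<in> Z"
        have "x * z \<in> K" if x: "x \<in> K" for x
        proof -
          have "x * z = z * x" using center_comm[OF z, of x] x by (simp add: K_def)
          then show ?thesis using Kl[of z x] z Z_sub x by auto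
        qed
        then show "z \<in> T" using z Z_sub by (auto simp: T_def)
      qed
    qed (auto simp: T_def)
    then have Kr: "x * s \<in> K" if "s \<in> S" "x \<in> K" for s x using that unfolding T_def by blast
    have "ideal_on S K" by (rule ideal_onI[OF K]) (use Kl Kr in \<open>auto simp: K_def\<close>)
    moreover have "I \<subseteq> K" using I'(2) m(4) IJ by (auto simp: K_def)
    ultimately have "I = {0} \<or> K = S"
      using simple addsub_zero[OF I'(1)] unfolding simple_on_def by blast
    then show "I = {0} \<or> J = {0}"
    proof
      assume "K = S"
      then have "\<forall>y\<in>J. e * y = 0" using R(3) unfolding K_def by blast
      then have "x = 0" if "x \<in> J" for x using MR(4)[of x] J'(2) that by auto
      then have "J \<subseteq> {0}" by blast
      then show ?thesis using addsub_zero[OF J'(1)] by blast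
    qed simp
  qed
qed

text \<open>\<open>M\<close> is a form of \<open>S\<close> over the subfield
  \<open>Z \<inter> M\<close>. A copy \<open>W\<close> in \<open>V\<close> of the simple module of
  \<open>M\<close> spans \<open>V\<close> over \<open>Z\<close>, and vectors independent over
  \<open>Z \<inter> M\<close> remain independent over \<open>Z\<close>, so both modules have the
  same dimension. As \<open>W\<close> differs from \<open>V\<close>, its stabilizer differs from
  \<open>S\<close>, and by maximality it is \<open>M\<close>.\<close>

lemma off_center_module:
  assumes M: "M \<in> off_center_max n"
  shows "\<exists>W. W \<subseteq> V \<and> scalar_space e (Z \<inter> M) W \<and> M = stabilizer S W \<and>
    card W = card (Z \<inter> M) ^ dimV \<and> card M = card (Z \<inter> M) ^ (dimV * dimV)"
proof -
  have M': "M \<in> \<M> n" "\<not> Z \<subseteq> M" using M by (auto simp: off_center_max_def)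
  note m = MD[OF M'(1)]
  obtain f0 ps0 where "simple_frame e M f0 ps0" by (rule exists_simple_frame[OF off_center_simple[OF M]])
  then interpret N: simple_frame e M f0 ps0 .
  have F0: "center M = Z \<inter> M" by (rule off_center_center[OF M])
  have f0S: "f0 \<in> S" using N.f(1) m(4) by blast
  obtain v0 where v0: "v0 \<in> V" "f0 * v0 \<noteq> 0" using faithful[OF f0S] N.f(2) by blast
  \<comment> \<open>The idempotent \<open>f0\<close> fixes \<open>w\<close>, so right multiplication
    by \<open>w\<close> does not kill \<open>f0\<close> and is injective on the simple module of
    \<open>M\<close>.\<close>
  define w where "w = f0 * v0"
  have w: "w \<in> V" "w \<noteq> 0" "f0 * w = w"
    using VM(2)[OF f0S v0(1)] v0(2) N.f(3) by (auto simp: w_def simp flip: mult.assoc)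
  have wS: "w \<in> S" using w(1) V_sub by blast
  obtain ws where ws: "set ws \<subseteq> N.V" "indep N.Z ws" "lspan N.Z ws = N.V" by (rule exists_basis[OF N.scalar_space_V])
  define s where "s = length ws"
  define W where "W = (\<lambda>x. x * w) ` N.V"
  have inj: "x = y" if "x \<in> N.V" "y \<in> N.V" "x * w = y * w" for x y
  proof -
    have "{x \<in> N.V. x * w = 0} = {0}"
      by (rule N.VM(5)[OF _ left_mod_right_annihilator N.f_V]) (use w N.simple_V in \<open>auto simp: simple_mod_def\<close>)
    moreover have "x - y \<in> {x \<in> N.V. x * w = 0}" using that addsub_diff[OF N.VM(1)] by (simp add: left_diff_distrib)
    ultimately show ?thesis by auto
  qed
  have NVS: "N.V \<subseteq> S" using N.V_sub m(4) by blast
  have WV: "W \<subseteq> V" unfolding W_def using VM(2) NVS w(1) by blast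
  have LW: "left_mod M W" unfolding W_def by (rule left_mod_mult_right) (use N.VM(1,2) in blast)+
  have cW: "card W = card N.Z ^ s"
  proof -
    have "card W = card N.V" unfolding W_def by (rule card_image) (use inj in \<open>auto simp: inj_on_def\<close>)
    then show ?thesis using N.card_S(2)[OF ws] by (simp add: s_def)
  qed
  have spW: "scalar_space e N.Z W"
  proof -
    have "left_mod N.Z W" using left_modD[OF LW] N.Z_sub by (auto simp: left_mod_def)
    moreover have "e * v = v" if "v \<in> W" for v using that WV V_sub R(4) by blast
    ultimately show ?thesis using N.div_Z finite_subset[OF WV finV] by (simp add: scalar_space_def)
  qed
  let ?ws = "map (\<lambda>x. x * w) ws"
  have wsV: "set ?ws \<subseteq> V" using ws(1) WV by (auto simp: W_def)
  have spanV: "lspan Z (map (\<lambda>x. x * w) ws) = V"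
  proof -
    let ?Y = "lspan Z ?ws"
    note L = lspan_closed[OF scalar_space_V wsV]
    have WY: "W \<subseteq> ?Y"
    proof -
      have "N.V \<subseteq> {x \<in> N.V. x * w \<in> ?Y}"
        unfolding ws(3)[symmetric]
      proof (rule lspan_least)
        show "addsub {x \<in> lspan N.Z ws. x * w \<in> ?Y}"
          unfolding ws(3)
        proof (rule addsubI)
          show "0 \<in> {x \<in> N.V. x * w \<in> ?Y}" using addsub_zero[OF N.VM(1)] addsub_zero[OF L(1)] by simp
          fix x y assume "x \<in> {x \<in> N.V. x * w \<in> ?Y}" "y \<in> {x \<in> N.V. x * w \<in> ?Y}"
          then show "x - y \<in> {x \<in> N.V. x * w \<in> ?Y}"
            using addsub_diff[OF N.VM(1)] addsub_diff[OF L(1)] by (simp add: left_diff_distrib)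
        qed
        fix z x assume zx: "z \<in> N.Z" "x \<in> set ws"
        have "x * w \<in> ?Y" using set_subset_lspan[OF scalar_space_V wsV] zx(2) by auto
        then have "z * x * w \<in> ?Y" using L(2)[of z "x * w"] zx(1) F0 by (simp add: mult.assoc)
        moreover have "z * x \<in> N.V" using N.VM(2) zx N.Z_sub ws(1) by blast
        ultimately show "z * x \<in> {x \<in> lspan N.Z ws. x * w \<in> ?Y}" by (simp add: ws(3))
      qed
      then show ?thesis unfolding W_def by blast
    qed
    have YR: "e * y = y" if "y \<in> ?Y" for y using that L(3) V_sub R(4) by blast
    have "stabilizer S ?Y = S"
    proof (rule generated_by_center[OF M'])
      show "ring_on e (stabilizer S ?Y)" by (rule ring_stabilizer[OF ring L(1) YR])
      show "M \<subseteq> stabilizer S ?Y"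
      proof
        fix x assume x: "x \<in> M"
        have xS: "x \<in> S" using x m(4) by blast
        have "?Y \<subseteq> {y \<in> V. x * y \<in> ?Y}"
        proof (rule lspan_least)
          show "addsub {y \<in> V. x * y \<in> ?Y}"
          proof (rule addsubI)
            show "0 \<in> {y \<in> V. x * y \<in> ?Y}" using addsub_zero[OF VM(1)] addsub_zero[OF L(1)] by simp
            fix y y' assume "y \<in> {y \<in> V. x * y \<in> ?Y}" "y' \<in> {y \<in> V. x * y \<in> ?Y}"
            then show "y - y' \<in> {y \<in> V. x * y \<in> ?Y}"
              using addsub_diff[OF VM(1)] addsub_diff[OF L(1)] by (simp add: right_diff_distrib)
          qed
          fix z u assume z: "z \<in> Z" and u: "u \<in> set ?ws"
          have "u \<in> W" using u ws(1) by (auto simp: W_def)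
          then have "x * u \<in> ?Y" using left_modD(2)[OF LW x] WY by blast
          then have "x * (z * u) \<in> ?Y" using L(2)[OF z] center_comm[OF z xS] by (metis mult.assoc)
          moreover have "z * u \<in> V" using VM(2) z Z_sub u wsV by blast
          ultimately show "z * u \<in> {y \<in> V. x * y \<in> ?Y}" by simp
        qed
        then show "x \<in> stabilizer S ?Y" using xS by (auto simp: stabilizer_def)
      qed
      show "Z \<subseteq> stabilizer S ?Y" using L(2) Z_sub by (auto simp: stabilizer_def)
    qed (auto simp: stabilizer_def)
    then have "\<And>s y. s \<in> S \<Longrightarrow> y \<in> ?Y \<Longrightarrow> s * y \<in> ?Y" unfolding stabilizer_def by blast
    then have "left_mod S ?Y" by (rule left_modI[OF L(1)])
    moreover have "w \<in> ?Y"
    proof -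
      have "f0 * w \<in> W" unfolding W_def using N.f_V by blast
      then show ?thesis using WY w(3) by auto
    qed
    ultimately show ?thesis using VM(4)[OF L(3)] w(2) by blast
  qed
  \<comment> \<open>Density of \<open>M\<close> provides an \<open>x\<close> in \<open>M\<close>
    that fixes \<open>a\<close> and kills the other vectors. As \<open>x\<close> commutes with
    \<open>Z\<close>, it separates \<open>a * w\<close> from the \<open>Z\<close>-span of their
    multiples by \<open>w\<close>.\<close>
  have indW: "indep Z (map (\<lambda>x. x * w) us)" if "set us \<subseteq> N.V" "indep N.Z us" for us
    using that
  proof (induction us)
    case (Cons a us)
    have a: "a \<in> N.V" "set us \<subseteq> N.V" "a \<notin> lspan N.Z us" using Cons.prems by auto
    have "\<exists>m\<in>N.action.ann us. m * a = a"
      using N.action.ann_onto[OF a(2,1,3)] a(1) by (metis (no_types, lifting) imageE)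
    then obtain x where x: "x \<in> M" "x * a = a" "\<And>u. u \<in> set us \<Longrightarrow> x * u = 0"
      by (auto simp: N.action.ann_def)
    have xS: "x \<in> S" using x m(4) by blast
    have "a * w \<notin> lspan Z (map (\<lambda>x. x * w) us)"
    proof
      assume in_span: "a * w \<in> lspan Z (map (\<lambda>x. x * w) us)"
      have "lspan Z (map (\<lambda>x. x * w) us) \<subseteq> {y \<in> V. x * y = 0}"
      proof (rule lspan_least)
        show "addsub {y \<in> V. x * y = 0}" by (rule addsub_kernel[OF VM(1)]) (simp add: right_diff_distrib)
        fix z u assume z: "z \<in> Z" and "u \<in> set (map (\<lambda>x. x * w) us)"
        then obtain y where y: "y \<in> set us" "u = y * w" by auto
        have "x * (z * u) = z * (x * y * w)" using center_comm[OF z xS] y(2) by (metis mult.assoc)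
        also have "\<dots> = 0" using x(3)[OF y(1)] by simp
        finally have "x * (z * u) = 0" .
        moreover have "u \<in> V" using y a(2) WV by (auto simp: W_def)
        then have "z * u \<in> V" using VM(2) z Z_sub by blast
        ultimately show "z * u \<in> {y \<in> V. x * y = 0}" by simp
      qed
      then have "x * (a * w) = 0" using in_span by blast
      then have "a * w = 0 * w" using x(2) by (simp flip: mult.assoc)
      then have "a = 0" using inj[OF a(1) addsub_zero[OF N.VM(1)]] by simp
      then show False using a(3) addsub_zero[OF lspan_closed(1)[OF N.scalar_space_V a(2)]] by simp
    qed
    then show ?case using Cons a by simp
  qed simp
  have sr: "s = dimV" using basis_length[OF wsV indW[OF ws(1,2)] spanV] by (simp add: s_def)
  have cM: "card M = card N.Z ^ (s * s)" using N.card_S[OF ws] by (simp add: s_def power_mult)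
  have "M = stabilizer S W"
  proof (rule max_subringD(5)[OF m(1), symmetric])
    note L = left_modD[OF LW]
    show "ring_on e (stabilizer S W)" by (rule ring_stabilizer[OF ring L(1)]) (use WV V_sub R(4) in blast)
    show "M \<subseteq> stabilizer S W" using L(2) m(4) by (auto simp: stabilizer_def)
    show "stabilizer S W \<noteq> S"
    proof
      assume "stabilizer S W = S"
      then have "\<And>s w. s \<in> S \<Longrightarrow> w \<in> W \<Longrightarrow> s * w \<in> W" unfolding stabilizer_def by blast
      then have "left_mod S W" by (rule left_modI[OF L(1)])
      then have "W = {0} \<or> W = V" using simple_V WV by (simp add: simple_mod_def)
      moreover have "w \<in> W"
      proof -
        have "f0 * w \<in> W" unfolding W_def using N.f_V by blast
        then show ?thesis using w(3) by simp
      qed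
      ultimately have "W = V" using w(2) by blast
      then have "card N.Z ^ dimV = card Z ^ dimV" using cW sr dimV(1) by simp
      then have "card N.Z = card Z" using dimV_pos power_eq_iff_eq_base by blast
      then have "Z \<inter> M = Z" using F0 card_subset_eq[OF finZ, of "Z \<inter> M"] by simp
      then show False using M'(2) by blast
    qed
  qed (auto simp: stabilizer_def)
  then show ?thesis using WV spW cW cM sr F0 by (intro exI[of _ W]) simp
qed

text \<open>The index determines \<open>card (Z \<inter> M)\<close>, and a finite field has at most
  one subfield of each order, so all these \<open>M\<close> share the scalars \<open>F0\<close>.
  Each is the stabilizer of an \<open>F0\<close>-form of \<open>V\<close>, and the bases of these
  forms are disjoint sets of \<open>r\<close>-tuples of \<open>V\<close>.\<close>

lemma off_center_count: "card (off_center_max n) \<le> 4 * n"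
proof (cases "off_center_max n = {}")
  case False
  then obtain M0 where M0: "M0 \<in> off_center_max n" by blast
  let ?q = "card Z" and ?r = dimV
  define q0 where "q0 = card (Z \<inter> M0)"
  define P where "P M W \<longleftrightarrow> W \<subseteq> V \<and> scalar_space e (Z \<inter> M) W \<and> M = stabilizer S W \<and>
    card W = card (Z \<inter> M) ^ dimV \<and> card M = card (Z \<inter> M) ^ (dimV * dimV)" for M W
  define W where "W M = (SOME W. P M W)" for M
  have PW: "P M (W M)" if M: "M \<in> off_center_max n" for M
  proof -
    have "\<exists>W. P M W" unfolding P_def by (rule off_center_module[OF M])
    then show ?thesis unfolding W_def by (rule someI_ex)
  qed
  have idx: "?q ^ (?r * ?r) = n * card M" if "M \<in> off_center_max n" for M
    using that MD(2)[of M n] dimV(2) by (simp add: off_center_max_def)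
  have n0: "n > 0" using idx[OF M0] q2 by (cases n) auto
  have q0: "card (Z \<inter> M) = q0" if M: "M \<in> off_center_max n" for M
  proof -
    have "n * card M = n * card M0" using idx[OF M] idx[OF M0] by (rule trans[OF sym])
    then have "card (Z \<inter> M) ^ (?r * ?r) = q0 ^ (?r * ?r)"
      using PW[OF M] PW[OF M0] n0 unfolding P_def q0_def by simp
    then show ?thesis using dimV_pos power_eq_iff_eq_base[of "?r * ?r" "card (Z \<inter> M)" q0] by simp
  qed
  have q0_2: "q0 \<ge> 2" using PW[OF M0] card_scalars_ge_2 unfolding P_def q0_def by blast
  \<comment> \<open>A subfield with \<open>q0\<close> elements consists of \<open>0\<close> and
    solutions of \<open>z ^ (q0 - 1) = e\<close>; there are at most \<open>q0 - 1\<close> of these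
    in \<open>Z\<close>, so the subfield contains all of them.\<close>
  have Zeq: "Z \<inter> M = {z \<in> Z. z = 0 \<or> z ^ (q0 - 1) = e}" if M: "M \<in> off_center_max n" for M
  proof -
    have d: "div_ring_on e (Z \<inter> M)" using PW[OF M] unfolding P_def scalar_space_def by blast
    have c: "x * y = y * x" if "x \<in> Z" "y \<in> Z" for x y using center_comm that Z_sub by blast
    have sub: "Z \<inter> M \<subseteq> {z \<in> Z. z = 0 \<or> z ^ (q0 - 1) = e}"
    proof
      fix x assume x: "x \<in> Z \<inter> M"
      have "x = 0 \<or> x ^ (card (Z \<inter> M) - 1) = e" using div_ring_pow_card[OF d _ x] c by blast
      then show "x \<in> {z \<in> Z. z = 0 \<or> z ^ (q0 - 1) = e}" using x q0[OF M] by simp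
    qed
    have "card {z \<in> Z. z = 0 \<or> z ^ (q0 - 1) = e} \<le> card (insert 0 {z \<in> Z. z ^ (q0 - 1) = e})"
      using finZ by (intro card_mono) auto
    also have "\<dots> \<le> Suc (card {z \<in> Z. z ^ (q0 - 1) = e})" using finZ by (simp add: card_insert_if)
    also have "\<dots> \<le> Suc (q0 - 1)" using field_on_roots[OF div_Z c, of "q0 - 1"] q0_2 by simp
    also have "\<dots> = card (Z \<inter> M)" using q0_2 q0[OF M] by simp
    finally show ?thesis using sub finZ by (intro card_seteq) auto
  qed
  define F0 where "F0 = {z \<in> Z. z = 0 \<or> z ^ (q0 - 1) = e}"
  have PW': "W M \<subseteq> V" "scalar_space e F0 (W M)" "M = stabilizer S (W M)" "card (W M) = card F0 ^ ?r"
    "card M = card F0 ^ (?r * ?r)" "card F0 = q0" if M: "M \<in> off_center_max n" for M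
    using PW[OF M] Zeq[OF M] q0[OF M] unfolding P_def F0_def by simp_all
  let ?c = "\<Prod>i<?r. q0 ^ ?r - q0 ^ i"
  have "card (off_center_max n) * ?c \<le> card {xs. set xs \<subseteq> V \<and> length xs = ?r}"
  proof (rule card_disjoint_bound[where X = "\<lambda>M. {us. length us = ?r \<and> set us \<subseteq> W M \<and> indep F0 us}"])
    show "finite {xs. set xs \<subseteq> V \<and> length xs = ?r}" using finV by (rule finite_lists_length_eq)
    show "finite (off_center_max n)" by (rule finite_subset[OF _ fin_M]) (auto simp: off_center_max_def)
    fix M assume M: "M \<in> off_center_max n"
    show "{us. length us = ?r \<and> set us \<subseteq> W M \<and> indep F0 us} \<subseteq> {xs. set xs \<subseteq> V \<and> length xs = ?r}"
      using PW'(1)[OF M] by blast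
    show "?c \<le> card {us. length us = ?r \<and> set us \<subseteq> W M \<and> indep F0 us}"
      using card_indep_lists[OF PW'(2)[OF M], of ?r] PW'(4,6)[OF M] by simp
    fix M' us assume M': "M' \<in> off_center_max n"
      and us: "us \<in> {us. length us = ?r \<and> set us \<subseteq> W M \<and> indep F0 us}" "us \<in> {us. length us = ?r \<and> set us \<subseteq> W M' \<and> indep F0 us}"
    have "lspan F0 us = W M" "lspan F0 us = W M'"
      using indep_length_lspan[OF PW'(2)[OF M], of us] indep_length_lspan[OF PW'(2)[OF M'], of us]
        us PW'(4)[OF M] PW'(4)[OF M'] by auto
    then show "M = M'" using PW'(3)[OF M] PW'(3)[OF M'] by metis
  qed
  also have "\<dots> = ?q ^ (?r * ?r)" using finV dimV(1) by (simp add: card_lists_in power_mult)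
  also have "\<dots> = n * q0 ^ (?r * ?r)" using idx[OF M0] PW'(5,6)[OF M0] by simp
  finally have 1: "card (off_center_max n) * ?c \<le> n * q0 ^ (?r * ?r)" .
  have "card (off_center_max n) * q0 ^ (?r * ?r) \<le> card (off_center_max n) * (4 * ?c)"
    using card_bases_ge[OF q0_2, of ?r] by (intro mult_left_mono) (simp_all add: power2_eq_square)
  also have "\<dots> \<le> 4 * n * q0 ^ (?r * ?r)" using 1 by simp
  finally show ?thesis using q0_2 by simp
qed simp

text \<open>The subrings off the centre contribute \<open>4 * n\<close>, each dimension
  \<open>0 < j < r\<close> at most \<open>4 * n\<close>, each degree
  \<open>2 \<le> l \<le> r\<close> at most \<open>8 * n\<close>. As soon as one of the last two
  types occurs, \<open>2 ^ (r - 1) \<le> n\<close>, so there are at most \<open>log 2 n\<close>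
  values of \<open>j\<close> and of \<open>l\<close>.\<close>

lemma simple_count: "card (\<M> n) \<le> real n * (4 + 12 * log 2 n)"
proof -
  let ?r = dimV
  let ?A = "\<Union>j\<in>{0<..<?r}. reducible_max n j" and ?B = "\<Union>l\<in>{2..?r}. degM n l"
  have sub: "\<M> n \<subseteq> off_center_max n \<union> ?A \<union> ?B"
  proof
    fix M assume M: "M \<in> \<M> n"
    show "M \<in> off_center_max n \<union> ?A \<union> ?B"
    proof (cases "Z \<subseteq> M \<and> M \<notin> ?A")
      case True
      then have "simple_mod M V" using simple_over_max[OF M] by auto
      then have "M \<in> irreducible_max n" using True M by (simp add: irreducible_max_def)
      then have "M \<in> degM n (LEAST l. \<exists>c\<in>centralizer S M. c \<notin> Z \<and> deg c = l)" by (simp add: degM_def)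
      moreover from this have "(LEAST l. \<exists>c\<in>centralizer S M. c \<notin> Z \<and> deg c = l) \<in> {2..?r}"
        using degM_count(2) by blast
      ultimately show ?thesis by blast
    qed (use M in \<open>auto simp: off_center_max_def\<close>)
  qed
  have f: "finite (off_center_max n)" "finite (reducible_max n j)" "finite (degM n l)" for j l
    by (rule finite_subset[OF _ fin_M[of n]]; force simp: off_center_max_def reducible_max_def degM_def irreducible_max_def)+
  have "card (\<M> n) \<le> card (off_center_max n \<union> ?A \<union> ?B)" using f by (intro card_mono[OF _ sub]) auto
  also have "\<dots> \<le> card (off_center_max n) + card ?A + card ?B"
    by (meson card_Un_le add_mono order_refl order_trans)
  finally have main: "card (\<M> n) \<le> card (off_center_max n) + card ?A + card ?B" .
  have A: "card ?A \<le> 4 * n * (?r - 1)"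
  proof -
    have "card ?A \<le> (\<Sum>j\<in>{0<..<?r}. card (reducible_max n j))" by (rule card_UN_le) simp
    also have "\<dots> \<le> (\<Sum>j\<in>{0<..<?r}. 4 * n)" by (rule sum_mono) (use reducible_count(1) in auto)
    finally show ?thesis by (simp add: mult.commute)
  qed
  have B: "card ?B \<le> 8 * n * (?r - 1)"
  proof -
    have "card ?B \<le> (\<Sum>l\<in>{2..?r}. card (degM n l))" by (rule card_UN_le) simp
    also have "\<dots> \<le> (\<Sum>l\<in>{2..?r}. 8 * n)" by (rule sum_mono) (use degM_count(1) in auto)
    finally show ?thesis by (simp add: mult.commute numeral_2_eq_2)
  qed
  have O: "card (off_center_max n) \<le> 4 * n" by (rule off_center_count)
  show ?thesis
  proof (cases "?A = {} \<and> ?B = {}")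
    case True
    then have c: "card (\<M> n) \<le> 4 * n" using main O by simp
    then have "real (card (\<M> n)) \<le> real (4 * n)" unfolding of_nat_le_iff .
    also have "\<dots> \<le> real n * (4 + 12 * log 2 n)" by (cases "n = 0") (auto simp: distrib_left)
    finally show ?thesis .
  next
    case False
    then consider "?A \<noteq> {}" | "?B \<noteq> {}" by blast
    then have r: "2 ^ (?r - 1) \<le> n"
    proof cases
      case 1
      then have "\<exists>j\<in>{0<..<?r}. reducible_max n j \<noteq> {}" by blast
      then obtain j where "j \<in> {0<..<?r}" "reducible_max n j \<noteq> {}" by (elim bexE)
      then show ?thesis using reducible_count(2)[of j n] by simp
    next
      case 2
      then have "\<exists>l. degM n l \<noteq> {}" by blast
      then show ?thesis using degM_count(2) by blast
    qed
    have "(0::nat) < 2 ^ (?r - 1)" by simp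
    then have n0: "n > 0" using r by linarith
    have "real (2 ^ (?r - 1)) \<le> real n" using r unfolding of_nat_le_iff .
    then have "real (?r - 1) \<le> log 2 n" using n0 by (simp add: le_log_iff powr_realpow)
    then have "real n * (12 * real (?r - 1)) \<le> real n * (12 * log 2 n)" by (intro mult_left_mono) auto
    moreover have "card (\<M> n) \<le> 4 * n + 4 * n * (?r - 1) + 8 * n * (?r - 1)" using main A B O by linarith
    then have "real (card (\<M> n)) \<le> real (4 * n + 4 * n * (?r - 1) + 8 * n * (?r - 1))" unfolding of_nat_le_iff .
    moreover have "real (4 * n + 4 * n * k + 8 * n * k) = real n * 4 + real n * (12 * real k)" for k
      by (simp add: algebra_simps)
    ultimately show ?thesis by (simp only: distrib_left)
  qed
qed

end

section \<open>Core-free maximal subrings of finite rings\<close>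

text \<open>A simple bimodule inside a larger ring. It is applied to ideals \<open>N\<close> of
  \<open>R\<close> on which a maximal subring \<open>M\<close> acts from both sides.\<close>

locale bimodule =
  fixes e :: "'r::ring_1" and M N
  assumes ring_M: "ring_on e M" and fin_M: "finite M" and fin_N: "finite N" and add_N: "addsub N" and N_nz: "N \<noteq> {0}"
    and left: "\<And>m x. m \<in> M \<Longrightarrow> x \<in> N \<Longrightarrow> m * x \<in> N" and right: "\<And>m x. m \<in> M \<Longrightarrow> x \<in> N \<Longrightarrow> x * m \<in> N"
    and unit: "\<And>x. x \<in> N \<Longrightarrow> e * x = x" "\<And>x. x \<in> N \<Longrightarrow> x * e = x"
    and simple_N: "\<And>I. I \<subseteq> N \<Longrightarrow> addsub I \<Longrightarrow> (\<And>m x. m \<in> M \<Longrightarrow> x \<in> I \<Longrightarrow> m * x \<in> I) \<Longrightarrow>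
      (\<And>m x. m \<in> M \<Longrightarrow> x \<in> I \<Longrightarrow> x * m \<in> I) \<Longrightarrow> I = {0} \<or> I = N"
begin

lemmas MR = ring_onD[OF ring_M]

lemma e_nz: "e \<noteq> 0"
proof
  assume "e = 0"
  then have "x = 0" if "x \<in> N" for x using unit(1)[OF that] by simp
  then have "N \<subseteq> {0}" by blast
  then show False using N_nz addsub_zero[OF add_N] by blast
qed

text \<open>Let \<open>P P' = 0\<close> with \<open>P\<close> nonzero. The elements of
  \<open>N\<close> killed by \<open>P'\<close> from the right form a sub-bimodule containing
  \<open>N P\<close>, which is not zero by faithfulness; so \<open>P'\<close> kills all of
  \<open>N\<close> and vanishes.\<close>

lemma prime_if_right_faithful:
  assumes faithful: "\<And>m. m \<in> M \<Longrightarrow> (\<And>x. x \<in> N \<Longrightarrow> x * m = 0) \<Longrightarrow> m = 0"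
  shows "simple_on e M"
proof (rule prime_imp_simple)
  show "prime_on e M"
    unfolding prime_on_def
  proof (intro conjI allI impI)
    show "ring_on e M" "finite M" "e \<noteq> 0" by (rule ring_M, rule fin_M, rule e_nz)
    fix P P' assume P: "ideal_on M P" and P': "ideal_on M P'" and z: "\<forall>x\<in>P. \<forall>y\<in>P'. x * y = 0"
    note I = ideal_onD[OF P] and I' = ideal_onD[OF P']
    show "P = {0} \<or> P' = {0}"
    proof (cases "P = {0}")
      case False
      then obtain p where p: "p \<in> P" "p \<noteq> 0" using nonzero_elem[OF I(1)] by blast
      then obtain x where x: "x \<in> N" "x * p \<noteq> 0" using faithful I(2) by blast
      let ?I = "{x \<in> N. \<forall>q\<in>P'. x * q = 0}"
      have "?I = {0} \<or> ?I = N"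
      proof (rule simple_N)
        show "addsub ?I"
        proof (rule addsubI)
          show "0 \<in> ?I" using addsub_zero[OF add_N] by simp
          fix x y assume "x \<in> ?I" "y \<in> ?I"
          then show "x - y \<in> ?I" using addsub_diff[OF add_N] by (simp add: left_diff_distrib)
        qed
        fix m x assume m: "m \<in> M" and x: "x \<in> ?I"
        show "m * x \<in> ?I" using left m x by (simp add: mult.assoc)
        show "x * m \<in> ?I" using right m x I'(3)[OF m] by (simp add: mult.assoc)
      qed blast
      moreover have "x * p \<in> ?I"
        using right[OF _ x(1)] p(1) I(2) z by (auto simp: mult.assoc)
      ultimately have "?I = N" using x(2) by blast
      then have "y * q = 0" if "y \<in> N" "q \<in> P'" for y q using that by blast
      then have "q = 0" if "q \<in> P'" for q using faithful[of q] I'(2) that by blast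
      then show ?thesis using addsub_zero[OF I'(1)] by blast
    qed simp
  qed
qed

definition derivation :: "('r \<Rightarrow> 'r) \<Rightarrow> bool" where
  "derivation d \<longleftrightarrow> (\<forall>m\<in>M. d m \<in> N) \<and> (\<forall>m\<in>M. \<forall>k\<in>M. d (m - k) = d m - d k) \<and>
     (\<forall>m\<in>M. \<forall>k\<in>M. d (m * k) = m * d k + d m * k)"

lemma derivationD:
  assumes "derivation d"
  shows "\<And>m. m \<in> M \<Longrightarrow> d m \<in> N" "\<And>m k. m \<in> M \<Longrightarrow> k \<in> M \<Longrightarrow> d (m - k) = d m - d k"
    "\<And>m k. m \<in> M \<Longrightarrow> k \<in> M \<Longrightarrow> d (m * k) = m * d k + d m * k" "d 0 = 0"
    "\<And>m k. m \<in> M \<Longrightarrow> k \<in> M \<Longrightarrow> d (m + k) = d m + d k"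
proof -
  show 1: "\<And>m. m \<in> M \<Longrightarrow> d m \<in> N" and 2: "\<And>m k. m \<in> M \<Longrightarrow> k \<in> M \<Longrightarrow> d (m - k) = d m - d k"
    and "\<And>m k. m \<in> M \<Longrightarrow> k \<in> M \<Longrightarrow> d (m * k) = m * d k + d m * k"
    using assms unfolding derivation_def by blast+
  show 0: "d 0 = 0" using 2[of 0 0] addsub_zero[OF MR(1)] by simp
  fix m k assume mk: "m \<in> M" "k \<in> M"
  have "d (- k) = - d k" using 2[of 0 k] 0 addsub_zero[OF MR(1)] mk by simp
  then show "d (m + k) = d m + d k" using 2[of m "- k"] addsub_uminus[OF MR(1)] mk by simp
qed

lemma derivation_diff:
  assumes "derivation d" "derivation d'"
  shows "derivation (\<lambda>m. d m - d' m)"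
  using addsub_diff[OF add_N] derivationD(1-3)[OF assms(1)] derivationD(1-3)[OF assms(2)]
  unfolding derivation_def by (simp add: algebra_simps)

text \<open>If \<open>M\<close> acts faithfully on the right, it is simple; a derivation is then determined by its value
  at a central element acting differently from the two sides, and is inner if there is none.
  Otherwise an idempotent of the right annihilator determines it.\<close>

lemma derivation_parameter:
  assumes faithful: "\<And>P. ideal_on M P \<Longrightarrow> (\<And>p x. p \<in> P \<Longrightarrow> x \<in> N \<Longrightarrow> p * x = 0) \<Longrightarrow>
    (\<And>p x. p \<in> P \<Longrightarrow> x \<in> N \<Longrightarrow> x * p = 0) \<Longrightarrow> P = {0}"
  shows "\<exists>\<Phi>. (\<forall>d. derivation d \<longrightarrow> \<Phi> d \<in> N) \<and>
    (\<forall>d d'. derivation d \<longrightarrow> derivation d' \<longrightarrow> \<Phi> d = \<Phi> d' \<longrightarrow> (\<forall>m\<in>M. d m = d' m))"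
proof -
  define rr where "rr = {m \<in> M. \<forall>x\<in>N. x * m = 0}"
  have by_value: ?thesis if c: "c \<in> M"
    and det: "\<And>d m. derivation d \<Longrightarrow> d c = 0 \<Longrightarrow> m \<in> M \<Longrightarrow> d m = 0" for c
  proof (intro exI[of _ "\<lambda>d. d c"] conjI allI impI ballI)
    show "d c \<in> N" if "derivation d" for d using derivationD(1)[OF that] c by blast
    fix d d' m assume d: "derivation d" "derivation d'" "d c = d' c" "m \<in> M"
    then show "d m = d' m" using det[OF derivation_diff[OF d(1,2)], of m] by simp
  qed
  show ?thesis
  proof (cases "rr = {0}")
    case False
    have rr: "ideal_on M rr"
    proof (rule ideal_onI)
      show "addsub rr"
      proof (rule addsubI)
        show "0 \<in> rr" using addsub_zero[OF MR(1)] by (simp add: rr_def)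
        fix x y assume "x \<in> rr" "y \<in> rr"
        then show "x - y \<in> rr" using addsub_diff[OF MR(1)] by (simp add: rr_def right_diff_distrib)
      qed
      show "rr \<subseteq> M" by (auto simp: rr_def)
      fix s x assume s: "s \<in> M" and x: "x \<in> rr"
      have "y * (s * x) = 0" if "y \<in> N" for y
        using x right[OF s that] by (simp add: rr_def flip: mult.assoc)
      then show "s * x \<in> rr" using MR(2) s x by (simp add: rr_def)
      show "x * s \<in> rr" using MR(2) s x by (simp add: rr_def flip: mult.assoc)
    qed
    note I = ideal_onD[OF rr]
    \<comment> \<open>The elements of \<open>rr\<close> that also kill \<open>N\<close> from the
      left form an ideal acting as zero on both sides. Hence \<open>rr\<close> acts faithfully from
      the left.\<close>
    have both: "m = 0" if m: "m \<in> rr" "\<And>x. x \<in> N \<Longrightarrow> m * x = 0" for m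
    proof -
      let ?P = "{m \<in> rr. \<forall>x\<in>N. m * x = 0}"
      have "?P = {0}"
      proof (rule faithful)
        show "ideal_on M ?P"
        proof (rule ideal_onI)
          show "addsub ?P"
          proof (rule addsubI)
            show "0 \<in> ?P" using addsub_zero[OF I(1)] by simp
            fix x y assume "x \<in> ?P" "y \<in> ?P"
            then show "x - y \<in> ?P" using addsub_diff[OF I(1)] by (simp add: left_diff_distrib)
          qed
          show "?P \<subseteq> M" using I(2) by blast
          fix s x assume s: "s \<in> M" and x: "x \<in> ?P"
          show "s * x \<in> ?P" using I(3)[OF s] x by (simp add: mult.assoc)
          show "x * s \<in> ?P" using I(4)[OF s] x left[OF s] by (simp add: mult.assoc)
        qed
      qed (auto simp: rr_def)
      then show ?thesis using m by blast
    qed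
    obtain p0 where p0: "p0 \<in> rr" "p0 \<noteq> 0" using nonzero_elem[OF I(1) False] by blast
    have "left_mod M N" by (rule left_modI[OF add_N left])
    then obtain L where L: "L \<subseteq> N" "simple_mod M L" by (rule exists_simple_mod[OF _ fin_N N_nz])
    note LM = simple_modD[OF L(2)]
    obtain l where l: "l \<in> L" "l \<noteq> 0" using nonzero_elem[OF LM(1,3)] by blast
    have "\<exists>p\<in>rr. \<exists>v\<in>L. p * v \<noteq> 0"
    proof (rule ccontr)
      assume n: "\<not> ?thesis"
      let ?I = "{x \<in> N. \<forall>p\<in>rr. p * x = 0}"
      have "?I = {0} \<or> ?I = N"
      proof (rule simple_N)
        show "addsub ?I"
        proof (rule addsubI)
          show "0 \<in> ?I" using addsub_zero[OF add_N] by simp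
          fix x y assume "x \<in> ?I" "y \<in> ?I"
          then show "x - y \<in> ?I" using addsub_diff[OF add_N] by (simp add: right_diff_distrib)
        qed
        fix m x assume m: "m \<in> M" and x: "x \<in> ?I"
        have "p * (m * x) = 0" if "p \<in> rr" for p using I(4)[OF m that] x by (simp flip: mult.assoc)
        then show "m * x \<in> ?I" using left m x by simp
        show "x * m \<in> ?I" using right m x by (simp flip: mult.assoc)
      qed blast
      moreover have "l \<in> ?I" using n l L(1) by blast
      ultimately have "?I = N" using l(2) by blast
      then have "p0 * x = 0" if "x \<in> N" for x using that p0(1) by blast
      then show False using both[OF p0(1)] p0(2) by blast
    qed
    then obtain p v where "p \<in> rr" "v \<in> L" "p * v \<noteq> 0" by blast
    then obtain f where f: "f \<in> rr" "\<And>v. v \<in> L \<Longrightarrow> f * v = v"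
      using ideal_contains_local_unit[OF ring_M fin_M L(2) finite_subset[OF L(1) fin_N] rr] by blast
    have fM: "f \<in> M" using f(1) I(2) by blast
    have fN: "f * x = x" if x: "x \<in> N" for x
    proof -
      let ?I = "{x \<in> N. \<forall>m\<in>M. f * (m * x) = m * x}"
      have "?I = {0} \<or> ?I = N"
      proof (rule simple_N)
        show "addsub ?I"
        proof (rule addsubI)
          show "0 \<in> ?I" using addsub_zero[OF add_N] by simp
          fix x y assume "x \<in> ?I" "y \<in> ?I"
          then show "x - y \<in> ?I" using addsub_diff[OF add_N] by (simp add: right_diff_distrib)
        qed
        fix m x assume m: "m \<in> M" and x: "x \<in> ?I"
        have "f * (k * (m * x)) = k * (m * x)" if "k \<in> M" for k
        proof -
          have "f * ((k * m) * x) = (k * m) * x" using x MR(2)[OF that m] by blast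
          then show ?thesis by (simp only: mult.assoc)
        qed
        then show "m * x \<in> ?I" using left m x by simp
        have "f * (k * (x * m)) = k * (x * m)" if "k \<in> M" for k
        proof -
          have "f * (k * x) * m = k * x * m" using x that by simp
          then show ?thesis by (simp add: mult.assoc)
        qed
        then show "x * m \<in> ?I" using right m x by simp
      qed blast
      moreover have "l \<in> ?I" using f(2) LM(2) l(1) L(1) by blast
      ultimately have "?I = N" using l(2) by blast
      then have "f * (e * x) = e * x" using x MR(3) by blast
      then show ?thesis using unit(1)[OF x] by simp
    qed
    \<comment> \<open>From the left \<open>f\<close> is the identity on \<open>N\<close>, from the
      right it is zero. So \<open>f * s - s * f\<close> acts as zero on both sides, and
      \<open>f\<close> is central. A derivation vanishing at \<open>f\<close> then satisfies
      \<open>d m = d (f * m) = d (m * f) = 0\<close>.\<close>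
    have fc: "f * s = s * f" if s: "s \<in> M" for s
    proof -
      have "f * s - s * f = 0"
      proof (rule both)
        show "f * s - s * f \<in> rr" using addsub_diff[OF I(1) I(4)[OF s f(1)] I(3)[OF s f(1)]] .
        show "(f * s - s * f) * x = 0" if "x \<in> N" for x
          using fN[OF that] fN[OF left[OF s that]] by (simp add: left_diff_distrib mult.assoc)
      qed
      then show ?thesis by simp
    qed
    show ?thesis
    proof (rule by_value[OF fM])
      fix d m assume d: "derivation d" "d f = 0" and m: "m \<in> M"
      have "d (f * m) = d m" using derivationD(3)[OF d(1) fM m] d(2) fN[OF derivationD(1)[OF d(1) m]] by simp
      moreover have "d (m * f) = 0"
        using derivationD(3)[OF d(1) m fM] d(2) derivationD(1)[OF d(1) m] f(1) by (simp add: rr_def)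
      ultimately show "d m = 0" using fc[OF m] by simp
    qed
  next
    case True
    have "m = 0" if "m \<in> M" "\<And>x. x \<in> N \<Longrightarrow> x * m = 0" for m
    proof -
      have "m \<in> rr" using that by (simp add: rr_def)
      then show ?thesis using True by blast
    qed
    then have simp: "simple_on e M" by (rule prime_if_right_faithful)
    obtain f ps where "simple_frame e M f ps" by (rule exists_simple_frame[OF simp])
    then interpret simple_frame e M f ps .
    show ?thesis
    proof (cases "\<exists>c\<in>Z. \<exists>x\<in>N. c * x \<noteq> x * c")
      case True
      then obtain c x0 where c: "c \<in> Z" "x0 \<in> N" "c * x0 \<noteq> x0 * c" by blast
      have cM: "c \<in> M" using c Z_sub by blast
      let ?I = "{x \<in> N. c * x = x * c}"
      have "?I = {0} \<or> ?I = N"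
      proof (rule simple_N)
        show "addsub ?I"
        proof (rule addsubI)
          show "0 \<in> ?I" using addsub_zero[OF add_N] by simp
          fix x y assume "x \<in> ?I" "y \<in> ?I"
          then show "x - y \<in> ?I" using addsub_diff[OF add_N] by (simp add: left_diff_distrib right_diff_distrib)
        qed
        fix m x assume m: "m \<in> M" and x: "x \<in> ?I"
        have cx: "c * x = x * c" using x by simp
        have "c * (m * x) = m * (c * x)" using center_comm[OF c(1) m] by (metis mult.assoc)
        then have "c * (m * x) = m * x * c" by (simp only: cx mult.assoc)
        then show "m * x \<in> ?I" using left[OF m] x by simp
        have "c * (x * m) = x * (c * m)" by (metis cx mult.assoc)
        then have "c * (x * m) = x * m * c" by (simp only: center_comm[OF c(1) m] mult.assoc)
        then show "x * m \<in> ?I" using right[OF m] x by simp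
      qed blast
      then have I0: "?I = {0}" using c by blast
      show ?thesis
      proof (rule by_value[OF cM])
        fix d m assume d: "derivation d" "d c = 0" and m: "m \<in> M"
        have "d (c * m) = c * d m" "d (m * c) = d m * c"
          using derivationD(3)[OF d(1) cM m] derivationD(3)[OF d(1) m cM] d(2) by simp_all
        then have "c * d m = d m * c" using center_comm[OF c(1) m] by simp
        then have "d m \<in> ?I" using derivationD(1)[OF d(1) m] by simp
        then show "d m = 0" using I0 by blast
      qed
    next
      case False
      then have cN: "c * x = x * c" if "c \<in> Z" "x \<in> N" for c x using that by blast
      \<comment> \<open>Differentiating \<open>c ^ card Z = c\<close> gives \<open>d c\<close> as a
        multiple of \<open>card Z\<close>, which annihilates \<open>Z\<close>. The power rule holds
        because here \<open>c\<close> commutes with \<open>d c\<close>.\<close>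
      have dZ: "d c = 0" if d: "derivation d" and c: "c \<in> Z" for d c
      proof (cases "c = 0")
        case True
        then show ?thesis using derivationD(4)[OF d] by simp
      next
        case False
        have cM: "c \<in> M" using c Z_sub by blast
        have dcN: "d c \<in> N" by (rule derivationD(1)[OF d cM])
        have pw: "c ^ Suc k \<in> M" for k using power_closed[of M c "Suc k"] MR(2) cM by blast
        have dp: "d (c ^ Suc k) = of_nat (Suc k) * (c ^ k * d c)" for k
        proof (induction k)
          case (Suc k)
          have "d (c ^ Suc (Suc k)) = c * d (c ^ Suc k) + d c * c ^ Suc k"
            using derivationD(3)[OF d cM pw[of k]] by simp
          also have "d c * c ^ Suc k = c ^ Suc k * d c"
            using power_commuting_commutes[OF cN[OF c dcN], of "Suc k"] by simp
          also have "c * d (c ^ Suc k) = of_nat (Suc k) * (c ^ Suc k * d c)"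
          proof -
            have "c * (of_nat i * y) = of_nat i * (c * y)" for i y by (metis mult.assoc mult_of_nat_commute)
            then have "c * d (c ^ Suc k) = of_nat (Suc k) * (c * (c ^ k * d c))" unfolding Suc .
            then show ?thesis by (simp only: power_Suc mult.assoc)
          qed
          finally show ?case by (simp add: algebra_simps)
        qed simp
        define k where "k = card Z - 1"
        have k: "card Z = Suc k" using q2 by (simp add: k_def)
        have ck: "c ^ k = e" unfolding k_def
          by (rule div_ring_pow_card[OF div_Z _ c False]) (use center_comm Z_sub in blast)
        have "c ^ Suc k = c" using ck R(5)[OF cM] by simp
        then have "d c = of_nat (card Z) * (e * d c)" using dp[of k] ck k by simp
        also have "\<dots> = of_nat (card Z) * e * d c" by (simp add: mult.assoc)
        also have "of_nat (card Z) * e = 0" by (rule card_mult_eq_0) (use ring_onD[OF ring_Z] finZ in blast)+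
        finally show ?thesis by simp
      qed
      \<comment> \<open>Followed by right multiplication by \<open>f\<close>, the derivation is
        \<open>F\<close>-linear on \<open>V\<close> because it vanishes on \<open>Z\<close>. So
        \<open>d v * f = \<Phi> d * v\<close> there, and \<open>d\<close> is the inner derivation
        \<open>s \<mapsto> \<Phi> d * s - s * \<Phi> d\<close>.\<close>
      define \<Phi> where "\<Phi> d = sum_list (map (\<lambda>(a, b). d a * b) ps)" for d :: "'r \<Rightarrow> 'r"
      have \<Phi>N: "\<Phi> d \<in> N" if d: "derivation d" for d
      proof -
        have "sum_list (map (\<lambda>(a, b). d a * b) qs) \<in> N" if "set qs \<subseteq> set ps" for qs
          using that
        proof (induction qs)
          case (Cons p qs)
          obtain a b where p: "p = (a, b)" "(a, b) \<in> set ps" using Cons.prems by (cases p) auto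
          have "a \<in> M" "b \<in> M" using ps[OF p(2)] V_sub by auto
          then have "d a * b \<in> N" using derivationD(1)[OF d] right by blast
          then show ?case using Cons p(1) addsub_add[OF add_N] by simp
        qed (simp add: addsub_zero[OF add_N])
        then show ?thesis unfolding \<Phi>_def by blast
      qed
      have inner: "d s = \<Phi> d * s - s * \<Phi> d" if d: "derivation d" and s: "s \<in> M" for d s
      proof -
        have VM': "v \<in> M" if "v \<in> V" for v using that V_sub by blast
        have D: "d v * f = \<Phi> d * v" if v: "v \<in> V" for v
        proof -
          have "d v * f = sum_list (map (\<lambda>(a, b). d a * f * b) ps) * v"
          proof (rule linear_is_mult[OF _ _ v])
            fix x y assume "x \<in> V" "y \<in> V"
            then show "d (x + y) * f = d x * f + d y * f"
              using derivationD(5)[OF d] VM' by (simp add: distrib_right)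
          next
            fix v x assume vx: "v \<in> V" "x \<in> F"
            obtain z where z: "z \<in> Z" "\<And>v. v \<in> V \<Longrightarrow> z * v = v * x" using corner_from_center[OF vx(2)] by blast
            have zM: "z \<in> M" using z Z_sub by blast
            have "d (v * x) = d (z * v)" using z(2)[OF vx(1)] by simp
            also have "\<dots> = z * d v" using derivationD(3)[OF d zM VM'[OF vx(1)]] dZ[OF d z(1)] by simp
            also have "\<dots> = d v * z" using cN[OF z(1) derivationD(1)[OF d VM'[OF vx(1)]]] .
            finally have "d (v * x) * f = d v * (z * f)" by (simp add: mult.assoc)
            also have "z * f = f * x" by (rule z(2)[OF f_V])
            finally show "d (v * x) * f = d v * f * x" by (simp add: mult.assoc)
          qed
          also have "map (\<lambda>(a, b). d a * f * b) ps = map (\<lambda>(a, b). d a * b) ps"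
            using ps by (auto simp: mult.assoc)
          finally show ?thesis by (simp add: \<Phi>_def)
        qed
        let ?y = "d s - (\<Phi> d * s - s * \<Phi> d)"
        have yV: "?y * v = 0" if v: "v \<in> V" for v
        proof -
          have sv: "s * v \<in> V" by (rule VM(2)[OF s v])
          have vf: "v * f = v" using v by (simp add: left_ideal_of_def)
          have "\<Phi> d * (s * v) = d (s * v) * f" using D[OF sv] by simp
          also have "\<dots> = s * (d v * f) + d s * (v * f)"
            using derivationD(3)[OF d s VM'[OF v]] by (simp add: distrib_right mult.assoc)
          also have "\<dots> = s * (\<Phi> d * v) + d s * v" using D[OF v] vf by simp
          finally show ?thesis by (simp add: algebra_simps)
        qed
        have yN: "?y \<in> N"
          by (intro addsub_diff[OF add_N] derivationD(1)[OF d s] left[OF s] right[OF s] \<Phi>N[OF d])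
        have "?y * sum_list (map (\<lambda>(a, b). a * b) qs) = 0" if "set qs \<subseteq> set ps" for qs
          using that
        proof (induction qs)
          case (Cons p qs)
          obtain a b where p: "p = (a, b)" "(a, b) \<in> set ps" using Cons.prems by (cases p) auto
          have "?y * (a * b) = 0" using yV[of a] ps[OF p(2)] by (simp flip: mult.assoc)
          then show ?case using Cons p(1) by (simp add: distrib_left)
        qed simp
        from this[of ps] have "?y * e = 0" by (simp flip: e_ps)
        then have "?y = 0" using unit(2)[OF yN] by simp
        then show ?thesis by simp
      qed
      show ?thesis
      proof (intro exI[of _ \<Phi>] conjI allI impI ballI)
        show "\<Phi> d \<in> N" if "derivation d" for d by (rule \<Phi>N[OF that])
        fix d d' m assume *: "derivation d" "derivation d'" "\<Phi> d = \<Phi> d'" "m \<in> M"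
        show "d m = d' m" unfolding inner[OF *(1,4)] inner[OF *(2,4)] *(3) ..
      qed
    qed
  qed
qed

end

text \<open>\<open>M + I\<close> is a subring; it is larger than \<open>M\<close> because
  \<open>M\<close> contains no nonzero ideal.\<close>

lemma core_free_sum:
  assumes R: "ring_on e R" "finite R" and M: "max_subring e R M" "core_free R M" "card R = n * card M"
    and I: "ideal_on R I" "I \<noteq> {0}"
  shows "R = {m + x | m x. m \<in> M \<and> x \<in> I}" "M \<inter> I = {0} \<Longrightarrow> card I = n"
proof -
  note RR = ring_onD[OF R(1)] and m = max_subringD[OF M(1)] and ID = ideal_onD[OF I(1)]
  note MR = ring_onD[OF m(1)]
  let ?T = "{m + x | m x. m \<in> M \<and> x \<in> I}"
  have MT: "M \<subseteq> ?T" using addsub_zero[OF ID(1)] by force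
  have IT: "I \<subseteq> ?T" using addsub_zero[OF MR(1)] by force
  have TR: "?T \<subseteq> R" using m(2) ID(2) by (auto intro!: addsub_add[OF RR(1)])
  have "ring_on e ?T"
    unfolding ring_on_def
  proof (intro conjI ballI)
    show "addsub ?T" by (rule addsub_setsum[OF MR(1) ID(1)])
    show "e \<in> ?T" using MT MR(3) by blast
    fix a b assume "a \<in> ?T" "b \<in> ?T"
    then obtain m1 x1 m2 x2 where *: "m1 \<in> M" "x1 \<in> I" "m2 \<in> M" "x2 \<in> I" "a = m1 + x1" "b = m2 + x2" by auto
    have "a * b = m1 * m2 + (m1 * x2 + (x1 * m2 + x1 * x2))" by (simp add: *(5,6) algebra_simps)
    moreover have "m1 * x2 + (x1 * m2 + x1 * x2) \<in> I"
      using * m(2) ID(2-4) by (intro addsub_add[OF ID(1)]) auto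
    ultimately show "a * b \<in> ?T" using MR(2)[OF *(1,3)] by blast
  next
    fix a assume "a \<in> ?T"
    then have "a \<in> R" using TR by blast
    then show "e * a = a" "a * e = a" by (rule RR(4), rule RR(5))
  qed
  moreover have "\<not> I \<subseteq> M" using M(2) I unfolding core_free_def by blast
  ultimately show T: "R = ?T" using m(4)[OF _ MT TR] IT by blast
  assume "M \<inter> I = {0}"
  moreover have "finite M" "finite I" using m(2) ID(2) R(2) finite_subset by auto
  ultimately have "card M * card I = card R" using card_sumset[OF MR(1) ID(1)] T by simp
  moreover have "card M > 0" using MR(3) \<open>finite M\<close> by (auto simp: card_gt_0_iff)
  ultimately show "card I = n" using M(3) by (metis mult.commute mult_cancel2 less_irrefl_nat)
qed

text \<open>For an ideal \<open>I \<subseteq> N\<close> the intersection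
  \<open>M' \<inter> I\<close> is an ideal of \<open>R = M' + N\<close>, because \<open>N\<close>
  annihilates \<open>I\<close>. So it vanishes, \<open>N\<close> is a minimal ideal of order
  \<open>n\<close>, and the parameter of a derivation from \<open>M\<close> to \<open>N\<close>
  takes at most \<open>n\<close> values.\<close>

lemma square_zero_count:
  assumes R: "ring_on e R" "finite R" and N: "ideal_on R N" "N \<noteq> {0}" "\<And>x y. x \<in> N \<Longrightarrow> y \<in> N \<Longrightarrow> x * y = 0"
  shows "card (core_free_max_subrings e R n) \<le> n"
proof (cases "core_free_max_subrings e R n = {}")
  case False
  then obtain M where "M \<in> core_free_max_subrings e R n" by blast
  then have M: "max_subring e R M" "core_free R M" "card R = n * card M" by (auto simp: core_free_max_subrings_def)
  note RR = ring_onD[OF R(1)] and ND = ideal_onD[OF N(1)]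
  have cap: "M' \<inter> I = {0}"
    if M': "max_subring e R M'" "core_free R M'" "card R = n * card M'" and I: "ideal_on R I" "I \<noteq> {0}" "I \<subseteq> N" for M' I
  proof -
    note ID = ideal_onD[OF I(1)] and m = max_subringD[OF M'(1)] and S = core_free_sum(1)[OF R M' N(1,2)]
    have "ideal_on R (M' \<inter> I)"
    proof (rule ideal_onI)
      show "addsub (M' \<inter> I)" by (rule addsub_Int[OF ring_onD(1)[OF m(1)] ID(1)])
      show "M' \<inter> I \<subseteq> R" using ID(2) by blast
      fix s x assume s: "s \<in> R" and x: "x \<in> M' \<inter> I"
      obtain k y where k: "k \<in> M'" "y \<in> N" "s = k + y" using s S by auto
      have "s * x = k * x" "x * s = x * k" using N(3) k(2) x I(3) by (auto simp: k(3) distrib_left distrib_right)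
      moreover have "k * x \<in> M'" "x * k \<in> M'" using ring_onD(2)[OF m(1)] k(1) x by auto
      moreover have "s * x \<in> I" "x * s \<in> I" using ID(3,4)[OF s] x by auto
      ultimately show "s * x \<in> M' \<inter> I" "x * s \<in> M' \<inter> I" by auto
    qed
    then show ?thesis using M'(2) unfolding core_free_def by blast
  qed
  have cN: "card N = n" by (rule core_free_sum(2)[OF R M N(1,2) cap[OF M N(1,2) order_refl]])
  have finN: "finite N" using ND(2) R(2) by (rule finite_subset)
  note m = max_subringD[OF M(1)]
  note MR = ring_onD[OF m(1)] and S = core_free_sum(1)[OF R M N(1,2)]
  interpret bimodule e M N
  proof
    show "ring_on e M" "finite N" "addsub N" "N \<noteq> {0}" by (fact m(1) finN ND(1) N(2))+
    show "finite M" using m(2) R(2) by (rule finite_subset)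
    show "m * x \<in> N" "x * m \<in> N" if "m \<in> M" "x \<in> N" for m x using ND(3,4) m(2) that by blast+
    show "e * x = x" "x * e = x" if "x \<in> N" for x using RR(4,5) ND(2) that by blast+
    fix I assume I: "I \<subseteq> N" "addsub I" "\<And>m x. m \<in> M \<Longrightarrow> x \<in> I \<Longrightarrow> m * x \<in> I" "\<And>m x. m \<in> M \<Longrightarrow> x \<in> I \<Longrightarrow> x * m \<in> I"
    show "I = {0} \<or> I = N"
    proof (cases "I = {0}")
      case False
      have iI: "ideal_on R I"
      proof (rule ideal_onI[OF I(2)])
        show "I \<subseteq> R" using I(1) ND(2) by blast
        fix s x assume s: "s \<in> R" and x: "x \<in> I"
        obtain k y where k: "k \<in> M" "y \<in> N" "s = k + y" using s S by auto
        have "s * x = k * x" "x * s = x * k" using N(3) k(2) x I(1) by (auto simp: k(3) distrib_left distrib_right)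
        then show "s * x \<in> I" "x * s \<in> I" using I(3,4) k(1) x by auto
      qed
      have "card I = n" by (rule core_free_sum(2)[OF R M iI False cap[OF M iI False I(1)]])
      then show ?thesis using card_subset_eq[OF finN I(1)] cN by simp
    qed simp
  qed
  have "\<exists>\<Phi>. (\<forall>d. derivation d \<longrightarrow> \<Phi> d \<in> N) \<and>
    (\<forall>d d'. derivation d \<longrightarrow> derivation d' \<longrightarrow> \<Phi> d = \<Phi> d' \<longrightarrow> (\<forall>m\<in>M. d m = d' m))"
  proof (rule derivation_parameter)
    fix P assume P: "ideal_on M P" "\<And>p x. p \<in> P \<Longrightarrow> x \<in> N \<Longrightarrow> p * x = 0" "\<And>p x. p \<in> P \<Longrightarrow> x \<in> N \<Longrightarrow> x * p = 0"
    note PD = ideal_onD[OF P(1)]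
    have "ideal_on R P"
    proof (rule ideal_onI[OF PD(1)])
      show "P \<subseteq> R" using PD(2) m(2) by blast
      fix s x assume s: "s \<in> R" and x: "x \<in> P"
      obtain k y where k: "k \<in> M" "y \<in> N" "s = k + y" using s S by auto
      have "s * x = k * x" "x * s = x * k" using P(2,3) k(2) x by (auto simp: k(3) distrib_left distrib_right)
      then show "s * x \<in> P" "x * s \<in> P" using PD(3,4) k(1) x by auto
    qed
    then show "P = {0}" using M(2) PD(2) unfolding core_free_def by blast
  qed
  then obtain \<Phi> where \<Phi>: "\<And>d. derivation d \<Longrightarrow> \<Phi> d \<in> N"
    "\<And>d d' m. derivation d \<Longrightarrow> derivation d' \<Longrightarrow> \<Phi> d = \<Phi> d' \<Longrightarrow> m \<in> M \<Longrightarrow> d m = d' m" by blast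
  \<comment> \<open>\<open>M'\<close> meets each coset of \<open>N\<close> exactly once;
    \<open>d M' k\<close> is the correction that moves \<open>k \<in> M\<close> into
    \<open>M'\<close>.\<close>
  define d where "d M' k = (SOME x. x \<in> N \<and> k + x \<in> M')" for M' k
  have ex: "derivation (d M') \<and> M' = (\<lambda>k. k + d M' k) ` M" if "M' \<in> core_free_max_subrings e R n" for M'
  proof -
    from that have M': "max_subring e R M'" "core_free R M'" "card R = n * card M'" by (auto simp: core_free_max_subrings_def)
    note m' = max_subringD[OF M'(1)]
    note MR' = ring_onD[OF m'(1)] and S' = core_free_sum(1)[OF R M' N(1,2)]
    have cap': "M' \<inter> N = {0}" by (rule cap[OF M' N(1,2) order_refl])
    have d: "d M' k \<in> N" "k + d M' k \<in> M'" if k: "k \<in> M" for k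
    proof -
      obtain k' x where k': "k' \<in> M'" "x \<in> N" "k = k' + x" using k m(2) S' by auto
      then have "- x \<in> N \<and> k + - x \<in> M'" using addsub_uminus[OF ND(1)] by simp
      then have "d M' k \<in> N \<and> k + d M' k \<in> M'" unfolding d_def by (rule someI)
      then show "d M' k \<in> N" "k + d M' k \<in> M'" by auto
    qed
    have un: "d M' k = x" if "k \<in> M" "x \<in> N" "k + x \<in> M'" for k x
    proof -
      have "d M' k - x \<in> M'" using addsub_diff[OF MR'(1) d(2)[OF that(1)] that(3)] by (simp add: algebra_simps)
      moreover have "d M' k - x \<in> N" by (rule addsub_diff[OF ND(1) d(1)[OF that(1)] that(2)])
      ultimately have "d M' k - x = 0" using cap' by blast
      then show ?thesis by simp
    qed
    have "derivation (d M')"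
      unfolding derivation_def
    proof (intro conjI ballI)
      show "d M' k \<in> N" if "k \<in> M" for k by (rule d(1)[OF that])
      fix k l assume kl: "k \<in> M" "l \<in> M"
      show "d M' (k - l) = d M' k - d M' l"
      proof (rule un)
        show "k - l \<in> M" by (rule addsub_diff[OF MR(1) kl])
        show "d M' k - d M' l \<in> N" by (rule addsub_diff[OF ND(1) d(1)[OF kl(1)] d(1)[OF kl(2)]])
        show "k - l + (d M' k - d M' l) \<in> M'"
          using addsub_diff[OF MR'(1) d(2)[OF kl(1)] d(2)[OF kl(2)]] by (simp add: algebra_simps)
      qed
      show "d M' (k * l) = k * d M' l + d M' k * l"
      proof (rule un)
        show "k * l \<in> M" by (rule MR(2)[OF kl])
        show "k * d M' l + d M' k * l \<in> N"
          by (rule addsub_add[OF ND(1) left[OF kl(1) d(1)[OF kl(2)]] right[OF kl(2) d(1)[OF kl(1)]]])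
        show "k * l + (k * d M' l + d M' k * l) \<in> M'"
          using MR'(2)[OF d(2)[OF kl(1)] d(2)[OF kl(2)]] N(3)[OF d(1)[OF kl(1)] d(1)[OF kl(2)]]
          by (simp add: algebra_simps)
      qed
    qed
    moreover have "M' = (\<lambda>k. k + d M' k) ` M"
    proof (intro equalityI subsetI)
      fix k' assume k': "k' \<in> M'"
      then obtain k x where k: "k \<in> M" "x \<in> N" "k' = k + x" using m'(2) S by auto
      then have "d M' k = x" using un k' by blast
      then show "k' \<in> (\<lambda>k. k + d M' k) ` M" using k by blast
    qed (use d in blast)
    ultimately show ?thesis by blast
  qed
  have "card (core_free_max_subrings e R n) \<le> card N"
  proof (rule card_inj_on_le[where f = "\<lambda>M'. \<Phi> (d M')"])
    show "inj_on (\<lambda>M'. \<Phi> (d M')) (core_free_max_subrings e R n)"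
    proof (rule inj_onI)
      fix M1 M2 assume *: "M1 \<in> core_free_max_subrings e R n" "M2 \<in> core_free_max_subrings e R n" "\<Phi> (d M1) = \<Phi> (d M2)"
      have "d M1 m = d M2 m" if "m \<in> M" for m using \<Phi>(2) ex[OF *(1)] ex[OF *(2)] *(3) that by blast
      then have "(\<lambda>k. k + d M1 k) ` M = (\<lambda>k. k + d M2 k) ` M" by (intro image_cong) auto
      then show "M1 = M2" using ex[OF *(1)] ex[OF *(2)] by simp
    qed
    show "(\<lambda>M'. \<Phi> (d M')) ` core_free_max_subrings e R n \<subseteq> N" using \<Phi>(1) ex by blast
  qed (rule finN)
  then show ?thesis using cN by simp
qed simp

section \<open>Automorphisms of simple rings, and semiprime rings that are not prime\<close>

definition ring_aut :: "'r::ring_1 set \<Rightarrow> ('r \<Rightarrow> 'r) \<Rightarrow> bool" where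
  "ring_aut S h \<longleftrightarrow> bij_betw h S S \<and> (\<forall>x\<in>S. \<forall>y\<in>S. h (x + y) = h x + h y) \<and> (\<forall>x\<in>S. \<forall>y\<in>S. h (x * y) = h x * h y)"

lemma ring_autD:
  assumes "ring_aut S h"
  shows "\<And>x. x \<in> S \<Longrightarrow> h x \<in> S" "\<And>x y. x \<in> S \<Longrightarrow> y \<in> S \<Longrightarrow> h (x + y) = h x + h y"
    "\<And>x y. x \<in> S \<Longrightarrow> y \<in> S \<Longrightarrow> h (x * y) = h x * h y" "inj_on h S" "\<And>y. y \<in> S \<Longrightarrow> \<exists>x\<in>S. h x = y"
proof -
  have b: "bij_betw h S S" using assms by (simp add: ring_aut_def)
  show "\<And>x. x \<in> S \<Longrightarrow> h x \<in> S" "inj_on h S" using b by (auto simp: bij_betw_def)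
  show "\<exists>x\<in>S. h x = y" if "y \<in> S" for y using b that unfolding bij_betw_def by (metis imageE)
  show "\<And>x y. x \<in> S \<Longrightarrow> y \<in> S \<Longrightarrow> h (x + y) = h x + h y" "\<And>x y. x \<in> S \<Longrightarrow> y \<in> S \<Longrightarrow> h (x * y) = h x * h y"
    using assms unfolding ring_aut_def by blast+
qed

lemma ring_aut_comp:
  assumes "ring_aut S g" "ring_aut S h"
  shows "ring_aut S (g \<circ> h)"
proof -
  have "bij_betw (g \<circ> h) S S" using assms bij_betw_trans unfolding ring_aut_def by blast
  then show ?thesis using ring_autD(2,3)[OF assms(1)] ring_autD(1-3)[OF assms(2)]
    unfolding ring_aut_def by simp
qed

lemma ring_aut_inv:
  assumes h: "ring_aut S h" and S: "\<And>x y. x \<in> S \<Longrightarrow> y \<in> S \<Longrightarrow> x + y \<in> S" "\<And>x y. x \<in> S \<Longrightarrow> y \<in> S \<Longrightarrow> x * y \<in> S"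
  shows "ring_aut S (inv_into S h)"
proof -
  note H = ring_autD[OF h]
  have b: "bij_betw h S S" using h by (simp add: ring_aut_def)
  have i: "inv_into S h y \<in> S" "h (inv_into S h y) = y" if "y \<in> S" for y
    using b that by (auto simp: bij_betw_def inv_into_into f_inv_into_f)
  have un: "inv_into S h y = x" if "x \<in> S" "h x = y" for x y using H(4) that by (metis inv_into_f_f)
  show ?thesis
    unfolding ring_aut_def using bij_betw_inv_into[OF b] i S H(2,3) by (auto intro!: un)
qed

text \<open>The Skolem-Noether theorem. For a nonzero \<open>y\<close> in \<open>V\<close> with
  \<open>k f * y = y\<close>, the map \<open>v \<mapsto> k v * y\<close> is \<open>F\<close>-linear
  because \<open>k\<close> fixes the centre, so it is left multiplication by some \<open>u\<close>.
  Comparing values at \<open>s * v\<close> gives \<open>u * s = k s * u\<close>.\<close>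

lemma (in simple_frame) center_fixing_aut_inner:
  assumes k: "ring_aut S k" and kZ: "\<And>z. z \<in> Z \<Longrightarrow> k z = z"
  shows "\<exists>u\<in>S. u \<noteq> 0 \<and> (\<forall>s\<in>S. u * s = k s * u)"
proof -
  note K = ring_autD[OF k]
  have k0: "k 0 = 0" using K(2)[of 0 0] addsub_zero[OF R(1)] by simp
  have kf: "k f \<in> S" "k f * k f = k f" using K(1)[OF f(1)] K(3)[OF f(1) f(1)] f(3) by simp_all
  have "k f \<noteq> 0"
  proof
    assume "k f = 0"
    then have "f = 0" using K(4) k0 f(1) addsub_zero[OF R(1)] by (auto simp: inj_on_def)
    then show False using f by simp
  qed
  then obtain v0 where v0: "v0 \<in> V" "k f * v0 \<noteq> 0" using faithful[OF kf(1)] by blast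
  define y where "y = k f * v0"
  have y: "y \<in> V" "y \<noteq> 0" "k f * y = y"
    using VM(2)[OF kf(1) v0(1)] v0(2) kf(2) by (simp_all add: y_def flip: mult.assoc)
  define u where "u = sum_list (map (\<lambda>(a, b). k a * y * b) ps)"
  have D: "k v * y = u * v" if v: "v \<in> V" for v
    unfolding u_def
  proof (rule linear_is_mult[OF _ _ v])
    show "k (v + w) * y = k v * y + k w * y" if "v \<in> V" "w \<in> V" for v w
    proof -
      have "v \<in> S" "w \<in> S" using that V_sub by blast+
      then show ?thesis using K(2) by (simp add: distrib_right)
    qed
    fix v x assume vx: "v \<in> V" "x \<in> F"
    obtain z where z: "z \<in> Z" "\<And>v. v \<in> V \<Longrightarrow> z * v = v * x" using corner_from_center[OF vx(2)] by blast
    have vS: "v \<in> S" using vx V_sub by blast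
    have "k (v * x) = z * k v" using z(2)[OF vx(1)] K(3)[of z v] kZ[OF z(1)] z(1) Z_sub vS by auto
    then have "k (v * x) * y = z * (k v * y)" by (simp add: mult.assoc)
    also have "\<dots> = k v * y * x" by (rule z(2)[OF VM(2)[OF K(1)[OF vS] y(1)]])
    finally show "k (v * x) * y = k v * y * x" .
  qed
  have uS: "u \<in> S" unfolding u_def
  proof (rule sum_list_in_S)
    fix a b assume "(a, b) \<in> set ps"
    then have ab: "a \<in> S" "b \<in> S" using ps V_sub by blast+
    have "y \<in> S" using y(1) V_sub by blast
    then show "k a * y * b \<in> S" by (intro R(2) K(1) ab)
  qed
  have "u * s = k s * u" if s: "s \<in> S" for s
  proof (rule eq_on_V)
    show "u * s \<in> S" "k s * u \<in> S" using R(2) uS s K(1) by auto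
    fix v assume v: "v \<in> V"
    have vS: "v \<in> S" using v V_sub by blast
    have "u * (s * v) = k (s * v) * y" using D[OF VM(2)[OF s v]] by simp
    also have "\<dots> = k s * (u * v)" using K(3)[OF s vS] D[OF v] by (simp add: mult.assoc)
    finally show "u * s * v = k s * u * v" by (simp add: mult.assoc)
  qed
  moreover have "u \<noteq> 0" using D[OF f_V] y by auto
  ultimately show ?thesis using uS by blast
qed

lemma (in simple_frame) finite_auts: "finite {h \<in> S \<rightarrow>\<^sub>E S. ring_aut S h}"
  using finite_PiE[OF fin, of "\<lambda>_. S"] fin by simp

text \<open>An automorphism moves a generator of the centre in at most \<open>card Z - 1\<close> ways, and two
  automorphisms agreeing on the centre differ by conjugation with an element that is unique
  up to the \<open>card Z - 1\<close> nonzero central elements.\<close>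

lemma (in simple_frame) card_auts: "card {h \<in> S \<rightarrow>\<^sub>E S. ring_aut S h} \<le> card S"
proof -
  have cZ: "x * y = y * x" if "x \<in> Z" "y \<in> Z" for x y using center_comm Z_sub that by blast
  obtain c where c: "c \<in> Z" "c \<noteq> 0" "Z - {0} = (\<lambda>i. c ^ i) ` {1..card Z - 1}"
    using field_on_generator[OF div_Z cZ] by metis
  have cS: "c \<in> S" using c Z_sub by blast
  define B where "B w = {h \<in> S \<rightarrow>\<^sub>E S. ring_aut S h \<and> h c = w}" for w
  have finB: "finite (B w)" for w by (rule finite_subset[OF _ finite_auts]) (auto simp: B_def)
  have bound: "card (B w) * (card Z - 1) \<le> card S" for w
  proof (cases "B w = {}")
    case False
    then obtain g where g: "g \<in> B w" by blast
    have ga: "ring_aut S g" "g c = w" using g by (auto simp: B_def)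
    note G = ring_autD[OF ga(1)]
    show ?thesis
    \<comment> \<open>The witnesses of \<open>h\<close> are the elements that intertwine
      \<open>g\<close> with \<open>h\<close>; among them are all nonzero central multiples of one
      \<open>u\<close>.\<close>
    proof (rule card_disjoint_bound[where X = "\<lambda>h. {t \<in> S. t \<noteq> 0 \<and> (\<forall>s\<in>S. t * g s = h s * t)}", OF fin _ _ _ finB])
      fix h assume h: "h \<in> B w"
      have ha: "ring_aut S h" "h c = w" using h by (auto simp: B_def)
      note H = ring_autD[OF ha(1)]
      have pS: "c ^ i \<in> S" if "i > 0" for i using power_closed[of S c i] R(2) cS that by blast
      have pw: "h' (c ^ i) = h' c ^ i" if "ring_aut S h'" "i > 0" for h' i
        using that(2)
      proof (induction i)
        case (Suc i)
        then show ?case using ring_autD(3)[OF that(1) cS pS[of i]] by (cases "i = 0") auto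
      qed simp
      have ag: "h z = g z" if z: "z \<in> Z" for z
      proof (cases "z = 0")
        case True
        have z0: "h' 0 = 0" if "ring_aut S h'" for h'
          using ring_autD(2)[OF that, of 0 0] addsub_zero[OF R(1)] by simp
        then show ?thesis using z0[OF ga(1)] z0[OF ha(1)] True by simp
      next
        case False
        then obtain i where "i \<in> {1..card Z - 1}" "z = c ^ i" using c(3) z by blast
        then show ?thesis using pw[OF ha(1), of i] pw[OF ga(1), of i] ha ga by simp
      qed
      have gi: "ring_aut S (inv_into S g)" by (rule ring_aut_inv[OF ga(1) addsub_add[OF R(1)] R(2)])
      have gZ: "g z \<in> Z" if z: "z \<in> Z" for z
      proof (rule Z_intro)
        have zS: "z \<in> S" using z Z_sub by blast
        show "g z \<in> S" by (rule G(1)[OF zS])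
        fix s assume "s \<in> S"
        then obtain s' where s': "s' \<in> S" "g s' = s" using G(5) by blast
        show "g z * s = s * g z" using G(3)[OF zS s'(1)] G(3)[OF s'(1) zS] center_comm[OF z s'(1)] s'(2) by simp
      qed
      have gZeq: "g ` Z = Z"
      proof (rule card_subset_eq[OF finZ])
        show "g ` Z \<subseteq> Z" using gZ by blast
        show "card (g ` Z) = card Z" by (rule card_image[OF inj_on_subset[OF G(4) Z_sub]])
      qed
      have "\<exists>u\<in>S. u \<noteq> 0 \<and> (\<forall>s\<in>S. u * s = (h \<circ> inv_into S g) s * u)"
      proof (rule center_fixing_aut_inner[OF ring_aut_comp[OF ha(1) gi]])
        fix z assume "z \<in> Z"
        then have "z \<in> g ` Z" by (simp only: gZeq)
        then obtain z' where z': "z' \<in> Z" "g z' = z" by blast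
        have "z' \<in> S" using z'(1) Z_sub by blast
        then have "inv_into S g z = z'" using inv_into_f_f[OF G(4)] z'(2) by blast
        then have "(h \<circ> inv_into S g) z = h z'" by (simp only: comp_apply)
        also have "\<dots> = z" unfolding ag[OF z'(1)] by (rule z'(2))
        finally show "(h \<circ> inv_into S g) z = z" .
      qed
      then obtain u where u: "u \<in> S" "u \<noteq> 0" "\<And>s. s \<in> S \<Longrightarrow> u * s = h (inv_into S g s) * u"
        unfolding comp_apply by blast
      have ug: "u * g s = h s * u" if "s \<in> S" for s
        using u(3)[OF G(1)[OF that]] inv_into_f_f[OF G(4) that] by simp
      have "card Z - 1 = card (Z - {0})" using finZ addsub_zero[OF ring_onD(1)[OF ring_Z]] by simp
      also have "\<dots> = card ((\<lambda>z. z * u) ` (Z - {0}))"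
      proof (rule card_image[symmetric], rule inj_onI)
        fix z z' assume *: "z \<in> Z - {0}" "z' \<in> Z - {0}" "z * u = z' * u"
        show "z = z'"
        proof (rule ccontr)
          assume "z \<noteq> z'"
          moreover have "(z - z') * u = 0" using *(3) by (simp add: left_diff_distrib)
          moreover have "z - z' \<in> Z" using addsub_diff[OF ring_onD(1)[OF ring_Z]] * by blast
          ultimately show False using center_regular u(1,2) by (metis right_minus_eq)
        qed
      qed
      also have "\<dots> \<le> card {t \<in> S. t \<noteq> 0 \<and> (\<forall>s\<in>S. t * g s = h s * t)}"
      proof (rule card_mono)
        show "finite {t \<in> S. t \<noteq> 0 \<and> (\<forall>s\<in>S. t * g s = h s * t)}" using fin by simp
        show "(\<lambda>z. z * u) ` (Z - {0}) \<subseteq> {t \<in> S. t \<noteq> 0 \<and> (\<forall>s\<in>S. t * g s = h s * t)}"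
        proof clarify
          fix z assume z: "z \<in> Z" "z \<noteq> 0"
          have "z * u * g s = h s * (z * u)" if s: "s \<in> S" for s
          proof -
            have "z * (u * g s) = z * h s * u" using ug[OF s] by (simp add: mult.assoc)
            also have "\<dots> = h s * z * u" using center_comm[OF z(1) H(1)[OF s]] by simp
            finally show ?thesis by (simp add: mult.assoc)
          qed
          then show "z * u \<in> S \<and> z * u \<noteq> 0 \<and> (\<forall>s\<in>S. z * u * g s = h s * (z * u))"
            using R(2) z Z_sub u center_regular[OF z u(1)] by blast
        qed
      qed
      finally show "card Z - 1 \<le> card {t \<in> S. t \<noteq> 0 \<and> (\<forall>s\<in>S. t * g s = h s * t)}" .
      fix h' t assume h': "h' \<in> B w" and t: "t \<in> {t \<in> S. t \<noteq> 0 \<and> (\<forall>s\<in>S. t * g s = h s * t)}"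
        "t \<in> {t \<in> S. t \<noteq> 0 \<and> (\<forall>s\<in>S. t * g s = h' s * t)}"
      have tS: "t \<in> S" "t \<noteq> 0" "\<And>s. s \<in> S \<Longrightarrow> t * g s = h s * t" "\<And>s. s \<in> S \<Longrightarrow> h s * t = h' s * t" using t by auto
      \<comment> \<open>The left annihilator of \<open>t\<close> is also stable under right
        multiplication, because every \<open>s * t\<close> is of the form \<open>t * g s'\<close>.
        So it is zero, \<open>t\<close> can be cancelled, and \<open>t\<close> determines
        \<open>h\<close>.\<close>
      have canc: "x = 0" if x: "x \<in> S" "x * t = 0" for x
      proof (rule ccontr)
        assume "x \<noteq> 0"
        have "ideal_on S {x \<in> S. x * t = 0}"
        proof (rule ideal_onI)
          show "addsub {x \<in> S. x * t = 0}" by (rule addsub_kernel[OF R(1)]) (simp add: left_diff_distrib)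
          fix s x assume s: "s \<in> S" and x: "x \<in> {x \<in> S. x * t = 0}"
          show "s * x \<in> {x \<in> S. x * t = 0}" using R(2) s x by (simp add: mult.assoc)
          obtain s' where s': "s' \<in> S" "h s' = s" using H(5)[OF s] by blast
          have "x * (s * t) = x * t * g s'" using tS(3)[OF s'(1)] s'(2) by (simp add: mult.assoc)
          also have "\<dots> = 0" using x by simp
          finally show "x * s \<in> {x \<in> S. x * t = 0}" using R(2) s x by (simp add: mult.assoc)
        qed auto
        then have "{x \<in> S. x * t = 0} = S" by (rule simpleD[OF _ _ \<open>x \<noteq> 0\<close>]) (use x in auto)
        then have "e * t = 0" using R(3) by blast
        then show False using R(4)[OF tS(1)] tS(2) by simp
      qed
      have h'a: "ring_aut S h'" using h' by (auto simp: B_def)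
      have "h s = h' s" if "s \<in> S" for s
      proof -
        have "h s - h' s \<in> S" by (rule addsub_diff[OF R(1) H(1)[OF that] ring_autD(1)[OF h'a that]])
        moreover have "(h s - h' s) * t = 0" using tS(4)[OF that] by (simp add: left_diff_distrib)
        ultimately have "h s - h' s = 0" by (rule canc)
        then show ?thesis by simp
      qed
      then show "h = h'" using h h' by (intro PiE_ext[of h S "\<lambda>_. S"]) (auto simp: B_def)
    qed auto
  qed simp
  have "{h \<in> S \<rightarrow>\<^sub>E S. ring_aut S h} \<subseteq> (\<Union>w\<in>Z - {0}. B w)"
  proof
    fix h assume h: "h \<in> {h \<in> S \<rightarrow>\<^sub>E S. ring_aut S h}"
    then have ha: "ring_aut S h" by simp
    note H = ring_autD[OF ha]
    have "h c \<in> Z"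
    proof (rule Z_intro[OF H(1)[OF cS]])
      fix s assume "s \<in> S"
      then obtain s' where s': "s' \<in> S" "h s' = s" using H(5) by blast
      show "h c * s = s * h c" using H(3)[OF cS s'(1)] H(3)[OF s'(1) cS] center_comm[OF c(1) s'(1)] s'(2) by simp
    qed
    moreover have "h c \<noteq> 0"
    proof
      assume "h c = 0"
      moreover have "h 0 = 0" using H(2)[of 0 0] addsub_zero[OF R(1)] by simp
      ultimately show False using H(4) cS c(2) addsub_zero[OF R(1)] by (auto simp: inj_on_def)
    qed
    ultimately show "h \<in> (\<Union>w\<in>Z - {0}. B w)" using h by (auto simp: B_def)
  qed
  then have "card {h \<in> S \<rightarrow>\<^sub>E S. ring_aut S h} \<le> card (\<Union>w\<in>Z - {0}. B w)"
    using finB finZ by (intro card_mono) auto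
  also have "\<dots> \<le> (\<Sum>w\<in>Z - {0}. card (B w))" by (rule card_UN_le) (use finZ in simp)
  finally have "card {h \<in> S \<rightarrow>\<^sub>E S. ring_aut S h} * (card Z - 1) \<le> (\<Sum>w\<in>Z - {0}. card (B w)) * (card Z - 1)"
    by (rule mult_right_mono) simp
  also have "\<dots> = (\<Sum>w\<in>Z - {0}. card (B w) * (card Z - 1))" by (rule sum_distrib_right)
  also have "\<dots> \<le> (\<Sum>w\<in>Z - {0}. card S)" by (rule sum_mono) (rule bound)
  also have "\<dots> = card S * (card Z - 1)" using finZ addsub_zero[OF ring_onD(1)[OF ring_Z]] by (simp add: mult.commute)
  finally show ?thesis using q2 by simp
qed

text \<open>Let \<open>I I' = 0\<close> with both ideals nonzero. As \<open>R = M + I'\<close> and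
  \<open>I'\<close> annihilates \<open>I\<close>, the intersection \<open>M \<inter> I\<close> is an
  ideal of \<open>R\<close>, hence zero, and likewise \<open>M \<inter> I'\<close>; so both ideals
  have order \<open>n\<close>. Moreover \<open>M\<close> is simple and meets \<open>I + I'\<close>
  nontrivially, which forces \<open>R = I + I'\<close> and splits the unit.\<close>

lemma semiprime_count:
  assumes R: "ring_on e R" "finite R" "e \<noteq> 0" and np: "\<not> prime_on e R"
    and sp: "\<And>N. ideal_on R N \<Longrightarrow> (\<And>x y. x \<in> N \<Longrightarrow> y \<in> N \<Longrightarrow> x * y = 0) \<Longrightarrow> N = {0}"
  shows "card (core_free_max_subrings e R n) \<le> n"
proof (cases "core_free_max_subrings e R n = {}")
  case False
  note RR = ring_onD[OF R(1)]
  obtain I I' where I: "ideal_on R I" "I \<noteq> {0}" and I': "ideal_on R I'" "I' \<noteq> {0}"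
    and II': "\<And>x y. x \<in> I \<Longrightarrow> y \<in> I' \<Longrightarrow> x * y = 0"
    using np R unfolding prime_on_def by blast
  note ID = ideal_onD[OF I(1)] and ID' = ideal_onD[OF I'(1)]
  have ideal_Int: "ideal_on R (X \<inter> Y)" if "ideal_on R X" "ideal_on R Y" for X Y
  proof (rule ideal_onI)
    note XD = ideal_onD[OF that(1)] and YD = ideal_onD[OF that(2)]
    show "addsub (X \<inter> Y)" by (rule addsub_Int[OF XD(1) YD(1)])
    show "X \<inter> Y \<subseteq> R" using XD(2) by blast
    fix s x assume "s \<in> R" "x \<in> X \<inter> Y"
    then show "s * x \<in> X \<inter> Y" "x * s \<in> X \<inter> Y" using XD(3,4) YD(3,4) by auto
  qed
  have disj: "I \<inter> I' = {0}" by (rule sp[OF ideal_Int[OF I(1) I'(1)]]) (use II' in blast)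
  have I'I: "y * x = 0" if "x \<in> I" "y \<in> I'" for x y
  proof -
    have "y * x \<in> I \<inter> I'" using ID(3) ID'(4) ID(2) ID'(2) that by blast
    then show ?thesis using disj by blast
  qed
  have finI: "finite I" and finI': "finite I'" using ID(2) ID'(2) R(2) finite_subset by auto
  have cap: "M \<inter> X = {0}" if M: "max_subring e R M" "core_free R M" "card R = n * card M"
    and X: "ideal_on R X" and Y: "ideal_on R Y" "Y \<noteq> {0}"
    and XY: "\<And>x y. x \<in> X \<Longrightarrow> y \<in> Y \<Longrightarrow> x * y = 0 \<and> y * x = 0" for M X Y
  proof -
    note XD = ideal_onD[OF X] and m = max_subringD[OF M(1)] and S = core_free_sum(1)[OF R(1,2) M Y]
    have "ideal_on R (M \<inter> X)"
    proof (rule ideal_onI)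
      show "addsub (M \<inter> X)" by (rule addsub_Int[OF ring_onD(1)[OF m(1)] XD(1)])
      show "M \<inter> X \<subseteq> R" using XD(2) by blast
      fix s x assume s: "s \<in> R" and x: "x \<in> M \<inter> X"
      obtain k y where k: "k \<in> M" "y \<in> Y" "s = k + y" using s S by auto
      have "s * x = k * x" "x * s = x * k" using XY[of x y] k(2) x by (auto simp: k(3) distrib_left distrib_right)
      moreover have "k * x \<in> M" "x * k \<in> M" using ring_onD(2)[OF m(1)] k(1) x by auto
      moreover have "s * x \<in> X" "x * s \<in> X" using XD(3,4)[OF s] x by auto
      ultimately show "s * x \<in> M \<inter> X" "x * s \<in> M \<inter> X" by auto
    qed
    then show ?thesis using M(2) unfolding core_free_def by blast
  qed
  have MI: "M \<inter> I = {0}" "M \<inter> I' = {0}" "card I = n" "card I' = n"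
    if M: "max_subring e R M" "core_free R M" "card R = n * card M" for M
  proof -
    show 1: "M \<inter> I = {0}" by (rule cap[OF M I(1) I']) (use II' I'I in blast)
    show 2: "M \<inter> I' = {0}" by (rule cap[OF M I'(1) I]) (use II' I'I in blast)
    show "card I = n" by (rule core_free_sum(2)[OF R(1,2) M I 1])
    show "card I' = n" by (rule core_free_sum(2)[OF R(1,2) M I' 2])
  qed
  obtain M0 where "M0 \<in> core_free_max_subrings e R n" using False by blast
  then have M0: "max_subring e R M0" "core_free R M0" "card R = n * card M0" by (auto simp: core_free_max_subrings_def)
  have cI: "card I = n" "card I' = n" by (rule MI[OF M0])+
  have n2: "n \<ge> 2"
  proof -
    obtain x where x: "x \<in> I" "x \<noteq> 0" using nonzero_elem[OF ID(1) I(2)] by blast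
    have "card {0, x} \<le> card I" by (rule card_mono[OF finI]) (use x addsub_zero[OF ID(1)] in blast)
    then show ?thesis using x(2) cI(1) by simp
  qed
  define Tt where "Tt = {x + y | x y. x \<in> I \<and> y \<in> I'}"
  have Tt: "ideal_on R Tt"
  proof (rule ideal_onI)
    show "addsub Tt" unfolding Tt_def by (rule addsub_setsum[OF ID(1) ID'(1)])
    show "Tt \<subseteq> R" unfolding Tt_def using ID(2) ID'(2) by (auto intro!: addsub_add[OF RR(1)])
    fix s t assume s: "s \<in> R" and "t \<in> Tt"
    then obtain x y where xy: "x \<in> I" "y \<in> I'" "t = x + y" by (auto simp: Tt_def)
    show "s * t \<in> Tt" "t * s \<in> Tt"
      unfolding Tt_def xy(3) distrib_left distrib_right using ID(3,4)[OF s xy(1)] ID'(3,4)[OF s xy(2)] by blast+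
  qed
  have ITt: "I \<subseteq> Tt" "I' \<subseteq> Tt" unfolding Tt_def using addsub_zero[OF ID(1)] addsub_zero[OF ID'(1)] by force+
  have M_structure: "simple_on e M \<and> M \<subseteq> Tt" if M: "max_subring e R M" "core_free R M" "card R = n * card M" for M
  proof -
    note m = max_subringD[OF M(1)]
    note MR = ring_onD[OF m(1)] and S' = core_free_sum(1)[OF R(1,2) M I']
    have finM: "finite M" using m(2) R(2) by (rule finite_subset)
    interpret bimodule e M I
    proof
      show "ring_on e M" "finite M" "finite I" "addsub I" "I \<noteq> {0}" by (fact m(1) finM finI ID(1) I(2))+
      show "k * x \<in> I" "x * k \<in> I" if "k \<in> M" "x \<in> I" for k x using ID(3,4) m(2) that by blast+
      show "e * x = x" "x * e = x" if "x \<in> I" for x using RR(4,5) ID(2) that by blast+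
      fix X assume X: "X \<subseteq> I" "addsub X" "\<And>m x. m \<in> M \<Longrightarrow> x \<in> X \<Longrightarrow> m * x \<in> X" "\<And>m x. m \<in> M \<Longrightarrow> x \<in> X \<Longrightarrow> x * m \<in> X"
      show "X = {0} \<or> X = I"
      proof (cases "X = {0}")
        case False
        have iX: "ideal_on R X"
        proof (rule ideal_onI[OF X(2)])
          show "X \<subseteq> R" using X(1) ID(2) by blast
          fix s x assume s: "s \<in> R" and x: "x \<in> X"
          obtain k y where k: "k \<in> M" "y \<in> I'" "s = k + y" using s S' by auto
          have "s * x = k * x" "x * s = x * k"
            using II'[of x y] I'I[of x y] k(2) x X(1) by (auto simp: k(3) distrib_left distrib_right)
          then show "s * x \<in> X" "x * s \<in> X" using X(3,4) k(1) x by auto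
        qed
        have "M \<inter> X = {0}" using MI(1)[OF M] X(1) addsub_zero[OF X(2)] addsub_zero[OF MR(1)] by blast
        then have "card X = n" by (rule core_free_sum(2)[OF R(1,2) M iX False])
        then show ?thesis using card_subset_eq[OF finI X(1)] cI(1) by simp
      qed simp
    qed
    have "simple_on e M"
    proof (rule prime_if_right_faithful)
      fix x assume x: "x \<in> M" "\<And>y. y \<in> I \<Longrightarrow> y * x = 0"
      \<comment> \<open>An \<open>x\<close> in \<open>M\<close> with \<open>I x = 0\<close> lies in
        the right annihilator \<open>K\<close> of \<open>I\<close>. As \<open>R\<close> has no
        nonzero ideal of square zero, \<open>K\<close> and \<open>I\<close> annihilate each other on
        both sides, so \<open>M \<inter> K\<close> vanishes as well.\<close>
      define K where "K = {s \<in> R. \<forall>p\<in>I. p * s = 0}"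
      have K: "ideal_on R K" unfolding K_def by (rule right_annihilator_ideal[OF R(1) ID(2,4)])
      note KD = ideal_onD[OF K]
      have "K \<inter> I = {0}" by (rule sp[OF ideal_Int[OF K I(1)]]) (auto simp: K_def)
      moreover have "k * i \<in> K \<inter> I" if "k \<in> K" "i \<in> I" for k i using KD(2,4) ID(2,3) that by blast
      ultimately have KI: "k * i = 0 \<and> i * k = 0" if "k \<in> K" "i \<in> I" for k i
        using that unfolding K_def by blast
      have "M \<inter> K = {0}" by (rule cap[OF M K I]) (use KI in blast)
      moreover have "x \<in> K" using x m(2) by (auto simp: K_def)
      ultimately show "x = 0" using x(1) by blast
    qed
    moreover have "M \<subseteq> Tt"
    proof -
      \<comment> \<open>Comparing orders, \<open>M\<close> meets \<open>Tt\<close> in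
        \<open>n \<ge> 2\<close> elements, and these form a nonzero ideal of the simple ring
        \<open>M\<close>.\<close>
      let ?D = "M \<inter> Tt"
      have "Tt \<noteq> {0}" using ITt(1) I(2) addsub_zero[OF ID(1)] by blast
      have sumR: "R = {m + x | m x. m \<in> M \<and> x \<in> Tt}" by (rule core_free_sum(1)[OF R(1,2) M Tt \<open>Tt \<noteq> {0}\<close>])
      have cT: "card Tt = n * n"
        using card_sumset[OF ID(1) ID'(1) finI finI'] disj cI by (simp add: Tt_def)
      have "card M * card Tt = card ?D * card R"
        using card_sumset[OF MR(1) ideal_onD(1)[OF Tt] finM finite_subset[OF ideal_onD(2)[OF Tt] R(2)]] sumR by simp
      then have "card M * (n * n) = card ?D * (n * card M)" unfolding cT M(3) .
      then have "(n * card M) * card ?D = (n * card M) * n" by (simp only: mult_ac)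
      then have "card ?D = n \<or> n * card M = 0" unfolding mult_cancel1 .
      moreover have "card M > 0" using MR(3) finM by (auto simp: card_gt_0_iff)
      ultimately have "card ?D = n" using n2 by simp
      then have D0: "?D \<noteq> {0}" using n2 by fastforce
      have "ideal_on M ?D"
      proof (rule ideal_onI[OF addsub_Int[OF MR(1) ideal_onD(1)[OF Tt]]])
        fix s x assume s: "s \<in> M" and x: "x \<in> ?D"
        have "s \<in> R" using s m(2) by blast
        then show "s * x \<in> ?D" "x * s \<in> ?D" using MR(2) s x ideal_onD(3,4)[OF Tt] by auto
      qed simp
      then have "?D = {0} \<or> ?D = M" using \<open>simple_on e M\<close> by (simp add: simple_on_def)
      then show ?thesis using D0 by blast
    qed
    ultimately show ?thesis by blast
  qed
  have TtR: "Tt = R"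
  proof -
    have "R = {m + x | m x. m \<in> M0 \<and> x \<in> I}" by (rule core_free_sum(1)[OF R(1,2) M0 I])
    moreover have "M0 \<subseteq> Tt" using M_structure[OF M0] by blast
    ultimately have "R \<subseteq> Tt" using ITt(1) addsub_add[OF ideal_onD(1)[OF Tt]] by blast
    then show ?thesis using ideal_onD(2)[OF Tt] by blast
  qed
  then obtain e1 e2 where ee: "e1 \<in> I" "e2 \<in> I'" "e = e1 + e2" using RR(3) by (auto simp: Tt_def)
  have e1: "e1 * x = x" "x * e1 = x" if "x \<in> I" for x
  proof -
    have xR: "x \<in> R" using that ID(2) by blast
    have "(e1 + e2) * x = x" "x * (e1 + e2) = x" using RR(4,5)[OF xR] ee(3) by auto
    then show "e1 * x = x" "x * e1 = x"
      using II'[OF that ee(2)] I'I[OF that ee(2)] by (simp_all add: distrib_left distrib_right)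
  qed
  have e2: "e2 * x = x" "x * e2 = x" if "x \<in> I'" for x
  proof -
    have xR: "x \<in> R" using that ID'(2) by blast
    have "(e1 + e2) * x = x" "x * (e1 + e2) = x" using RR(4,5)[OF xR] ee(3) by auto
    then show "e2 * x = x" "x * e2 = x"
      using II'[OF ee(1) that] I'I[OF ee(1) that] by (simp_all add: distrib_left distrib_right)
  qed
  have e1c: "e1 * x = x * e1" "e2 * x = x * e2" "x = e1 * x + e2 * x" "e1 * x \<in> I" "e2 * x \<in> I'" if x: "x \<in> R" for x
  proof -
    obtain y z where yz: "y \<in> I" "z \<in> I'" "x = y + z" using x TtR by (auto simp: Tt_def)
    have "e1 * x = y" "x * e1 = y" "e2 * x = z" "x * e2 = z"
      using e1[OF yz(1)] e2[OF yz(2)] II'[OF ee(1) yz(2)] I'I[OF ee(1) yz(2)] II'[OF yz(1) ee(2)] I'I[OF yz(1) ee(2)]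
      by (simp_all add: yz(3) distrib_left distrib_right)
    then show "e1 * x = x * e1" "e2 * x = x * e2" "x = e1 * x + e2 * x" "e1 * x \<in> I" "e2 * x \<in> I'" using yz by auto
  qed
  have proj: "inj_on ((*) e1) M" "(*) e1 ` M = I" "inj_on ((*) e2) M" "(*) e2 ` M = I'"
    if M: "max_subring e R M" "core_free R M" "card R = n * card M" for M
  proof -
    note m = max_subringD[OF M(1)]
    note MR = ring_onD[OF m(1)]
    have finM: "finite M" using m(2) R(2) by (rule finite_subset)
    have cM: "card M = n"
    proof -
      have "card R = n * n" using card_sumset[OF ID(1) ID'(1) finI finI'] disj cI TtR by (simp add: Tt_def)
      then show ?thesis using M(3) n2 by simp
    qed
    have inj: "inj_on ((*) a) M" if ab: "\<And>x. x \<in> R \<Longrightarrow> a * x = 0 \<Longrightarrow> x \<in> X" "M \<inter> X = {0}" for a X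
    proof (rule inj_onI)
      fix x y assume xy: "x \<in> M" "y \<in> M" "a * x = a * y"
      have "x - y \<in> M" by (rule addsub_diff[OF MR(1) xy(1,2)])
      moreover have "a * (x - y) = 0" using xy(3) by (simp add: right_diff_distrib)
      ultimately have "x - y \<in> M \<inter> X" using ab(1) m(2) by blast
      then show "x = y" using ab(2) by auto
    qed
    show i1: "inj_on ((*) e1) M"
      by (rule inj[OF _ MI(2)[OF M]]) (metis e1c(3,5) add_0)
    show i2: "inj_on ((*) e2) M"
      by (rule inj[OF _ MI(1)[OF M]]) (metis e1c(3,4) add_0_right)
    show "(*) e1 ` M = I"
      by (rule card_subset_eq[OF finI]) (use e1c(4) m(2) card_image[OF i1] cM cI in auto)
    show "(*) e2 ` M = I'"
      by (rule card_subset_eq[OF finI']) (use e1c(5) m(2) card_image[OF i2] cM cI in auto)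
  qed
  have mult1: "e1 * (x * y) = (e1 * x) * (e1 * y)" "e2 * (x * y) = (e2 * x) * (e2 * y)" if "x \<in> R" "y \<in> R" for x y
  proof -
    have "e1 * x * e1 = e1 * x" by (rule e1(2)[OF e1c(4)[OF that(1)]])
    then show "e1 * (x * y) = (e1 * x) * (e1 * y)" by (simp flip: mult.assoc)
    have "e2 * x * e2 = e2 * x" by (rule e2(2)[OF e1c(5)[OF that(1)]])
    then show "e2 * (x * y) = (e2 * x) * (e2 * y)" by (simp flip: mult.assoc)
  qed
  note m0 = max_subringD[OF M0(1)]
  note MR0 = ring_onD[OF m0(1)] and P0 = proj[OF M0]
  have simple_I: "simple_on e1 I"
    unfolding simple_on_def
  proof (intro conjI allI impI)
    show "ring_on e1 I" unfolding ring_on_def using ID(1) ID(2,3) ee(1) e1 by blast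
    show "finite I" by (rule finI)
    show "e1 \<noteq> 0"
    proof
      assume "e1 = 0"
      then have "I \<subseteq> {0}" using e1(1) by fastforce
      then show False using I(2) addsub_zero[OF ID(1)] by blast
    qed
    fix X assume X: "ideal_on I X"
    note XD = ideal_onD[OF X]
    have "ideal_on R X"
    proof (rule ideal_onI[OF XD(1)])
      show "X \<subseteq> R" using XD(2) ID(2) by blast
      fix s x assume s: "s \<in> R" and x: "x \<in> X"
      have xI: "x \<in> I" using x XD(2) by blast
      have "s * x = (e1 * s) * x" using e1(1)[OF xI] e1c(1)[OF s] by (simp add: mult.assoc)
      then show "s * x \<in> X" using XD(3)[OF e1c(4)[OF s] x] by simp
      have "x * s = x * (e1 * s)" using e1(2)[OF xI] by (simp flip: mult.assoc)
      then show "x * s \<in> X" using XD(4)[OF e1c(4)[OF s] x] by simp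
    qed
    show "X = {0} \<or> X = I"
    proof (cases "X = {0}")
      case False
      have "M0 \<inter> X = {0}" using MI(1)[OF M0] XD(2) addsub_zero[OF XD(1)] addsub_zero[OF MR0(1)] by blast
      then have "card X = n" by (rule core_free_sum(2)[OF R(1,2) M0 \<open>ideal_on R X\<close> False])
      then show ?thesis using card_subset_eq[OF finI XD(2)] cI(1) by simp
    qed simp
  qed
  obtain f ps where "simple_frame e1 I f ps" by (rule exists_simple_frame[OF simple_I])
  then interpret simple_frame e1 I f ps .
  text \<open>Each \<open>M\<close> is the graph of an isomorphism \<open>I \<rightarrow> I'\<close>; composing it with the inverse of the
    isomorphism given by \<open>M0\<close> turns it into an automorphism of \<open>I\<close>.\<close>
  define \<pi> where "\<pi> M x = (THE m. m \<in> M \<and> e1 * m = x)" for M x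
  define \<rho> where "\<rho> y = (THE m. m \<in> M0 \<and> e2 * m = y)" for y
  define h where "h M = (\<lambda>x\<in>I. e1 * \<rho> (e2 * \<pi> M x))" for M
  have \<pi>: "\<pi> M x \<in> M" "e1 * \<pi> M x = x" "m \<in> M \<Longrightarrow> e1 * m = x \<Longrightarrow> \<pi> M x = m"
    if M: "max_subring e R M" "core_free R M" "card R = n * card M" and x: "x \<in> I" for M x m
  proof -
    obtain m' where m': "m' \<in> M" "e1 * m' = x" using proj(2)[OF M] x by blast
    have un: "k = k'" if "k \<in> M" "k' \<in> M" "e1 * k = e1 * k'" for k k'
      by (rule inj_onD[OF proj(1)[OF M] that(3,1,2)])
    have "\<pi> M x \<in> M \<and> e1 * \<pi> M x = x" unfolding \<pi>_def
    proof (rule theI[of _ m'])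
      fix k assume "k \<in> M \<and> e1 * k = x"
      then show "k = m'" using un[of k m'] m' by simp
    qed (use m' in simp)
    then show 1: "\<pi> M x \<in> M" and 2: "e1 * \<pi> M x = x" by auto
    show "\<pi> M x = m" if "m \<in> M" "e1 * m = x" by (rule un[OF 1 that(1)]) (simp only: 2 that(2))
  qed
  have \<rho>: "\<rho> y \<in> M0" "e2 * \<rho> y = y" "m \<in> M0 \<Longrightarrow> e2 * m = y \<Longrightarrow> \<rho> y = m" if y: "y \<in> I'" for y m
  proof -
    obtain m' where m': "m' \<in> M0" "e2 * m' = y" using P0(4) y by blast
    have un: "k = k'" if "k \<in> M0" "k' \<in> M0" "e2 * k = e2 * k'" for k k'
      by (rule inj_onD[OF P0(3) that(3,1,2)])
    have "\<rho> y \<in> M0 \<and> e2 * \<rho> y = y" unfolding \<rho>_def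
    proof (rule theI[of _ m'])
      fix k assume "k \<in> M0 \<and> e2 * k = y"
      then show "k = m'" using un[of k m'] m' by simp
    qed (use m' in simp)
    then show 1: "\<rho> y \<in> M0" and 2: "e2 * \<rho> y = y" by auto
    show "\<rho> y = m" if "m \<in> M0" "e2 * m = y" by (rule un[OF 1 that(1)]) (simp only: 2 that(2))
  qed
  have key: "h M \<in> I \<rightarrow>\<^sub>E I \<and> ring_aut I (h M) \<and> M = (\<lambda>x. x + e2 * \<pi> M0 (h M x)) ` I"
    if "M \<in> core_free_max_subrings e R n" for M
  proof -
    from that have M: "max_subring e R M" "core_free R M" "card R = n * card M" by (auto simp: core_free_max_subrings_def)
    note m = max_subringD[OF M(1)]
    note MR = ring_onD[OF m(1)] and p = \<pi>[OF M]
    have e2p: "e2 * \<pi> M x \<in> I'" if "x \<in> I" for x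
      by (rule e1c(5)[OF subsetD[OF m(2) p(1)[OF that]]])
    have r: "\<rho> (e2 * \<pi> M x) \<in> M0" "e2 * \<rho> (e2 * \<pi> M x) = e2 * \<pi> M x" if "x \<in> I" for x
      by (rule \<rho>(1)[OF e2p[OF that]], rule \<rho>(2)[OF e2p[OF that]])
    have hx: "h M x = e1 * \<rho> (e2 * \<pi> M x)" if "x \<in> I" for x using that by (simp add: h_def)
    have hI: "h M x \<in> I" if "x \<in> I" for x
      unfolding hx[OF that] by (rule e1c(4)[OF subsetD[OF m0(2) r(1)[OF that]]])
    have hom: "h M (x + y) = h M x + h M y \<and> h M (x * y) = h M x * h M y" if xy: "x \<in> I" "y \<in> I" for x y
    proof -
      have xyI: "x + y \<in> I" "x * y \<in> I"
        by (rule addsub_add[OF ID(1) xy], rule ID(3)[OF subsetD[OF ID(2) xy(1)] xy(2)])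
      have pR: "\<pi> M x \<in> R" "\<pi> M y \<in> R"
        by (rule subsetD[OF m(2) p(1)[OF xy(1)]], rule subsetD[OF m(2) p(1)[OF xy(2)]])
      have rR: "\<rho> (e2 * \<pi> M x) \<in> R" "\<rho> (e2 * \<pi> M y) \<in> R"
        by (rule subsetD[OF m0(2) r(1)[OF xy(1)]], rule subsetD[OF m0(2) r(1)[OF xy(2)]])
      have 1: "\<pi> M (x + y) = \<pi> M x + \<pi> M y"
        by (rule p(3)[OF xyI(1) addsub_add[OF MR(1) p(1)[OF xy(1)] p(1)[OF xy(2)]]])
          (simp only: distrib_left p(2)[OF xy(1)] p(2)[OF xy(2)])
      have 2: "\<pi> M (x * y) = \<pi> M x * \<pi> M y"
        by (rule p(3)[OF xyI(2) MR(2)[OF p(1)[OF xy(1)] p(1)[OF xy(2)]]])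
          (simp only: mult1(1)[OF pR] p(2)[OF xy(1)] p(2)[OF xy(2)])
      have 3: "\<rho> (e2 * \<pi> M (x + y)) = \<rho> (e2 * \<pi> M x) + \<rho> (e2 * \<pi> M y)"
        by (rule \<rho>(3)[OF e2p[OF xyI(1)] addsub_add[OF MR0(1) r(1)[OF xy(1)] r(1)[OF xy(2)]]])
          (simp only: 1 distrib_left r(2)[OF xy(1)] r(2)[OF xy(2)])
      have 4: "\<rho> (e2 * \<pi> M (x * y)) = \<rho> (e2 * \<pi> M x) * \<rho> (e2 * \<pi> M y)"
        by (rule \<rho>(3)[OF e2p[OF xyI(2)] MR0(2)[OF r(1)[OF xy(1)] r(1)[OF xy(2)]]])
          (simp only: 2 mult1(2)[OF pR] mult1(2)[OF rR] r(2)[OF xy(1)] r(2)[OF xy(2)])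
      show ?thesis unfolding hx[OF xyI(1)] hx[OF xyI(2)] hx[OF xy(1)] hx[OF xy(2)] 3 4 distrib_left mult1(1)[OF rR] by simp
    qed
    have inj: "inj_on (h M) I"
    proof (rule inj_onI)
      fix x y assume xy: "x \<in> I" "y \<in> I" "h M x = h M y"
      have "e1 * \<rho> (e2 * \<pi> M x) = e1 * \<rho> (e2 * \<pi> M y)" using xy(3) unfolding hx[OF xy(1)] hx[OF xy(2)] .
      from inj_onD[OF P0(1) this r(1)[OF xy(1)] r(1)[OF xy(2)]]
      have "e2 * \<rho> (e2 * \<pi> M x) = e2 * \<rho> (e2 * \<pi> M y)" by (rule arg_cong)
      then have "e2 * \<pi> M x = e2 * \<pi> M y" unfolding r(2)[OF xy(1)] r(2)[OF xy(2)] .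
      from inj_onD[OF proj(3)[OF M] this p(1)[OF xy(1)] p(1)[OF xy(2)]]
      have "e1 * \<pi> M x = e1 * \<pi> M y" by (rule arg_cong)
      then show "x = y" unfolding p(2)[OF xy(1)] p(2)[OF xy(2)] .
    qed
    have "h M ` I = I" by (rule card_subset_eq[OF finI _ card_image[OF inj]]) (use hI in blast)
    then have aut: "ring_aut I (h M)" unfolding ring_aut_def bij_betw_def using inj hom by blast
    have pi0: "\<pi> M0 (h M x) = \<rho> (e2 * \<pi> M x)" if x: "x \<in> I" for x
      by (rule \<pi>(3)[OF M0 hI[OF x] r(1)[OF x] hx[OF x, symmetric]])
    have eq: "x + e2 * \<pi> M0 (h M x) = \<pi> M x" if x: "x \<in> I" for x
    proof -
      have "\<pi> M x \<in> R" using p(1)[OF x] m(2) by blast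
      from e1c(3)[OF this] show ?thesis by (simp only: pi0[OF x] r(2)[OF x] p(2)[OF x])
    qed
    have "M = (\<lambda>x. x + e2 * \<pi> M0 (h M x)) ` I"
    proof (intro equalityI subsetI)
      fix k assume k: "k \<in> M"
      have xI: "e1 * k \<in> I" using e1c(4) k m(2) by blast
      have "k = e1 * k + e2 * \<pi> M0 (h M (e1 * k))" unfolding eq[OF xI] p(3)[OF xI k refl] ..
      then show "k \<in> (\<lambda>x. x + e2 * \<pi> M0 (h M x)) ` I" using xI by (rule image_eqI)
    next
      fix k assume "k \<in> (\<lambda>x. x + e2 * \<pi> M0 (h M x)) ` I"
      then obtain x where x: "x \<in> I" "k = x + e2 * \<pi> M0 (h M x)" by blast
      then show "k \<in> M" using p(1)[OF x(1)] by (simp only: eq[OF x(1)])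
    qed
    moreover have "h M \<in> I \<rightarrow>\<^sub>E I" using hI by (auto simp: h_def)
    ultimately show ?thesis using aut by blast
  qed
  have "card (core_free_max_subrings e R n) \<le> card {g \<in> I \<rightarrow>\<^sub>E I. ring_aut I g}"
  proof (rule card_inj_on_le[where f = h])
    show "inj_on h (core_free_max_subrings e R n)"
    proof (rule inj_onI)
      fix M1 M2 assume *: "M1 \<in> core_free_max_subrings e R n" "M2 \<in> core_free_max_subrings e R n" "h M1 = h M2"
      have 1: "M1 = (\<lambda>x. x + e2 * \<pi> M0 (h M1 x)) ` I" and 2: "M2 = (\<lambda>x. x + e2 * \<pi> M0 (h M2 x)) ` I"
        by (rule conjunct2[OF conjunct2[OF key[OF *(1)]]], rule conjunct2[OF conjunct2[OF key[OF *(2)]]])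
      show "M1 = M2" by (rule trans[OF 1[unfolded *(3)] 2[symmetric]])
    qed
    show "h ` core_free_max_subrings e R n \<subseteq> {g \<in> I \<rightarrow>\<^sub>E I. ring_aut I g}" using key by blast
  qed (rule finite_auts)
  also have "\<dots> \<le> card I" by (rule card_auts)
  finally show ?thesis using cI by simp
qed simp

theorem core_free_max_subrings_bound:
  assumes R: "ring_on e R" "finite R"
  shows "finite (core_free_max_subrings e R n)"
    "real (card (core_free_max_subrings e R n)) \<le> real n * (4 + 12 * log 2 n)"
proof -
  show "finite (core_free_max_subrings e R n)"
    by (rule finite_subset[of _ "Pow R"]) (use R in \<open>auto simp: core_free_max_subrings_def max_subring_def\<close>)
  have le: "real (card (core_free_max_subrings e R n)) \<le> real n * (4 + 12 * log 2 n)"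
    if c: "card (core_free_max_subrings e R n) \<le> n"
  proof (cases "n = 0")
    case False
    then have "real n * 1 \<le> real n * (4 + 12 * log 2 n)" by (intro mult_left_mono) auto
    then show ?thesis using c by simp
  qed (use c in simp)
  show "real (card (core_free_max_subrings e R n)) \<le> real n * (4 + 12 * log 2 n)"
  proof (cases "e = 0")
    case True
    have "x = 0" if "x \<in> R" for x using ring_onD(4)[OF R(1) that] True by simp
    then have R0: "R \<subseteq> {0}" by blast
    have "M \<notin> core_free_max_subrings e R n" for M
    proof
      assume "M \<in> core_free_max_subrings e R n"
      then have "max_subring e R M" by (simp add: core_free_max_subrings_def)
      note m = max_subringD[OF this]
      have "M = R" using m(2) R0 addsub_zero[OF ring_onD(1)[OF m(1)]] by blast
      then show False using m(3) by simp
    qed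
    then have "core_free_max_subrings e R n = {}" by blast
    then show ?thesis by (intro le) simp
  next
    case e: False
    show ?thesis
    proof (cases "\<exists>N. ideal_on R N \<and> N \<noteq> {0} \<and> (\<forall>x\<in>N. \<forall>y\<in>N. x * y = 0)")
      case True
      then obtain N where "ideal_on R N" "N \<noteq> {0}" "\<And>x y. x \<in> N \<Longrightarrow> y \<in> N \<Longrightarrow> x * y = 0" by blast
      then show ?thesis by (intro le square_zero_count[OF R])
    next
      case nN: False
      show ?thesis
      proof (cases "prime_on e R")
        case True
        obtain f ps where "simple_frame e R f ps" by (rule exists_simple_frame[OF prime_imp_simple[OF True]])
        then show ?thesis by (rule simple_frame.simple_count)
      next
        case False
        show ?thesis by (intro le semiprime_count[OF R e False]) (use nN in blast)
      qed
    qed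
  qed
qed

text \<open>The ring type below is the product of all rings with elements in \<open>'x\<close> (and \<open>int\<close>, to ensure
  \<open>0 \<noteq> 1\<close>), so every such ring embeds into it, without preserving the unit.\<close>

typedef 'x product_ring = "{(k :: int, g :: 'x ring \<Rightarrow> 'x). \<forall>c. if ring c then g c \<in> carrier c else g c = undefined}"
  by (rule exI[of _ "(0, \<lambda>c. if ring c then \<zero>\<^bsub>c\<^esub> else undefined)"]) (auto simp: ring.ring_simprules)

setup_lifting type_definition_product_ring

lemma ring_r_one: "ring c \<Longrightarrow> x \<in> carrier c \<Longrightarrow> x \<otimes>\<^bsub>c\<^esub> \<one>\<^bsub>c\<^esub> = x"
  by (simp add: monoid.r_one ring.is_monoid)

instantiation product_ring :: (type) ring_1
begin

lift_definition zero_product_ring :: "'a product_ring"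
  is "(0, \<lambda>c. if ring c then \<zero>\<^bsub>c\<^esub> else undefined)"
  by (auto simp: ring.ring_simprules)

lift_definition one_product_ring :: "'a product_ring"
  is "(1, \<lambda>c. if ring c then \<one>\<^bsub>c\<^esub> else undefined)"
  by (auto simp: ring.ring_simprules)

lift_definition plus_product_ring :: "'a product_ring \<Rightarrow> 'a product_ring \<Rightarrow> 'a product_ring"
  is "\<lambda>(k, g) (l, h). (k + l, \<lambda>c. if ring c then g c \<oplus>\<^bsub>c\<^esub> h c else undefined)"
  by (auto simp: ring.ring_simprules)

lift_definition times_product_ring :: "'a product_ring \<Rightarrow> 'a product_ring \<Rightarrow> 'a product_ring"
  is "\<lambda>(k, g) (l, h). (k * l, \<lambda>c. if ring c then g c \<otimes>\<^bsub>c\<^esub> h c else undefined)"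
  by (auto simp: ring.ring_simprules)

lift_definition uminus_product_ring :: "'a product_ring \<Rightarrow> 'a product_ring"
  is "\<lambda>(k, g). (- k, \<lambda>c. if ring c then \<ominus>\<^bsub>c\<^esub> g c else undefined)"
  by (auto simp: ring.ring_simprules)

lift_definition minus_product_ring :: "'a product_ring \<Rightarrow> 'a product_ring \<Rightarrow> 'a product_ring"
  is "\<lambda>(k, g) (l, h). (k - l, \<lambda>c. if ring c then g c \<ominus>\<^bsub>c\<^esub> h c else undefined)"
  by (auto simp: ring.ring_simprules)

instance
proof
  fix a b c :: "'a product_ring"
  show "a + b + c = a + (b + c)"
    by transfer (auto simp: fun_eq_iff ring.ring_simprules split: if_splits)
  show "a + b = b + a"
    by transfer (auto simp: fun_eq_iff ring.ring_simprules split: if_splits)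
  show "0 + a = a" by transfer (auto simp: fun_eq_iff ring.ring_simprules split: if_splits; metis)
  show "- a + a = 0" by transfer (auto simp: fun_eq_iff ring.ring_simprules split: if_splits)
  show "a - b = a + - b" by transfer (auto simp: fun_eq_iff a_minus_def)
  show "a * b * c = a * (b * c)"
    by transfer (auto simp: fun_eq_iff ring.ring_simprules split: if_splits)
  show "(a + b) * c = a * c + b * c"
    by transfer (auto simp: fun_eq_iff ring.ring_simprules distrib_right split: if_splits)
  show "a * (b + c) = a * b + a * c"
    by transfer (auto simp: fun_eq_iff ring.ring_simprules distrib_left split: if_splits)
  show "1 * a = a" by transfer (auto simp: fun_eq_iff ring.ring_simprules split: if_splits; metis)
  show "a * 1 = a" by transfer (auto simp: fun_eq_iff ring_r_one split: if_splits; metis)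
  show "(0 :: 'a product_ring) \<noteq> 1" by transfer simp
qed

end

section \<open>Quotients of an algebra as rings inside the product\<close>

definition product_embed :: "'x ring \<Rightarrow> 'x \<Rightarrow> 'x product_ring" where
  "product_embed d x = Abs_product_ring (0, \<lambda>c. if ring c then (if c = d then x else \<zero>\<^bsub>c\<^esub>) else undefined)"

lemma Rep_product_embed:
  "ring d \<Longrightarrow> x \<in> carrier d \<Longrightarrow>
    Rep_product_ring (product_embed d x) = (0, \<lambda>c. if ring c then (if c = d then x else \<zero>\<^bsub>c\<^esub>) else undefined)"
  unfolding product_embed_def by (subst Abs_product_ring_inverse) (auto simp: ring.ring_simprules)

lemma product_embed_hom:
  assumes "ring d" "x \<in> carrier d" "y \<in> carrier d"
  shows "product_embed d (x \<oplus>\<^bsub>d\<^esub> y) = product_embed d x + product_embed d y"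
    "product_embed d (x \<otimes>\<^bsub>d\<^esub> y) = product_embed d x * product_embed d y"
    "product_embed d x = product_embed d y \<longleftrightarrow> x = y"
    "product_embed d \<zero>\<^bsub>d\<^esub> = 0"
proof -
  interpret ring d by fact
  have xy: "x \<oplus>\<^bsub>d\<^esub> y \<in> carrier d" "x \<otimes>\<^bsub>d\<^esub> y \<in> carrier d" "\<zero>\<^bsub>d\<^esub> \<in> carrier d" using assms by auto
  show "product_embed d (x \<oplus>\<^bsub>d\<^esub> y) = product_embed d x + product_embed d y"
    unfolding Rep_product_ring_inject[symmetric] plus_product_ring.rep_eq
    using assms xy by (auto simp: Rep_product_embed fun_eq_iff ring.ring_simprules)
  show "product_embed d (x \<otimes>\<^bsub>d\<^esub> y) = product_embed d x * product_embed d y"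
    unfolding Rep_product_ring_inject[symmetric] times_product_ring.rep_eq
    using assms xy by (auto simp: Rep_product_embed fun_eq_iff ring.ring_simprules)
  show "product_embed d \<zero>\<^bsub>d\<^esub> = 0"
    unfolding Rep_product_ring_inject[symmetric] zero_product_ring.rep_eq
    using assms xy by (auto simp: Rep_product_embed fun_eq_iff)
  show "product_embed d x = product_embed d y \<longleftrightarrow> x = y"
    unfolding Rep_product_ring_inject[symmetric]
    using assms by (auto simp: Rep_product_embed fun_eq_iff dest!: spec[of _ d])
qed

text \<open>\<open>\<kappa>\<close> is the quotient map modulo \<open>C\<close> followed by the
  inclusion of one factor into the product. The image of \<one> is an idempotent different from
  \<open>1\<close>, which is why the ring theory carries its own unit \<open>e\<close>.\<close>

lemma quotient_embedding:
  assumes "ring A" "ideal C A"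
  obtains \<kappa> :: "'a \<Rightarrow> 'a set product_ring" where
    "\<And>x y. x \<in> carrier A \<Longrightarrow> y \<in> carrier A \<Longrightarrow> \<kappa> (x \<oplus>\<^bsub>A\<^esub> y) = \<kappa> x + \<kappa> y"
    "\<And>x y. x \<in> carrier A \<Longrightarrow> y \<in> carrier A \<Longrightarrow> \<kappa> (x \<otimes>\<^bsub>A\<^esub> y) = \<kappa> x * \<kappa> y"
    "\<And>x. x \<in> carrier A \<Longrightarrow> \<kappa> x = 0 \<longleftrightarrow> x \<in> C"
    "finite (a_rcosets\<^bsub>A\<^esub> C) \<Longrightarrow> finite (\<kappa> ` carrier A)"
proof -
  interpret ring A by fact
  interpret C: ideal C A by fact
  let ?Q = "A Quot C"
  let ?\<kappa> = "\<lambda>x. product_embed ?Q (C +>\<^bsub>A\<^esub> x)"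
  have Q: "ring ?Q" by (rule C.quotient_is_ring)
  have h: "(+>\<^bsub>A\<^esub>) C \<in> ring_hom A ?Q" by (rule C.rcos_ring_hom)
  have c: "C +>\<^bsub>A\<^esub> x \<in> carrier ?Q" if "x \<in> carrier A" for x using ring_hom_closed[OF h that] .
  show ?thesis
  proof (rule that[of ?\<kappa>])
    fix x y assume xy: "x \<in> carrier A" "y \<in> carrier A"
    show "?\<kappa> (x \<oplus>\<^bsub>A\<^esub> y) = ?\<kappa> x + ?\<kappa> y"
      unfolding ring_hom_add[OF h xy] by (rule product_embed_hom(1)[OF Q c[OF xy(1)] c[OF xy(2)]])
    show "?\<kappa> (x \<otimes>\<^bsub>A\<^esub> y) = ?\<kappa> x * ?\<kappa> y"
      unfolding ring_hom_mult[OF h xy] by (rule product_embed_hom(2)[OF Q c[OF xy(1)] c[OF xy(2)]])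
  next
    fix x assume x: "x \<in> carrier A"
    have "?\<kappa> x = 0 \<longleftrightarrow> C +>\<^bsub>A\<^esub> x = \<zero>\<^bsub>?Q\<^esub>"
      using product_embed_hom(3,4)[OF Q c[OF x] ring.ring_simprules(2)[OF Q]] by metis
    also have "\<dots> \<longleftrightarrow> C +>\<^bsub>A\<^esub> x = C +>\<^bsub>A\<^esub> \<zero>\<^bsub>A\<^esub>"
      by (simp add: FactRing_def C.a_subset a_coset_add_zero)
    also have "\<dots> \<longleftrightarrow> x \<in> C"
      using quotient_eq_iff_same_a_r_cos[OF C.is_ideal x zero_closed] x by (simp add: minus_eq)
    finally show "?\<kappa> x = 0 \<longleftrightarrow> x \<in> C" .
  next
    assume "finite (a_rcosets\<^bsub>A\<^esub> C)"
    then have "finite (product_embed ?Q ` (a_rcosets\<^bsub>A\<^esub> C))" by simp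
    moreover have "?\<kappa> ` carrier A \<subseteq> product_embed ?Q ` (a_rcosets\<^bsub>A\<^esub> C)"
      using c by (auto simp: FactRing_def)
    ultimately show "finite (?\<kappa> ` carrier A)" by (rule finite_subset[rotated])
  qed
qed

section \<open>Cosets of additive subgroups\<close>

context ring
begin

lemma additive_subgroup_closed:
  assumes "additive_subgroup H R"
  shows "H \<subseteq> carrier R" "\<zero> \<in> H" "\<And>x y. x \<in> H \<Longrightarrow> y \<in> H \<Longrightarrow> x \<oplus> y \<in> H" "\<And>x. x \<in> H \<Longrightarrow> \<ominus> x \<in> H"
    "\<And>x y. x \<in> H \<Longrightarrow> y \<in> H \<Longrightarrow> x \<ominus> y \<in> H"
proof -
  interpret additive_subgroup H R by fact
  show "H \<subseteq> carrier R" "\<zero> \<in> H" by (rule a_subset, rule zero_closed)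
  show 1: "\<And>x y. x \<in> H \<Longrightarrow> y \<in> H \<Longrightarrow> x \<oplus> y \<in> H" by (rule a_closed)
  show 2: "\<And>x. x \<in> H \<Longrightarrow> \<ominus> x \<in> H" by (rule a_inv_closed)
  show "\<And>x y. x \<in> H \<Longrightarrow> y \<in> H \<Longrightarrow> x \<ominus> y \<in> H" using 1 2 by (simp add: a_minus_def)
qed

lemma minus_plus_cancel: "x \<in> carrier R \<Longrightarrow> y \<in> carrier R \<Longrightarrow> (x \<ominus> y) \<oplus> y = x"
  and plus_minus_cancel: "x \<in> carrier R \<Longrightarrow> y \<in> carrier R \<Longrightarrow> (x \<oplus> y) \<ominus> y = x"
  and minus_self: "x \<in> carrier R \<Longrightarrow> x \<ominus> x = \<zero>"
  by (simp_all add: a_minus_def a_assoc l_neg r_neg)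

lemma coset_mem:
  assumes H: "additive_subgroup H R" and x: "x \<in> carrier R"
  shows "y \<in> H +> x \<longleftrightarrow> y \<in> carrier R \<and> y \<ominus> x \<in> H"
proof
  note D = additive_subgroup_closed[OF H]
  assume "y \<in> H +> x"
  then obtain h where h: "h \<in> H" "y = h \<oplus> x" by (auto simp: a_r_coset_def')
  then show "y \<in> carrier R \<and> y \<ominus> x \<in> H" using D(1) x plus_minus_cancel[of h x] by auto
next
  assume y: "y \<in> carrier R \<and> y \<ominus> x \<in> H"
  then have "y = (y \<ominus> x) \<oplus> x" using minus_plus_cancel x by simp
  then show "y \<in> H +> x" using y by (auto simp: a_r_coset_def')
qed

lemma coset_self: "additive_subgroup H R \<Longrightarrow> x \<in> carrier R \<Longrightarrow> x \<in> H +> x"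
  using coset_mem[of H x x] additive_subgroup_closed(2)[of H] by (simp add: minus_self)

lemma coset_sub: "additive_subgroup H R \<Longrightarrow> x \<in> carrier R \<Longrightarrow> H +> x \<subseteq> carrier R"
  using coset_mem by blast

lemma coset_eq_iff:
  assumes H: "additive_subgroup H R" and xy: "x \<in> carrier R" "y \<in> carrier R"
  shows "H +> x = H +> y \<longleftrightarrow> x \<ominus> y \<in> H"
proof
  note D = additive_subgroup_closed[OF H]
  assume "H +> x = H +> y"
  then show "x \<ominus> y \<in> H" using coset_self[OF H xy(1)] coset_mem[OF H xy(2)] by blast
next
  note D = additive_subgroup_closed[OF H]
  assume d: "x \<ominus> y \<in> H"
  have "z \<ominus> x \<in> H \<longleftrightarrow> z \<ominus> y \<in> H" if z: "z \<in> carrier R" for z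
  proof -
    have n: "\<ominus> x \<in> carrier R" "\<ominus> y \<in> carrier R" "x \<ominus> y \<in> carrier R" "z \<ominus> x \<in> carrier R" using xy z by simp_all
    have "(z \<ominus> x) \<oplus> (x \<ominus> y) = z \<oplus> (\<ominus> x \<oplus> (x \<oplus> \<ominus> y))"
      unfolding a_minus_def by (rule a_assoc[OF z n(1)]) (use n(3) in \<open>simp only: a_minus_def\<close>)
    also have "\<dots> = z \<oplus> \<ominus> y" using xy(1) n(2) by (simp only: r_neg1)
    finally have 1: "z \<ominus> y = (z \<ominus> x) \<oplus> (x \<ominus> y)" by (simp only: a_minus_def)
    have 2: "z \<ominus> x = (z \<ominus> y) \<ominus> (x \<ominus> y)"
      unfolding 1 by (rule plus_minus_cancel[OF n(4,3), symmetric])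
    show ?thesis using D(3)[OF _ d, of "z \<ominus> x", folded 1] D(5)[OF _ d, of "z \<ominus> y", folded 2] by blast
  qed
  then show "H +> x = H +> y" using coset_mem[OF H xy(1)] coset_mem[OF H xy(2)] by blast
qed

lemma Union_cosets:
  assumes H: "additive_subgroup H R"
  shows "\<Union>(a_rcosets H) = carrier R"
  using coset_self[OF H] coset_sub[OF H] by (auto simp: A_RCOSETS_def')

lemma cosets_disjoint:
  assumes H: "additive_subgroup H R" and "X \<in> a_rcosets H" "Y \<in> a_rcosets H" "z \<in> X" "z \<in> Y"
  shows "X = Y"
proof -
  obtain x y where xy: "x \<in> carrier R" "y \<in> carrier R" "X = H +> x" "Y = H +> y"
    using assms by (auto simp: A_RCOSETS_def')
  have z: "z \<in> carrier R" "z \<ominus> x \<in> H" "z \<ominus> y \<in> H"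
    using coset_mem[OF H] xy assms(4,5) by auto
  then show ?thesis using coset_eq_iff[OF H z(1) xy(1)] coset_eq_iff[OF H z(1) xy(2)] xy by simp
qed

end

text \<open>The same as \<open>assoc_algebra\<close>, but with \<open>A\<close> as the default structure.\<close>

locale algebra_over = assoc_algebra K A
  for K :: "('k, 'n) ring_scheme" and A :: "('k, 'a, 'm) module_scheme" (structure)
begin

lemma unital_subalgebraD:
  assumes "unital_subalgebra K A S"
  shows "S \<subseteq> carrier A" "\<zero> \<in> S" "\<one> \<in> S" "\<And>x y. x \<in> S \<Longrightarrow> y \<in> S \<Longrightarrow> x \<oplus> y \<in> S"
    "\<And>x y. x \<in> S \<Longrightarrow> y \<in> S \<Longrightarrow> x \<otimes> y \<in> S" "\<And>x. x \<in> S \<Longrightarrow> \<ominus> x \<in> S"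
    "\<And>x y. x \<in> S \<Longrightarrow> y \<in> S \<Longrightarrow> x \<ominus> y \<in> S"
    "\<And>c x. c \<in> carrier K \<Longrightarrow> x \<in> S \<Longrightarrow> c \<odot> x \<in> S" "additive_subgroup S A"
proof -
  have S: "subring S A" "submodule S K A" using assms by (auto simp: unital_subalgebra_def)
  show "S \<subseteq> carrier A" "\<zero> \<in> S" "\<one> \<in> S" using subringE[OF S(1)] by auto
  show "\<And>x y. x \<in> S \<Longrightarrow> y \<in> S \<Longrightarrow> x \<oplus> y \<in> S" "\<And>x y. x \<in> S \<Longrightarrow> y \<in> S \<Longrightarrow> x \<otimes> y \<in> S"
    "\<And>x. x \<in> S \<Longrightarrow> \<ominus> x \<in> S" using subringE[OF S(1)] by auto
  then show "\<And>x y. x \<in> S \<Longrightarrow> y \<in> S \<Longrightarrow> x \<ominus> y \<in> S" by (simp add: a_minus_def)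
  show "\<And>c x. c \<in> carrier K \<Longrightarrow> x \<in> S \<Longrightarrow> c \<odot> x \<in> S"
    using S(2) unfolding submodule_def submodule_axioms_def by blast
  show "additive_subgroup S A" using S(1) by (simp add: subring_def additive_subgroup_def)
qed

lemma unital_subalgebraI:
  assumes "S \<subseteq> carrier A" "\<one> \<in> S" "\<And>x y. x \<in> S \<Longrightarrow> y \<in> S \<Longrightarrow> x \<oplus> y \<in> S"
    "\<And>x y. x \<in> S \<Longrightarrow> y \<in> S \<Longrightarrow> x \<otimes> y \<in> S" "\<And>x. x \<in> S \<Longrightarrow> \<ominus> x \<in> S"
    "\<And>c x. c \<in> carrier K \<Longrightarrow> x \<in> S \<Longrightarrow> c \<odot> x \<in> S"
  shows "unital_subalgebra K A S"
proof -
  have "subring S A" by (rule subringI) (use assms in auto)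
  moreover have "submodule S K A"
    using \<open>subring S A\<close> assms(6) by (auto simp: submodule_def submodule_axioms_def subring_def)
  ultimately show ?thesis by (simp add: unital_subalgebra_def)
qed

lemma smult_eq_mult: "c \<in> carrier K \<Longrightarrow> x \<in> carrier A \<Longrightarrow> c \<odot> x = (c \<odot> \<one>) \<otimes> x"
  using smult_mult_left[of c "\<one>" x] by simp

text \<open>A subring containing \<open>K 1\<close> is a subalgebra, so maximal subalgebras are maximal subrings.\<close>

lemma card_max_subalgebras_with_core:
  fixes n :: nat
  assumes C: "ideal C A" and finC: "finite (a_rcosets C)"
  defines "\<X> \<equiv> {M. maximal_subalgebra K A M \<and> C \<subseteq> M \<and> (\<forall>I. ideal I A \<longrightarrow> I \<subseteq> M \<longrightarrow> I \<subseteq> C) \<and>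
      finite (a_rcosets M) \<and> card (a_rcosets M) = n}"
  shows "finite \<X>" "real (card \<X>) \<le> real n * (4 + 12 * log 2 n)"
proof -
  interpret C: ideal C A by fact
  obtain \<kappa> :: "'a \<Rightarrow> 'a set product_ring" where
    add: "\<And>x y. x \<in> carrier A \<Longrightarrow> y \<in> carrier A \<Longrightarrow> \<kappa> (x \<oplus> y) = \<kappa> x + \<kappa> y" and
    mult: "\<And>x y. x \<in> carrier A \<Longrightarrow> y \<in> carrier A \<Longrightarrow> \<kappa> (x \<otimes> y) = \<kappa> x * \<kappa> y" and
    ker: "\<And>x. x \<in> carrier A \<Longrightarrow> \<kappa> x = 0 \<longleftrightarrow> x \<in> C" and
    fin: "finite (\<kappa> ` carrier A)"
    using quotient_embedding[OF ring_axioms C] finC by metis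
  let ?R = "\<kappa> ` carrier A" and ?e = "\<kappa> \<one>"
  have zero: "\<kappa> \<zero> = 0" using ker by simp
  have minus: "\<kappa> (x \<ominus> y) = \<kappa> x - \<kappa> y" if "x \<in> carrier A" "y \<in> carrier A" for x y
  proof -
    have "\<kappa> (x \<ominus> y) + \<kappa> y = \<kappa> x" using add[of "x \<ominus> y" y] that by (simp add: a_minus_def a_assoc l_neg)
    then show ?thesis by (simp add: algebra_simps)
  qed
  have img: "ring_on ?e (\<kappa> ` S)" if S: "unital_subalgebra K A S" for S
  proof -
    note D = unital_subalgebraD[OF S]
    have D': "x \<in> carrier A" if "x \<in> S" for x using that D(1) by blast
    show ?thesis
      unfolding ring_on_def
    proof (intro conjI ballI)
      show "addsub (\<kappa> ` S)"
      proof (rule addsubI)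
        show "0 \<in> \<kappa> ` S" using zero D(2) by (metis imageI)
        fix u v assume "u \<in> \<kappa> ` S" "v \<in> \<kappa> ` S"
        then obtain x y where xy: "x \<in> S" "y \<in> S" "u = \<kappa> x" "v = \<kappa> y" by blast
        then have "u - v = \<kappa> (x \<ominus> y)" using minus D' by simp
        then show "u - v \<in> \<kappa> ` S" using D(7)[OF xy(1,2)] by blast
      qed
      show "?e \<in> \<kappa> ` S" using D(3) by blast
      fix u v assume "u \<in> \<kappa> ` S" "v \<in> \<kappa> ` S"
      then obtain x y where xy: "x \<in> S" "y \<in> S" "u = \<kappa> x" "v = \<kappa> y" by blast
      then have "u * v = \<kappa> (x \<otimes> y)" using mult D' by simp
      then show "u * v \<in> \<kappa> ` S" using D(5)[OF xy(1,2)] by blast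
    next
      fix u assume "u \<in> \<kappa> ` S"
      then obtain x where x: "x \<in> S" "u = \<kappa> x" by blast
      show "?e * u = u" "u * ?e = u" using mult[of "\<one>" x] mult[of x "\<one>"] D'[OF x(1)] x(2) by simp_all
    qed
  qed
  have carrier_sub: "unital_subalgebra K A (carrier A)" by (rule unital_subalgebraI) auto
  have R: "ring_on ?e ?R" by (rule img[OF carrier_sub])
  have mem: "x \<in> M" if M: "unital_subalgebra K A M" "C \<subseteq> M" and x: "x \<in> carrier A" "\<kappa> x \<in> \<kappa> ` M" for M x
  proof -
    note D = unital_subalgebraD[OF M(1)]
    obtain m where m: "m \<in> M" "\<kappa> x = \<kappa> m" using x(2) by blast
    have mA: "m \<in> carrier A" using m D(1) by blast
    have "x \<ominus> m \<in> C" using minus[OF x(1) mA] m(2) ker[of "x \<ominus> m"] x(1) mA by simp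
    then have "(x \<ominus> m) \<oplus> m \<in> M" using D(4) M(2) m(1) by blast
    then show ?thesis using x(1) mA by (simp add: a_minus_def a_assoc l_neg)
  qed
  have pre: "unital_subalgebra K A {x \<in> carrier A. \<kappa> x \<in> S}"
    if M: "unital_subalgebra K A M" and S: "ring_on ?e S" "\<kappa> ` M \<subseteq> S" for M S
  proof (rule unital_subalgebraI)
    note D = unital_subalgebraD[OF M] and SD = ring_onD[OF S(1)]
    show "\<one> \<in> {x \<in> carrier A. \<kappa> x \<in> S}" using SD(3) by simp
    fix x assume x: "x \<in> {x \<in> carrier A. \<kappa> x \<in> S}"
    have "\<kappa> (\<ominus> x) = - \<kappa> x" using minus[of "\<zero>" x] zero x by (simp add: a_minus_def)
    then show "\<ominus> x \<in> {x \<in> carrier A. \<kappa> x \<in> S}" using x addsub_uminus[OF SD(1)] by simp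
  next
    note D = unital_subalgebraD[OF M] and SD = ring_onD[OF S(1)]
    fix x y assume x: "x \<in> {x \<in> carrier A. \<kappa> x \<in> S}" and y: "y \<in> {x \<in> carrier A. \<kappa> x \<in> S}"
    show "x \<oplus> y \<in> {x \<in> carrier A. \<kappa> x \<in> S}" using x y add addsub_add[OF SD(1)] by simp
    show "x \<otimes> y \<in> {x \<in> carrier A. \<kappa> x \<in> S}" using x y mult SD(2) by simp
  next
    note D = unital_subalgebraD[OF M] and SD = ring_onD[OF S(1)]
    fix c x assume c: "c \<in> carrier K" and x: "x \<in> {x \<in> carrier A. \<kappa> x \<in> S}"
    have c1: "c \<odot> \<one> \<in> M" using D(3,8) c by blast
    then have "\<kappa> (c \<odot> \<one>) \<in> S" "c \<odot> \<one> \<in> carrier A" using S(2) D(1) by blast+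
    then show "c \<odot> x \<in> {x \<in> carrier A. \<kappa> x \<in> S}"
      using smult_eq_mult[OF c, of x] mult[of "c \<odot> \<one>" x] x SD(2) c by simp
  qed auto
  have inM: "\<kappa> ` M \<in> core_free_max_subrings ?e ?R n" if "M \<in> \<X>" for M
  proof -
    from that have M: "maximal_subalgebra K A M" "C \<subseteq> M" "\<And>I. ideal I A \<Longrightarrow> I \<subseteq> M \<Longrightarrow> I \<subseteq> C"
      "finite (a_rcosets M)" "card (a_rcosets M) = n" by (auto simp: \<X>_def)
    have MS: "unital_subalgebra K A M" "M \<noteq> carrier A"
      "\<And>S. unital_subalgebra K A S \<Longrightarrow> M \<subseteq> S \<Longrightarrow> S = M \<or> S = carrier A"
      using M(1) by (auto simp: maximal_subalgebra_def)
    note D = unital_subalgebraD[OF MS(1)]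
    have "max_subring ?e ?R (\<kappa> ` M)"
      unfolding max_subring_def
    proof (intro conjI allI impI)
      show "ring_on ?e (\<kappa> ` M)" by (rule img[OF MS(1)])
      show "\<kappa> ` M \<subseteq> ?R" using D(1) by blast
      show "\<kappa> ` M \<noteq> ?R"
      proof
        assume "\<kappa> ` M = ?R"
        then have "carrier A \<subseteq> M" using mem[OF MS(1) M(2)] by blast
        then show False using D(1) MS(2) by blast
      qed
      fix S assume S: "ring_on ?e S" "\<kappa> ` M \<subseteq> S" "S \<subseteq> ?R"
      let ?P = "{x \<in> carrier A. \<kappa> x \<in> S}"
      have "?P = M \<or> ?P = carrier A" by (rule MS(3)[OF pre[OF MS(1) S(1,2)]]) (use D(1) S(2) in blast)
      moreover have im: "S = \<kappa> ` ?P"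
      proof (intro equalityI subsetI)
        fix u assume u: "u \<in> S"
        then obtain x where "x \<in> carrier A" "u = \<kappa> x" using S(3) by blast
        then show "u \<in> \<kappa> ` ?P" using u by simp
      qed auto
      ultimately show "S = \<kappa> ` M \<or> S = ?R" by (elim disjE) (simp_all only: simp_thms)
    qed
    moreover have "core_free ?R (\<kappa> ` M)"
      unfolding core_free_def
    proof (intro allI impI)
      fix J assume J: "ideal_on ?R J" "J \<subseteq> \<kappa> ` M"
      note JD = ideal_onD[OF J(1)]
      let ?P = "{x \<in> carrier A. \<kappa> x \<in> J}"
      have "ideal ?P A"
      proof (rule idealI[OF ring_axioms])
        show "subgroup ?P (add_monoid A)"
        proof (rule group.subgroupI[OF a_group])
          show "?P \<noteq> {}" using zero addsub_zero[OF JD(1)] zero_closed by force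
          fix a assume a: "a \<in> ?P"
          have "\<kappa> (\<ominus> a) = - \<kappa> a" using minus[of "\<zero>" a] zero a by (simp add: a_minus_def)
          then show "inv\<^bsub>add_monoid A\<^esub> a \<in> ?P" using a addsub_uminus[OF JD(1)] by (simp add: a_inv_def[symmetric])
          fix b assume "b \<in> ?P"
          then show "a \<otimes>\<^bsub>add_monoid A\<^esub> b \<in> ?P" using a add addsub_add[OF JD(1)] by simp
        qed auto
        fix a x assume "a \<in> ?P" "x \<in> carrier A"
        then show "x \<otimes> a \<in> ?P" "a \<otimes> x \<in> ?P" using mult JD(3,4) by auto
      qed
      moreover have "?P \<subseteq> M" using mem[OF MS(1) M(2)] J(2) by blast
      ultimately have "?P \<subseteq> C" by (rule M(3))
      have "u = 0" if u: "u \<in> J" for u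
      proof -
        obtain x where x: "x \<in> carrier A" "u = \<kappa> x" using u JD(2) by blast
        then have "x \<in> C" using u \<open>?P \<subseteq> C\<close> by blast
        then show ?thesis using ker[OF x(1)] x(2) by simp
      qed
      then have "J \<subseteq> {0}" by blast
      then show "J = {0}" using addsub_zero[OF JD(1)] by blast
    qed
    moreover have "card ?R = n * card (\<kappa> ` M)"
    proof -
      have cos: "\<kappa> ` (M +> a) = (\<lambda>u. u + \<kappa> a) ` \<kappa> ` M" if a: "a \<in> carrier A" for a
      proof -
        have "M +> a = (\<lambda>m. m \<oplus> a) ` M" by (auto simp: a_r_coset_def')
        then have "\<kappa> ` (M +> a) = (\<lambda>m. \<kappa> (m \<oplus> a)) ` M" by (simp only: image_image)
        also have "\<dots> = (\<lambda>m. \<kappa> m + \<kappa> a) ` M" by (rule image_cong[OF refl]) (use add a D(1) in blast)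
        finally show ?thesis by (simp only: image_image)
      qed
      have "?R = \<kappa> ` \<Union>(a_rcosets M)" by (simp only: Union_cosets[OF D(9)])
      then have "?R = (\<Union>X\<in>a_rcosets M. \<kappa> ` X)" by (simp only: image_Union)
      also have "card \<dots> = (\<Sum>X\<in>a_rcosets M. card (\<kappa> ` X))"
      proof (rule card_UN_disjoint)
        show "finite (a_rcosets M)" by fact
        have sub: "X \<subseteq> carrier A" if "X \<in> a_rcosets M" for X using Union_cosets[OF D(9)] that by blast
        show "\<forall>X\<in>a_rcosets M. finite (\<kappa> ` X)" using sub fin by (meson finite_subset image_mono)
        show "\<forall>X\<in>a_rcosets M. \<forall>Y\<in>a_rcosets M. X \<noteq> Y \<longrightarrow> \<kappa> ` X \<inter> \<kappa> ` Y = {}"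
        proof (intro ballI impI, rule ccontr)
          fix X Y assume XY: "X \<in> a_rcosets M" "Y \<in> a_rcosets M" "X \<noteq> Y" "\<kappa> ` X \<inter> \<kappa> ` Y \<noteq> {}"
          obtain a b where ab: "a \<in> carrier A" "b \<in> carrier A" "X = M +> a" "Y = M +> b"
            using XY(1,2) by (auto simp: A_RCOSETS_def')
          obtain m m' where m: "m \<in> M" "m' \<in> M" "\<kappa> m + \<kappa> a = \<kappa> m' + \<kappa> b"
            using XY(4) unfolding ab(3,4) cos[OF ab(1)] cos[OF ab(2)] by blast
          have mA: "m \<in> carrier A" "m' \<in> carrier A" using m D(1) by auto
          have "\<kappa> (a \<ominus> b) = \<kappa> (m' \<ominus> m)"
            unfolding minus[OF ab(1,2)] minus[OF mA(2,1)] using m(3) by (simp add: algebra_simps)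
          then have "\<kappa> (a \<ominus> b) \<in> \<kappa> ` M" using D(7)[OF m(2,1)] by (metis imageI)
          then have abM: "a \<ominus> b \<in> M" using mem[OF MS(1) M(2)] ab by simp
          then have "M +> a = M +> b" using coset_eq_iff[OF D(9) ab(1,2)] by simp
          then show False using XY(3) ab by simp
        qed
      qed
      also have "\<dots> = (\<Sum>X\<in>a_rcosets M. card (\<kappa> ` M))"
      proof (rule sum.cong)
        fix X assume "X \<in> a_rcosets M"
        then obtain a where "a \<in> carrier A" "X = M +> a" by (auto simp: A_RCOSETS_def')
        then show "card (\<kappa> ` X) = card (\<kappa> ` M)" using cos by (simp add: card_image)
      qed simp
      finally show ?thesis using M(5) by simp
    qed
    ultimately show ?thesis by (simp add: core_free_max_subrings_def)
  qed
  have inj: "inj_on (\<lambda>M. \<kappa> ` M) \<X>"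
  proof (rule inj_onI)
    fix M M' assume *: "M \<in> \<X>" "M' \<in> \<X>" "\<kappa> ` M = \<kappa> ` M'"
    have U: "unital_subalgebra K A N" "C \<subseteq> N" "N \<subseteq> carrier A" if "N \<in> \<X>" for N
      using that unital_subalgebraD(1)[of N] by (auto simp: \<X>_def maximal_subalgebra_def)
    show "M = M'"
    proof (intro equalityI subsetI)
      show "x \<in> M'" if "x \<in> M" for x using mem[OF U(1,2)[OF *(2)], of x] U(3)[OF *(1)] that *(3) by blast
      show "x \<in> M" if "x \<in> M'" for x using mem[OF U(1,2)[OF *(1)], of x] U(3)[OF *(2)] that *(3) by blast
    qed
  qed
  note B = core_free_max_subrings_bound[OF R fin]
  have sub: "(\<lambda>M. \<kappa> ` M) ` \<X> \<subseteq> core_free_max_subrings ?e ?R n" using inM by blast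
  show "finite \<X>" by (rule inj_on_finite[OF inj sub B(1)])
  have "card \<X> \<le> card (core_free_max_subrings ?e ?R n)" by (rule card_inj_on_le[OF inj sub B(1)])
  then show "real (card \<X>) \<le> real n * (4 + 12 * log 2 n)" using B(2)[of n] by linarith
qed

end

section \<open>Profinite algebras\<close>

text \<open>Besides compactness, all that is used of the topology is a directed family of ideals of
  finite index whose cosets are open and form a base. For a projective limit these are the kernels
  of the projections.\<close>

locale profinite_base = algebra_over K A
  for K :: "('k, 'n) ring_scheme" and A :: "('k, 'a, 'm) module_scheme" (structure) +
  fixes T :: "'a topology" and \<C> :: "'a set set"
  assumes fin_K: "finite (carrier K)"
    and space: "topspace T = carrier A" and compact: "compact_space T" and C_ne: "\<C> \<noteq> {}"
    and C_ideal: "C \<in> \<C> \<Longrightarrow> ideal C A" and C_fin: "C \<in> \<C> \<Longrightarrow> finite (a_rcosets C)"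
    and C_coset_open: "C \<in> \<C> \<Longrightarrow> x \<in> carrier A \<Longrightarrow> openin T (C +> x)"
    and C_directed: "C \<in> \<C> \<Longrightarrow> D \<in> \<C> \<Longrightarrow> \<exists>E\<in>\<C>. E \<subseteq> C \<inter> D"
    and base: "openin T U \<Longrightarrow> x \<in> U \<Longrightarrow> \<exists>C\<in>\<C>. C +> x \<subseteq> U"

lemma ring_hom_fibres:
  assumes "ring R" "ring S" "h \<in> ring_hom R S"
  shows "ideal {x \<in> carrier R. h x = \<zero>\<^bsub>S\<^esub>} R" "h \<zero>\<^bsub>R\<^esub> = \<zero>\<^bsub>S\<^esub>"
    "x \<in> carrier R \<Longrightarrow> y \<in> carrier R \<Longrightarrow> h (x \<ominus>\<^bsub>R\<^esub> y) = \<zero>\<^bsub>S\<^esub> \<longleftrightarrow> h x = h y"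
proof -
  have rh: "ring_hom_ring R S h" by (rule ring_hom_ringI2[OF assms])
  show "ideal {x \<in> carrier R. h x = \<zero>\<^bsub>S\<^esub>} R"
    using ring_hom_ring.kernel_is_ideal[OF rh] by (simp only: a_kernel_def')
  show z: "h \<zero>\<^bsub>R\<^esub> = \<zero>\<^bsub>S\<^esub>" by (rule ring_hom_zero[OF assms(3,1,2)])
  assume xy: "x \<in> carrier R" "y \<in> carrier R"
  interpret R: ring R by fact
  interpret S: ring S by fact
  have c: "h x \<in> carrier S" "h y \<in> carrier S" "h (\<ominus>\<^bsub>R\<^esub> y) \<in> carrier S"
    using xy ring_hom_closed[OF assms(3)] by auto
  have "h (\<ominus>\<^bsub>R\<^esub> y) \<oplus>\<^bsub>S\<^esub> h y = \<zero>\<^bsub>S\<^esub>"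
    using ring_hom_add[OF assms(3), of "\<ominus>\<^bsub>R\<^esub> y" y] xy z by (simp add: R.l_neg)
  then have n: "h (\<ominus>\<^bsub>R\<^esub> y) = \<ominus>\<^bsub>S\<^esub> h y" using S.minus_equality[OF _ c(2,3)] by simp
  have "h (x \<ominus>\<^bsub>R\<^esub> y) = h x \<ominus>\<^bsub>S\<^esub> h y"
    using ring_hom_add[OF assms(3) xy(1), of "\<ominus>\<^bsub>R\<^esub> y"] xy n by (simp add: a_minus_def)
  then show "h (x \<ominus>\<^bsub>R\<^esub> y) = \<zero>\<^bsub>S\<^esub> \<longleftrightarrow> h x = h y" using c(1,2) by simp
qed

text \<open>The limit is closed in a product of finite discrete spaces, hence compact. A basic open
  set of the product constrains finitely many coordinates, which by directedness are all controlled
  by one index \<open>k\<close>; so it contains a coset of the kernel at \<open>k\<close> around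
  each of its points in the limit.\<close>

lemma profinite_algebra_base:
  fixes K :: "('k, 'n) ring_scheme" and A :: "('k, 'a, 'm) module_scheme" and T :: "'a topology"
  assumes K: "field K" "finite (carrier K)" and prof: "profinite_algebra TYPE('i) TYPE('b) K A T"
  obtains \<C> where "profinite_base K A T \<C>"
proof -
  obtain I :: "'i set" and r and B :: "'i \<Rightarrow> ('k, 'b) module" and \<phi> h where
    ta: "topological_algebra K A T" and sys: "finite_inverse_system K I r B \<phi>"
    and h: "h \<in> algebra_hom K A (projective_limit I r B \<phi>)"
    and hom: "homeomorphic_map T (projective_limit_topology I r B \<phi>) h"
    using prof unfolding profinite_algebra_def by blast
  interpret algebra_over K A using ta by (simp add: topological_algebra_def algebra_over_def)
  have space: "topspace T = carrier A" using ta by (simp add: topological_algebra_def)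
  let ?L = "projective_limit I r B \<phi>"
  let ?P = "product_topology (\<lambda>i. discrete_topology (carrier (B i))) I"
  have Ine: "I \<noteq> {}" and po: "partial_order_on I r"
    and dir: "\<And>i j. i \<in> I \<Longrightarrow> j \<in> I \<Longrightarrow> \<exists>k\<in>I. (i, k) \<in> r \<and> (j, k) \<in> r"
    and Bfin: "\<And>i. i \<in> I \<Longrightarrow> assoc_algebra K (B i) \<and> finite (carrier (B i))"
    and Bhom: "\<And>i j. (i, j) \<in> r \<Longrightarrow> \<phi> i j \<in> algebra_hom K (B j) (B i)"
    using sys unfolding finite_inverse_system_def by blast+
  have rI: "i \<in> I" "j \<in> I" if "(i, j) \<in> r" for i j
    using po that by (auto simp: partial_order_on_def preorder_on_def refl_on_def)
  have Lc: "x \<in> carrier ?L \<longleftrightarrow> x \<in> (\<Pi>\<^sub>E i\<in>I. carrier (B i)) \<and> (\<forall>i j. (i, j) \<in> r \<longrightarrow> \<phi> i j (x j) = x i)" for x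
    by (simp add: projective_limit_def)
  have hr: "h \<in> ring_hom A ?L" using h by (simp add: algebra_hom_def)
  have hc: "h x \<in> carrier ?L" if "x \<in> carrier A" for x using ring_hom_closed[OF hr that] .
  have hB: "h x i \<in> carrier (B i)" if "x \<in> carrier A" "i \<in> I" for x i using hc[OF that(1)] that(2) Lc by auto
  have hadd: "h (x \<oplus>\<^bsub>A\<^esub> y) i = h x i \<oplus>\<^bsub>B i\<^esub> h y i" and hmult: "h (x \<otimes>\<^bsub>A\<^esub> y) i = h x i \<otimes>\<^bsub>B i\<^esub> h y i"
    if "x \<in> carrier A" "y \<in> carrier A" "i \<in> I" for x y i
    using ring_hom_add[OF hr that(1,2)] ring_hom_mult[OF hr that(1,2)] that(3) by (simp_all add: projective_limit_def)
  have hi: "(\<lambda>x. h x i) \<in> ring_hom A (B i)" if i: "i \<in> I" for i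
    by (rule ring_hom_memI) (use hB hadd hmult i ring_hom_one[OF hr] in \<open>auto simp: projective_limit_def\<close>)
  have closed: "closedin ?P (carrier ?L)"
  proof -
    have "openin ?P (topspace ?P - carrier ?L)"
    proof (subst openin_subopen, clarify)
      fix x assume x: "x \<in> topspace ?P" "x \<notin> carrier ?L"
      then obtain i j where ij: "(i, j) \<in> r" "\<phi> i j (x j) \<noteq> x i" by (auto simp: Lc)
      let ?U = "{y \<in> topspace ?P. y i \<in> {x i}} \<inter> {y \<in> topspace ?P. y j \<in> {x j}}"
      have "openin ?P {y \<in> topspace ?P. y k \<in> {x k}}" if "k \<in> I" for k
        by (rule openin_continuous_map_preimage[OF continuous_map_product_projection[OF that]])
          (use x(1) that in auto)
      then have "openin ?P ?U" using rI[OF ij(1)] by (intro openin_Int) auto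
      moreover have "?U \<subseteq> topspace ?P - carrier ?L"
      proof
        fix y assume y: "y \<in> ?U"
        have "y \<notin> carrier ?L"
        proof
          assume "y \<in> carrier ?L"
          then have "\<phi> i j (y j) = y i" using ij(1) unfolding Lc by blast
          then show False using y ij(2) by simp
        qed
        then show "y \<in> topspace ?P - carrier ?L" using y by blast
      qed
      ultimately show "\<exists>U. openin ?P U \<and> x \<in> U \<and> U \<subseteq> topspace ?P - carrier ?L" using x(1) by blast
    qed
    moreover have "carrier ?L \<subseteq> topspace ?P" by (auto simp: Lc)
    ultimately show ?thesis by (simp add: closedin_def)
  qed
  have "compact_space ?P" using Bfin by (auto simp: compact_space_product_topology compact_space_discrete_topology)
  then have cL: "compact_space (projective_limit_topology I r B \<phi>)"
    unfolding projective_limit_topology_def using closed closedin_compact_space compact_space_subtopology by blast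
  then have compact: "compact_space T"
    using hom homeomorphic_map_imp_homeomorphic_space homeomorphic_compact_space by blast
  have tL: "topspace (projective_limit_topology I r B \<phi>) = carrier ?L"
    using closedin_subset[OF closed] by (simp add: projective_limit_topology_def Int_absorb1)
  define ker where "ker i = {x \<in> carrier A. h x i = \<zero>\<^bsub>B i\<^esub>}" for i
  have Bring: "ring (B i)" if i: "i \<in> I" for i using Bfin[OF i] by (simp add: assoc_algebra_def)
  have kideal: "ideal (ker i) A" if i: "i \<in> I" for i
    unfolding ker_def by (rule ring_hom_fibres(1)[OF ring_axioms Bring[OF i] hi[OF i]])
  have ksub: "additive_subgroup (ker i) A" if "i \<in> I" for i using kideal[OF that] by (simp add: ideal_def)
  have kcos: "ker i +>\<^bsub>A\<^esub> x = {y \<in> carrier A. h y i = h x i}" if i: "i \<in> I" and x: "x \<in> carrier A" for i x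
  proof -
    have "y \<ominus>\<^bsub>A\<^esub> x \<in> ker i \<longleftrightarrow> h y i = h x i" if y: "y \<in> carrier A" for y
      using ring_hom_fibres(3)[OF ring_axioms Bring[OF i] hi[OF i] y x] x y by (simp add: ker_def)
    then show ?thesis using coset_mem[OF ksub[OF i] x] by blast
  qed
  have kfin: "finite (a_rcosets\<^bsub>A\<^esub> (ker i))" if i: "i \<in> I" for i
  proof -
    have "a_rcosets\<^bsub>A\<^esub> (ker i) \<subseteq> (\<lambda>b. {y \<in> carrier A. h y i = b}) ` carrier (B i)"
      using kcos[OF i] hB i by (auto simp: A_RCOSETS_def')
    then show ?thesis using Bfin[OF i] finite_surj by blast
  qed
  have cont: "continuous_map T (discrete_topology (carrier (B i))) (\<lambda>x. h x i)" if i: "i \<in> I" for i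
  proof -
    have "continuous_map T ?P h"
      using homeomorphic_imp_continuous_map[OF hom]
      by (simp add: projective_limit_topology_def continuous_map_in_subtopology)
    then show ?thesis using continuous_map_componentwise[of T "\<lambda>i. discrete_topology (carrier (B i))" I h] i by blast
  qed
  have kopen: "openin T (ker i +>\<^bsub>A\<^esub> x)" if i: "i \<in> I" and x: "x \<in> carrier A" for i x
  proof -
    have "openin T {y \<in> topspace T. h y i \<in> {h x i}}"
      by (rule openin_continuous_map_preimage[OF cont[OF i]]) (use hB[OF x i] in simp)
    then show ?thesis by (simp add: kcos[OF i x] space)
  qed
  have kmono: "ker k \<subseteq> ker i" if ik: "(i, k) \<in> r" for i k
  proof
    fix x assume x: "x \<in> ker k"
    have p: "\<phi> i k \<in> ring_hom (B k) (B i)" using Bhom[OF ik] by (simp add: algebra_hom_def)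
    note z = ring_hom_fibres(2)[OF Bring[OF rI(2)[OF ik]] Bring[OF rI(1)[OF ik]] p]
    have xA: "x \<in> carrier A" using x by (simp add: ker_def)
    have "h x i = \<phi> i k (h x k)" using hc[OF xA] Lc ik by metis
    then show "x \<in> ker i" using x z by (simp add: ker_def)
  qed
  have "profinite_base K A T (ker ` I)"
  proof (intro profinite_base.intro profinite_base_axioms.intro)
    show "algebra_over K A" by (rule algebra_over_axioms)
    show "finite (carrier K)" "topspace T = carrier A" "compact_space T" by fact+
    show "ker ` I \<noteq> {}" using Ine by simp
    show "ideal C A" "finite (a_rcosets\<^bsub>A\<^esub> C)" if "C \<in> ker ` I" for C using that kideal kfin by auto
    show "openin T (C +>\<^bsub>A\<^esub> x)" if "C \<in> ker ` I" "x \<in> carrier A" for C x using that kopen by auto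
    show "\<exists>E\<in>ker ` I. E \<subseteq> C \<inter> D" if CD: "C \<in> ker ` I" "D \<in> ker ` I" for C D
    proof -
      obtain i j where ij: "i \<in> I" "j \<in> I" "C = ker i" "D = ker j" using CD by blast
      obtain k where "k \<in> I" "(i, k) \<in> r" "(j, k) \<in> r" using dir[OF ij(1,2)] by blast
      then show ?thesis using kmono ij by blast
    qed
    fix U x assume U: "openin T U" "x \<in> U"
    have xA: "x \<in> carrier A" using openin_subset[OF U(1)] U(2) space by blast
    have "openin (projective_limit_topology I r B \<phi>) (h ` U)"
      using homeomorphic_imp_open_map[OF hom] U(1) by (simp add: open_map_def)
    then obtain W where W: "openin ?P W" "h ` U = W \<inter> carrier ?L"
      by (auto simp: projective_limit_topology_def openin_subtopology)
    have "h x \<in> W" using W(2) U(2) by blast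
    then obtain G where G: "finite {i \<in> I. G i \<noteq> carrier (B i)}" "h x \<in> Pi\<^sub>E I G" "Pi\<^sub>E I G \<subseteq> W"
      using W(1) unfolding openin_product_topology_alt by fastforce
    have "\<exists>k\<in>I. \<forall>i\<in>F. (i, k) \<in> r" if "finite F" "F \<subseteq> I" for F
      using that
    proof (induction F)
      case empty
      then show ?case using Ine by blast
    next
      case (insert j F)
      then obtain k where k: "k \<in> I" "\<forall>i\<in>F. (i, k) \<in> r" by auto
      obtain l where l: "l \<in> I" "(k, l) \<in> r" "(j, l) \<in> r" using dir[OF k(1), of j] insert.prems by blast
      have tr: "trans r" using po by (simp add: partial_order_on_def preorder_on_def)
      have "(i, l) \<in> r" if "i \<in> F" for i using transD[OF tr _ l(2)] k(2) that by blast
      then show ?case using l by blast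
    qed
    from this[OF G(1)] obtain k where k: "k \<in> I" "\<And>i. i \<in> I \<Longrightarrow> G i \<noteq> carrier (B i) \<Longrightarrow> (i, k) \<in> r" by blast
    have "ker k +>\<^bsub>A\<^esub> x \<subseteq> U"
    proof
      fix y assume "y \<in> ker k +>\<^bsub>A\<^esub> x"
      then have y: "y \<in> carrier A" "h y k = h x k" using kcos[OF k(1) xA] by auto
      have "h y i \<in> G i" if i: "i \<in> I" for i
      proof (cases "G i = carrier (B i)")
        case False
        have ik: "(i, k) \<in> r" using k(2)[OF i False] .
        have "h y i = \<phi> i k (h y k)" "h x i = \<phi> i k (h x k)" using hc[OF y(1)] hc[OF xA] Lc ik by metis+
        then have "h y i = h x i" using y by simp
        then show ?thesis using G(2) i by auto
      qed (use hB[OF y(1) i] in simp)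
      moreover have "h y \<in> extensional I" using hc[OF y(1)] Lc by (auto simp: PiE_def)
      ultimately have "h y \<in> Pi\<^sub>E I G" by (auto simp: PiE_def)
      then have "h y \<in> h ` U" using W(2) G(3) hc[OF y(1)] by blast
      then obtain u where u: "u \<in> U" "h y = h u" by blast
      have "inj_on h (topspace T)" using homeomorphic_imp_injective_map[OF hom] .
      then show "y \<in> U" using u y(1) openin_subset[OF U(1)] space by (metis inj_onD subsetD)
    qed
    then show "\<exists>C\<in>ker ` I. C +>\<^bsub>A\<^esub> x \<subseteq> U" using k(1) by blast
  qed
  then show ?thesis by (rule that)
qed

section \<open>Open maximal subalgebras and topological generation\<close>

context profinite_base
begin

lemma C_sub: "C \<in> \<C> \<Longrightarrow> additive_subgroup C A"
  using C_ideal by (simp add: ideal_def)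

lemma C_zero: "C \<in> \<C> \<Longrightarrow> C +> \<zero> = C"
  using additive_subgroup_closed(1)[OF C_sub] by (simp add: a_coset_add_zero)

lemma ideal_smult:
  assumes C: "ideal C A" and c: "c \<in> carrier K" and x: "x \<in> C"
  shows "c \<odot> x \<in> C"
proof -
  have "additive_subgroup C A" using C by (simp add: ideal_def)
  then have xA: "x \<in> carrier A" using additive_subgroup_closed(1) x by blast
  show "c \<odot> x \<in> C"
    unfolding smult_eq_mult[OF c xA] by (rule ideal.I_l_closed[OF C x]) (use c in simp)
qed

lemma open_contains_ideal:
  assumes "openin T M" "\<zero> \<in> M"
  shows "\<exists>C\<in>\<C>. C \<subseteq> M"
  using base[OF assms] C_zero by metis

lemma subalgebra_plus_ideal:
  assumes S: "unital_subalgebra K A S" and C: "ideal C A"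
  defines "P \<equiv> {x \<in> carrier A. \<exists>s\<in>S. x \<ominus> s \<in> C}"
  shows "unital_subalgebra K A P" "S \<subseteq> P" "C \<subseteq> P"
proof -
  note D = unital_subalgebraD[OF S] and CD = additive_subgroup_closed[OF C[THEN ideal.axioms(1)]]
  have SA: "s \<in> carrier A" if "s \<in> S" for s using that D(1) by blast
  have CA: "c \<in> carrier A" if "c \<in> C" for c using that CD(1) by blast
  have PI: "s \<oplus> c \<in> P" if "s \<in> S" "c \<in> C" for s c
  proof -
    have "(s \<oplus> c) \<ominus> s = c" using plus_minus_cancel[of c s] SA CA that by (simp add: a_comm)
    moreover have "s \<oplus> c \<in> carrier A" using SA CA that by simp
    ultimately show ?thesis unfolding P_def using that by (auto intro!: bexI[of _ s])
  qed
  have PE: "\<exists>s\<in>S. \<exists>c\<in>C. x = s \<oplus> c" if xP: "x \<in> P" for x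
  proof -
    obtain s where s: "s \<in> S" "x \<in> carrier A" "x \<ominus> s \<in> C" using xP by (auto simp: P_def)
    have "x = s \<oplus> (x \<ominus> s)" using minus_plus_cancel[OF s(2) SA[OF s(1)]] SA[OF s(1)] CA[OF s(3)] by (simp add: a_comm)
    then show ?thesis using s by blast
  qed
  show "S \<subseteq> P" using PI[OF _ CD(2)] SA by (metis r_zero subsetI)
  show "C \<subseteq> P" using PI[OF D(2)] CA by (metis l_zero subsetI)
  show "unital_subalgebra K A P"
  proof (rule unital_subalgebraI)
    show "P \<subseteq> carrier A" by (auto simp: P_def)
    show "\<one> \<in> P" using \<open>S \<subseteq> P\<close> D(3) by blast
    fix x y assume "x \<in> P" "y \<in> P"
    then obtain s c s' c' where *: "s \<in> S" "c \<in> C" "x = s \<oplus> c" "s' \<in> S" "c' \<in> C" "y = s' \<oplus> c'" using PE by meson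
    note cl = SA[OF *(1)] SA[OF *(4)] CA[OF *(2)] CA[OF *(5)]
    have "x \<oplus> y = (s \<oplus> s') \<oplus> (c \<oplus> c')" using cl unfolding *(3,6) by (simp add: a_ac)
    then show "x \<oplus> y \<in> P" using PI[OF D(4)[OF *(1,4)] CD(3)[OF *(2,5)]] by simp
    have "x \<otimes> y = (s \<otimes> s') \<oplus> (s \<otimes> c' \<oplus> (c \<otimes> s' \<oplus> c \<otimes> c'))"
      using cl unfolding *(3,6) by (simp add: l_distr r_distr a_ac)
    moreover have "s \<otimes> c' \<oplus> (c \<otimes> s' \<oplus> c \<otimes> c') \<in> C"
      using ideal.I_l_closed[OF C] ideal.I_r_closed[OF C] cl * CD(3) by simp
    ultimately show "x \<otimes> y \<in> P" using PI[OF D(5)[OF *(1,4)]] by simp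
  next
    fix x assume "x \<in> P"
    then obtain s c where *: "s \<in> S" "c \<in> C" "x = s \<oplus> c" using PE by meson
    note cl = SA[OF *(1)] CA[OF *(2)]
    have "\<ominus> x = \<ominus> s \<oplus> \<ominus> c" using cl unfolding *(3) by (rule minus_add)
    then show "\<ominus> x \<in> P" using PI[OF D(6)[OF *(1)] CD(4)[OF *(2)]] by simp
  next
    fix k x assume k: "k \<in> carrier K" and "x \<in> P"
    then obtain s c where *: "s \<in> S" "c \<in> C" "x = s \<oplus> c" using PE by meson
    note cl = SA[OF *(1)] CA[OF *(2)]
    have "k \<odot> x = k \<odot> s \<oplus> k \<odot> c" using cl k unfolding *(3) by (simp add: smult_r_distr)
    then show "k \<odot> x \<in> P" using PI[OF D(8)[OF k *(1)] ideal_smult[OF C k *(2)]] by simp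
  qed
qed

lemma sub_with_ideal_cosets:
  assumes H: "additive_subgroup H A" and C: "C \<in> \<C>" "C \<subseteq> H"
  shows "openin T H" "finite (a_rcosets H)" "x \<in> carrier A \<Longrightarrow> openin T (H +> x)"
proof -
  note HD = additive_subgroup_closed[OF H]
  have sub: "C +> y \<subseteq> H +> x" if x: "x \<in> carrier A" and y: "y \<in> H +> x" for x y
  proof -
    have yA: "y \<in> carrier A" "y \<ominus> x \<in> H" using y coset_mem[OF H x] by auto
    then have eq: "H +> y = H +> x" using coset_eq_iff[OF H yA(1) x] by simp
    have "C +> y \<subseteq> H +> y" using coset_mem[OF H yA(1)] coset_mem[OF C_sub[OF C(1)] yA(1)] C(2) by blast
    then show ?thesis using eq by simp
  qed
  show op: "openin T (H +> x)" if x: "x \<in> carrier A" for x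
  proof (subst openin_subopen, intro ballI)
    fix y assume y: "y \<in> H +> x"
    then have yA: "y \<in> carrier A" using coset_mem[OF H x] by blast
    show "\<exists>U. openin T U \<and> y \<in> U \<and> U \<subseteq> H +> x"
      using C_coset_open[OF C(1) yA] coset_self[OF C_sub[OF C(1)] yA] sub[OF x y] by blast
  qed
  show "openin T H" using op[of "\<zero>"] HD(1) by (simp add: a_coset_add_zero)
  have "a_rcosets H \<subseteq> (\<lambda>X. \<Union>x\<in>X. H +> x) ` (a_rcosets C)"
  proof
    fix Y assume "Y \<in> a_rcosets H"
    then obtain x where x: "x \<in> carrier A" "Y = H +> x" by (auto simp: A_RCOSETS_def')
    have "H +> y = Y" if "y \<in> C +> x" for y
    proof -
      have yA: "y \<in> carrier A" "y \<ominus> x \<in> H" using that coset_mem[OF C_sub[OF C(1)] x(1)] C(2) by auto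
      then show ?thesis using coset_eq_iff[OF H yA(1) x(1)] x(2) by simp
    qed
    then have "Y = (\<Union>y\<in>C +> x. H +> y)" using coset_self[OF C_sub[OF C(1)] x(1)] by blast
    moreover have "C +> x \<in> a_rcosets C" using x(1) by (auto simp: A_RCOSETS_def')
    ultimately show "Y \<in> (\<lambda>X. \<Union>x\<in>X. H +> x) ` (a_rcosets C)" by blast
  qed
  then show "finite (a_rcosets H)" using C_fin[OF C(1)] finite_surj by blast
qed

definition open_max :: "'a set set" where
  "open_max = {M. maximal_subalgebra K A M \<and> openin T M}"

lemma open_maxD:
  assumes "M \<in> open_max"
  shows "unital_subalgebra K A M" "M \<noteq> carrier A" "additive_subgroup M A" "M \<subseteq> carrier A" "\<exists>C\<in>\<C>. C \<subseteq> M"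
    "finite (a_rcosets M)" "card (a_rcosets M) \<ge> 2"
    "\<And>S. unital_subalgebra K A S \<Longrightarrow> M \<subseteq> S \<Longrightarrow> S = M \<or> S = carrier A"
proof -
  show u: "unital_subalgebra K A M" and ne: "M \<noteq> carrier A" and
    "\<And>S. unital_subalgebra K A S \<Longrightarrow> M \<subseteq> S \<Longrightarrow> S = M \<or> S = carrier A"
    using assms by (auto simp: open_max_def maximal_subalgebra_def)
  note D = unital_subalgebraD[OF u]
  show H: "additive_subgroup M A" "M \<subseteq> carrier A" by (rule D(9), rule D(1))
  show C: "\<exists>C\<in>\<C>. C \<subseteq> M" by (rule open_contains_ideal[OF _ D(2)]) (use assms in \<open>simp add: open_max_def\<close>)
  then show f: "finite (a_rcosets M)" using sub_with_ideal_cosets(2)[OF H(1)] by blast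
  obtain x where x: "x \<in> carrier A" "x \<notin> M" using H(2) ne by blast
  have ne: "M +> x \<noteq> M +> \<zero>" using coset_eq_iff[OF H(1) x(1)] x by (simp add: a_minus_def)
  have "{M +> x, M +> \<zero>} \<subseteq> a_rcosets M" using x by (auto simp: A_RCOSETS_def')
  from card_mono[OF f this] show "card (a_rcosets M) \<ge> 2" using ne by simp
qed

lemma open_maxI:
  assumes "maximal_subalgebra K A M" "C \<in> \<C>" "C \<subseteq> M"
  shows "M \<in> open_max"
  using assms sub_with_ideal_cosets(1)[OF unital_subalgebraD(9)] by (auto simp: open_max_def maximal_subalgebra_def)

text \<open>Subalgebras containing \<open>C\<close> are unions of cosets of \<open>C\<close>, so
  there are only finitely many of them.\<close>

lemma exists_max_above:
  assumes P: "unital_subalgebra K A P" "P \<noteq> carrier A" and C: "C \<in> \<C>" "C \<subseteq> P"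
  shows "\<exists>M\<in>open_max. P \<subseteq> M"
proof -
  let ?F = "{S. unital_subalgebra K A S \<and> P \<subseteq> S \<and> S \<noteq> carrier A}"
  have "inj_on (\<lambda>S. (\<lambda>x. C +> x) ` S) ?F"
  proof (rule inj_onI)
    fix S S' assume *: "S \<in> ?F" "S' \<in> ?F" "(\<lambda>x. C +> x) ` S = (\<lambda>x. C +> x) ` S'"
    have half: "S1 \<subseteq> S2" if S: "S1 \<in> ?F" "S2 \<in> ?F" "(\<lambda>x. C +> x) ` S1 = (\<lambda>x. C +> x) ` S2" for S1 S2
    proof
      fix x assume x: "x \<in> S1"
      have U: "unital_subalgebra K A S1" "unital_subalgebra K A S2" "C \<subseteq> S2" using S C(2) by auto
      note D1 = unital_subalgebraD[OF U(1)] and D2 = unital_subalgebraD[OF U(2)]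
      obtain y where y: "y \<in> S2" "C +> x = C +> y" using S(3) x by blast
      have xy: "x \<in> carrier A" "y \<in> carrier A" using x y D1(1) D2(1) by auto
      have "x \<ominus> y \<in> S2" using coset_eq_iff[OF C_sub[OF C(1)] xy] y(2) U(3) by blast
      then show "x \<in> S2" using D2(4)[OF _ y(1), of "x \<ominus> y"] minus_plus_cancel[OF xy] by simp
    qed
    show "S = S'" using half[OF *(1,2,3)] half[OF *(2,1) *(3)[symmetric]] by blast
  qed
  moreover have "(\<lambda>S. (\<lambda>x. C +> x) ` S) ` ?F \<subseteq> Pow (a_rcosets C)"
    using unital_subalgebraD(1) by (fastforce simp: A_RCOSETS_def')
  ultimately have "finite ?F" using C_fin[OF C(1)] by (meson finite_Pow_iff inj_on_finite)
  moreover have "?F \<noteq> {}" using P by blast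
  ultimately have "\<exists>M\<in>?F. \<forall>S\<in>?F. M \<subseteq> S \<longrightarrow> M = S" by (rule finite_has_maximal)
  then obtain M where M: "M \<in> ?F" "\<forall>S\<in>?F. M \<subseteq> S \<longrightarrow> M = S" by (elim bexE)
  have "maximal_subalgebra K A M"
    unfolding maximal_subalgebra_def
  proof (intro conjI allI impI)
    fix S assume S: "unital_subalgebra K A S" "M \<subseteq> S"
    show "S = M \<or> S = carrier A"
    proof (rule disjCI, rule ccontr)
      assume n: "S \<noteq> carrier A" "S \<noteq> M"
      then have "S \<in> ?F" using S M(1) by auto
      then show False using M(2) S(2) n(2) by auto
    qed
  qed (use M(1) in simp_all)
  then show ?thesis using open_maxI[OF _ C(1)] C(2) M(1) by blast
qed

text \<open>Density means meeting every coset of every \<open>C\<close>, that is, mapping onto each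
  finite quotient.\<close>

lemma dense_iff:
  assumes "S \<subseteq> carrier A"
  shows "T closure_of S = carrier A \<longleftrightarrow> (\<forall>C\<in>\<C>. \<forall>x\<in>carrier A. \<exists>s\<in>S. x \<ominus> s \<in> C)"
proof
  assume d: "T closure_of S = carrier A"
  show "\<forall>C\<in>\<C>. \<forall>x\<in>carrier A. \<exists>s\<in>S. x \<ominus> s \<in> C"
  proof (intro ballI)
    fix C x assume C: "C \<in> \<C>" and x: "x \<in> carrier A"
    have "x \<in> T closure_of S" using d x by simp
    then obtain s where s: "s \<in> S" "s \<in> C +> x"
      using C_coset_open[OF C x] coset_self[OF C_sub[OF C] x] unfolding in_closure_of by blast
    then have "C +> s = C +> x"
      using coset_mem[OF C_sub[OF C] x] coset_eq_iff[OF C_sub[OF C] _ x] by blast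
    then show "\<exists>s\<in>S. x \<ominus> s \<in> C" using coset_eq_iff[OF C_sub[OF C] x, of s] s(1) assms by auto
  qed
next
  assume d: "\<forall>C\<in>\<C>. \<forall>x\<in>carrier A. \<exists>s\<in>S. x \<ominus> s \<in> C"
  show "T closure_of S = carrier A"
  proof
    show "T closure_of S \<subseteq> carrier A" using closure_of_subset_topspace space by metis
    show "carrier A \<subseteq> T closure_of S"
    proof
      fix x assume x: "x \<in> carrier A"
      have "\<exists>y. y \<in> S \<and> y \<in> U" if U: "x \<in> U" "openin T U" for U
      proof -
        obtain C where C: "C \<in> \<C>" "C +> x \<subseteq> U" using base[OF U(2,1)] by blast
        obtain s where s: "s \<in> S" "x \<ominus> s \<in> C" using d C(1) x by blast
        have sA: "s \<in> carrier A" using s assms by blast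
        have "C +> x = C +> s" using coset_eq_iff[OF C_sub[OF C(1)] x sA] s(2) by simp
        then show ?thesis using coset_self[OF C_sub[OF C(1)] sA] C(2) s(1) by blast
      qed
      then show "x \<in> T closure_of S" using x space by (auto simp: in_closure_of)
    qed
  qed
qed

lemma generated_subalgebra:
  assumes "X \<subseteq> carrier A"
  shows "unital_subalgebra K A (generated_subalgebra K A X)" "X \<subseteq> generated_subalgebra K A X"
    "\<And>S. unital_subalgebra K A S \<Longrightarrow> X \<subseteq> S \<Longrightarrow> generated_subalgebra K A X \<subseteq> S"
proof -
  have cA: "unital_subalgebra K A (carrier A)" by (rule unital_subalgebraI) auto
  show "X \<subseteq> generated_subalgebra K A X" "\<And>S. unital_subalgebra K A S \<Longrightarrow> X \<subseteq> S \<Longrightarrow> generated_subalgebra K A X \<subseteq> S"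
    by (auto simp: generated_subalgebra_def)
  show "unital_subalgebra K A (generated_subalgebra K A X)"
  proof (rule unital_subalgebraI)
    show "generated_subalgebra K A X \<subseteq> carrier A" using cA assms by (auto simp: generated_subalgebra_def)
  qed (use unital_subalgebraD(3-6,8) in \<open>auto simp: generated_subalgebra_def\<close>)
qed

text \<open>If the generated subalgebra \<open>S\<close> is not dense, some \<open>S + C\<close> is
  proper and lies in an open maximal subalgebra. Conversely, an open maximal \<open>M\<close>
  containing \<open>X\<close> contains some \<open>C\<close>, hence \<open>S + C\<close>, which is
  then proper.\<close>

lemma topologically_generates_iff:
  assumes X: "X \<subseteq> carrier A"
  shows "topologically_generates K A T X \<longleftrightarrow> (\<forall>M\<in>open_max. \<not> X \<subseteq> M)"
proof -
  let ?S = "generated_subalgebra K A X"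
  note G = generated_subalgebra[OF X]
  note D = unital_subalgebraD[OF G(1)]
  have "topologically_generates K A T X \<longleftrightarrow> (\<forall>C\<in>\<C>. \<forall>x\<in>carrier A. \<exists>s\<in>?S. x \<ominus> s \<in> C)"
    unfolding topologically_generates_def by (rule dense_iff[OF D(1)])
  also have "\<dots> \<longleftrightarrow> (\<forall>M\<in>open_max. \<not> X \<subseteq> M)"
  proof
    assume d: "\<forall>C\<in>\<C>. \<forall>x\<in>carrier A. \<exists>s\<in>?S. x \<ominus> s \<in> C"
    show "\<forall>M\<in>open_max. \<not> X \<subseteq> M"
    proof (intro ballI notI)
      fix M assume M: "M \<in> open_max" "X \<subseteq> M"
      note MD = open_maxD[OF M(1)]
      have SM: "?S \<subseteq> M" by (rule G(3)[OF MD(1) M(2)])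
      obtain C where C: "C \<in> \<C>" "C \<subseteq> M" using MD(5) by blast
      have "x \<in> M" if x: "x \<in> carrier A" for x
      proof -
        obtain s where s: "s \<in> ?S" "x \<ominus> s \<in> C" using d C(1) x by blast
        have "(x \<ominus> s) \<oplus> s \<in> M" using unital_subalgebraD(4)[OF MD(1)] s SM C(2) by blast
        then show ?thesis using minus_plus_cancel[OF x] s(1) D(1) by auto
      qed
      then show False using MD(2,4) by blast
    qed
  next
    assume n: "\<forall>M\<in>open_max. \<not> X \<subseteq> M"
    show "\<forall>C\<in>\<C>. \<forall>x\<in>carrier A. \<exists>s\<in>?S. x \<ominus> s \<in> C"
    proof (rule ballI)
      fix C assume C: "C \<in> \<C>"
      let ?P = "{x \<in> carrier A. \<exists>s\<in>?S. x \<ominus> s \<in> C}"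
      note P = subalgebra_plus_ideal[OF G(1) C_ideal[OF C]]
      have "?P = carrier A"
      proof (rule ccontr)
        assume "?P \<noteq> carrier A"
        then obtain M where "M \<in> open_max" "?P \<subseteq> M" using exists_max_above[OF P(1) _ C P(3)] by blast
        then show False using n P(2) G(2) by blast
      qed
      then show "\<forall>x\<in>carrier A. \<exists>s\<in>?S. x \<ominus> s \<in> C" by blast
    qed
  qed
  finally show ?thesis .
qed

end

section \<open>Countability of the base when some tuple generates\<close>

context profinite_base
begin

text \<open>The multiplication table of \<open>A / C\<close>, with cosets numbered by \<open>\<beta> C\<close> and the generators marked,
  determines \<open>C\<close>.\<close>

lemma countable_base:
  fixes X :: "nat \<Rightarrow> 'a"
  assumes X: "X ` {..<d} \<subseteq> carrier A" and gen: "topologically_generates K A T (X ` {..<d})"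
  shows "countable \<C>"
proof -
  define \<beta> where "\<beta> C a = to_nat_on (a_rcosets C) (C +> a)" for C a
  define \<kappa> where "\<kappa> = to_nat_on (carrier K)"
  \<comment> \<open>The lengths 5, 3, 1 and 2 tell apart the entries for sums and products, scalars,
    the unit and the generators.\<close>
  define dat where "dat C = (\<lambda>(a, b). [\<beta> C a, \<beta> C b, \<beta> C (a \<oplus> b), \<beta> C (a \<otimes> b), 0]) ` (carrier A \<times> carrier A)
    \<union> (\<lambda>(c, a). [\<kappa> c, \<beta> C a, \<beta> C (c \<odot> a)]) ` (carrier K \<times> carrier A) \<union> {[\<beta> C \<one>]} \<union> (\<lambda>i. [i, \<beta> C (X i)]) ` {..<d}" for C
  have dat_mem: "a \<in> carrier A \<Longrightarrow> b \<in> carrier A \<Longrightarrow> [\<beta> C a, \<beta> C b, \<beta> C (a \<oplus> b), \<beta> C (a \<otimes> b), 0] \<in> dat C"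
    "c \<in> carrier K \<Longrightarrow> a \<in> carrier A \<Longrightarrow> [\<kappa> c, \<beta> C a, \<beta> C (c \<odot> a)] \<in> dat C"
    "[\<beta> C \<one>] \<in> dat C" "i < d \<Longrightarrow> [i, \<beta> C (X i)] \<in> dat C" for C a b c i
    unfolding dat_def
    by (rule UnI1, rule UnI1, rule UnI1, rule image_eqI[of _ _ "(a, b)"], simp, simp)
      (rule UnI1, rule UnI1, rule UnI2, rule image_eqI[of _ _ "(c, a)"], simp, simp,
       rule UnI1, rule UnI2, simp, rule UnI2, rule image_eqI[of _ _ i], simp, simp)
  have dat_cases: "x \<in> dat C \<longleftrightarrow> (\<exists>a\<in>carrier A. \<exists>b\<in>carrier A. x = [\<beta> C a, \<beta> C b, \<beta> C (a \<oplus> b), \<beta> C (a \<otimes> b), 0])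
      \<or> (\<exists>c\<in>carrier K. \<exists>a\<in>carrier A. x = [\<kappa> c, \<beta> C a, \<beta> C (c \<odot> a)]) \<or> x = [\<beta> C \<one>] \<or> (\<exists>i<d. x = [i, \<beta> C (X i)])" for x C
    unfolding dat_def Un_iff image_iff bex_simps by (simp add: Bex_def)
  have \<beta>_coset: "\<beta> C a = \<beta> C b \<longleftrightarrow> C +> a = C +> b" if "C \<in> \<C>" "a \<in> carrier A" "b \<in> carrier A" for C a b
    unfolding \<beta>_def by (rule inj_on_eq_iff[OF inj_on_to_nat_on[OF countable_finite[OF C_fin[OF that(1)]]]])
      (use that in \<open>auto simp: A_RCOSETS_def'\<close>)
  have \<beta>_eq: "\<beta> C a = \<beta> C b \<longleftrightarrow> a \<ominus> b \<in> C" if "C \<in> \<C>" "a \<in> carrier A" "b \<in> carrier A" for C a b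
    using \<beta>_coset[OF that] coset_eq_iff[OF C_sub[OF that(1)] that(2,3)] by simp
  have \<kappa>_eq: "\<kappa> c = \<kappa> c' \<longleftrightarrow> c = c'" if "c \<in> carrier K" "c' \<in> carrier K" for c c'
    unfolding \<kappa>_def by (rule inj_on_eq_iff[OF inj_on_to_nat_on[OF countable_finite[OF fin_K]] that])
  have fin: "finite (dat C)" if C: "C \<in> \<C>" for C
  proof -
    have "\<beta> C ` carrier A \<subseteq> to_nat_on (a_rcosets C) ` (a_rcosets C)" by (auto simp: \<beta>_def A_RCOSETS_def')
    then have f: "finite (\<beta> C ` carrier A)" using C_fin[OF C] finite_subset by blast
    have "dat C \<subseteq> {xs. set xs \<subseteq> \<beta> C ` carrier A \<union> \<kappa> ` carrier K \<union> {..<d} \<union> {0} \<and> length xs \<le> 5}"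
      using X by (auto simp: dat_def)
    then show ?thesis
      by (rule finite_subset) (intro finite_lists_length_le finite_UnI f finite_imageI fin_K finite_lessThan finite.intros)
  qed
  have cong: "\<beta> C (a \<oplus> b) = \<beta> C (a' \<oplus> b')" "\<beta> C (a \<otimes> b) = \<beta> C (a' \<otimes> b')"
    if C: "C \<in> \<C>" and cl: "a \<in> carrier A" "b \<in> carrier A" "a' \<in> carrier A" "b' \<in> carrier A"
      and e: "\<beta> C a = \<beta> C a'" "\<beta> C b = \<beta> C b'" for C a b a' b'
  proof -
    have h: "(+>) C \<in> ring_hom A (A Quot C)" by (rule ideal.rcos_ring_hom[OF C_ideal[OF C]])
    note e' = e(1)[unfolded \<beta>_coset[OF C cl(1,3)]] e(2)[unfolded \<beta>_coset[OF C cl(2,4)]]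
    show "\<beta> C (a \<oplus> b) = \<beta> C (a' \<oplus> b')"
      unfolding \<beta>_def ring_hom_add[OF h cl(1,2)] ring_hom_add[OF h cl(3,4)] e' ..
    show "\<beta> C (a \<otimes> b) = \<beta> C (a' \<otimes> b')"
      unfolding \<beta>_def ring_hom_mult[OF h cl(1,2)] ring_hom_mult[OF h cl(3,4)] e' ..
  qed
  have cong_smult: "\<beta> C (c \<odot> a) = \<beta> C (c \<odot> a')"
    if "C \<in> \<C>" "c \<in> carrier K" "a \<in> carrier A" "a' \<in> carrier A" "\<beta> C a = \<beta> C a'" for C c a a'
    unfolding smult_eq_mult[OF that(2,3)] smult_eq_mult[OF that(2,4)]
    by (rule cong(2)) (use that in simp_all)
  have half: "C \<subseteq> C'" if C: "C \<in> \<C>" "C' \<in> \<C>" "dat C = dat C'" for C C'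
  proof -
    \<comment> \<open>Equal tables make the elements with the same coset number for \<open>C\<close>
      and \<open>C'\<close> a subalgebra. It contains the generators, so it is dense, and modulo a
      \<open>D \<subseteq> C \<inter> C'\<close> every element is congruent to one of it.\<close>
    define E where "E = {a \<in> carrier A. \<beta> C a = \<beta> C' a}"
    have ops: "a \<oplus> b \<in> E" "a \<otimes> b \<in> E" if ab: "a \<in> E" "b \<in> E" for a b
    proof -
      have cl: "a \<in> carrier A" "b \<in> carrier A" and e: "\<beta> C a = \<beta> C' a" "\<beta> C b = \<beta> C' b" using ab by (auto simp: E_def)
      have "[\<beta> C a, \<beta> C b, \<beta> C (a \<oplus> b), \<beta> C (a \<otimes> b), 0] \<in> dat C'"
        unfolding C(3)[symmetric] by (rule dat_mem(1)[OF cl])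
      then have "\<exists>a'\<in>carrier A. \<exists>b'\<in>carrier A. [\<beta> C a, \<beta> C b, \<beta> C (a \<oplus> b), \<beta> C (a \<otimes> b), 0]
          = [\<beta> C' a', \<beta> C' b', \<beta> C' (a' \<oplus> b'), \<beta> C' (a' \<otimes> b'), 0]"
        unfolding dat_cases by (elim disjE bexE exE conjE, blast, simp_all)
      then obtain a' b' where ab1: "a' \<in> carrier A" "b' \<in> carrier A"
        and L: "[\<beta> C a, \<beta> C b, \<beta> C (a \<oplus> b), \<beta> C (a \<otimes> b), 0]
          = [\<beta> C' a', \<beta> C' b', \<beta> C' (a' \<oplus> b'), \<beta> C' (a' \<otimes> b'), 0]" by (elim bexE)
      have ab2: "\<beta> C a = \<beta> C' a'" "\<beta> C b = \<beta> C' b'"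
        "\<beta> C (a \<oplus> b) = \<beta> C' (a' \<oplus> b')" "\<beta> C (a \<otimes> b) = \<beta> C' (a' \<otimes> b')"
        using L by (simp_all only: list.inject)
      note ab' = ab1 ab2
      have e': "\<beta> C' a' = \<beta> C' a" "\<beta> C' b' = \<beta> C' b" using e ab'(3,4) by auto
      show "a \<oplus> b \<in> E" unfolding E_def
        by (rule CollectI, rule conjI, rule a_closed[OF cl], rule trans[OF ab'(5) cong(1)[OF C(2) ab'(1,2) cl e']])
      show "a \<otimes> b \<in> E" unfolding E_def
        by (rule CollectI, rule conjI, rule m_closed[OF cl], rule trans[OF ab'(6) cong(2)[OF C(2) ab'(1,2) cl e']])
    qed
    have sm: "c \<odot> a \<in> E" if c: "c \<in> carrier K" and a: "a \<in> E" for c a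
    proof -
      have cl: "a \<in> carrier A" and e: "\<beta> C a = \<beta> C' a" using a by (auto simp: E_def)
      have "[\<kappa> c, \<beta> C a, \<beta> C (c \<odot> a)] \<in> dat C'" unfolding C(3)[symmetric] by (rule dat_mem(2)[OF c cl])
      then have "\<exists>c'\<in>carrier K. \<exists>a'\<in>carrier A. [\<kappa> c, \<beta> C a, \<beta> C (c \<odot> a)] = [\<kappa> c', \<beta> C' a', \<beta> C' (c' \<odot> a')]"
        unfolding dat_cases by (elim disjE bexE exE conjE, simp_all)
      then obtain c' a' where ca1: "c' \<in> carrier K" "a' \<in> carrier A"
        and L: "[\<kappa> c, \<beta> C a, \<beta> C (c \<odot> a)] = [\<kappa> c', \<beta> C' a', \<beta> C' (c' \<odot> a')]" by (elim bexE)
      have ca2: "\<kappa> c = \<kappa> c'" "\<beta> C a = \<beta> C' a'" "\<beta> C (c \<odot> a) = \<beta> C' (c' \<odot> a')"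
        using L by (simp_all only: list.inject)
      note ca = ca1 ca2
      have "c' = c" using \<kappa>_eq[OF c ca(1)] ca(3) by simp
      have "\<beta> C' (c \<odot> a') = \<beta> C' (c \<odot> a)" by (rule cong_smult[OF C(2) c ca(2) cl]) (simp only: e[symmetric] ca(4))
      from trans[OF ca(5)[unfolded \<open>c' = c\<close>] this] show ?thesis unfolding E_def mem_Collect_eq
        using smult_closed[OF c cl] by blast
    qed
    have E: "unital_subalgebra K A E"
    proof (rule unital_subalgebraI)
      have "[\<beta> C \<one>] \<in> dat C'" unfolding C(3)[symmetric] by (rule dat_mem(3))
      then show "\<one> \<in> E" unfolding dat_cases E_def by simp
      fix a assume a: "a \<in> E"
      have "(\<ominus>\<^bsub>K\<^esub> \<one>\<^bsub>K\<^esub>) \<odot> a \<in> E" by (rule sm[OF _ a]) simp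
      then show "\<ominus> a \<in> E" using a smult_l_minus[of "\<one>\<^bsub>K\<^esub>" a] by (simp add: E_def)
    qed (use ops sm in \<open>auto simp: E_def\<close>)
    have XE: "X ` {..<d} \<subseteq> E"
    proof (rule image_subsetI)
      fix i assume i: "i \<in> {..<d}"
      then have "[i, \<beta> C (X i)] \<in> dat C'" unfolding C(3)[symmetric] by (intro dat_mem(4)) simp
      then have "\<beta> C (X i) = \<beta> C' (X i)" unfolding dat_cases by simp
      then show "X i \<in> E" using X i by (auto simp: E_def)
    qed
    let ?S = "generated_subalgebra K A (X ` {..<d})"
    have SE: "?S \<subseteq> E" by (rule generated_subalgebra(3)[OF X E XE])
    have SA: "?S \<subseteq> carrier A" using SE by (auto simp: E_def)
    obtain D where D: "D \<in> \<C>" "D \<subseteq> C \<inter> C'" using C_directed[OF C(1,2)] by blast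
    have all: "\<beta> C a = \<beta> C' a" if a: "a \<in> carrier A" for a
    proof -
      obtain s where s: "s \<in> ?S" "a \<ominus> s \<in> D"
        using gen[unfolded topologically_generates_def dense_iff[OF SA]] D(1) a by blast
      have sA: "s \<in> carrier A" and sE: "\<beta> C s = \<beta> C' s" using s SE by (auto simp: E_def)
      have "\<beta> C a = \<beta> C s" "\<beta> C' a = \<beta> C' s"
        using \<beta>_eq[OF C(1) a sA] \<beta>_eq[OF C(2) a sA] s(2) D(2) by auto
      then show ?thesis using sE by simp
    qed
    show ?thesis
    proof
      fix a assume a: "a \<in> C"
      have aA: "a \<in> carrier A" using a additive_subgroup_closed(1)[OF C_sub[OF C(1)]] by blast
      have z: "a \<ominus> \<zero> = a" using aA by (simp add: a_minus_def)
      have "\<beta> C' a = \<beta> C' \<zero>" using \<beta>_eq[OF C(1) aA, of "\<zero>"] a all[OF aA] all[of "\<zero>"] z by simp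
      then show "a \<in> C'" using \<beta>_eq[OF C(2) aA, of "\<zero>"] z by simp
    qed
  qed
  have "inj_on dat \<C>" using half by (intro inj_onI equalityI) auto
  moreover have "countable (dat ` \<C>)"
    by (rule countable_subset[OF _ countable_Collect_finite]) (use fin in auto)
  ultimately show ?thesis by (rule countable_image_inj_on[rotated])
qed

section \<open>Clopen sets and their content\<close>

definition saturated :: "'a set \<Rightarrow> 'a set \<Rightarrow> bool" where
  "saturated H U \<longleftrightarrow> U \<subseteq> carrier A \<and> (\<forall>x\<in>U. H +> x \<subseteq> U)"

definition cosets_in :: "'a set \<Rightarrow> 'a set \<Rightarrow> 'a set set" where
  "cosets_in H U = {X \<in> a_rcosets H. X \<subseteq> U}"

abbreviation translate :: "'a \<Rightarrow> 'a set \<Rightarrow> 'a set" where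
  "translate a U \<equiv> (\<lambda>x. a \<oplus> x) ` U"

lemma translate_coset:
  assumes H: "additive_subgroup H A" and ax: "a \<in> carrier A" "x \<in> carrier A"
  shows "translate a (H +> x) = H +> (a \<oplus> x)"
proof -
  have HA: "h \<in> carrier A" if "h \<in> H" for h using that additive_subgroup_closed(1)[OF H] by blast
  have "translate a (H +> x) = (\<lambda>h. a \<oplus> (h \<oplus> x)) ` H" by (auto simp: a_r_coset_def')
  also have "\<dots> = (\<lambda>h. h \<oplus> (a \<oplus> x)) ` H" by (rule image_cong[OF refl]) (use ax HA a_lcomm in blast)
  finally show ?thesis by (auto simp: a_r_coset_def')
qed

lemma translate_sub:
  assumes H: "additive_subgroup H A" and x: "x \<in> carrier A"
  shows "translate x H = H +> x"
  using translate_coset[OF H x zero_closed] additive_subgroup_closed(1)[OF H] x by (simp add: a_coset_add_zero)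

lemma inj_translate: "a \<in> carrier A \<Longrightarrow> inj_on (\<lambda>x. a \<oplus> x) (carrier A)"
  by (rule inj_on_inverseI[of _ "\<lambda>x. \<ominus> a \<oplus> x"]) (simp add: r_neg1)

lemma saturated_translate:
  assumes H: "additive_subgroup H A" and a: "a \<in> carrier A" and U: "saturated H U"
  shows "saturated H (translate a U)"
  unfolding saturated_def
proof (intro conjI ballI)
  show "translate a U \<subseteq> carrier A" using U a by (auto simp: saturated_def)
  fix x assume "x \<in> translate a U"
  then obtain u where u: "u \<in> U" "x = a \<oplus> u" by blast
  have "H +> u \<subseteq> U" and uA: "u \<in> carrier A" using U u(1) by (auto simp: saturated_def)
  then show "H +> x \<subseteq> translate a U" unfolding u(2) translate_coset[OF H a uA, symmetric] by (rule_tac image_mono)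
qed

lemma cosetsE:
  assumes "X \<in> a_rcosets H" "additive_subgroup H A"
  obtains x where "x \<in> carrier A" "X = H +> x" "x \<in> X"
proof -
  obtain x where x: "x \<in> carrier A" "X = H +> x" using assms(1) by (auto simp: A_RCOSETS_def')
  show ?thesis by (rule that[OF x]) (use coset_self[OF assms(2) x(1)] x(2) in simp)
qed

lemma coset_in_cosets: "x \<in> carrier A \<Longrightarrow> H +> x \<in> a_rcosets H"
  by (auto simp: A_RCOSETS_def')

lemma card_cosets_in_translate:
  assumes H: "additive_subgroup H A" and a: "a \<in> carrier A" and U: "U \<subseteq> carrier A"
  shows "card (cosets_in H (translate a U)) = card (cosets_in H U)"
proof -
  have "cosets_in H (translate a U) = translate a ` cosets_in H U"
  proof (intro equalityI subsetI)
    fix X assume X: "X \<in> cosets_in H (translate a U)"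
    then obtain z where z: "z \<in> carrier A" "X = H +> z" "X \<subseteq> translate a U"
      by (auto simp: cosets_in_def A_RCOSETS_def')
    let ?z = "\<ominus> a \<oplus> z"
    have zA: "?z \<in> carrier A" using a z(1) by simp
    have tX: "translate a (H +> ?z) = X" unfolding translate_coset[OF H a zA] using a z(1,2) by (simp add: r_neg2)
    have "H +> ?z \<subseteq> U"
    proof
      fix w assume w: "w \<in> H +> ?z"
      then have "a \<oplus> w \<in> translate a U" using tX z(3) by blast
      then obtain u where u: "u \<in> U" "a \<oplus> w = a \<oplus> u" by blast
      have "w = u" by (rule inj_onD[OF inj_translate[OF a] u(2)]) (use w coset_sub[OF H zA] u(1) U in auto)
      then show "w \<in> U" using u(1) by simp
    qed
    then have "H +> ?z \<in> cosets_in H U" using coset_in_cosets[OF zA] by (simp add: cosets_in_def)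
    then show "X \<in> translate a ` cosets_in H U" using tX by blast
  next
    fix X assume "X \<in> translate a ` cosets_in H U"
    then obtain z where z: "z \<in> carrier A" "H +> z \<subseteq> U" "X = translate a (H +> z)"
      by (auto simp: cosets_in_def A_RCOSETS_def')
    have "X \<in> a_rcosets H" unfolding z(3) translate_coset[OF H a z(1)] by (rule coset_in_cosets) (use a z in simp)
    moreover have "X \<subseteq> translate a U" unfolding z(3) by (rule image_mono[OF z(2)])
    ultimately show "X \<in> cosets_in H (translate a U)" by (simp add: cosets_in_def)
  qed
  moreover have "inj_on ((`) (\<lambda>x. a \<oplus> x)) (cosets_in H U)"
    by (rule inj_on_image, rule inj_on_subset[OF inj_translate[OF a]]) (use U in \<open>auto simp: cosets_in_def\<close>)
  ultimately show ?thesis by (simp add: card_image)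
qed

lemma saturated_subset:
  assumes D: "additive_subgroup D A" "additive_subgroup C A" "D \<subseteq> C" and U: "saturated C U"
  shows "saturated D U"
  unfolding saturated_def
proof (intro conjI ballI)
  show "U \<subseteq> carrier A" using U by (simp add: saturated_def)
  fix x assume x: "x \<in> U"
  then have xA: "x \<in> carrier A" and "C +> x \<subseteq> U" using U by (auto simp: saturated_def)
  moreover have "D +> x \<subseteq> C +> x" using coset_mem[OF D(1) xA] coset_mem[OF D(2) xA] D(3) by blast
  ultimately show "D +> x \<subseteq> U" by blast
qed

lemma saturated_self: "additive_subgroup H A \<Longrightarrow> saturated H (carrier A)"
  using coset_sub by (simp add: saturated_def)

lemma saturated_coset:
  assumes H: "additive_subgroup H A" and x: "x \<in> carrier A"
  shows "saturated H (H +> x)"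
  unfolding saturated_def
proof (intro conjI ballI coset_sub[OF H x])
  fix y assume y: "y \<in> H +> x"
  then have yA: "y \<in> carrier A" using coset_sub[OF H x] by blast
  show "H +> y \<subseteq> H +> x"
    using cosets_disjoint[OF H coset_in_cosets[OF yA] coset_in_cosets[OF x] coset_self[OF H yA] y] by simp
qed

text \<open>Every coset of \<open>C\<close> is a translate of \<open>C\<close>, so all of them
  contain equally many cosets of \<open>D\<close>.\<close>

lemma card_cosets_in_refine:
  assumes D: "additive_subgroup D A" "additive_subgroup C A" "D \<subseteq> C"
    and fin: "finite (a_rcosets D)" "finite (a_rcosets C)" and U: "saturated C U"
  shows "card (cosets_in D U) = card (cosets_in D C) * card (cosets_in C U)"
proof -
  have "cosets_in D U = (\<Union>X\<in>cosets_in C U. cosets_in D X)"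
  proof (intro equalityI subsetI)
    fix Y assume Y: "Y \<in> cosets_in D U"
    then have YU: "Y \<in> a_rcosets D" "Y \<subseteq> U" by (auto simp: cosets_in_def)
    obtain y where y: "y \<in> carrier A" "Y = D +> y" "y \<in> Y" by (rule cosetsE[OF YU(1) D(1)])
    have "C +> y \<in> cosets_in C U"
      using U y(3) YU(2) coset_in_cosets[OF y(1)] by (auto simp: cosets_in_def saturated_def)
    moreover have "Y \<subseteq> C +> y" unfolding y(2) using coset_mem[OF D(1) y(1)] coset_mem[OF D(2) y(1)] D(3) by blast
    ultimately show "Y \<in> (\<Union>X\<in>cosets_in C U. cosets_in D X)" using YU(1) by (auto simp: cosets_in_def)
  qed (auto simp: cosets_in_def)
  also have "card \<dots> = (\<Sum>X\<in>cosets_in C U. card (cosets_in D X))"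
  proof (rule card_UN_disjoint)
    show "finite (cosets_in C U)" "\<forall>X\<in>cosets_in C U. finite (cosets_in D X)" using fin by (auto simp: cosets_in_def)
    show "\<forall>X\<in>cosets_in C U. \<forall>X'\<in>cosets_in C U. X \<noteq> X' \<longrightarrow> cosets_in D X \<inter> cosets_in D X' = {}"
    proof (intro ballI impI, rule ccontr)
      fix X X' assume X: "X \<in> cosets_in C U" "X' \<in> cosets_in C U" "X \<noteq> X'" "cosets_in D X \<inter> cosets_in D X' \<noteq> {}"
      then obtain Y where Y: "Y \<in> a_rcosets D" "Y \<subseteq> X" "Y \<subseteq> X'" by (auto simp: cosets_in_def)
      obtain y where "y \<in> Y" using cosetsE[OF Y(1) D(1)] by blast
      then show False using cosets_disjoint[OF D(2), of X X' y] X(1,2,3) Y by (auto simp: cosets_in_def)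
    qed
  qed
  also have "\<dots> = (\<Sum>X\<in>cosets_in C U. card (cosets_in D C))"
  proof (rule sum.cong[OF refl])
    fix X assume "X \<in> cosets_in C U"
    then obtain x where x: "x \<in> carrier A" "X = translate x C"
      using translate_sub[OF D(2)] by (auto simp: cosets_in_def A_RCOSETS_def')
    show "card (cosets_in D X) = card (cosets_in D C)"
      unfolding x(2) by (rule card_cosets_in_translate[OF D(1) x(1) additive_subgroup_closed(1)[OF D(2)]])
  qed
  finally show ?thesis by simp
qed

lemma cosets_in_carrier: "additive_subgroup H A \<Longrightarrow> cosets_in H (carrier A) = a_rcosets H"
  using Union_cosets by (auto simp: cosets_in_def)

definition density :: "'a set \<Rightarrow> 'a set \<Rightarrow> real" where
  "density H U = card (cosets_in H U) / card (a_rcosets H)"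

lemma card_cosets_pos: "finite (a_rcosets H) \<Longrightarrow> card (a_rcosets H) > 0"
  using coset_in_cosets[OF zero_closed] by (auto simp: card_gt_0_iff)

lemma density_refine:
  assumes D: "additive_subgroup D A" "additive_subgroup C A" "D \<subseteq> C"
    and fin: "finite (a_rcosets D)" "finite (a_rcosets C)" and U: "saturated C U"
  shows "density D U = density C U"
proof -
  have 1: "card (a_rcosets D) = card (cosets_in D C) * card (a_rcosets C)"
    using card_cosets_in_refine[OF D fin saturated_self[OF D(2)]] cosets_in_carrier D(1,2) by simp
  then have "card (cosets_in D C) > 0" using card_cosets_pos[OF fin(1)] by simp
  then show ?thesis unfolding density_def 1 card_cosets_in_refine[OF D fin U] by simp
qed

text \<open>Unions of cosets of a single ideal of the family. By directedness they form an algebra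
  of sets, on which the measure is given by counting.\<close>

definition clopens :: "'a set set" where
  "clopens = {U. \<exists>C\<in>\<C>. saturated C U}"

text \<open>By \<open>density_refine\<close> the density is the same for a smaller ideal, and any
  two admissible ideals contain a common one; so the choice does not matter.\<close>

definition content :: "'a set \<Rightarrow> real" where
  "content U = density (SOME C. C \<in> \<C> \<and> saturated C U) U"

lemma content_eq:
  assumes C: "C \<in> \<C>" "saturated C U"
  shows "content U = density C U"
proof -
  let ?C = "SOME C. C \<in> \<C> \<and> saturated C U"
  have C': "?C \<in> \<C> \<and> saturated ?C U" by (rule someI[of _ C]) (use C in simp)
  obtain D where D: "D \<in> \<C>" "D \<subseteq> C" "D \<subseteq> ?C" using C_directed[OF C(1), of ?C] C' by blast
  show ?thesis unfolding content_def
    using density_refine[OF C_sub[OF D(1)] C_sub[OF C(1)] D(2) C_fin[OF D(1)] C_fin[OF C(1)] C(2)]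
      density_refine[OF C_sub[OF D(1)] C_sub D(3) C_fin[OF D(1)] C_fin, of U] C' by simp
qed

lemma clopens_common:
  assumes "U \<in> clopens" "V \<in> clopens"
  shows "\<exists>C\<in>\<C>. saturated C U \<and> saturated C V"
proof -
  obtain C D where CD: "C \<in> \<C>" "D \<in> \<C>" "saturated C U" "saturated D V" using assms by (auto simp: clopens_def)
  obtain E where E: "E \<in> \<C>" "E \<subseteq> C" "E \<subseteq> D" using C_directed[OF CD(1,2)] by blast
  show ?thesis
    using saturated_subset[OF C_sub[OF E(1)] C_sub[OF CD(1)] E(2) CD(3)]
      saturated_subset[OF C_sub[OF E(1)] C_sub[OF CD(2)] E(3) CD(4)] E(1) by blast
qed

lemma saturated_compl:
  assumes H: "additive_subgroup H A" and U: "saturated H U"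
  shows "saturated H (carrier A - U)"
  unfolding saturated_def
proof (intro conjI ballI)
  fix x assume x: "x \<in> carrier A - U"
  then have xA: "x \<in> carrier A" by simp
  show "H +> x \<subseteq> carrier A - U"
  proof
    fix y assume y: "y \<in> H +> x"
    have yA: "y \<in> carrier A" using y coset_sub[OF H xA] by blast
    have "y \<notin> U"
    proof
      assume "y \<in> U"
      then have "H +> y \<subseteq> U" using U by (simp add: saturated_def)
      moreover have "H +> y = H +> x"
        by (rule cosets_disjoint[OF H coset_in_cosets[OF yA] coset_in_cosets[OF xA] coset_self[OF H yA] y])
      ultimately show False using coset_self[OF H xA] x by blast
    qed
    then show "y \<in> carrier A - U" using yA by simp
  qed
qed simp

lemma algebra_clopens: "Sigma_Algebra.algebra (carrier A) clopens"
  unfolding algebra_iff_Un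
proof (intro conjI ballI)
  show "clopens \<subseteq> Pow (carrier A)" by (auto simp: clopens_def saturated_def)
  show "{} \<in> clopens" using C_ne by (auto simp: clopens_def saturated_def)
  show "carrier A - U \<in> clopens" if "U \<in> clopens" for U
    using that saturated_compl[OF C_sub] unfolding clopens_def by blast
  show "U \<union> V \<in> clopens" if UV: "U \<in> clopens" "V \<in> clopens" for U V
  proof -
    obtain C where "C \<in> \<C>" "saturated C U" "saturated C V" using clopens_common[OF UV] by blast
    moreover have "saturated C (U \<union> V)" using \<open>saturated C U\<close> \<open>saturated C V\<close> unfolding saturated_def by blast
    ultimately show ?thesis by (auto simp: clopens_def)
  qed
qed

lemma clopens_open:
  assumes "U \<in> clopens"
  shows "openin T U" "closedin T U"
proof -
  have op: "openin T U" if U: "U \<in> clopens" for U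
  proof (subst openin_subopen, intro ballI)
    fix x assume x: "x \<in> U"
    obtain C where C: "C \<in> \<C>" "saturated C U" using U by (auto simp: clopens_def)
    have xA: "x \<in> carrier A" using x C(2) by (auto simp: saturated_def)
    show "\<exists>V. openin T V \<and> x \<in> V \<and> V \<subseteq> U"
      using C_coset_open[OF C(1) xA] coset_self[OF C_sub[OF C(1)] xA] C(2) x by (auto simp: saturated_def)
  qed
  show "openin T U" using op assms .
  have "carrier A - U \<in> clopens" using algebra_clopens assms by (simp add: algebra_iff_Un)
  then show "closedin T U" using op openin_subset[OF op[OF assms]] by (simp add: closedin_def space)
qed

lemma content_add:
  assumes UV: "U \<in> clopens" "V \<in> clopens" "U \<inter> V = {}"
  shows "content (U \<union> V) = content U + content V"
proof -
  obtain C where C: "C \<in> \<C>" "saturated C U" "saturated C V" using clopens_common[OF UV(1,2)] by blast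
  have W: "saturated C (U \<union> V)" using C unfolding saturated_def by blast
  have "cosets_in C (U \<union> V) = cosets_in C U \<union> cosets_in C V"
  proof (intro equalityI subsetI)
    fix X assume X: "X \<in> cosets_in C (U \<union> V)"
    then have XC: "X \<in> a_rcosets C" by (simp add: cosets_in_def)
    obtain x where x: "x \<in> carrier A" "X = C +> x" "x \<in> X" by (rule cosetsE[OF XC C_sub[OF C(1)]])
    have "x \<in> U \<or> x \<in> V" using x(3) X by (auto simp: cosets_in_def)
    then have "X \<subseteq> U \<or> X \<subseteq> V" using C(2,3) x(2) by (auto simp: saturated_def)
    then show "X \<in> cosets_in C U \<union> cosets_in C V" using X by (auto simp: cosets_in_def)
  qed (auto simp: cosets_in_def)
  moreover have "cosets_in C U \<inter> cosets_in C V = {}"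
  proof (rule ccontr)
    assume "cosets_in C U \<inter> cosets_in C V \<noteq> {}"
    then obtain X where X: "X \<in> a_rcosets C" "X \<subseteq> U" "X \<subseteq> V" by (auto simp: cosets_in_def)
    obtain x where "x \<in> X" using cosetsE[OF X(1) C_sub[OF C(1)]] by blast
    then show False using X UV(3) by blast
  qed
  moreover have "finite (cosets_in C U)" "finite (cosets_in C V)" using C_fin[OF C(1)] by (auto simp: cosets_in_def)
  ultimately have "card (cosets_in C (U \<union> V)) = card (cosets_in C U) + card (cosets_in C V)" by (simp add: card_Un_disjoint)
  then show ?thesis unfolding content_eq[OF C(1) W] content_eq[OF C(1,2)] content_eq[OF C(1,3)] density_def
    by (simp add: add_divide_distrib)
qed

lemma content_nonneg: "content U \<ge> 0"
  by (simp add: content_def density_def)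

lemma content_carrier: "content (carrier A) = 1"
proof -
  obtain C where C: "C \<in> \<C>" using C_ne by blast
  show ?thesis unfolding content_eq[OF C saturated_self[OF C_sub[OF C]]] density_def cosets_in_carrier[OF C_sub[OF C]]
    using card_cosets_pos[OF C_fin[OF C]] by simp
qed

lemma content_empty: "content {} = 0"
proof -
  have "{} \<in> clopens" using algebra_clopens by (simp add: algebra_iff_Un)
  from content_add[OF this this] show ?thesis by simp
qed

lemma translate_clopens:
  assumes a: "a \<in> carrier A" and U: "U \<in> clopens"
  shows "translate a U \<in> clopens" "content (translate a U) = content U"
proof -
  obtain C where C: "C \<in> \<C>" "saturated C U" using U by (auto simp: clopens_def)
  have s: "saturated C (translate a U)" by (rule saturated_translate[OF C_sub[OF C(1)] a C(2)])
  then show "translate a U \<in> clopens" using C(1) by (auto simp: clopens_def)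
  have UA: "U \<subseteq> carrier A" using C(2) by (simp add: saturated_def)
  show "content (translate a U) = content U"
    unfolding content_eq[OF C(1) s] content_eq[OF C] density_def
    by (simp only: card_cosets_in_translate[OF C_sub[OF C(1)] a UA])
qed

end

section \<open>Haar measure\<close>

text \<open>The measure is an arbitrary one with the Haar property, so that its values on clopen
  sets can be computed before uniqueness is known.\<close>

locale haar_base = profinite_base K A T \<C>
  for K :: "('k, 'n) ring_scheme" and A :: "('k, 'a, 'm) module_scheme" (structure) and T :: "'a topology" and \<C> +
  fixes \<mu> :: "'a measure"
  assumes haar: "is_haar_probability A T \<mu>"
begin

lemma space_haar: "space \<mu> = carrier A"
  using haar by (simp add: is_haar_probability_def space)

lemma sets_haar: "sets \<mu> = sigma_sets (carrier A) {U. openin T U}"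
  using haar by (simp add: is_haar_probability_def space)

lemma prob_space_haar: "prob_space \<mu>"
  using haar unfolding is_haar_probability_def by (intro prob_spaceI) blast

lemma open_in_sets: "openin T U \<Longrightarrow> U \<in> sets \<mu>"
  unfolding sets_haar by (rule sigma_sets.Basic) simp

lemma measure_translate: "a \<in> carrier A \<Longrightarrow> E \<in> sets \<mu> \<Longrightarrow> measure \<mu> (translate a E) = measure \<mu> E"
  using haar by (simp add: is_haar_probability_def measure_def)

lemma measure_sum_cosets:
  assumes H: "additive_subgroup H A" "C \<in> \<C>" "C \<subseteq> H" and F: "F \<subseteq> a_rcosets H" and E: "E \<in> sets \<mu>"
  shows "measure \<mu> (\<Union>F \<inter> E) = (\<Sum>X\<in>F. measure \<mu> (X \<inter> E))"
proof -
  interpret prob_space \<mu> by (rule prob_space_haar)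
  note S = sub_with_ideal_cosets[OF H]
  have XS: "X \<in> sets \<mu>" if "X \<in> F" for X
    using that F open_in_sets S(3) by (auto simp: A_RCOSETS_def')
  have "measure \<mu> (\<Union>X\<in>F. X \<inter> E) = (\<Sum>X\<in>F. measure \<mu> (X \<inter> E))"
  proof (rule finite_measure_finite_Union)
    show "finite F" using S(2) F finite_subset by blast
    show "(\<lambda>X. X \<inter> E) ` F \<subseteq> sets \<mu>" using XS E by auto
    show "disjoint_family_on (\<lambda>X. X \<inter> E) F"
      using cosets_disjoint[OF H(1)] F by (fastforce simp: disjoint_family_on_def)
  qed
  moreover have "(\<Union>X\<in>F. X \<inter> E) = \<Union>F \<inter> E" by blast
  ultimately show ?thesis by simp
qed

lemma measure_coset:
  assumes H: "additive_subgroup H A" "C \<in> \<C>" "C \<subseteq> H" and x: "x \<in> carrier A"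
  shows "measure \<mu> (H +> x) = 1 / card (a_rcosets H)"
proof -
  interpret prob_space \<mu> by (rule prob_space_haar)
  note S = sub_with_ideal_cosets[OF H]
  have HS: "H \<in> sets \<mu>" by (rule open_in_sets[OF S(1)])
  have c: "measure \<mu> (H +> y) = measure \<mu> H" if "y \<in> carrier A" for y
    unfolding translate_sub[OF H(1) that, symmetric] by (rule measure_translate[OF that HS])
  have "measure \<mu> (carrier A) = 1" using prob_space by (simp only: space_haar)
  moreover have "measure \<mu> (\<Union>(a_rcosets H) \<inter> carrier A) = (\<Sum>X\<in>a_rcosets H. measure \<mu> (X \<inter> carrier A))"
    by (rule measure_sum_cosets[OF H order_refl]) (use sets.top[of \<mu>] space_haar in simp)
  moreover have "\<dots> = (\<Sum>X\<in>a_rcosets H. measure \<mu> H)"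
  proof (rule sum.cong[OF refl])
    fix X assume "X \<in> a_rcosets H"
    then obtain y where y: "y \<in> carrier A" "X = H +> y" by (auto simp: A_RCOSETS_def')
    have "X \<inter> carrier A = H +> y" using y coset_sub[OF H(1)] by blast
    then show "measure \<mu> (X \<inter> carrier A) = measure \<mu> H" using c[OF y(1)] by simp
  qed
  ultimately have "card (a_rcosets H) * measure \<mu> H = 1" by (simp add: Union_cosets[OF H(1)])
  then show ?thesis using c[OF x] card_cosets_pos[OF S(2)] by (simp add: field_simps)
qed

lemma measure_subgroup:
  assumes H: "additive_subgroup H A" "C \<in> \<C>" "C \<subseteq> H"
  shows "measure \<mu> H = 1 / card (a_rcosets H)"
  using measure_coset[OF H zero_closed] additive_subgroup_closed(1)[OF H(1)] by (simp add: a_coset_add_zero)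

lemma measure_clopen:
  assumes U: "U \<in> clopens"
  shows "measure \<mu> U = content U"
proof -
  obtain C where C: "C \<in> \<C>" "saturated C U" using U by (auto simp: clopens_def)
  note H = C_sub[OF C(1)]
  have UA: "U \<subseteq> carrier A" using C(2) by (simp add: saturated_def)
  have "\<Union>(cosets_in C U) \<inter> carrier A = U"
  proof (intro equalityI subsetI)
    fix x assume x: "x \<in> U"
    have xA: "x \<in> carrier A" using x UA by blast
    have "C +> x \<in> cosets_in C U" using C(2) x coset_in_cosets[OF xA] by (simp add: cosets_in_def saturated_def)
    then show "x \<in> \<Union>(cosets_in C U) \<inter> carrier A" using coset_self[OF H xA] xA by blast
  qed (auto simp: cosets_in_def)
  then have "measure \<mu> U = (\<Sum>X\<in>cosets_in C U. measure \<mu> (X \<inter> carrier A))"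
    using measure_sum_cosets[OF H C(1) order_refl, of "cosets_in C U" "carrier A"] sets.top[of \<mu>] space_haar
    by (simp add: cosets_in_def)
  also have "\<dots> = (\<Sum>X\<in>cosets_in C U. 1 / card (a_rcosets C))"
  proof (rule sum.cong[OF refl])
    fix X assume "X \<in> cosets_in C U"
    then obtain y where y: "y \<in> carrier A" "X = C +> y" by (auto simp: cosets_in_def A_RCOSETS_def')
    have "X \<inter> carrier A = C +> y" using y coset_sub[OF H] by blast
    then show "measure \<mu> (X \<inter> carrier A) = 1 / card (a_rcosets C)"
      using measure_coset[OF H C(1) order_refl y(1)] by simp
  qed
  finally show ?thesis by (simp add: content_eq[OF C] density_def)
qed

text \<open>Since \<open>H1 + H2 = A\<close>, every coset of \<open>H1\<close> has a representative
  in \<open>H2\<close> and meets \<open>H2\<close> in a translate of \<open>H1 \<inter> H2\<close>.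
  So \<open>H2\<close> is cut into parts of equal measure, one for each coset of
  \<open>H1\<close>.\<close>

lemma measure_Int_subgroups:
  assumes H1: "additive_subgroup H1 A" "C1 \<in> \<C>" "C1 \<subseteq> H1" and H2: "additive_subgroup H2 A" "C2 \<in> \<C>" "C2 \<subseteq> H2"
    and sum: "\<And>a. a \<in> carrier A \<Longrightarrow> \<exists>h\<in>H2. a \<ominus> h \<in> H1"
  shows "measure \<mu> (H1 \<inter> H2) = measure \<mu> H1 * measure \<mu> H2"
proof -
  note D1 = additive_subgroup_closed[OF H1(1)] and D2 = additive_subgroup_closed[OF H2(1)]
  have S: "H1 \<in> sets \<mu>" "H2 \<in> sets \<mu>" using open_in_sets sub_with_ideal_cosets(1) H1 H2 by blast+
  have "measure \<mu> H2 = measure \<mu> (\<Union>(a_rcosets H1) \<inter> H2)"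
    using D2(1) by (simp add: Union_cosets[OF H1(1)] Int_absorb1)
  also have "\<dots> = (\<Sum>X\<in>a_rcosets H1. measure \<mu> (X \<inter> H2))"
    by (rule measure_sum_cosets[OF H1 order_refl S(2)])
  also have "\<dots> = (\<Sum>X\<in>a_rcosets H1. measure \<mu> (H1 \<inter> H2))"
  proof (rule sum.cong[OF refl])
    fix X assume "X \<in> a_rcosets H1"
    then obtain x where x: "x \<in> carrier A" "X = H1 +> x" by (auto simp: A_RCOSETS_def')
    obtain h where h: "h \<in> H2" "x \<ominus> h \<in> H1" using sum[OF x(1)] by blast
    have hA: "h \<in> carrier A" using h D2(1) by blast
    have Xh: "X = H1 +> h" unfolding x(2) coset_eq_iff[OF H1(1) x(1) hA] by (rule h(2))
    have "X \<inter> H2 = translate h (H1 \<inter> H2)"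
    proof (intro equalityI subsetI)
      fix y assume y: "y \<in> X \<inter> H2"
      have yA: "y \<in> carrier A" using y D2(1) by blast
      have "y \<ominus> h \<in> H1 \<inter> H2" using y D2(5) h(1) Xh coset_mem[OF H1(1) hA] by blast
      moreover have "y = h \<oplus> (y \<ominus> h)"
        using minus_plus_cancel[OF yA hA] a_comm[OF hA minus_closed[OF yA hA]] by (simp only:)
      ultimately show "y \<in> translate h (H1 \<inter> H2)" by (rule rev_image_eqI)
    next
      fix y assume "y \<in> translate h (H1 \<inter> H2)"
      then obtain z where z: "z \<in> H1" "z \<in> H2" "y = h \<oplus> z" by blast
      have zA: "z \<in> carrier A" using z D2(1) by blast
      have "y \<in> H2" unfolding z(3) by (rule D2(3)[OF h(1) z(2)])
      moreover have "y \<ominus> h = z" unfolding z(3) a_comm[OF hA zA] by (rule plus_minus_cancel[OF zA hA])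
      ultimately show "y \<in> X \<inter> H2" unfolding Xh using coset_mem[OF H1(1) hA] z(1) D2(1) by blast
    qed
    then show "measure \<mu> (X \<inter> H2) = measure \<mu> (H1 \<inter> H2)" using measure_translate[OF hA] S by simp
  qed
  finally have e: "measure \<mu> H2 = card (a_rcosets H1) * measure \<mu> (H1 \<inter> H2)" by simp
  show ?thesis unfolding e measure_subgroup[OF H1] using card_cosets_pos[OF sub_with_ideal_cosets(2)[OF H1]] by simp
qed

end

section \<open>Existence and uniqueness of the Haar measure\<close>

context profinite_base
begin

text \<open>An open set is the union of the cosets that it contains, and countability of
  \<open>\<C>\<close> leaves only countably many cosets.\<close>

lemma sigma_sets_clopens:
  assumes "countable \<C>"
  shows "sigma_sets (carrier A) clopens = sigma_sets (carrier A) {U. openin T U}"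
proof (rule sigma_sets_eqI)
  show "U \<in> sigma_sets (carrier A) {U. openin T U}" if "U \<in> clopens" for U
    using clopens_open(1)[OF that] by (intro sigma_sets.Basic) simp
  fix U assume U: "U \<in> {U. openin T U}"
  let ?F = "{X \<in> (\<Union>C\<in>\<C>. a_rcosets C). X \<subseteq> U}"
  have cos: "X \<in> clopens" if "X \<in> (\<Union>C\<in>\<C>. a_rcosets C)" for X
    using that saturated_coset[OF C_sub] by (auto simp: clopens_def A_RCOSETS_def')
  have "U = \<Union>?F"
  proof (intro equalityI subsetI)
    fix x assume x: "x \<in> U"
    then have xA: "x \<in> carrier A" using U openin_subset space by blast
    obtain C where C: "C \<in> \<C>" "C +> x \<subseteq> U" using base U x by blast
    then show "x \<in> \<Union>?F" using coset_self[OF C_sub[OF C(1)] xA] coset_in_cosets[OF xA] by blast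
  qed blast
  moreover have "\<Union>?F \<in> sigma_sets (carrier A) clopens"
  proof (rule sigma_sets_UNION)
    have "countable (\<Union>C\<in>\<C>. a_rcosets C)" using assms C_fin countable_finite by (intro countable_UN) auto
    then show "countable ?F" by (rule countable_subset[rotated]) blast
    show "X \<in> sigma_sets (carrier A) clopens" if "X \<in> ?F" for X using that cos by (intro sigma_sets.Basic) blast
  qed
  ultimately show "U \<in> sigma_sets (carrier A) clopens" by simp
qed

lemma clopens_measure_eqI:
  fixes M N :: "'a measure"
  assumes "sets M = sigma_sets (carrier A) clopens" "sets N = sigma_sets (carrier A) clopens"
    and "\<And>U. U \<in> clopens \<Longrightarrow> emeasure M U = emeasure N U" and "emeasure M (carrier A) \<noteq> \<infinity>"
  shows "M = N"
proof -
  interpret R: Sigma_Algebra.algebra "carrier A" clopens by (rule algebra_clopens)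
  show ?thesis
  proof (rule measure_eqI_generator_eq[where \<Omega> = "carrier A" and E = clopens and A = "\<lambda>_. carrier A"])
    show "Int_stable clopens" by (auto simp: Int_stable_def)
    show "clopens \<subseteq> Pow (carrier A)" by (rule R.space_closed)
  qed (use assms R.top in auto)
qed

text \<open>Caratheodory's extension of \<open>content\<close>. Countable additivity comes from
  compactness: clopen sets are closed, so a decreasing sequence of them with empty intersection is
  eventually empty.\<close>

lemma haar_exists:
  assumes cnt: "countable \<C>"
  shows "\<exists>\<mu>. is_haar_probability A T \<mu>"
proof -
  interpret R: Sigma_Algebra.algebra "carrier A" clopens by (rule algebra_clopens)
  let ?f = "\<lambda>U. ennreal (content U)" and ?\<Sigma> = "sigma_sets (carrier A) clopens"
  let ?O = "outer_measure clopens ?f"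
  have pos: "positive clopens ?f" by (simp add: positive_def content_empty)
  have add: "additive clopens ?f" by (simp add: additive_def content_add content_nonneg)
  have ca: "countably_additive clopens ?f"
  proof (rule R.empty_continuous_imp_countably_additive[OF pos add])
    fix F :: "nat \<Rightarrow> 'a set" assume F: "range F \<subseteq> clopens" "decseq F" "(\<Inter>i. F i) = {}"
    have "\<exists>n. F n = {}"
    proof (rule ccontr)
      assume "\<nexists>n. F n = {}"
      then have "(\<Inter>i. F i) \<noteq> {}"
        by (intro compact_space_imp_nest[OF compact _ _ F(2)]) (use F(1) clopens_open(2) in auto)
      then show False using F(3) by blast
    qed
    then obtain n where n: "F n = {}" by blast
    have "?f (F i) = 0" if "i \<ge> n" for i using decseqD[OF F(2) that] n by (simp add: content_empty)
    then show "(\<lambda>i. ?f (F i)) \<longlonglongrightarrow> 0" by (intro tendsto_eventually) (auto simp: eventually_sequentially)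
  qed simp
  have inc: "increasing clopens ?f" by (rule R.additive_increasing[OF pos add])
  have mls: "measure_space (carrier A) (lambda_system (carrier A) (Pow (carrier A)) ?O) ?O"
    by (rule sigma_algebra.caratheodory_lemma[OF sigma_algebra_Pow R.outer_measure_space_outer_measure[OF pos inc]])
  have "sigma_algebra (carrier A) (lambda_system (carrier A) (Pow (carrier A)) ?O)" using mls by (simp add: measure_space_def)
  from sigma_algebra.sigma_sets_subset[OF this R.algebra_subset_lambda_system[OF pos inc add]]
  have ms: "measure_space (carrier A) ?\<Sigma> ?O"
    by (intro measure_down[OF mls] sigma_algebra_sigma_sets R.space_closed)
  define \<mu> where "\<mu> = measure_of (carrier A) ?\<Sigma> ?O"
  have sa: "sigma_algebra (carrier A) ?\<Sigma>" by (rule sigma_algebra_sigma_sets[OF R.space_closed])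
  have sets: "sets \<mu> = ?\<Sigma>" and sp: "space \<mu> = carrier A"
    using sigma_algebra.sets_measure_of_eq[OF sa] sigma_algebra.space_measure_of_eq[OF sa] by (simp_all add: \<mu>_def)
  have em: "emeasure \<mu> E = ?O E" if "E \<in> ?\<Sigma>" for E
    unfolding \<mu>_def using ms that by (intro emeasure_measure_of_sigma) (auto simp: measure_space_def)
  have ec: "emeasure \<mu> U = ?f U" if U: "U \<in> clopens" for U
    using em[OF sigma_sets.Basic[OF U]] R.outer_measure_agrees[OF pos ca U] by simp
  have e1: "emeasure \<mu> (carrier A) = 1" using ec[OF R.top] by (simp add: content_carrier)
  \<comment> \<open>The image measure under subtraction of \<open>a\<close> gives \<open>E\<close>
    the measure of its translate by \<open>a\<close>. It agrees with the original measure on clopen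
    sets, hence everywhere.\<close>
  have inv: "emeasure \<mu> (translate a E) = emeasure \<mu> E" if a: "a \<in> carrier A" and E: "E \<in> sets \<mu>" for a E
  proof -
    let ?g = "\<lambda>x. \<ominus> a \<oplus> x"
    have pre: "?g -` U \<inter> carrier A = translate a U" if U: "U \<subseteq> carrier A" for U
    proof (intro equalityI subsetI)
      fix x assume x: "x \<in> ?g -` U \<inter> carrier A"
      then have "x = a \<oplus> ?g x" using a by (simp add: r_neg2)
      then show "x \<in> translate a U" using x by blast
    next
      fix x assume "x \<in> translate a U"
      then obtain u where u: "u \<in> U" "x = a \<oplus> u" by blast
      then show "x \<in> ?g -` U \<inter> carrier A" using a U by (auto simp: r_neg1)
    qed
    have gm: "?g \<in> measurable \<mu> \<mu>"
    proof (rule measurable_sigma_sets[OF sets R.space_closed])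
      show "?g \<in> space \<mu> \<rightarrow> carrier A" using a by (simp add: sp)
      fix U assume U: "U \<in> clopens"
      have "?g -` U \<inter> space \<mu> = translate a U" unfolding sp by (rule pre) (use U R.space_closed in blast)
      then show "?g -` U \<inter> space \<mu> \<in> sets \<mu>" using translate_clopens(1)[OF a U] by (simp add: sets)
    qed
    have dE: "emeasure (distr \<mu> \<mu> ?g) E = emeasure \<mu> (translate a E)" if "E \<in> sets \<mu>" for E
    proof -
      have "?g -` E \<inter> space \<mu> = translate a E" unfolding sp by (rule pre) (use sets.sets_into_space[OF that] sp in simp)
      then show ?thesis using emeasure_distr[OF gm that] by simp
    qed
    have "\<mu> = distr \<mu> \<mu> ?g"
    proof (rule clopens_measure_eqI)
      fix U assume U: "U \<in> clopens"
      have "emeasure (distr \<mu> \<mu> ?g) U = emeasure \<mu> (translate a U)" by (rule dE) (simp add: sets U)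
      then show "emeasure \<mu> U = emeasure (distr \<mu> \<mu> ?g) U"
        using ec[OF U] ec[OF translate_clopens(1)[OF a U]] translate_clopens(2)[OF a U] by simp
    qed (use e1 in \<open>simp_all add: sets\<close>)
    then show ?thesis using dE[OF E] by simp
  qed
  \<comment> \<open>The outer measure is an infimum over countable unions of clopen sets, and such
    unions are open; regularity thus comes with the construction.\<close>
  have reg: "emeasure \<mu> E = (INF U \<in> {U. openin T U \<and> E \<subseteq> U}. emeasure \<mu> U)" if E: "E \<in> sets \<mu>" for E
  proof (rule antisym)
    have os: "U \<in> sets \<mu>" if "openin T U" for U
      unfolding sets sigma_sets_clopens[OF cnt] using that by (intro sigma_sets.Basic) simp
    show "emeasure \<mu> E \<le> (INF U \<in> {U. openin T U \<and> E \<subseteq> U}. emeasure \<mu> U)"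
      by (rule INF_greatest) (use os in \<open>auto intro: emeasure_mono\<close>)
    have "(INF U \<in> {U. openin T U \<and> E \<subseteq> U}. emeasure \<mu> U) \<le> ?O E"
      unfolding outer_measure_def
    proof (rule INF_greatest)
      fix F :: "nat \<Rightarrow> 'a set"
      assume "F \<in> {F. range F \<subseteq> clopens \<and> disjoint_family F \<and> E \<subseteq> \<Union>(range F)}"
      then have F: "range F \<subseteq> clopens" "disjoint_family F" "E \<subseteq> (\<Union>i. F i)" by auto
      have "openin T (\<Union>i. F i)" using F(1) clopens_open(1) by (intro openin_Union) auto
      then have "(INF U \<in> {U. openin T U \<and> E \<subseteq> U}. emeasure \<mu> U) \<le> emeasure \<mu> (\<Union>i. F i)"
        using F(3) by (intro INF_lower) simp
      also have "\<dots> = (\<Sum>i. emeasure \<mu> (F i))"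
        by (rule suminf_emeasure[symmetric]) (use F in \<open>auto simp: sets intro: sigma_sets.Basic\<close>)
      also have "\<dots> = (\<Sum>i. ?f (F i))" using F(1) ec by (intro suminf_cong) auto
      finally show "(INF U \<in> {U. openin T U \<and> E \<subseteq> U}. emeasure \<mu> U) \<le> (\<Sum>i. ?f (F i))" .
    qed
    then show "(INF U \<in> {U. openin T U \<and> E \<subseteq> U}. emeasure \<mu> U) \<le> emeasure \<mu> E"
      using em E sets by simp
  qed
  have "is_haar_probability A T \<mu>"
    unfolding is_haar_probability_def
  proof (intro conjI ballI)
    show "space \<mu> = topspace T" "emeasure \<mu> (space \<mu>) = 1" by (simp_all add: sp space e1)
    show "sets \<mu> = sigma_sets (topspace T) {U. openin T U}" unfolding sets space by (rule sigma_sets_clopens[OF cnt])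
  qed (fact inv, fact reg)
  then show ?thesis by blast
qed

lemma haar_unique:
  assumes cnt: "countable \<C>" and h: "is_haar_probability A T \<mu>" "is_haar_probability A T \<nu>"
  shows "\<mu> = \<nu>"
proof -
  interpret m: haar_base K A T \<C> \<mu> by unfold_locales (rule h(1))
  interpret n: haar_base K A T \<C> \<nu> by unfold_locales (rule h(2))
  interpret mp: prob_space \<mu> by (rule m.prob_space_haar)
  interpret np: prob_space \<nu> by (rule n.prob_space_haar)
  show ?thesis
    by (rule clopens_measure_eqI)
      (simp_all add: m.sets_haar n.sets_haar sigma_sets_clopens[OF cnt] mp.emeasure_eq_measure np.emeasure_eq_measure
        m.measure_clopen n.measure_clopen)
qed

lemma haar_base_haar_probability:
  assumes "countable \<C>"
  shows "haar_base K A T \<C> (haar_probability A T)"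
proof unfold_locales
  show "is_haar_probability A T (haar_probability A T)"
    unfolding haar_probability_def
    by (rule theI', rule ex_ex1I, rule haar_exists[OF assms], rule haar_unique[OF assms])
qed

end

section \<open>Positive finite generation and subalgebra growth\<close>

text \<open>The second moment of \<open>\<Sum>M\<in>F. indicator (E M) - p\<close> is at most \<open>card F * p\<close>, and this sum is
  \<open>- card F * p\<close> on \<open>G\<close>.\<close>

lemma (in prob_space) card_pairwise_independent_events:
  fixes p :: real
  assumes F: "finite F" and E: "\<And>M. M \<in> F \<Longrightarrow> E M \<in> events" "\<And>M. M \<in> F \<Longrightarrow> prob (E M) = p"
    and ind: "\<And>M N. M \<in> F \<Longrightarrow> N \<in> F \<Longrightarrow> M \<noteq> N \<Longrightarrow> prob (E M \<inter> E N) = p\<^sup>2"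
    and G: "G \<in> events" "\<And>M. M \<in> F \<Longrightarrow> G \<inter> E M = {}" and p: "0 < p"
  shows "card F * p * prob G \<le> 1"
proof (cases "F = {}")
  case False
  let ?Y = "\<lambda>M x. indicator (E M) x - p :: real"
  have int1: "integrable M (indicator B :: _ \<Rightarrow> real)" if "B \<in> events" for B
    using that by (simp add: integrable_indicator_iff emeasure_eq_measure)
  have prod: "?Y N x * ?Y N' x = indicator (E N \<inter> E N') x - p * indicator (E N) x - p * indicator (E N') x + p\<^sup>2" for N N' x
    by (auto simp: indicator_def power2_eq_square algebra_simps)
  have intY: "integrable M (\<lambda>x. ?Y N x * ?Y N' x)" if "N \<in> F" "N' \<in> F" for N N'
    unfolding prod using that E(1) by (intro Bochner_Integration.integrable_add Bochner_Integration.integrable_diff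
      integrable_mult_right int1 sets.Int integrable_const) auto
  have Y: "(\<integral>x. ?Y N x * ?Y N' x \<partial>M) = prob (E N \<inter> E N') - p\<^sup>2" if N: "N \<in> F" "N' \<in> F" for N N'
  proof -
    have "(\<integral>x. ?Y N x * ?Y N' x \<partial>M) = prob (E N \<inter> E N') - p * prob (E N) - p * prob (E N') + p\<^sup>2"
      unfolding prod using N E(1) int1[of "E N"] int1[of "E N'"] int1[of "E N \<inter> E N'"] by (simp add: prob_space)
    then show ?thesis using E(2) N by (simp add: power2_eq_square)
  qed
  have sq: "(\<Sum>N\<in>F. ?Y N x)\<^sup>2 = (\<Sum>N\<in>F. \<Sum>N'\<in>F. ?Y N x * ?Y N' x)" for x
    by (simp add: power2_eq_square sum_product)
  have "(card F * p)\<^sup>2 * prob G = (\<integral>x. (card F * p)\<^sup>2 * indicator G x \<partial>M)"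
    using G(1) by simp
  also have "\<dots> \<le> (\<integral>x. (\<Sum>N\<in>F. ?Y N x)\<^sup>2 \<partial>M)"
  proof (rule integral_mono)
    show "integrable M (\<lambda>x. (card F * p)\<^sup>2 * indicator G x)" by (intro integrable_mult_right int1 G(1))
    show "integrable M (\<lambda>x. (\<Sum>N\<in>F. ?Y N x)\<^sup>2)" unfolding sq by (intro Bochner_Integration.integrable_sum intY)
    fix x
    show "(card F * p)\<^sup>2 * indicator G x \<le> (\<Sum>N\<in>F. ?Y N x)\<^sup>2"
    proof (cases "x \<in> G")
      case True
      then have "(\<Sum>N\<in>F. ?Y N x) = (\<Sum>N\<in>F. - p)" using G(2) by (intro sum.cong refl) (auto simp: indicator_def)
      then show ?thesis using True by simp
    qed simp
  qed
  also have "\<dots> = (\<Sum>N\<in>F. \<Sum>N'\<in>F. prob (E N \<inter> E N') - p\<^sup>2)"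
    unfolding sq using intY Y by (simp add: Bochner_Integration.integral_sum Bochner_Integration.integrable_sum)
  also have "\<dots> \<le> (\<Sum>N\<in>F. \<Sum>N'\<in>F. if N' = N then p else 0)"
    using ind E by (intro sum_mono) auto
  also have "\<dots> = card F * p" using F by simp
  finally have "(card F * p) * (card F * p * prob G) \<le> (card F * p) * 1" by (simp add: power2_eq_square algebra_simps)
  then show ?thesis using p F False by (subst (asm) mult_le_cancel_left_pos) (simp_all add: card_gt_0_iff)
qed simp

section \<open>Cores and the independence of their subalgebras\<close>

context algebra_over
begin

text \<open>For an additive subgroup \<open>M\<close>, testing the single products
  \<open>a \<otimes> x \<otimes> b\<close> is enough to test the whole ideal generated by
  \<open>x\<close>.\<close>

definition core :: "'a set \<Rightarrow> 'a set" where
  "core M = {x \<in> carrier A. \<forall>a\<in>carrier A. \<forall>b\<in>carrier A. a \<otimes> x \<otimes> b \<in> M}"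

lemma core_ideal:
  assumes M: "additive_subgroup M A"
  shows "ideal (core M) A"
proof (rule idealI[OF ring_axioms])
  note D = additive_subgroup_closed[OF M]
  show "subgroup (core M) (add_monoid A)"
  proof (rule group.subgroupI[OF a_group])
    show "core M \<subseteq> carrier (add_monoid A)" by (auto simp: core_def)
    have "\<zero> \<in> core M" using D(2) by (simp add: core_def)
    then show "core M \<noteq> {}" by blast
    fix x assume x: "x \<in> core M"
    have "a \<otimes> (\<ominus> x) \<otimes> b \<in> M" if ab: "a \<in> carrier A" "b \<in> carrier A" for a b
    proof -
      have "\<ominus> (a \<otimes> x \<otimes> b) \<in> M" by (rule D(4)) (use x ab in \<open>simp add: core_def\<close>)
      then show ?thesis using x ab by (simp add: core_def r_minus l_minus)
    qed
    then show "inv\<^bsub>add_monoid A\<^esub> x \<in> core M" using x by (simp add: a_inv_def[symmetric] core_def)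
    fix y assume y: "y \<in> core M"
    have "a \<otimes> (x \<oplus> y) \<otimes> b \<in> M" if ab: "a \<in> carrier A" "b \<in> carrier A" for a b
    proof -
      have "a \<otimes> x \<otimes> b \<oplus> a \<otimes> y \<otimes> b \<in> M" by (rule D(3)) (use x y ab in \<open>simp_all add: core_def\<close>)
      then show ?thesis using x y ab by (simp add: core_def r_distr l_distr)
    qed
    then show "x \<otimes>\<^bsub>add_monoid A\<^esub> y \<in> core M" using x y by (simp add: core_def)
  qed
  fix x c assume x: "x \<in> core M" and c: "c \<in> carrier A"
  then have xA: "x \<in> carrier A" by (simp add: core_def)
  have "a \<otimes> (c \<otimes> x) \<otimes> b \<in> M" if ab: "a \<in> carrier A" "b \<in> carrier A" for a b
  proof -
    have "(a \<otimes> c) \<otimes> x \<otimes> b \<in> M" using x m_closed[OF ab(1) c] ab(2) unfolding core_def by blast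
    then show ?thesis using m_assoc[OF ab(1) c xA] by simp
  qed
  then show "c \<otimes> x \<in> core M" using xA c by (simp add: core_def)
  have "a \<otimes> (x \<otimes> c) \<otimes> b \<in> M" if ab: "a \<in> carrier A" "b \<in> carrier A" for a b
  proof -
    have "a \<otimes> x \<otimes> (c \<otimes> b) \<in> M" using x m_closed[OF c ab(2)] ab(1) unfolding core_def by blast
    then show ?thesis using m_assoc[OF m_closed[OF ab(1) xA] c ab(2)] m_assoc[OF ab(1) xA c] by simp
  qed
  then show "x \<otimes> c \<in> core M" using xA c by (simp add: core_def)
qed

lemma core_subset: "core M \<subseteq> M"
proof
  fix x assume "x \<in> core M"
  then have x: "x \<in> carrier A" and *: "\<forall>a\<in>carrier A. \<forall>b\<in>carrier A. a \<otimes> x \<otimes> b \<in> M" by (auto simp: core_def)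
  have "\<one> \<in> carrier A" by simp
  then have "\<one> \<otimes> x \<otimes> \<one> \<in> M" using * by blast
  then show "x \<in> M" using x by simp
qed

lemma core_greatest:
  assumes I: "ideal I A" "I \<subseteq> M"
  shows "I \<subseteq> core M"
proof
  fix x assume x: "x \<in> I"
  have "x \<in> carrier A" using additive_subgroup_closed(1)[OF ideal.axioms(1)[OF I(1)]] x by blast
  moreover have "a \<otimes> x \<otimes> b \<in> M" if "a \<in> carrier A" "b \<in> carrier A" for a b
    using ideal.I_r_closed[OF I(1) ideal.I_l_closed[OF I(1) x that(1)] that(2)] I(2) by blast
  ultimately show "x \<in> core M" by (simp add: core_def)
qed

end

context profinite_base
begin

lemma open_maximal_subalgebras_eq:
  "open_maximal_subalgebras K A T n = {M \<in> open_max. card (a_rcosets M) = n}"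
  using open_maxD(6) by (auto simp: open_maximal_subalgebras_def open_max_def)

text \<open>If, say, the core \<open>I\<close> of \<open>M\<close> is not contained in \<open>N\<close>, then \<open>I + N\<close> is a subalgebra and thus equal to \<open>A\<close>.\<close>

lemma open_max_sum:
  assumes M: "M \<in> open_max" "N \<in> open_max" and nc: "\<not> core M \<subseteq> N" and a: "a \<in> carrier A"
  shows "\<exists>h\<in>N. a \<ominus> h \<in> M"
proof -
  note MD = open_maxD[OF M(1)] and ND = open_maxD[OF M(2)]
  let ?P = "{x \<in> carrier A. \<exists>s\<in>N. x \<ominus> s \<in> core M}"
  note P = subalgebra_plus_ideal[OF ND(1) core_ideal[OF MD(3)]]
  have "?P = N \<or> ?P = carrier A" by (rule ND(8)[OF P(1,2)])
  then have "?P = carrier A" using P(3) nc by blast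
  then show ?thesis using a core_subset by blast
qed

end

context haar_base
begin

lemma measure_open_max:
  assumes "M \<in> open_max"
  shows "M \<in> sets \<mu>" "measure \<mu> M = 1 / card (a_rcosets M)"
  using open_maxD[OF assms] measure_subgroup assms open_in_sets by (auto simp: open_max_def)

text \<open>If each core lay in the other subalgebra, each would lie in the other core. So, for
  different cores, one subalgebra does not contain the core of the other, and their sum is
  \<open>A\<close>.\<close>

lemma measure_Int_open_max:
  assumes M: "M \<in> open_max" "N \<in> open_max" and ne: "core M \<noteq> core N"
  shows "measure \<mu> (M \<inter> N) = measure \<mu> M * measure \<mu> N"
proof -
  have *: "measure \<mu> (M \<inter> N) = measure \<mu> M * measure \<mu> N"
    if M: "M \<in> open_max" "N \<in> open_max" and nc: "\<not> core M \<subseteq> N" for M N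
  proof -
    obtain C D where C: "C \<in> \<C>" "C \<subseteq> M" and D: "D \<in> \<C>" "D \<subseteq> N" using open_maxD(5)[OF M(1)] open_maxD(5)[OF M(2)] by blast
    show ?thesis
      by (rule measure_Int_subgroups[OF open_maxD(3)[OF M(1)] C open_maxD(3)[OF M(2)] D open_max_sum[OF M nc]])
  qed
  have "\<not> core M \<subseteq> N \<or> \<not> core N \<subseteq> M"
    using core_greatest[OF core_ideal[OF open_maxD(3)[OF M(1)]], of N]
      core_greatest[OF core_ideal[OF open_maxD(3)[OF M(2)]], of M] ne by blast
  then show ?thesis
  proof
    assume "\<not> core N \<subseteq> M"
    from *[OF M(2,1) this] show ?thesis by (simp only: Int_commute mult.commute)
  qed (rule *[OF M])
qed

text \<open>The second moment estimate with \<open>p = (1 / n) ^ d\<close>: a generating tuple lies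
  in no power of an open maximal subalgebra, so the set of generating tuples avoids all the
  events.\<close>

lemma card_distinct_cores:
  assumes F: "finite F" "F \<subseteq> open_maximal_subalgebras K A T n" "inj_on core F" and n: "n > 0"
    and P: "measure (\<Pi>\<^sub>M i\<in>{..<d}. \<mu>) {x \<in> {..<d} \<rightarrow>\<^sub>E carrier A. topologically_generates K A T (x ` {..<d})} > 0" (is "measure _ ?G > 0")
  shows "real (card F) \<le> real n ^ d / measure (\<Pi>\<^sub>M i\<in>{..<d}. \<mu>) ?G"
proof -
  interpret p: prob_space \<mu> by (rule prob_space_haar)
  interpret pp: finite_product_prob_space "\<lambda>_. \<mu>" "{..<d}" by unfold_locales simp
  let ?N = "\<Pi>\<^sub>M i\<in>{..<d}. \<mu>" and ?E = "\<lambda>M. {..<d} \<rightarrow>\<^sub>E M"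
  have FM: "M \<in> open_max" "card (a_rcosets M) = n" if "M \<in> F" for M
    using that F(2) by (auto simp: open_maximal_subalgebras_eq)
  have "card F * (1 / real n) ^ d * measure ?N ?G \<le> 1"
  proof (rule pp.card_pairwise_independent_events[where E = ?E])
    fix M assume M: "M \<in> F"
    note MM = measure_open_max[OF FM(1)[OF M]]
    show "?E M \<in> sets ?N" using MM(1) by (intro sets_PiM_I_finite) auto
    show "measure ?N (?E M) = (1 / real n) ^ d"
      using pp.prob_times[of "\<lambda>_. M"] MM FM(2)[OF M] by simp
    show "?G \<inter> ?E M = {}"
    proof (rule ccontr)
      assume "?G \<inter> ?E M \<noteq> {}"
      then obtain x where x: "x \<in> {..<d} \<rightarrow>\<^sub>E carrier A" "topologically_generates K A T (x ` {..<d})" "x \<in> ?E M" by blast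
      have "x ` {..<d} \<subseteq> carrier A" "x ` {..<d} \<subseteq> M" using x(1,3) by auto
      then show False using x(2) topologically_generates_iff FM(1)[OF M] by blast
    qed
    fix N assume N: "N \<in> F" "M \<noteq> N"
    note NN = measure_open_max[OF FM(1)[OF N(1)]]
    have "core M \<noteq> core N" using F(3) M N by (auto dest: inj_onD)
    then have "measure \<mu> (M \<inter> N) = 1 / real n * (1 / real n)"
      using measure_Int_open_max[OF FM(1)[OF M] FM(1)[OF N(1)]] MM(2) NN(2) FM(2) M N(1) by simp
    moreover have "?E M \<inter> ?E N = ?E (M \<inter> N)" by (auto simp: PiE_def)
    ultimately show "measure ?N (?E M \<inter> ?E N) = ((1 / real n) ^ d)\<^sup>2"
      using pp.prob_times[of "\<lambda>_. M \<inter> N"] MM(1) NN(1) by (simp add: power2_eq_square power_mult_distrib power_divide)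
  next
    \<comment> \<open>\<open>measure\<close> is \<open>0\<close> on sets that are not measurable, so
      positivity of the measure yields measurability.\<close>
    show "?G \<in> sets ?N" using P measure_notin_sets by force
  qed (use F(1) n in auto)
  then show ?thesis using P n by (simp add: field_simps power_divide)
qed

end

section \<open>Growth of positively finitely generated algebras\<close>

context profinite_base
begin

text \<open>The first factor bounds the number of cores, the second the number of subalgebras
  sharing one. The core of an open \<open>M\<close> again contains an ideal of the family, so its
  quotient is a finite ring.\<close>

lemma card_open_maximal_subalgebras_le:
  assumes P: "generation_probability K A T d > 0" and n: "n > 0"
  shows "finite (open_maximal_subalgebras K A T n)"
    and "real (card (open_maximal_subalgebras K A T n)) \<le> real n ^ d / generation_probability K A T d * (real n * (4 + 12 * log 2 n))"
proof -
  let ?S = "open_maximal_subalgebras K A T n" and ?B = "real n ^ d / generation_probability K A T d"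
  let ?G = "{x \<in> {..<d} \<rightarrow>\<^sub>E carrier A. topologically_generates K A T (x ` {..<d})}"
  \<comment> \<open>A positive probability needs at least one generating tuple; it makes
    \<open>\<C>\<close> countable and so gives access to the Haar measure.\<close>
  have "?G \<noteq> {}"
  proof
    assume e: "?G = {}"
    show False using P unfolding generation_probability_def e by simp
  qed
  then obtain x where x: "x \<in> {..<d} \<rightarrow>\<^sub>E carrier A" "topologically_generates K A T (x ` {..<d})" by blast
  have "x ` {..<d} \<subseteq> carrier A" using x(1) by auto
  then have cnt: "countable \<C>" using countable_base x(2) by blast
  interpret haar_base K A T \<C> "haar_probability A T" by (rule haar_base_haar_probability[OF cnt])
  \<comment> \<open>The bound is obtained for finite sets of cores; being uniform, it also shows
    that there are only finitely many cores.\<close>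
  have sub: "finite R \<and> real (card R) \<le> ?B" if R: "R \<subseteq> core ` ?S" "finite R" for R
  proof -
    obtain F where F: "F \<subseteq> ?S" "inj_on core F" "core ` F = R" using subset_image_inj[of R core ?S] R(1) by blast
    have "finite F" by (rule finite_imageD[OF _ F(2)]) (simp add: F(3) R(2))
    have "card F = card R" using card_image[OF F(2)] by (simp only: F(3))
    then show ?thesis
      using card_distinct_cores[OF \<open>finite F\<close> F(1,2) n] P R(2) by (simp add: generation_probability_def)
  qed
  have fin: "finite (core ` ?S)"
  proof (rule ccontr)
    assume "infinite (core ` ?S)"
    then obtain R where R: "finite R" "card R = nat \<lceil>?B\<rceil> + 1" "R \<subseteq> core ` ?S" using infinite_arbitrarily_large by blast
    then show False using sub[OF R(3,1)] real_nat_ceiling_ge[of ?B] by linarith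
  qed
  define X where "X C = {M. maximal_subalgebra K A M \<and> C \<subseteq> M \<and> (\<forall>I. ideal I A \<longrightarrow> I \<subseteq> M \<longrightarrow> I \<subseteq> C) \<and>
      finite (a_rcosets M) \<and> card (a_rcosets M) = n}" for C
  have X: "finite (X C)" "real (card (X C)) \<le> real n * (4 + 12 * log 2 n)" if CS: "C \<in> core ` ?S" for C
  proof -
    obtain M where M: "M \<in> open_max" "C = core M" using CS by (auto simp: open_maximal_subalgebras_eq)
    have id: "ideal C A" unfolding M(2) by (rule core_ideal[OF open_maxD(3)[OF M(1)]])
    obtain D where D: "D \<in> \<C>" "D \<subseteq> M" using open_maxD(5)[OF M(1)] by blast
    have "D \<subseteq> C" unfolding M(2) by (rule core_greatest[OF C_ideal[OF D(1)] D(2)])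
    then have "finite (a_rcosets C)" by (rule sub_with_ideal_cosets(2)[OF ideal.axioms(1)[OF id] D(1)])
    from card_max_subalgebras_with_core[OF id this, of n]
    show "finite (X C)" "real (card (X C)) \<le> real n * (4 + 12 * log 2 n)" unfolding X_def by blast+
  qed
  have cover: "?S \<subseteq> (\<Union>C\<in>core ` ?S. X C)"
  proof
    fix M assume M: "M \<in> ?S"
    then have "M \<in> X (core M)"
      using core_subset[of M] core_greatest[of _ M] by (auto simp: X_def open_maximal_subalgebras_def)
    then show "M \<in> (\<Union>C\<in>core ` ?S. X C)" using M by blast
  qed
  have finU: "finite (\<Union>C\<in>core ` ?S. X C)" using fin X(1) by blast
  show "finite ?S" by (rule finite_subset[OF cover finU])
  have pos: "real n * (4 + 12 * log 2 n) \<ge> 0" using n by simp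
  have "card ?S \<le> (\<Sum>C\<in>core ` ?S. card (X C))"
    using card_mono[OF finU cover] card_UN_le[OF fin, of X] by linarith
  then have "real (card ?S) \<le> real (\<Sum>C\<in>core ` ?S. card (X C))" by (rule of_nat_mono)
  also have "\<dots> = (\<Sum>C\<in>core ` ?S. real (card (X C)))" by simp
  also have "\<dots> \<le> (\<Sum>C\<in>core ` ?S. real n * (4 + 12 * log 2 n))" by (rule sum_mono) (rule X(2))
  also have "\<dots> = real (card (core ` ?S)) * (real n * (4 + 12 * log 2 n))" by simp
  also have "\<dots> \<le> ?B * (real n * (4 + 12 * log 2 n))"
    by (rule mult_right_mono[OF _ pos]) (use sub[OF subset_refl fin] in blast)
  finally show "real (card ?S) \<le> ?B * (real n * (4 + 12 * log 2 n))" .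
qed

lemma pfg_imp_growth:
  assumes "positively_finitely_generated K A T"
  shows "polynomial_maximal_subalgebra_growth K A T"
proof -
  obtain d where P: "generation_probability K A T d > 0" (is "?P > 0") using assms by (auto simp: positively_finitely_generated_def)
  \<comment> \<open>The constant \<open>1 / P\<close> is absorbed into \<open>n ^ k\<close>, which
    is possible since \<open>n \<ge> 2\<close>.\<close>
  define k where "k = nat \<lceil>1 / ?P\<rceil>"
  have k: "1 / ?P \<le> 2 ^ k" using real_nat_ceiling_ge[of "1 / ?P"] of_nat_less_two_power[of k] unfolding k_def[symmetric] by (metis dual_order.trans less_imp_le)
  \<comment> \<open>The exponent has \<open>d\<close> from the tuples, \<open>k\<close> from
    \<open>1 / P\<close>, and \<open>1 + 5\<close> from
    \<open>n * (4 + 12 * log 2 n) \<le> n * (16 * n) \<le> n * n ^ 5\<close>.\<close>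
  have "real (card (open_maximal_subalgebras K A T n)) \<le> real n powr real (d + k + 6)" if n: "n \<ge> 2" for n
  proof -
    have lg: "log 2 n \<le> n" using log2_of_power_le[of n n] less_exp[of n] n by simp
    have "(16::real) \<le> real n ^ 4" using power_mono[of 2 "real n" 4] n by simp
    then have "16 * real n \<le> real n ^ 4 * real n" by (rule mult_right_mono) simp
    moreover have "4 + 12 * log 2 n \<le> 16 * real n" using lg n by linarith
    ultimately have l: "4 + 12 * log 2 n \<le> real n ^ 5" using power_Suc2[of "real n" 4] by simp
    have "(2::real) ^ k \<le> real n ^ k" using n by (intro power_mono) auto
    then have "1 / ?P \<le> real n ^ k" using k by linarith
    have "real (card (open_maximal_subalgebras K A T n)) \<le> real n ^ d * (1 / ?P) * (real n * (4 + 12 * log 2 n))"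
      using card_open_maximal_subalgebras_le(2)[OF P, of n] n by simp
    also have "\<dots> \<le> real n ^ d * real n ^ k * (real n * real n ^ 5)"
      using \<open>1 / ?P \<le> real n ^ k\<close> l P n by (intro mult_mono mult_nonneg_nonneg) (auto simp del: divide_le_eq)
    also have "\<dots> = real n ^ (d + k + 6)" by (simp add: power_add power_numeral_reduce)
    also have "\<dots> = real n powr real (d + k + 6)" using n by (intro powr_realpow[symmetric]) simp
    finally show ?thesis .
  qed
  then show ?thesis
    unfolding polynomial_maximal_subalgebra_growth_def max_subalgebra_count_def
    using card_open_maximal_subalgebras_le(1)[OF P] by (intro exI[of _ "real (d + k + 6)"]) auto
qed

text \<open>After taking logarithms, the factors \<open>4 + 12 * log 2 n\<close> and
  \<open>1 / P\<close> contribute a term of order \<open>log (log n) / log n\<close> at most, which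
  tends to \<open>0\<close>.\<close>

lemma Mstar_le:
  assumes P: "generation_probability K A T d > 0" (is "?P > 0")
  shows "Mstar K A T \<le> ereal (real d + 1)"
proof -
  let ?g = "\<lambda>n. real d + 1 + log 2 ((4 + 12 * log 2 (real n)) / ?P) / log 2 (real n)"
  have le: "log2_enat (max_subalgebra_count K A T n) / ereal (log 2 (real n)) \<le> ereal (?g n)" if n: "n \<ge> 2" for n
  proof -
    let ?c = "card (open_maximal_subalgebras K A T n)"
    have c: "max_subalgebra_count K A T n = enat ?c"
      using card_open_maximal_subalgebras_le(1)[OF P, of n] n by (simp add: max_subalgebra_count_def)
    have ln: "log 2 n > 0" using n by simp
    show ?thesis
    proof (cases "?c = 0")
      case True
      have "log2_enat (enat 0) = -\<infinity>" unfolding log2_enat_def by (simp only: enat.case) simp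
      then show ?thesis unfolding c True using ln by simp
    next
      case False
      have pos: "(4 + 12 * log 2 (real n)) / ?P > 0" using ln P by (intro divide_pos_pos) auto
      have "real ?c \<le> real n ^ (d + 1) * ((4 + 12 * log 2 n) / ?P)"
        using card_open_maximal_subalgebras_le(2)[OF P, of n] n by (simp add: mult_ac)
      then have "log 2 ?c \<le> log 2 (real n ^ (d + 1) * ((4 + 12 * log 2 n) / ?P))" using False by simp
      also have "\<dots> = log 2 (real n ^ (d + 1)) + log 2 ((4 + 12 * log 2 n) / ?P)" using pos n by (intro log_mult_pos) auto
      also have "\<dots> = (d + 1) * log 2 n + log 2 ((4 + 12 * log 2 n) / ?P)" using n by (simp add: log_nat_power del: power_Suc)
      finally have "log 2 ?c / log 2 n \<le> ((d + 1) * log 2 n + log 2 ((4 + 12 * log 2 n) / ?P)) / log 2 n"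
        using ln by (intro divide_right_mono) auto
      also have "\<dots> = ?g n" using ln by (simp add: add_divide_distrib)
      finally show ?thesis unfolding c using False ln by (simp add: log2_enat_def)
    qed
  qed
  have "(\<lambda>n. ?g n) \<longlonglongrightarrow> real d + 1" using P by real_asymp
  then have "(\<lambda>n. ereal (?g n)) \<longlonglongrightarrow> ereal (real d + 1)" by simp
  then have lim: "limsup (\<lambda>n. ereal (?g n)) = ereal (real d + 1)" by (intro lim_imp_Limsup) auto
  have "eventually (\<lambda>n. log2_enat (max_subalgebra_count K A T n) / ereal (log 2 (real n)) \<le> ereal (?g n)) sequentially"
    using le by (auto simp: eventually_sequentially)
  from Limsup_mono[OF this] show ?thesis unfolding Mstar_def lim .
qed

end

text \<open>The choice of \<open>d\<close> leaves terms of at most \<open>1 / n ^ 3\<close> for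
  \<open>n \<ge> 2\<close>, and \<open>1 / (m + 1) ^ 3 \<le> 1 / (2 * m) - 1 / (2 * (m + 1))\<close>
  makes their sum telescope.\<close>

lemma sum_growth_bound:
  fixes s :: "nat \<Rightarrow> nat" and c :: real
  assumes s: "\<And>n. n \<ge> 2 \<Longrightarrow> real (s n) \<le> real n powr c" "\<And>n. n < 2 \<Longrightarrow> s n = 0" and d: "real d \<ge> c + 3"
  shows "(\<Sum>n<N. real (s n) * (1 / real n) ^ d) \<le> 1 / 2"
proof -
  let ?a = "\<lambda>n. real (s n) * (1 / real n) ^ d"
  have a: "?a n \<le> 1 / real n ^ 3" if n: "n \<ge> 2" for n
  proof -
    have "?a n \<le> real n powr c * (1 / real n) ^ d" by (intro mult_right_mono s(1) n) auto
    also have "\<dots> = real n powr (c - real d)" using n by (simp add: powr_diff powr_realpow power_divide)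
    also have "\<dots> \<le> real n powr (- 3)" using n d by (intro powr_mono) auto
    also have "\<dots> = 1 / real n ^ 3" using n by (simp add: powr_minus powr_numeral divide_inverse)
    finally show ?thesis .
  qed
  \<comment> \<open>The terms at \<open>0\<close> and \<open>1\<close> vanish; the shift by
    \<open>2\<close> lets the induction begin with the empty remainder.\<close>
  have "(\<Sum>n<N + 2. ?a n) \<le> 1 / 2 - 1 / (2 * (real N + 1))" for N
  proof (induction N)
    case 0
    have "(\<Sum>n<0 + 2. ?a n) = 0" by (rule sum.neutral) (use s(2) in auto)
    then show ?case by simp
  next
    case (Suc N)
    have key: "1 / (m + 1) ^ 3 \<le> 1 / (2 * m) - 1 / (2 * (m + 1))" if m: "m \<ge> 1" for m :: real
    proof -
      have "2 * m \<le> (m + 1)\<^sup>2" by (simp add: power2_eq_square algebra_simps)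
      then have "1 / ((m + 1) * (m + 1)\<^sup>2) \<le> 1 / ((m + 1) * (2 * m))" using m by (intro divide_left_mono mult_left_mono) auto
      also have "\<dots> = 1 / (2 * m) - 1 / (2 * (m + 1))" using m by (simp add: field_simps)
      finally show ?thesis by (simp add: power3_eq_cube power2_eq_square mult.assoc)
    qed
    have "?a (N + 2) \<le> 1 / (real N + 1 + 1) ^ 3" using a[of "N + 2"] by (simp add: add.commute)
    also have "\<dots> \<le> 1 / (2 * (real N + 1)) - 1 / (2 * (real N + 1 + 1))" by (rule key) simp
    finally show ?case using Suc.IH by (simp add: add.commute)
  qed
  from this[of N] have "(\<Sum>n<N + 2. ?a n) \<le> 1 / 2"
    by (rule order_trans) simp
  moreover have "(\<Sum>n<N. ?a n) \<le> (\<Sum>n<N + 2. ?a n)" by (rule sum_mono2) auto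
  ultimately show ?thesis by linarith
qed

section \<open>Generation probability under polynomial growth\<close>

context profinite_base
begin

lemma card_cosets_in_open_max:
  assumes M: "M \<in> open_max" and C: "C \<in> \<C>" "C \<subseteq> M"
  shows "card (cosets_in C M) * card (a_rcosets M) = card (a_rcosets C)"
  using card_cosets_in_refine[OF C_sub[OF C(1)] open_maxD(3)[OF M] C(2) C_fin[OF C(1)] open_maxD(6)[OF M]
      saturated_self[OF open_maxD(3)[OF M]]]
  by (simp add: cosets_in_carrier[OF C_sub[OF C(1)]] cosets_in_carrier[OF open_maxD(3)[OF M]])

text \<open>A union bound in the finite set of \<open>d\<close>-tuples of cosets of
  \<open>C\<close>: the tuples inside one \<open>M \<supseteq> C\<close> of index \<open>n\<close>
  are a fraction \<open>1 / n ^ d\<close> of all, which adds up to at most a half.\<close>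

lemma generating_tuple_mod:
  assumes fin: "\<And>n. finite (open_maximal_subalgebras K A T n)"
    and bound: "\<And>N. (\<Sum>n<N. real (card (open_maximal_subalgebras K A T n)) * (1 / real n) ^ d) \<le> 1 / 2"
    and C: "C \<in> \<C>"
  shows "\<exists>x \<in> {..<d} \<rightarrow>\<^sub>E carrier A. \<forall>M\<in>open_max. C \<subseteq> M \<longrightarrow> \<not> x ` {..<d} \<subseteq> M"
proof -
  let ?S = "open_maximal_subalgebras K A T" and ?Q = "a_rcosets C"
  let ?q = "card ?Q"
  have q: "?q > 0" by (rule card_cosets_pos[OF C_fin[OF C]])
  define S' where "S' n = {M \<in> ?S n. C \<subseteq> M}" for n
  define bad where "bad M = ({..<d} \<rightarrow>\<^sub>E cosets_in C M)" for M
  have finS': "finite (S' n)" for n using fin by (simp add: S'_def)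
  have finb: "finite (bad M)" for M
    unfolding bad_def using C_fin[OF C] by (intro finite_PiE) (auto simp: cosets_in_def)
  have card_bad: "real (card (bad M)) = real ?q ^ d * (1 / real n) ^ d" if "M \<in> S' n" for M n
  proof -
    have M: "M \<in> open_max" "C \<subseteq> M" "card (a_rcosets M) = n" using that by (auto simp: S'_def open_maximal_subalgebras_eq)
    have e: "card (cosets_in C M) * n = ?q" using card_cosets_in_open_max[OF M(1) C M(2)] M(3) by simp
    then have "n > 0" using q by (cases n) auto
    moreover have "real (card (cosets_in C M)) * real n = real ?q" unfolding e[symmetric] by simp
    ultimately have "real (card (cosets_in C M)) = real ?q * (1 / real n)" by (simp add: field_simps)
    then show ?thesis by (simp add: bad_def card_PiE power_mult_distrib power_divide)
  qed
  \<comment> \<open>The index of an \<open>M \<supseteq> C\<close> divides \<open>?q\<close>, so the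
    range \<open>n < ?q + 1\<close> covers all of them.\<close>
  have "real (card (\<Union>n<?q + 1. \<Union>M\<in>S' n. bad M)) \<le> (\<Sum>n<?q + 1. real (card (\<Union>M\<in>S' n. bad M)))"
    using card_UN_le[of "{..<?q + 1}" "\<lambda>n. \<Union>M\<in>S' n. bad M"] by (simp flip: of_nat_sum)
  also have "\<dots> \<le> (\<Sum>n<?q + 1. real ?q ^ d * (real (card (?S n)) * (1 / real n) ^ d))"
  proof (rule sum_mono)
    fix n
    have "real (card (\<Union>M\<in>S' n. bad M)) \<le> (\<Sum>M\<in>S' n. real (card (bad M)))"
      using card_UN_le[OF finS'[of n], of bad] by (simp flip: of_nat_sum)
    also have "\<dots> = real (card (S' n)) * (real ?q ^ d * (1 / real n) ^ d)" using card_bad by simp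
    also have "\<dots> \<le> real (card (?S n)) * (real ?q ^ d * (1 / real n) ^ d)"
      using card_mono[OF fin[of n], of "S' n"] by (intro mult_right_mono) (auto simp: S'_def)
    finally show "real (card (\<Union>M\<in>S' n. bad M)) \<le> real ?q ^ d * (real (card (?S n)) * (1 / real n) ^ d)"
      by (simp only: mult.left_commute)
  qed
  also have "\<dots> \<le> real ?q ^ d * (1 / 2)"
    unfolding sum_distrib_left[symmetric] by (intro mult_left_mono bound) simp
  also have "\<dots> < real ?q ^ d" using q by simp
  also have "\<dots> = real (card ({..<d} \<rightarrow>\<^sub>E ?Q))" by (simp add: card_PiE)
  finally have "card (\<Union>n<?q + 1. \<Union>M\<in>S' n. bad M) < card ({..<d} \<rightarrow>\<^sub>E ?Q)" by simp
  moreover have "finite (\<Union>n<?q + 1. \<Union>M\<in>S' n. bad M)" using finS' finb by blast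
  ultimately have "\<not> ({..<d} \<rightarrow>\<^sub>E ?Q) \<subseteq> (\<Union>n<?q + 1. \<Union>M\<in>S' n. bad M)"
    using card_mono[of "\<Union>n<?q + 1. \<Union>M\<in>S' n. bad M" "{..<d} \<rightarrow>\<^sub>E ?Q"] by linarith
  then obtain t where t: "t \<in> {..<d} \<rightarrow>\<^sub>E ?Q" "t \<notin> (\<Union>n<?q + 1. \<Union>M\<in>S' n. bad M)" by blast
  have "\<forall>i\<in>{..<d}. \<exists>y. y \<in> carrier A \<and> t i = C +> y"
  proof
    fix i assume "i \<in> {..<d}"
    then have "t i \<in> ?Q" by (rule PiE_mem[OF t(1)])
    then show "\<exists>y. y \<in> carrier A \<and> t i = C +> y" by (auto simp: A_RCOSETS_def')
  qed
  from bchoice[OF this] obtain y where y: "\<And>i. i < d \<Longrightarrow> y i \<in> carrier A \<and> t i = C +> y i" by auto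
  let ?x = "\<lambda>i\<in>{..<d}. y i"
  show ?thesis
  proof (rule bexI[of _ ?x], intro ballI impI notI)
    show "?x \<in> {..<d} \<rightarrow>\<^sub>E carrier A" using y by auto
    fix M assume M: "M \<in> open_max" "C \<subseteq> M" "?x ` {..<d} \<subseteq> M"
    have "t i \<in> cosets_in C M" if i: "i < d" for i
    proof -
      have yM: "y i \<in> M" using M(3) i by auto
      have sat: "saturated C M"
        using saturated_subset[OF C_sub[OF C] open_maxD(3)[OF M(1)] M(2) saturated_coset[OF open_maxD(3)[OF M(1)] zero_closed]]
          open_maxD(4)[OF M(1)] by (simp add: a_coset_add_zero)
      then show ?thesis using y[OF i] yM coset_in_cosets by (auto simp: cosets_in_def saturated_def)
    qed
    then have "t \<in> bad M" using t(1) by (auto simp: bad_def PiE_def)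
    moreover have "card (a_rcosets M) < ?q + 1"
    proof -
      have e: "card (cosets_in C M) * card (a_rcosets M) = ?q" by (rule card_cosets_in_open_max[OF M(1) C M(2)])
      then have "card (cosets_in C M) > 0" using q by (cases "card (cosets_in C M)") auto
      then show ?thesis using e by (cases "card (cosets_in C M)") auto
    qed
    ultimately show False using t(2) M(1,2) by (auto simp: S'_def open_maximal_subalgebras_eq)
  qed
qed

lemma directed_lower_bound:
  assumes "finite \<F>" "\<F> \<subseteq> \<C>"
  shows "\<exists>E\<in>\<C>. \<forall>C\<in>\<F>. E \<subseteq> C"
  using assms
proof (induction \<F>)
  case empty
  then show ?case using C_ne by blast
next
  case (insert D \<F>)
  then obtain E where E: "E \<in> \<C>" "\<forall>C\<in>\<F>. E \<subseteq> C" by auto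
  obtain G where "G \<in> \<C>" "G \<subseteq> E \<inter> D" using C_directed[OF E(1), of D] insert.prems by blast
  then show ?case using E(2) by blast
qed

text \<open>The sets \<open>Z C\<close> of tuples that avoid every open maximal subalgebra
  containing \<open>C\<close> are closed and nonempty, and they shrink as \<open>C\<close> shrinks;
  compactness gives a common point. It avoids all open maximal subalgebras, since each contains some
  \<open>C\<close>.\<close>

lemma exists_generating_tuple:
  assumes fin: "\<And>n. finite (open_maximal_subalgebras K A T n)"
    and bound: "\<And>N. (\<Sum>n<N. real (card (open_maximal_subalgebras K A T n)) * (1 / real n) ^ d) \<le> 1 / 2"
  shows "\<exists>x \<in> {..<d} \<rightarrow>\<^sub>E carrier A. topologically_generates K A T (x ` {..<d})"
proof -
  let ?Y = "product_topology (\<lambda>_. T) {..<d}"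
  define Z where "Z C = {x \<in> {..<d} \<rightarrow>\<^sub>E carrier A. \<forall>M\<in>open_max. C \<subseteq> M \<longrightarrow> \<not> x ` {..<d} \<subseteq> M}" for C
  have Y: "topspace ?Y = {..<d} \<rightarrow>\<^sub>E carrier A" by (simp add: space)
  have "compact_space ?Y" using compact by (simp add: compact_space_product_topology)
  moreover have "\<forall>W\<in>Z ` \<C>. closedin ?Y W"
  proof
    fix W assume "W \<in> Z ` \<C>"
    then obtain C where C: "W = Z C" by blast
    have "topspace ?Y - W = (\<Union>M\<in>{M\<in>open_max. C \<subseteq> M}. {..<d} \<rightarrow>\<^sub>E M)"
    proof (intro equalityI subsetI)
      fix x assume x: "x \<in> topspace ?Y - W"
      then obtain M where M: "M \<in> open_max" "C \<subseteq> M" "x ` {..<d} \<subseteq> M" unfolding C Z_def Y by blast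
      then have "x \<in> {..<d} \<rightarrow>\<^sub>E M" using x unfolding Y by (auto simp: PiE_def)
      then show "x \<in> (\<Union>M\<in>{M\<in>open_max. C \<subseteq> M}. {..<d} \<rightarrow>\<^sub>E M)" using M(1,2) by blast
    next
      fix x assume "x \<in> (\<Union>M\<in>{M\<in>open_max. C \<subseteq> M}. {..<d} \<rightarrow>\<^sub>E M)"
      then obtain M where M: "M \<in> open_max" "C \<subseteq> M" "x \<in> {..<d} \<rightarrow>\<^sub>E M" by blast
      have "x ` {..<d} \<subseteq> M" using M(3) by auto
      then have "x \<notin> W" using M(1,2) unfolding C Z_def by blast
      moreover have "x \<in> topspace ?Y" unfolding Y using M(3) open_maxD(4)[OF M(1)] by (auto simp: PiE_def)
      ultimately show "x \<in> topspace ?Y - W" by blast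
    qed
    moreover have "openin ?Y (\<Union>M\<in>{M\<in>open_max. C \<subseteq> M}. {..<d} \<rightarrow>\<^sub>E M)"
    proof (rule openin_Union)
      fix U assume "U \<in> (\<lambda>M. {..<d} \<rightarrow>\<^sub>E M) ` {M\<in>open_max. C \<subseteq> M}"
      then obtain M where M: "M \<in> open_max" "U = {..<d} \<rightarrow>\<^sub>E M" by blast
      have "openin T M" using M(1) by (simp add: open_max_def)
      then show "openin ?Y U" unfolding M(2) by (simp add: openin_PiE)
    qed
    moreover have "W \<subseteq> topspace ?Y" unfolding Y C Z_def by blast
    ultimately show "closedin ?Y W" by (simp add: closedin_def)
  qed
  moreover have "\<forall>\<F>. finite \<F> \<and> \<F> \<subseteq> Z ` \<C> \<longrightarrow> \<Inter>\<F> \<noteq> {}"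
  proof (intro allI impI)
    fix \<F> assume F: "finite \<F> \<and> \<F> \<subseteq> Z ` \<C>"
    then obtain \<G> where G: "\<G> \<subseteq> \<C>" "finite \<G>" "\<F> = Z ` \<G>" using finite_subset_image by metis
    obtain E where E: "E \<in> \<C>" "\<forall>C\<in>\<G>. E \<subseteq> C" using directed_lower_bound[OF G(2,1)] by blast
    obtain x where x: "x \<in> {..<d} \<rightarrow>\<^sub>E carrier A" "\<forall>M\<in>open_max. E \<subseteq> M \<longrightarrow> \<not> x ` {..<d} \<subseteq> M"
      using generating_tuple_mod[OF fin bound E(1)] by blast
    have "x \<in> Z C" if "C \<in> \<G>" for C
    proof -
      have EC: "E \<subseteq> C" by (rule bspec[OF E(2) that])
      have "\<not> x ` {..<d} \<subseteq> M" if "M \<in> open_max" "C \<subseteq> M" for M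
        by (rule mp[OF bspec[OF x(2) that(1)] order_trans[OF EC that(2)]])
      then show ?thesis unfolding Z_def by (intro CollectI conjI ballI impI x(1))
    qed
    then show "\<Inter>\<F> \<noteq> {}" unfolding G(3) by blast
  qed
  ultimately have "\<Inter>(Z ` \<C>) \<noteq> {}" unfolding compact_space_fip by blast
  then obtain x where x: "\<And>C. C \<in> \<C> \<Longrightarrow> x \<in> Z C" by blast
  obtain C where C: "C \<in> \<C>" using C_ne by blast
  have xA: "x \<in> {..<d} \<rightarrow>\<^sub>E carrier A" using x[OF C] by (simp add: Z_def)
  then have xs: "x ` {..<d} \<subseteq> carrier A" by auto
  have "topologically_generates K A T (x ` {..<d})"
    unfolding topologically_generates_iff[OF xs]
  proof
    fix M assume M: "M \<in> open_max"
    obtain D where "D \<in> \<C>" "D \<subseteq> M" using open_maxD(5)[OF M] by blast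
    then show "\<not> x ` {..<d} \<subseteq> M" using x[of D] M by (simp add: Z_def)
  qed
  then show ?thesis using xA by blast
qed

text \<open>A generating tuple makes \<open>\<C>\<close> countable, and the generating tuples are
  the complement of the union of the \<open>B n\<close>, each a finite union of measurable boxes; so
  the union bound now applies to the Haar measure itself.\<close>

lemma generation_probability_ge:
  assumes fin: "\<And>n. finite (open_maximal_subalgebras K A T n)"
    and bound: "\<And>N. (\<Sum>n<N. real (card (open_maximal_subalgebras K A T n)) * (1 / real n) ^ d) \<le> 1 / 2"
  shows "generation_probability K A T d \<ge> 1 / 2"
proof -
  let ?S = "open_maximal_subalgebras K A T"
  obtain x where x: "x \<in> {..<d} \<rightarrow>\<^sub>E carrier A" "topologically_generates K A T (x ` {..<d})"
    using exists_generating_tuple[OF fin bound] by blast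
  have "x ` {..<d} \<subseteq> carrier A" using x(1) by auto
  then have cnt: "countable \<C>" using countable_base x(2) by blast
  let ?\<mu> = "haar_probability A T"
  interpret haar_base K A T \<C> ?\<mu> by (rule haar_base_haar_probability[OF cnt])
  interpret p: prob_space ?\<mu> by (rule prob_space_haar)
  interpret pp: finite_product_prob_space "\<lambda>_. ?\<mu>" "{..<d}" by unfold_locales simp
  let ?N = "\<Pi>\<^sub>M i\<in>{..<d}. ?\<mu>"
  define B where "B n = (\<Union>M\<in>?S n. {..<d} \<rightarrow>\<^sub>E M)" for n
  have SM: "M \<in> open_max" "card (a_rcosets M) = n" if "M \<in> ?S n" for M n
    using that by (auto simp: open_maximal_subalgebras_eq)
  have EM: "({..<d} \<rightarrow>\<^sub>E M) \<in> sets ?N" if "M \<in> ?S n" for M n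
    using measure_open_max(1)[OF SM(1)[OF that]] by (intro sets_PiM_I_finite) auto
  have Bs: "B n \<in> sets ?N" for n unfolding B_def using fin EM by (intro sets.finite_UN) auto
  have Bm: "measure ?N (B n) \<le> real (card (?S n)) * (1 / real n) ^ d" for n
  proof -
    have "measure ?N (B n) \<le> (\<Sum>M\<in>?S n. measure ?N ({..<d} \<rightarrow>\<^sub>E M))"
      unfolding B_def by (rule pp.finite_measure_subadditive_finite) (use fin EM in auto)
    also have "\<dots> = (\<Sum>M\<in>?S n. (1 / real n) ^ d)"
    proof (rule sum.cong[OF refl])
      fix M assume M: "M \<in> ?S n"
      show "measure ?N ({..<d} \<rightarrow>\<^sub>E M) = (1 / real n) ^ d"
        using pp.prob_times[of "\<lambda>_. M"] measure_open_max[OF SM(1)[OF M]] SM(2)[OF M] by simp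
    qed
    finally show ?thesis by simp
  qed
  have part: "(\<Sum>n<N. measure ?N (B n)) \<le> 1 / 2" for N
    by (rule order_trans[OF sum_mono bound[of N]]) (rule Bm)
  have sm: "summable (\<lambda>n. measure ?N (B n))" by (rule summableI_nonneg_bounded[OF measure_nonneg part])
  have "measure ?N (\<Union>n. B n) \<le> (\<Sum>n. measure ?N (B n))"
    by (rule pp.finite_measure_subadditive_countably) (use Bs sm in auto)
  also have "\<dots> \<le> 1 / 2" by (rule suminf_le_const[OF sm part])
  finally have half: "measure ?N (\<Union>n. B n) \<le> 1 / 2" .
  have spN: "space ?N = {..<d} \<rightarrow>\<^sub>E carrier A" by (simp add: space_PiM space_haar)
  let ?G = "{x \<in> {..<d} \<rightarrow>\<^sub>E carrier A. topologically_generates K A T (x ` {..<d})}"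
  have "?G = space ?N - (\<Union>n. B n)"
  proof (intro equalityI subsetI)
    fix x assume x: "x \<in> ?G"
    have xs: "x ` {..<d} \<subseteq> carrier A" using x by auto
    have "x \<notin> B n" for n
    proof
      assume "x \<in> B n"
      then obtain M where M: "M \<in> ?S n" "x \<in> {..<d} \<rightarrow>\<^sub>E M" by (auto simp: B_def)
      have "x ` {..<d} \<subseteq> M" using M(2) by auto
      then show False using x SM(1)[OF M(1)] unfolding mem_Collect_eq topologically_generates_iff[OF xs] by blast
    qed
    then show "x \<in> space ?N - (\<Union>n. B n)" using x unfolding spN by blast
  next
    fix x assume x: "x \<in> space ?N - (\<Union>n. B n)"
    then have xE: "x \<in> {..<d} \<rightarrow>\<^sub>E carrier A" by (simp only: spN Diff_iff)
    then have xs: "x ` {..<d} \<subseteq> carrier A" by auto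
    have "\<not> x ` {..<d} \<subseteq> M" if M: "M \<in> open_max" for M
    proof
      assume "x ` {..<d} \<subseteq> M"
      then have "x \<in> {..<d} \<rightarrow>\<^sub>E M" using xE by (auto simp: PiE_def)
      then have "x \<in> B (card (a_rcosets M))" using M by (auto simp: B_def open_maximal_subalgebras_eq)
      then show False using x by blast
    qed
    then show "x \<in> ?G" using xE unfolding mem_Collect_eq topologically_generates_iff[OF xs] by blast
  qed
  then have "measure ?N ?G = 1 - measure ?N (\<Union>n. B n)" using pp.prob_compl[of "\<Union>n. B n"] Bs by simp
  then show ?thesis using half by (simp add: generation_probability_def)
qed

lemma growth_imp_pfg:
  assumes "polynomial_maximal_subalgebra_growth K A T"
  shows "positively_finitely_generated K A T"
proof -
  let ?S = "open_maximal_subalgebras K A T"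
  obtain c where c: "\<And>n. n \<ge> 2 \<Longrightarrow> ereal_of_enat (max_subalgebra_count K A T n) \<le> ereal (real n powr c)"
    using assms by (auto simp: polynomial_maximal_subalgebra_growth_def)
  have S2: "finite (?S n)" "real (card (?S n)) \<le> real n powr c" if "n \<ge> 2" for n
    using c[OF that] by (auto simp: max_subalgebra_count_def split: if_splits)
  \<comment> \<open>Proper subalgebras have index at least \<open>2\<close>, so the growth condition
    for \<open>n \<ge> 2\<close> speaks of all of them.\<close>
  have S1: "?S n = {}" if "n < 2" for n using that open_maxD(7) by (fastforce simp: open_maximal_subalgebras_eq)
  have fin: "finite (?S n)" for n using S2(1) S1 by (cases "n < 2") auto
  \<comment> \<open>The summand \<open>3\<close> leaves terms of size \<open>1 / n ^ 3\<close> and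
    also ensures \<open>d \<ge> 1\<close>.\<close>
  define d where "d = nat \<lceil>c\<rceil> + 3"
  have d: "real d \<ge> c + 3" using real_nat_ceiling_ge[of c] by (simp add: d_def)
  have "(\<Sum>n<N. real (card (?S n)) * (1 / real n) ^ d) \<le> 1 / 2" for N
    by (rule sum_growth_bound[OF S2(2) _ d]) (simp_all add: S1)
  then have "generation_probability K A T d \<ge> 1 / 2" by (rule generation_probability_ge[OF fin])
  then show ?thesis unfolding positively_finitely_generated_def by (intro exI[of _ d]) (simp add: d_def)
qed

end

theorem theorem1p11:
  fixes K :: "('k, 'n) ring_scheme"
    and A :: "('k, 'a, 'm) module_scheme"
    and T :: "'a topology"
  assumes "field K" and "finite (carrier K)"
    and "profinite_algebra TYPE('i) TYPE('b) K A T"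
  shows "(positively_finitely_generated K A T \<longleftrightarrow> polynomial_maximal_subalgebra_growth K A T) \<and>
    (infinite (carrier A) \<longrightarrow> Mstar K A T \<le> ereal_of_enat (d0 K A T) + 1)"
proof -
  obtain \<C> where "profinite_base K A T \<C>" using profinite_algebra_base[OF assms] by blast
  then interpret profinite_base K A T \<C> .
  have "Mstar K A T \<le> ereal_of_enat (d0 K A T) + 1"
  proof (cases "\<exists>d\<ge>1. generation_probability K A T d > 0")
    case True
    let ?d = "LEAST d. 1 \<le> d \<and> generation_probability K A T d > 0"
    have "1 \<le> ?d \<and> generation_probability K A T ?d > 0" by (rule LeastI_ex) (use True in blast)
    then have "Mstar K A T \<le> ereal (real ?d + 1)" by (intro Mstar_le) simp
    then show ?thesis using True by (simp add: d0_def one_ereal_def)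
  next
    case False
    then have "d0 K A T = \<infinity>" unfolding d0_def by (rule if_not_P)
    then show ?thesis by simp
  qed
  then show ?thesis using pfg_imp_growth growth_imp_pfg by blast
qed

end
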